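(* Let $T>0$, $d,m\ge1$, and let $f:[0,T]\times\mathbb{R}^d\times\mathbb{R}^m\to\mathbb{R}^d$, $g:[0,T]\times\mathbb{R}^d\times\mathbb{R}^m\to\mathbb{R}^m$ be such that $f(t,x,\cdot)$ and $g(t,x,\cdot)$ are continuous for $(t,x)\in[0,T]\times\mathbb{R}^d$, $$\int_0^T\sup_{(x,u)\in\mathbb{R}^d\times\mathbb{R}^m}\left(\frac{|f(t,x,u)|}{1+|x|}+\frac{|g(t,x,u)|}{1+|u|}\right)dt<\infty,$$ and, for some nonnegative $C_0\in L^1([0,T])$, a.e. $t\in[0,T]$, and all $i,j\in\{1,\dots,d\}$ and $k,\ell\in\{1,\dots,m\}$, $$\partial_{x_i}f^j(t,\cdot,\cdot)\ge-C_0(t)\delta_{ij},\quad\partial_{u_k}g^\ell(t,\cdot,\cdot)\ge-C_0(t)\delta_{k\ell},\quad\partial_{x_i}g^\ell\le0,\quad\partial_{u_k}f^j\le0.$$ Let $u_T:\mathbb{R}^d\to\mathbb{R}^m$ be decreasing with $u_T(1+|\cdot|)^{-1}\in L^\infty$. Consider the system $$\partial_tu+f(t,x,u)\cdot\nabla_xu+g(t,x,u)=0\ \text{ in }(0,T)\times\mathbb{R}^d,\qquad u(T,\cdot)=u_T.\qquad(\mathrm{N})$$ Then there exist two decreasing solutions $u^+$, $u^-$ of (N) with the following properties: (a) For all $t\in[0,T]$, $u^+(t,\cdot)$ is upper semicontinuous, $u^-(t,\cdot)$ is lower semicontinuous, and both $u^+$ and $u^-$ are continuous a.e. in $[0,T]\times\mathbb{R}^d$.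 (b) If $u$ is any other solution of (N), then $u^-\le u\le u^+$.
   Context: For $x,y\in\mathbb{R}^n$, $x\le y$ means $x_i\le y_i$ for all $i$; a map $\mathbb{R}^d\to\mathbb{R}^m$ is increasing (decreasing) if it preserves (reverses) these orders. Semicontinuity of vector-valued maps is coordinatewise. (N) reads $\partial_tu^k+\sum_{j=1}^df^j(t,x,u)\partial_{x_j}u^k+g^k(t,x,u)=0$ for $k=1,\dots,m$. Definition of solution of (N). If $u:[0,T]\times\mathbb{R}^d\to\mathbb{R}^m$ is decreasing in $x$ with $u(t,x)/(1+|x|)\in L^\infty$, then $b(t,x):=f(t,x,u(t,x))$ has at most linear growth, $|b(t,x)|\le K(t)(1+|x|)$ with $K\in L^1$, and $x\mapsto b(t,x)+C_0(t)x$ is increasing. Hence $b$ has a regular Lagrangian flow $\phi$: for every $s$ and a.e. $x$, $[s,T]\ni t\mapsto\phi_{t,s}(x)$ is the unique absolutely continuous solution of $\partial_t\phi_{t,s}(x)\in\prod_{i=1}^d[b^i_*(t,\phi_{t,s}(x)),b^{i,*}(t,\phi_{t,s}(x))]$ for a.e. $t$, $\phi_{s,s}(x)=x$, where $b_*,b^*$ are the coordinatewise semicontinuous envelopes in $x$; composition with $\phi_{t,s}$ is well defined on $L^1_{\mathrm{loc}}$. A locally bounded $u$, decreasing in the $\mathbb{R}^d$-variable and with $u(t,x)/(1+|x|)\in L^\infty$, is a solution of (N) if it is the solution of the linear equation $$-\partial_tu-b(t,x)\cdot\nabla u-c(t)u-D(t,x)=0,\qquad u(T,\cdot)=u_T,$$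 with $b(t,x)=f(t,x,u(t,x))$, $c(t)=-C_0(t)$, $D(t,x)=g(t,x,u(t,x))+C_0(t)u(t,x)$; that is, for every $t\in[0,T]$ and a.e. $x\in\mathbb{R}^d$, $$u(t,x)=u_T(\phi_{T,t}(x))\,e^{\int_t^Tc(s)ds}+\int_t^TD(s,\phi_{s,t}(x))\,e^{\int_t^sc(r)dr}\,ds.$$ *)

theory Defs
  imports "HOL-Analysis.Analysis"
begin

text \<open>
  The order on \<^typ>\<open>real ^ 'n\<close> is the library's componentwise one, so increasing and decreasing maps
  are \<^const>\<open>mono\<close> and \<^const>\<open>antimono\<close> maps. Time-dependent objects are functions of a real \<open>t\<close>,
  and only their values for \<open>t \<in> {0..T}\<close> matter. Measurable means Lebesgue measurable.
\<close>

section \<open>One-sided bounds on derivatives of functions that need not be continuous\<close>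

text \<open>
  The Dini derivates of \<open>h\<close> at \<open>z\<close> in direction \<open>e\<close>: the two-sided \<open>liminf\<close> and \<open>limsup\<close> of the
  difference quotients. The coefficients of the system may jump in \<open>x\<close>, so one-sided bounds on their
  partial derivatives are read as bounds, at every point, on these derivates. By
  \<open>lower_deriv_ge_iff\<close> and \<open>upper_deriv_le_iff\<close> below, such bounds are the usual monotonicity
  conditions, and by \<open>lower_deriv_eq\<close> and \<open>upper_deriv_eq\<close> the derivates are the ordinary derivative
  where that exists.
\<close>

definition lower_deriv :: "('a::real_vector \<Rightarrow> real) \<Rightarrow> 'a \<Rightarrow> 'a \<Rightarrow> ereal" where
  "lower_deriv h e z = Liminf (at (0::real)) (\<lambda>s. ereal ((h (z + s *\<^sub>R e) - h z) / s))"

definition upper_deriv :: "('a::real_vector \<Rightarrow> real) \<Rightarrow> 'a \<Rightarrow> 'a \<Rightarrow> ereal" where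
  "upper_deriv h e z = Limsup (at (0::real)) (\<lambda>s. ereal ((h (z + s *\<^sub>R e) - h z) / s))"

lemma lower_deriv_eq:
  assumes "((\<lambda>s. h (z + s *\<^sub>R e)) has_real_derivative D) (at 0)"
  shows "lower_deriv h e z = ereal D"
  unfolding lower_deriv_def using assms
  by (intro lim_imp_Liminf) (auto simp: DERIV_def)

lemma upper_deriv_eq:
  assumes "((\<lambda>s. h (z + s *\<^sub>R e)) has_real_derivative D) (at 0)"
  shows "upper_deriv h e z = ereal D"
  unfolding upper_deriv_def using assms
  by (intro lim_imp_Limsup) (auto simp: DERIV_def)

lemma lower_deriv_ge_iff:
  "(\<forall>z. ereal c \<le> lower_deriv h e z) \<longleftrightarrow> (\<forall>z. \<forall>s\<ge>0. h z + c * s \<le> h (z + s *\<^sub>R e))"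
proof
  assume L: "\<forall>z. ereal c \<le> lower_deriv h e z"
  show "\<forall>z. \<forall>s\<ge>0. h z + c * s \<le> h (z + s *\<^sub>R e)"
  proof (intro allI impI)
    fix z and S :: real assume S: "0 \<le> S"
    define k where "k = (\<lambda>s. h (z + s *\<^sub>R e))"
    have main: "k 0 + (c - \<epsilon>) * (S - 0) \<le> k S" if "\<epsilon> > 0" for \<epsilon>
      using S
    proof (rule Bolzano[where P = "\<lambda>p q. k p + (c - \<epsilon>) * (q - p) \<le> k q"])
      fix p q r assume "k p + (c - \<epsilon>) * (q - p) \<le> k q" "k q + (c - \<epsilon>) * (r - q) \<le> k r"
      then show "k p + (c - \<epsilon>) * (r - p) \<le> k r" by (simp add: algebra_simps)
    next
      fix x :: real
      have "ereal (c - \<epsilon>) < lower_deriv h e (z + x *\<^sub>R e)"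
        using L \<open>\<epsilon> > 0\<close> by (meson diff_less_eq ereal_less_eq(3) less_add_same_cancel1 less_le_trans less_ereal.simps(1))
      then have "\<forall>\<^sub>F s in at 0. ereal (c - \<epsilon>) < ereal ((h ((z + x *\<^sub>R e) + s *\<^sub>R e) - h (z + x *\<^sub>R e)) / s)"
        unfolding lower_deriv_def by (rule less_LiminfD)
      then have "\<forall>\<^sub>F s in at 0. c - \<epsilon> < (k (x + s) - k x) / s"
        by (simp add: k_def algebra_simps)
      then obtain d where d: "d > 0" "\<And>s. s \<noteq> 0 \<Longrightarrow> \<bar>s\<bar> < d \<Longrightarrow> c - \<epsilon> < (k (x + s) - k x) / s"
        by (auto simp: eventually_at dist_real_def)
      have R: "k x + (c - \<epsilon>) * (q - x) \<le> k q" if "x \<le> q" "q - x < d" for q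
        using d(2)[of "q - x"] that by (cases "q = x") (auto simp: field_simps)
      have Lf: "k p + (c - \<epsilon>) * (x - p) \<le> k x" if "p \<le> x" "x - p < d" for p
      proof (cases "p = x")
        case False
        then have "p - x < 0" using that by simp
        with d(2)[of "p - x"] that show ?thesis by (simp add: less_divide_eq algebra_simps)
      qed simp
      show "\<exists>d>0. \<forall>p q. p \<le> x \<and> x \<le> q \<and> q - p < d \<longrightarrow> k p + (c - \<epsilon>) * (q - p) \<le> k q"
      proof (intro exI[of _ d] conjI allI impI d(1))
        fix p q assume pq: "p \<le> x \<and> x \<le> q \<and> q - p < d"
        have "k p + (c - \<epsilon>) * (x - p) \<le> k x" "k x + (c - \<epsilon>) * (q - x) \<le> k q"
          using pq by (auto intro!: R Lf)
        then show "k p + (c - \<epsilon>) * (q - p) \<le> k q" by (simp add: algebra_simps)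
      qed
    qed
    have "k 0 + c * S \<le> k S"
    proof (cases "S = 0")
      case False
      show ?thesis
      proof (rule field_le_epsilon)
        fix \<eta> :: real assume "\<eta> > 0"
        with main[of "\<eta> / S"] False S show "k 0 + c * S \<le> k S + \<eta>"
          by (simp add: algebra_simps)
      qed
    qed simp
    then show "h z + c * S \<le> h (z + S *\<^sub>R e)" by (simp add: k_def)
  qed
next
  assume M: "\<forall>z. \<forall>s\<ge>0. h z + c * s \<le> h (z + s *\<^sub>R e)"
  have q: "c \<le> (h (z + s *\<^sub>R e) - h z) / s" if "s \<noteq> 0" for z s
  proof (cases "s > 0")
    case True
    then show ?thesis using M[rule_format, of s z] by (simp add: field_simps)
  next
    case False
    then have "s < 0" using that by simp
    moreover have "h (z + s *\<^sub>R e) + c * (- s) \<le> h z"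
      using M[rule_format, of "- s" "z + s *\<^sub>R e"] \<open>s < 0\<close> by simp
    ultimately show ?thesis by (simp add: le_divide_eq algebra_simps)
  qed
  show "\<forall>z. ereal c \<le> lower_deriv h e z"
    unfolding lower_deriv_def using q
    by (auto intro!: Liminf_bounded simp: eventually_at_filter)
qed

lemma upper_deriv_le_iff:
  "(\<forall>z. upper_deriv h e z \<le> ereal c) \<longleftrightarrow> (\<forall>z. \<forall>s\<ge>0. h (z + s *\<^sub>R e) \<le> h z + c * s)"
proof -
  have "lower_deriv (\<lambda>z. - h z) e z = - upper_deriv h e z" for z
    unfolding lower_deriv_def upper_deriv_def
    by (subst ereal_Liminf_uminus[symmetric]) (simp add: minus_divide_left)
  then have "(upper_deriv h e z \<le> ereal c) \<longleftrightarrow> ereal (- c) \<le> lower_deriv (\<lambda>z. - h z) e z" for z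
    by (metis ereal_minus_le_minus uminus_ereal.simps(1))
  then show ?thesis
    using lower_deriv_ge_iff[of "- c" "\<lambda>z. - h z" e] by (simp add: algebra_simps)
qed


section \<open>Semicontinuity\<close>

text \<open>\<^term>\<open>nhds x\<close> does not exclude \<open>x\<close> itself, so \<open>lower_env h \<le> h \<le> upper_env h\<close>.\<close>

definition lower_env :: "('a::topological_space \<Rightarrow> real) \<Rightarrow> 'a \<Rightarrow> ereal" where
  "lower_env h x = Liminf (nhds x) (\<lambda>y. ereal (h y))"

definition upper_env :: "('a::topological_space \<Rightarrow> real) \<Rightarrow> 'a \<Rightarrow> ereal" where
  "upper_env h x = Limsup (nhds x) (\<lambda>y. ereal (h y))"

definition lower_semicontinuous :: "('a::topological_space \<Rightarrow> real ^ 'm) \<Rightarrow> bool" where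
  "lower_semicontinuous h \<longleftrightarrow> (\<forall>i x. ereal (h x $ i) \<le> lower_env (\<lambda>y. h y $ i) x)"

definition upper_semicontinuous :: "('a::topological_space \<Rightarrow> real ^ 'm) \<Rightarrow> bool" where
  "upper_semicontinuous h \<longleftrightarrow> (\<forall>i x. upper_env (\<lambda>y. h y $ i) x \<le> ereal (h x $ i))"


section \<open>Function spaces\<close>

definition L_infinity :: "'a measure \<Rightarrow> ('a \<Rightarrow> 'b::real_normed_vector) \<Rightarrow> bool" where
  "L_infinity M h \<longleftrightarrow> h \<in> borel_measurable M \<and> (\<exists>C. AE z in M. norm (h z) \<le> C)"

definition abs_continuous_on_interval ::
    "real \<Rightarrow> real \<Rightarrow> (real \<Rightarrow> 'a::real_normed_vector) \<Rightarrow> bool" where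
  "abs_continuous_on_interval a b y \<longleftrightarrow>
     (\<forall>\<epsilon>>0. \<exists>\<delta>>0. \<forall>I. finite I \<and> (\<forall>(p, q)\<in>I. a \<le> p \<and> p \<le> q \<and> q \<le> b) \<and>
        disjoint_family_on (\<lambda>(p, q). {p<..<q}) I \<and> (\<Sum>(p, q)\<in>I. q - p) < \<delta> \<longrightarrow>
        (\<Sum>(p, q)\<in>I. norm (y q - y p)) < \<epsilon>)"


definition growth ::
    "(real \<Rightarrow> 'a::real_normed_vector \<Rightarrow> 'b::real_normed_vector \<Rightarrow> 'c::real_normed_vector) \<Rightarrow>
     (real \<Rightarrow> 'a \<Rightarrow> 'b \<Rightarrow> 'b) \<Rightarrow> real \<Rightarrow> ennreal" where
  "growth f g t = (SUP (x, u) \<in> UNIV.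
     ennreal (norm (f t x u) / (1 + norm x) + norm (g t x u) / (1 + norm u)))"


section \<open>The regular Lagrangian flow\<close>

definition filippov_solution ::
    "real \<Rightarrow> (real \<Rightarrow> real ^ 'd \<Rightarrow> real ^ 'd) \<Rightarrow> real \<Rightarrow> real ^ 'd \<Rightarrow> (real \<Rightarrow> real ^ 'd) \<Rightarrow> bool" where
  "filippov_solution T b s x y \<longleftrightarrow>
     abs_continuous_on_interval s T y \<and> y s = x \<and>
     (AE t in lebesgue_on {s..T}. \<exists>v. (y has_vector_derivative v) (at t within {s..T}) \<and>
        (\<forall>i. lower_env (\<lambda>z. b t z $ i) (y t) \<le> ereal (v $ i) \<and>
             ereal (v $ i) \<le> upper_env (\<lambda>z. b t z $ i) (y t)))"

text \<open>
  \<open>\<phi> t s x\<close> is the position at time \<open>t \<ge> s\<close> of the trajectory that is at \<open>x\<close> at time \<open>s\<close>.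
  The last condition is the usual regularity (bounded compression) of a regular Lagrangian flow; it
  is what makes composition with \<open>\<phi> t s\<close> well defined on classes of \<open>L\<^sup>1\<^sub>l\<^sub>o\<^sub>c\<close> functions.
\<close>

definition regular_lagrangian_flow ::
    "real \<Rightarrow> (real \<Rightarrow> real ^ 'd \<Rightarrow> real ^ 'd) \<Rightarrow> (real \<Rightarrow> real \<Rightarrow> real ^ 'd \<Rightarrow> real ^ 'd) \<Rightarrow> bool" where
  "regular_lagrangian_flow T b \<phi> \<longleftrightarrow>
     (\<forall>s\<in>{0..T}. AE x in lebesgue.
        filippov_solution T b s x (\<lambda>t. \<phi> t s x) \<and>
        (\<forall>y. filippov_solution T b s x y \<longrightarrow> (\<forall>t\<in>{s..T}. y t = \<phi> t s x))) \<and>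
     (\<exists>C::real. \<forall>s\<in>{0..T}. \<forall>t\<in>{s..T}.
        \<phi> t s \<in> lebesgue \<rightarrow>\<^sub>M lebesgue \<and>
        (\<forall>A\<in>sets lebesgue. emeasure lebesgue (\<phi> t s -` A) \<le> ennreal C * emeasure lebesgue A))"


section \<open>Solutions\<close>

text \<open>
  The solution of \<open>- \<partial>\<^sub>t u - b \<cdot> \<nabla>u - c u - D = 0\<close>, \<open>u(T, _) = uT\<close>, is given by the representation
  formula along the flow of \<open>b\<close>. Integrability is required explicitly because the library's
  integral of a non-integrable function is \<open>0\<close>.
\<close>

definition linear_solution ::
    "real \<Rightarrow> (real \<Rightarrow> real ^ 'd \<Rightarrow> real ^ 'd) \<Rightarrow> (real \<Rightarrow> real) \<Rightarrow> (real \<Rightarrow> real ^ 'd \<Rightarrow> real ^ 'm) \<Rightarrow>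
     (real ^ 'd \<Rightarrow> real ^ 'm) \<Rightarrow> (real \<Rightarrow> real ^ 'd \<Rightarrow> real ^ 'm) \<Rightarrow> bool" where
  "linear_solution T b c D uT u \<longleftrightarrow>
     (\<exists>\<phi>. regular_lagrangian_flow T b \<phi> \<and>
       (\<forall>t\<in>{0..T}. AE x in lebesgue.
          set_integrable lebesgue {t..T}
            (\<lambda>s. exp (LINT r:{t..s}|lebesgue. c r) *\<^sub>R D s (\<phi> s t x)) \<and>
          u t x = exp (LINT s:{t..T}|lebesgue. c s) *\<^sub>R uT (\<phi> T t x)
            + (LINT s:{t..T}|lebesgue. exp (LINT r:{t..s}|lebesgue. c r) *\<^sub>R D s (\<phi> s t x))))"

definition nonlinear_solution ::
    "real \<Rightarrow> (real \<Rightarrow> real ^ 'd \<Rightarrow> real ^ 'm \<Rightarrow> real ^ 'd) \<Rightarrow> (real \<Rightarrow> real ^ 'd \<Rightarrow> real ^ 'm \<Rightarrow> real ^ 'm) \<Rightarrow>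
     (real \<Rightarrow> real) \<Rightarrow> (real ^ 'd \<Rightarrow> real ^ 'm) \<Rightarrow> (real \<Rightarrow> real ^ 'd \<Rightarrow> real ^ 'm) \<Rightarrow> bool" where
  "nonlinear_solution T f g C\<^sub>0 uT u \<longleftrightarrow>
     (\<forall>R. bounded ((\<lambda>(t, x). u t x) ` ({0..T} \<times> cball 0 R))) \<and>
     (\<forall>t\<in>{0..T}. antimono (u t)) \<and>
     L_infinity (lebesgue_on ({0..T} \<times> UNIV)) (\<lambda>(t, x). u t x /\<^sub>R (1 + norm x)) \<and>
     linear_solution T
       (\<lambda>t x. f t x (u t x))
       (\<lambda>t. - C\<^sub>0 t)
       (\<lambda>t x. g t x (u t x) + C\<^sub>0 t *\<^sub>R u t x)
       uT u"

end

theory Submission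
  imports Defs
begin

text \<open>The relation \<open>x \<lless> y\<close> (all coordinates strictly increase) carries the argument. A set without two
  points related by \<open>\<lless>\<close> is negligible (\<open>antichain_negligible\<close>). Hence a map that is monotone along
  \<open>\<lless>\<close> is continuous almost everywhere, and two maps that dominate each other after arbitrarily small
  strict shifts agree almost everywhere.

  The flow. If \<open>b t x + C t x\<close> increases in \<open>x\<close>, Filippov's inclusion says that the velocity lies
  between the values of the field at strictly smaller and at strictly larger points
  (\<open>filippov_solution_iff_trajectory\<close>). Trajectories that start in the order \<open>\<lless>\<close> stay in it
  (\<open>trajectory_comparison\<close>). So each trajectory is squeezed between those from nearby points, and it is unique
  wherever one choice of trajectories is continuous in the starting point, that is, almost everywhere
  (\<open>AE_unique_trajectory\<close>). For existence, a change of variables removes \<open>C\<close>; for an increasing field,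
  Picard iteration from below gives minimal trajectories. Their flow is a limit of compositions of shears
  \<open>x + h x *\<^sub>R axis i 1\<close> with \<open>h\<close> increasing, which do not compress volume
  (\<open>minimal_flow_noncompressing\<close>).

  The system. For \<open>u\<close> decreasing in \<open>x\<close> let \<open>val u\<close> be the right-hand side of the representation formula
  along the flow of \<open>f(t, x, u(t, x))\<close>. A larger \<open>u\<close> gives smaller velocities and positions, at which the
  decreasing terminal value and source are larger; so \<open>val\<close> increases with \<open>u\<close> (\<open>val_compare\<close>). A solution's
  excess over an explicit barrier contracts, so the barrier dominates every solution
  (\<open>char_solution_le_top_barrier\<close>). Iterating \<open>val\<close> from it gives a decreasing sequence of upper
  semicontinuous maps above every solution. Its limit is a fixed point up to strict shifts
  (\<open>maximal_le_val\<close>, \<open>val_le_maximal\<close>), thus almost everywhere, and hence the largest solution. It is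
  continuous in \<open>(t, x)\<close> wherever it is continuous in \<open>x\<close>, because trajectories move little over short times
  (\<open>interlaced_jointly_continuous\<close>). Changing the signs of \<open>x\<close> and \<open>u\<close> gives the smallest solution.\<close>

section \<open>The strict coordinatewise order and negligible antichains\<close>

text \<open>The upper and lower cones of this order are open, so it survives small perturbations.\<close>

definition strictly_below :: "real ^ 'n \<Rightarrow> real ^ 'n \<Rightarrow> bool" (infix "\<lless>" 50) where
  "x \<lless> y \<longleftrightarrow> (\<forall>i. x $ i < y $ i)"

lemma strictly_below_imp_le: "x \<lless> y \<Longrightarrow> x \<le> y"
  by (auto simp: strictly_below_def less_eq_vec_def less_imp_le)

lemma strictly_below_trans: "x \<lless> y \<Longrightarrow> y \<lless> z \<Longrightarrow> x \<lless> z"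
  by (auto simp: strictly_below_def intro: less_trans)

lemma strictly_below_le_trans: "x \<lless> y \<Longrightarrow> y \<le> z \<Longrightarrow> x \<lless> z"
  by (auto simp: strictly_below_def less_eq_vec_def intro: less_le_trans)

lemma strictly_below_minus: "- x \<lless> - y \<longleftrightarrow> y \<lless> x"
  by (auto simp: strictly_below_def)

lemma strictly_below_shift: "0 < r \<Longrightarrow> x - r *\<^sub>R 1 \<lless> x" "0 < r \<Longrightarrow> x \<lless> x + r *\<^sub>R 1"
  by (auto simp: strictly_below_def)

lemma strictly_below_scaleR: "0 < r \<Longrightarrow> x \<lless> y \<Longrightarrow> r *\<^sub>R x \<lless> r *\<^sub>R y"
  by (auto simp: strictly_below_def)

lemma strictly_below_dense: "x \<lless> y \<Longrightarrow> \<exists>z. x \<lless> z \<and> z \<lless> y"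
  by (intro exI[of _ "(1/2) *\<^sub>R (x + y)"]) (auto simp: strictly_below_def)

lemma open_strictly_below: "open {z. x \<lless> z}" "open {z. z \<lless> x}"
proof -
  have "{z. x \<lless> z} = (\<Inter>i. {z. x $ i < z $ i})" "{z. z \<lless> x} = (\<Inter>i. {z. z $ i < x $ i})"
    by (auto simp: strictly_below_def)
  then show "open {z. x \<lless> z}" "open {z. z \<lless> x}"
    by (auto intro!: open_INT open_Collect_less continuous_intros)
qed

lemma strictly_below_gap:
  fixes x y :: "real ^ 'n"
  assumes "x \<lless> y" obtains r where "r > 0" "x + r *\<^sub>R 1 \<lless> y"
proof -
  have "open ((\<lambda>r::real. x + r *\<^sub>R 1) -` {z. z \<lless> y})"
    by (intro open_vimage open_strictly_below continuous_intros)
  moreover have "0 \<in> (\<lambda>r::real. x + r *\<^sub>R 1) -` {z. z \<lless> y}" using assms by simp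
  ultimately obtain e where "e > 0" "ball 0 e \<subseteq> (\<lambda>r::real. x + r *\<^sub>R 1) -` {z. z \<lless> y}"
    by (meson openE)
  then show ?thesis using that[of "e/2"] by (auto simp: subset_iff dist_real_def)
qed

lemma strict_approximation:
  fixes x :: "real ^ 'n"
  shows "(\<lambda>n. x - (1 / (real n + 1)) *\<^sub>R 1) \<longlonglongrightarrow> x" "(\<lambda>n. x + (1 / (real n + 1)) *\<^sub>R 1) \<longlonglongrightarrow> x"
proof -
  have 0: "(\<lambda>n. 1 / (real n + 1)) \<longlonglongrightarrow> 0"
    using LIMSEQ_inverse_real_of_nat by (simp add: inverse_eq_divide add.commute)
  show "(\<lambda>n. x - (1 / (real n + 1)) *\<^sub>R 1) \<longlonglongrightarrow> x"
    using tendsto_diff[OF tendsto_const tendsto_scaleR[OF 0 tendsto_const], of x 1] by simp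
  show "(\<lambda>n. x + (1 / (real n + 1)) *\<^sub>R 1) \<longlonglongrightarrow> x"
    using tendsto_add[OF tendsto_const tendsto_scaleR[OF 0 tendsto_const], of x 1] by simp
qed

lemma continuous_strict_limit:
  fixes c :: "real ^ 'n \<Rightarrow> real"
  assumes c: "continuous_on UNIV c"
  shows "(\<And>z. z \<lless> x \<Longrightarrow> a \<le> c z) \<Longrightarrow> a \<le> c x" and "(\<And>z. x \<lless> z \<Longrightarrow> a \<le> c z) \<Longrightarrow> a \<le> c x"
    and "(\<And>z. z \<lless> x \<Longrightarrow> c z \<le> a) \<Longrightarrow> c x \<le> a"
proof -
  have cx: "isCont c x" using c by (simp add: continuous_on_eq_continuous_at)
  note lim = isCont_tendsto_compose[OF cx strict_approximation(1)] isCont_tendsto_compose[OF cx strict_approximation(2)]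
  have "x - (1 / (real n + 1)) *\<^sub>R 1 \<lless> x" "x \<lless> x + (1 / (real n + 1)) *\<^sub>R 1" for n
    by (simp_all add: strictly_below_shift)
  then show "(\<And>z. z \<lless> x \<Longrightarrow> a \<le> c z) \<Longrightarrow> a \<le> c x" "(\<And>z. x \<lless> z \<Longrightarrow> a \<le> c z) \<Longrightarrow> a \<le> c x"
    "(\<And>z. z \<lless> x \<Longrightarrow> c z \<le> a) \<Longrightarrow> c x \<le> a"
    using LIMSEQ_le_const[OF lim(1)] LIMSEQ_le_const[OF lim(2)] LIMSEQ_le_const2[OF lim(1)] by blast+
qed

lemma tendsto_of_strict_squeeze:
  fixes h :: "real ^ 'n \<Rightarrow> real ^ 'k"
  assumes h: "isCont h x" and lo: "\<And>z. z \<lless> x \<Longrightarrow> \<forall>\<^sub>F n in F. h z \<le> v n" and up: "\<And>z. x \<lless> z \<Longrightarrow> \<forall>\<^sub>F n in F. v n \<le> h z"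
  shows "(v \<longlongrightarrow> h x) F"
proof (rule vec_tendstoI)
  fix i
  note lim = tendsto_vec_nth[OF isCont_tendsto_compose[OF h strict_approximation(1)], of i]
    tendsto_vec_nth[OF isCont_tendsto_compose[OF h strict_approximation(2)], of i]
  show "((\<lambda>n. v n $ i) \<longlongrightarrow> h x $ i) F"
  proof (rule order_tendstoI)
    fix a assume "a < h x $ i"
    then obtain k where k: "a < h (x - (1 / (real k + 1)) *\<^sub>R 1) $ i"
      using order_tendstoD(1)[OF lim(1)] eventually_happens'[OF sequentially_bot] by blast
    have "x - (1 / (real k + 1)) *\<^sub>R 1 \<lless> x" by (simp add: strictly_below_shift)
    from lo[OF this] show "\<forall>\<^sub>F n in F. a < v n $ i"
      by eventually_elim (use k in "auto simp: less_eq_vec_def intro: less_le_trans")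
  next
    fix a assume "h x $ i < a"
    then obtain k where k: "h (x + (1 / (real k + 1)) *\<^sub>R 1) $ i < a"
      using order_tendstoD(2)[OF lim(2)] eventually_happens'[OF sequentially_bot] by blast
    have "x \<lless> x + (1 / (real k + 1)) *\<^sub>R 1" by (simp add: strictly_below_shift)
    from up[OF this] show "\<forall>\<^sub>F n in F. v n $ i < a"
      by eventually_elim (use k in "auto simp: less_eq_vec_def intro: le_less_trans")
  qed
qed

lemma AE_lebesgue_iff_negligible: "(AE x in lebesgue. P x) \<longleftrightarrow> negligible {x. \<not> P x}"
proof
  assume "AE x in lebesgue. P x"
  then obtain N where "N \<in> null_sets lebesgue" "{x. \<not> P x} \<subseteq> N"
    by (auto simp: eventually_ae_filter)
  then show "negligible {x. \<not> P x}" using negligible_iff_null_sets negligible_subset by blast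
next
  assume "negligible {x. \<not> P x}"
  then show "AE x in lebesgue. P x"
    unfolding eventually_ae_filter by (intro bexI[of _ "{x. \<not> P x}"]) (auto simp: negligible_iff_null_sets)
qed

lemma AE_dense:
  fixes S :: "('a::euclidean_space) set"
  assumes "AE x in lebesgue. P x" "open S" "S \<noteq> {}"
  shows "\<exists>x\<in>S. P x"
proof (rule ccontr)
  assume "\<not> ?thesis"
  then have "S \<subseteq> {x. \<not> P x}" by auto
  moreover have "negligible {x. \<not> P x}"
    using assms(1) by (simp add: AE_lebesgue_iff_negligible)
  ultimately show False
    using assms(2,3) negligible_subset open_not_negligible by blast
qed

text \<open>The translates of an antichain along the diagonal are pairwise disjoint, so infinitely many sets of
  equal measure fit into a bounded set.\<close>

lemma bounded_antichain_negligible: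
  fixes A :: "(real ^ 'n) set"
  assumes "bounded A" and anti: "\<And>x y. x \<in> A \<Longrightarrow> y \<in> A \<Longrightarrow> \<not> x \<lless> y"
  shows "negligible A"
proof -
  define K where "K = closure A"
  have K: "compact K" using assms(1) by (simp add: K_def)
  have antiK: "\<not> x \<lless> y" if "x \<in> K" "y \<in> K" for x y
  proof
    assume "x \<lless> y"
    then obtain z where z: "x \<lless> z" "z \<lless> y" using strictly_below_dense by blast
    have "\<exists>a\<in>A. a \<lless> z" "\<exists>b\<in>A. z \<lless> b"
      using that z open_strictly_below[of z] unfolding K_def
      by (metis closure_iff_nhds_not_empty disjoint_iff mem_Collect_eq subset_refl)+
    then show False using anti strictly_below_trans by blast
  qed
  define r where "r = (\<lambda>k::nat. 1 / (real k + 1))"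
  define S where "S = (\<lambda>k. (+) (r k *\<^sub>R (1::real^'n)) ` K)"
  have rinj: "r i < r j" if "j < i" for i j
    using that by (simp add: r_def field_simps)
  have disj: "disjoint_family S"
  proof -
    have "S i \<inter> S j = {}" if "j < i" for i j
    proof (rule ccontr)
      assume "S i \<inter> S j \<noteq> {}"
      then obtain x y where xy: "x \<in> K" "y \<in> K" "r i *\<^sub>R 1 + x = r j *\<^sub>R 1 + y"
        unfolding S_def by blast
      have "x = y + (r j - r i) *\<^sub>R 1"
        using xy(3) by (simp add: vec_eq_iff algebra_simps)
      then have "y \<lless> x" using rinj[OF that] strictly_below_shift(2)[of "r j - r i" y] by simp
      then show False using antiK xy by blast
    qed
    then show ?thesis unfolding disjoint_family_on_def by (metis Int_commute linorder_neqE_nat)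
  qed
  have Slm: "S k \<in> lmeasurable" for k
    unfolding S_def using K by (simp add: lmeasurable_compact measurable_translation)
  have Sm: "measure lebesgue (S k) = measure lebesgue K" for k
    unfolding S_def by (rule measure_translation)
  obtain R where R: "\<And>x. x \<in> K \<Longrightarrow> norm x \<le> R"
    using K compact_imp_bounded bounded_iff by metis
  have Sb: "S k \<subseteq> cball 0 (R + norm (1::real^'n))" for k
  proof
    fix z assume "z \<in> S k"
    then obtain x where x: "x \<in> K" "z = r k *\<^sub>R 1 + x" unfolding S_def by auto
    have "norm z \<le> \<bar>r k\<bar> * norm (1::real^'n) + norm x" unfolding x(2)
      by (metis norm_scaleR norm_triangle_ineq)
    moreover have "\<bar>r k\<bar> * norm (1::real^'n) \<le> 1 * norm (1::real^'n)"
      by (rule mult_right_mono) (auto simp: r_def)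
    moreover note R[OF x(1)]
    ultimately have "norm z \<le> R + norm (1::real^'n)" by linarith
    then show "z \<in> cball 0 (R + norm (1::real^'n))" by simp
  qed
  have bnd: "real n * measure lebesgue K \<le> measure lebesgue (cball (0::real^'n) (R + norm (1::real^'n)))" for n
  proof -
    have "measure lebesgue (\<Union>k<n. S k) = (\<Sum>k<n. measure lebesgue (S k))"
      using disj fmeasurableD[OF Slm] fmeasurableD2[OF Slm]
      by (intro measure_finite_Union disjoint_family_on_mono[OF subset_UNIV disj]) auto
    moreover have "measure lebesgue (\<Union>k<n. S k) \<le> measure lebesgue (cball (0::real^'n) (R + norm (1::real^'n)))"
      using Sb Slm by (intro measure_mono_fmeasurable) (auto simp: fmeasurableD)
    ultimately show ?thesis using Sm by simp
  qed
  have "measure lebesgue K = 0"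
  proof (rule ccontr)
    assume "measure lebesgue K \<noteq> 0"
    then have "0 < measure lebesgue K" by (simp add: zero_less_measure_iff)
    then obtain n where "measure lebesgue (cball (0::real^'n) (R + norm (1::real^'n))) < real n * measure lebesgue K"
      using reals_Archimedean3 by blast
    with bnd[of n] show False by simp
  qed
  then have "negligible K" using K by (simp add: negligible_iff_measure lmeasurable_compact)
  then show ?thesis unfolding K_def using closure_subset negligible_subset by blast
qed

lemma antichain_negligible:
  fixes A :: "(real ^ 'n) set"
  assumes anti: "\<And>x y. x \<in> A \<Longrightarrow> y \<in> A \<Longrightarrow> \<not> x \<lless> y"
  shows "negligible A"
proof -
  have "negligible (\<Union>n. A \<inter> cball 0 (real n))"
    by (intro negligible_countable_Union) (auto intro!: bounded_antichain_negligible simp: anti)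
  moreover have "(\<Union>n. A \<inter> cball 0 (real n)) = A"
    by (auto simp: real_arch_simple)
  ultimately show ?thesis by simp
qed

text \<open>The points at which a fixed rational separates the two values form an antichain.\<close>

lemma AE_le_of_strict_comparison:
  fixes h1 h2 :: "real ^ 'n \<Rightarrow> real"
  assumes "\<And>x y. x \<lless> y \<Longrightarrow> h2 x \<le> h1 y"
  shows "AE x in lebesgue. h2 x \<le> h1 x"
proof -
  have "negligible {x. h1 x < of_rat q \<and> of_rat q < h2 x}" for q
    by (rule antichain_negligible) (use assms in fastforce)
  then have "negligible (\<Union>q. {x. h1 x < of_rat q \<and> of_rat q < h2 x})"
    by (intro negligible_countable_Union) auto
  moreover have "{x. \<not> h2 x \<le> h1 x} \<subseteq> (\<Union>q. {x. h1 x < of_rat q \<and> of_rat q < h2 x})"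
    by (auto simp: not_le dest: of_rat_dense)
  ultimately show ?thesis unfolding AE_lebesgue_iff_negligible using negligible_subset by blast
qed

text \<open>The limits from strictly below and from strictly above are ordered after any strict shift, hence
  equal almost everywhere.\<close>

lemma mono_AE_isCont_real:
  fixes h :: "real ^ 'n \<Rightarrow> real"
  assumes mono: "\<And>x y. x \<lless> y \<Longrightarrow> h x \<le> h y"
  shows "AE x in lebesgue. isCont h x"
proof -
  define l where "l = (\<lambda>x. SUP y\<in>{y. y \<lless> x}. h y)"
  define r where "r = (\<lambda>x. INF y\<in>{y. x \<lless> y}. h y)"
  have ne: "{y. y \<lless> x} \<noteq> {}" "{y. x \<lless> y} \<noteq> {}" for x :: "real ^ 'n"
    using strictly_below_shift[of 1 x] by auto
  have up: "bdd_above (h ` {y. y \<lless> x})" "bdd_below (h ` {y. x \<lless> y})" for x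
    using mono by (auto intro!: bdd_aboveI2[of _ _ "h x"] bdd_belowI2[of _ "h x"])
  have "r x \<le> l y" if xy: "x \<lless> y" for x y
  proof -
    obtain z where z: "x \<lless> z" "z \<lless> y" using xy strictly_below_dense by blast
    have "r x \<le> h z" unfolding r_def by (rule cINF_lower[OF up(2)]) (use z in auto)
    also have "h z \<le> l y" unfolding l_def by (rule cSUP_upper[OF _ up(1)]) (use z in auto)
    finally show ?thesis .
  qed
  then have "AE x in lebesgue. r x \<le> l x" by (rule AE_le_of_strict_comparison)
  then show ?thesis
  proof eventually_elim
    case (elim x)
    show ?case unfolding isCont_def
    proof (rule tendstoI)
      fix e :: real assume "e > 0"
      obtain y where y: "x \<lless> y" "h y < r x + e / 2"
        using cInf_lessD[of "h ` {y. x \<lless> y}" "r x + e/2"] ne `e > 0` unfolding r_def by auto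
      obtain z where z: "z \<lless> x" "l x - e / 2 < h z"
        using less_cSupD[of "h ` {y. y \<lless> x}" "l x - e/2"] ne `e > 0` unfolding l_def by auto
      have "open ({w. z \<lless> w} \<inter> {w. w \<lless> y})" using open_strictly_below by blast
      then have "\<forall>\<^sub>F w in at x. w \<in> {w. z \<lless> w} \<inter> {w. w \<lless> y}"
        using y z eventually_at_in_open' by blast
      then show "\<forall>\<^sub>F w in at x. dist (h w) (h x) < e"
      proof eventually_elim
        case (elim w)
        then have "h z \<le> h w" "h w \<le> h y" "h z \<le> h x" "h x \<le> h y"
          using mono y z by auto
        then show ?case using y z `r x \<le> l x` by (auto simp: dist_real_def)
      qed
    qed
  qed
qed

lemma antimono_AE_isCont:
  fixes h :: "real ^ 'n \<Rightarrow> real ^ 'm"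
  assumes "antimono h"
  shows "AE x in lebesgue. isCont h x"
proof -
  have "AE x in lebesgue. isCont (\<lambda>x. - h x $ i) x" for i
    by (rule mono_AE_isCont_real) (use assms in "auto dest!: strictly_below_imp_le simp: monotone_on_def less_eq_vec_def")
  then have "AE x in lebesgue. \<forall>i. isCont (\<lambda>x. - h x $ i) x" by (simp add: AE_all_countable)
  then show ?thesis
  proof eventually_elim
    case (elim x)
    then have "isCont (\<lambda>x. h x $ i) x" for i using continuous_minus[of "at x" "\<lambda>x. - h x $ i"] by auto
    then show ?case unfolding isCont_def by (auto intro: vec_tendstoI)
  qed
qed

lemma AE_lebesgue_image:
  fixes L :: "'a::euclidean_space \<Rightarrow> 'a"
  assumes "AE x in lebesgue. P x" and "linear L" and "\<And>x. L (M x) = x"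
  shows "AE x in lebesgue. P (M x)"
proof -
  have "negligible (L ` {x. \<not> P x})"
    using assms(1,2) by (simp add: AE_lebesgue_iff_negligible negligible_differentiable_image_negligible linear_imp_differentiable_on)
  moreover have "{x. \<not> P (M x)} \<subseteq> L ` {x. \<not> P x}" using assms(3) by (metis (mono_tags, lifting) image_eqI mem_Collect_eq subsetI)
  ultimately show ?thesis unfolding AE_lebesgue_iff_negligible using negligible_subset by blast
qed

section \<open>Absolutely continuous functions of one variable\<close>

abbreviation AC :: "real \<Rightarrow> real \<Rightarrow> (real \<Rightarrow> 'a::real_normed_vector) \<Rightarrow> bool" where
  "AC \<equiv> abs_continuous_on_interval"

definition small_variation :: "real \<Rightarrow> real \<Rightarrow> (real \<Rightarrow> 'a::real_normed_vector) \<Rightarrow> real \<Rightarrow> real \<Rightarrow> bool" where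
  "small_variation a b y d e \<longleftrightarrow> (\<forall>I. finite I \<and> (\<forall>(p, q)\<in>I. a \<le> p \<and> p \<le> q \<and> q \<le> b) \<and>
        disjoint_family_on (\<lambda>(p, q). {p<..<q}) I \<and> (\<Sum>(p, q)\<in>I. q - p) < d \<longrightarrow>
        (\<Sum>(p, q)\<in>I. norm (y q - y p)) < e)"

lemma AC_iff_small_variation:
  "AC a b y \<longleftrightarrow> (\<forall>e>0. \<exists>d>0. small_variation a b y d e)"
  by (simp add: abs_continuous_on_interval_def small_variation_def)

lemma small_variationI:
  "(\<And>I. finite I \<Longrightarrow> (\<And>p q. (p, q) \<in> I \<Longrightarrow> a \<le> p \<and> p \<le> q \<and> q \<le> b) \<Longrightarrow> disjoint_family_on (\<lambda>(p, q). {p<..<q}) I \<Longrightarrow>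
    (\<Sum>(p, q)\<in>I. q - p) < d \<Longrightarrow> (\<Sum>(p, q)\<in>I. norm (y q - y p)) < e) \<Longrightarrow> small_variation a b y d e"
  unfolding small_variation_def by blast

lemma small_variationD:
  "small_variation a b y d e \<Longrightarrow> finite I \<Longrightarrow> (\<And>p q. (p, q) \<in> I \<Longrightarrow> a \<le> p \<and> p \<le> q \<and> q \<le> b) \<Longrightarrow>
    disjoint_family_on (\<lambda>(p, q). {p<..<q}) I \<Longrightarrow> (\<Sum>(p, q)\<in>I. q - p) < d \<Longrightarrow> (\<Sum>(p, q)\<in>I. norm (y q - y p)) < e"
  unfolding small_variation_def by blast

lemma AC_empty: assumes "b < a" shows "AC a b y"
  unfolding AC_iff_small_variation
proof (intro allI impI exI[of _ "1::real"] conjI small_variationI)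
  fix e :: real and I assume "e > 0" and "\<And>p q. (p, q) \<in> I \<Longrightarrow> a \<le> p \<and> p \<le> q \<and> q \<le> b"
  then have "I = {}" using assms by force
  then show "(\<Sum>(p, q)\<in>I. norm (y q - y p)) < e" using `e > 0` by simp
qed simp

text \<open>The closure properties of absolute continuity that follow are instances of this one.\<close>

lemma AC_dominated:
  assumes "AC a b g" "AC a b h"
    and dom: "\<And>p q. a \<le> p \<Longrightarrow> p \<le> q \<Longrightarrow> q \<le> b \<Longrightarrow>
      norm (y q - y p) \<le> L * (norm (g q - g p) + norm (h q - h p))"
  shows "AC a b y"
  unfolding AC_iff_small_variation
proof (intro allI impI)
  fix e :: real assume "e > 0"
  define M where "M = \<bar>L\<bar> + 1"
  have "M > 0" by (simp add: M_def)
  define e' where "e' = e / (2 * M)"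
  have "e' > 0" using `M > 0` `e > 0` by (simp add: e'_def)
  obtain d1 where d1: "d1 > 0" "small_variation a b g d1 e'"
      using assms(1) `e' > 0` unfolding AC_iff_small_variation by blast
  obtain d2 where d2: "d2 > 0" "small_variation a b h d2 e'"
      using assms(2) `e' > 0` unfolding AC_iff_small_variation by blast
  show "\<exists>d>0. small_variation a b y d e"
  proof (intro exI[of _ "min d1 d2"] conjI small_variationI)
    fix I assume I: "finite I" "\<And>p q. (p, q) \<in> I \<Longrightarrow> a \<le> p \<and> p \<le> q \<and> q \<le> b"
      "disjoint_family_on (\<lambda>(p, q). {p<..<q}) I" "(\<Sum>(p, q)\<in>I. q - p) < min d1 d2"
    have s1: "(\<Sum>(p, q)\<in>I. norm (g q - g p)) < e'" by (rule small_variationD[OF d1(2)]) (use I in auto)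
    have s2: "(\<Sum>(p, q)\<in>I. norm (h q - h p)) < e'" by (rule small_variationD[OF d2(2)]) (use I in auto)
    have "(\<Sum>(p, q)\<in>I. norm (y q - y p)) \<le> (\<Sum>(p, q)\<in>I. M * (norm (g q - g p) + norm (h q - h p)))"
    proof (rule sum_mono, clarify)
      fix p q assume "(p, q) \<in> I"
      then have "norm (y q - y p) \<le> L * (norm (g q - g p) + norm (h q - h p))"
        using I by (intro dom) auto
      also have "... \<le> M * (norm (g q - g p) + norm (h q - h p))"
        by (rule mult_right_mono) (auto simp: M_def)
      finally show "norm (y q - y p) \<le> M * (norm (g q - g p) + norm (h q - h p))" .
    qed
    also have "... = M * ((\<Sum>(p, q)\<in>I. norm (g q - g p)) + (\<Sum>(p, q)\<in>I. norm (h q - h p)))"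
      by (simp add: sum_distrib_left sum.distrib[symmetric] case_prod_unfold distrib_left)
    also have "... < M * (e' + e')"
      using s1 s2 `M > 0` by (intro mult_strict_left_mono add_strict_mono)
    also have "... = e" using `M > 0` by (simp add: e'_def)
    finally show "(\<Sum>(p, q)\<in>I. norm (y q - y p)) < e" .
  qed (use d1 d2 in auto)
qed

lemma AC_uniform:
  assumes "AC a b y" "e > 0"
  obtains d where "d > 0" "\<And>p q. a \<le> p \<Longrightarrow> p \<le> q \<Longrightarrow> q \<le> b \<Longrightarrow> q - p < d \<Longrightarrow> norm (y q - y p) < e"
proof -
  obtain d where d: "d > 0" "small_variation a b y d e"
      using assms unfolding AC_iff_small_variation by blast
  show ?thesis
    using that[of d] d(1) small_variationD[OF d(2), of "{(p, q)}" for p q] by (auto simp: disjoint_family_on_def)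
qed

lemma AC_imp_continuous_on:
  fixes y :: "real \<Rightarrow> 'a::real_normed_vector"
  assumes "AC a b y"
  shows "continuous_on {a..b} y"
  unfolding continuous_on_iff
proof (intro ballI allI impI)
  fix x e assume "x \<in> {a..b}" "(e::real) > 0"
  obtain d where d: "d > 0" "\<And>p q. a \<le> p \<Longrightarrow> p \<le> q \<Longrightarrow> q \<le> b \<Longrightarrow> q - p < d \<Longrightarrow> norm (y q - y p) < e"
    using AC_uniform[OF assms `e > 0`] by blast
  have "dist (y x') (y x) < e" if "x' \<in> {a..b}" "dist x' x < d" for x'
    using d(2)[of x x'] d(2)[of x' x] that `x \<in> {a..b}`
    by (cases "x \<le> x'") (auto simp: dist_norm norm_minus_commute)
  then show "\<exists>d>0. \<forall>x'\<in>{a..b}. dist x' x < d \<longrightarrow> dist (y x') (y x) < e"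
    using d(1) by blast
qed

lemma AC_subinterval:
  assumes "AC a b y" "a \<le> a'" "b' \<le> b"
  shows "AC a' b' y"
  using assms(1) unfolding AC_iff_small_variation small_variation_def
  by (elim all_forward imp_forward ex_forward conj_forward) (use assms(2,3) in force)+

lemma AC_add:
  assumes "AC a b g" "AC a b h"
  shows "AC a b (\<lambda>t. g t + h t)"
  by (rule AC_dominated[OF assms, of _ 1]) (simp add: norm_diff_triangle_ineq)

lemma AC_bounded_linear:
  assumes "AC a b g" "bounded_linear f"
  shows "AC a b (\<lambda>t. f (g t))"
proof -
  obtain K where K: "K > 0" "\<And>x. norm (f x) \<le> norm x * K" using bounded_linear.pos_bounded[OF assms(2)] by blast
  show ?thesis
  proof (rule AC_dominated[OF assms(1) assms(1), of _ K])
    fix p q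
    have "norm (f (g q) - f (g p)) \<le> norm (g q - g p) * K"
      using K(2)[of "g q - g p"] bounded_linear.linear[OF assms(2)] by (simp add: linear_diff)
    also have "... \<le> K * (norm (g q - g p) + norm (g q - g p))" using K(1) by (simp add: algebra_simps)
    finally show "norm (f (g q) - f (g p)) \<le> K * (norm (g q - g p) + norm (g q - g p))" .
  qed
qed

lemma AC_bounded:
  fixes y :: "real \<Rightarrow> 'a::real_normed_vector"
  assumes "AC a b y"
  obtains B where "B > 0" "\<And>t. t \<in> {a..b} \<Longrightarrow> norm (y t) \<le> B"
proof -
  have "compact (y ` {a..b})"
    by (intro compact_continuous_image AC_imp_continuous_on[OF assms]) auto
  then show ?thesis using that compact_imp_bounded bounded_pos by (metis imageI)
qed

lemma AC_scaleR:
  fixes h :: "real \<Rightarrow> 'a::real_normed_vector"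
  assumes "AC a b (g :: real \<Rightarrow> real)" "AC a b h"
  shows "AC a b (\<lambda>t. g t *\<^sub>R h t)"
proof -
  obtain B1 where B1: "B1 > 0" "\<And>t. t \<in> {a..b} \<Longrightarrow> norm (g t) \<le> B1" using AC_bounded[OF assms(1)] by blast
  obtain B2 where B2: "B2 > 0" "\<And>t. t \<in> {a..b} \<Longrightarrow> norm (h t) \<le> B2" using AC_bounded[OF assms(2)] by blast
  show ?thesis
  proof (rule AC_dominated[OF assms, of _ "B1 + B2"])
    fix p q assume pq: "a \<le> p" "p \<le> q" "q \<le> b"
    have "g q *\<^sub>R h q - g p *\<^sub>R h p = g q *\<^sub>R (h q - h p) + (g q - g p) *\<^sub>R h p" by (simp add: algebra_simps)
    then have "norm (g q *\<^sub>R h q - g p *\<^sub>R h p) \<le> norm (g q) * norm (h q - h p) + norm (g q - g p) * norm (h p)"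
      using norm_triangle_ineq[of "g q *\<^sub>R (h q - h p)" "(g q - g p) *\<^sub>R h p"] by simp
    also have "... \<le> B1 * norm (h q - h p) + norm (g q - g p) * B2"
      by (intro add_mono mult_left_mono mult_right_mono B1 B2) (use pq in auto)
    also have "... \<le> (B1 + B2) * (norm (g q - g p) + norm (h q - h p))"
      using B1(1) B2(1) by (simp add: algebra_simps)
    finally show "norm (g q *\<^sub>R h q - g p *\<^sub>R h p) \<le> (B1 + B2) * (norm (g q - g p) + norm (h q - h p))" .
  qed
qed

lemma AC_exp:
  assumes "AC a b (g :: real \<Rightarrow> real)"
  shows "AC a b (\<lambda>t. exp (g t))"
proof -
  obtain B where B: "B > 0" "\<And>t. t \<in> {a..b} \<Longrightarrow> norm (g t) \<le> B" using AC_bounded[OF assms] by blast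
  have exp_le: "\<bar>exp u - exp v\<bar> \<le> exp B * \<bar>u - v\<bar>" if "u \<le> B" "v \<le> B" for u v :: real
  proof -
    have "norm (exp u - exp v) \<le> exp B * norm (u - v)"
    proof (rule field_differentiable_bound[of "{..B}" exp exp])
      show "(exp has_field_derivative exp z) (at z within {..B})" for z :: real
        using DERIV_exp has_field_derivative_at_within by blast
    qed (use that in auto)
    then show ?thesis by simp
  qed
  show ?thesis
  proof (rule AC_dominated[OF assms assms, of _ "exp B"])
    fix p q assume "a \<le> p" "p \<le> q" "q \<le> b"
    then have "g p \<le> B" "g q \<le> B" using B(2)[of p] B(2)[of q] by auto
    from exp_le[OF this(2,1)] show "norm (exp (g q) - exp (g p)) \<le> exp B * (norm (g q - g p) + norm (g q - g p))"
      by (smt (verit) exp_ge_zero mult_left_mono real_norm_def)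
  qed
qed

text \<open>An open set around the exceptional null set can be so small that absolute continuity makes its
  contribution less than \<open>e\<close>; at all other points the derivative controls nearby increments. A gauge
  collects both kinds of intervals in one tagged division.\<close>

lemma AC_nondecreasing:
  fixes F :: "real \<Rightarrow> real"
  assumes AC: "AC a b F" and "a \<le> b"
    and deriv: "AE t in lebesgue. a < t \<and> t < b \<longrightarrow> (\<exists>D\<ge>0. (F has_real_derivative D) (at t))"
  shows "F a \<le> F b"
proof -
  have main: "F a - F b \<le> e * (1 + (b - a))" if "e > 0" for e
  proof -
    define N where "N = {t. \<not> (a < t \<and> t < b \<longrightarrow> (\<exists>D\<ge>0. (F has_real_derivative D) (at t)))} \<union> {a, b}"
    have "negligible N" unfolding N_def using deriv by (auto simp: AE_lebesgue_iff_negligible intro!: negligible_Un)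
    then have N0: "N \<in> null_sets lebesgue" by (simp add: negligible_iff_null_sets)
    obtain d where d: "d > 0" "small_variation a b F d e"
      using AC `e > 0` unfolding AC_iff_small_variation by blast
    obtain U where U: "open U" "N \<subseteq> U" "(U - N) \<in> lmeasurable" "emeasure lebesgue (U - N) < ennreal d"
      using sets_lebesgue_outer_open[of N d] N0 d(1) by (auto simp: null_setsD2)
    have Ud: "emeasure lebesgue U < ennreal d"
      using U(3,4) N0 emeasure_Un_null_set[of "U - N" lebesgue N] U(2)
      by (simp add: fmeasurableD Un_absorb2)
    have "\<exists>r>0. t \<notin> N \<longrightarrow> a < t \<longrightarrow> t < b \<longrightarrow>
       (\<forall>s. \<bar>s - t\<bar> < r \<longrightarrow> (t \<le> s \<longrightarrow> - e * (s - t) \<le> F s - F t) \<and> (s \<le> t \<longrightarrow> - e * (t - s) \<le> F t - F s))" for t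
    proof (cases "t \<notin> N \<and> a < t \<and> t < b")
      case True
      then obtain D where D: "D \<ge> 0" "(F has_real_derivative D) (at t)" by (auto simp: N_def)
      have "((\<lambda>h. (F (t + h) - F t) / h) \<longlongrightarrow> D) (at 0)" using D(2) by (simp add: DERIV_def)
      then have "\<forall>\<^sub>F h in at 0. - e < (F (t + h) - F t) / h"
        using D(1) `e > 0` by (intro order_tendstoD) auto
      then obtain r where r: "r > 0" "\<And>h. h \<noteq> 0 \<Longrightarrow> \<bar>h\<bar> < r \<Longrightarrow> - e < (F (t + h) - F t) / h"
        by (auto simp: eventually_at dist_real_def)
      have "- e * (s - t) \<le> F s - F t" if "\<bar>s - t\<bar> < r" "t \<le> s" for s
      proof (cases "s = t")
        case False
        then have "- e < (F s - F t) / (s - t)" using r(2)[of "s - t"] that by auto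
        then show ?thesis using False that by (simp add: pos_less_divide_eq)
      qed simp
      moreover have "- e * (t - s) \<le> F t - F s" if "\<bar>s - t\<bar> < r" "s \<le> t" for s
      proof (cases "s = t")
        case False
        then have "- e < (F s - F t) / (s - t)" using r(2)[of "s - t"] that by auto
        then show ?thesis using False that by (simp add: neg_less_divide_eq algebra_simps)
      qed simp
      ultimately show ?thesis using r(1) by blast
    qed (auto intro: exI[of _ 1])
    then obtain r where r: "\<And>t. r t > 0" "\<And>t s. t \<notin> N \<Longrightarrow> a < t \<Longrightarrow> t < b \<Longrightarrow> \<bar>s - t\<bar> < r t \<Longrightarrow> t \<le> s \<Longrightarrow> - e * (s - t) \<le> F s - F t"
      "\<And>t s. t \<notin> N \<Longrightarrow> a < t \<Longrightarrow> t < b \<Longrightarrow> \<bar>s - t\<bar> < r t \<Longrightarrow> s \<le> t \<Longrightarrow> - e * (t - s) \<le> F t - F s"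
      by metis
    define \<gamma> where "\<gamma> = (\<lambda>t. if t \<in> N then U else ball t (r t))"
    have "gauge \<gamma>" using r(1) U by (auto simp: \<gamma>_def gauge_def)
    then obtain P where P: "P tagged_division_of {a..b}" "\<gamma> fine P"
      using fine_division_exists_real by blast
    have Pf: "finite P" using P(1) by blast
    have Pk: "\<exists>p q. k = {p..q} \<and> a \<le> p \<and> p \<le> x \<and> x \<le> q \<and> q \<le> b" if xk: "(x, k) \<in> P" for x k
    proof -
      obtain p q where "k = cbox p q" using tagged_division_ofD(4)[OF P(1) xk] by blast
      moreover have "x \<in> k" "k \<subseteq> {a..b}" using tagged_division_ofD(2,3)[OF P(1) xk] by auto
      ultimately show ?thesis by auto
    qed
    define P1 where "P1 = {z\<in>P. fst z \<in> N \<and> Inf (snd z) < Sup (snd z)}"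
    define I where "I = (\<lambda>z. (Inf (snd z), Sup (snd z))) ` P1"
    have inter: "{Inf k1<..<Sup k1} \<inter> {Inf k2<..<Sup k2} = {}"
      if "(x1, k1) \<in> P" "(x2, k2) \<in> P" "(x1, k1) \<noteq> (x2, k2)" for x1 k1 x2 k2
    proof -
      have "interior k1 \<inter> interior k2 = {}" using tagged_division_ofD(5)[OF P(1) that] .
      then show ?thesis using Pk[OF that(1)] Pk[OF that(2)] by auto
    qed
    have inj: "inj_on (\<lambda>z. (Inf (snd z), Sup (snd z))) P1"
    proof (rule inj_onI, rule ccontr)
      fix z z' assume z: "z \<in> P1" "z' \<in> P1" "(Inf (snd z), Sup (snd z)) = (Inf (snd z'), Sup (snd z'))" "z \<noteq> z'"
      then have "{Inf (snd z)<..<Sup (snd z)} \<inter> {Inf (snd z')<..<Sup (snd z')} = {}"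
        using inter[of "fst z" "snd z" "fst z'" "snd z'"] by (auto simp: P1_def)
      then show False using z by (auto simp: P1_def)
    qed
    have disj: "disjoint_family_on (\<lambda>(p, q). {p<..<q}) I"
      unfolding disjoint_family_on_def I_def
    proof (intro ballI impI)
      fix m n assume "m \<in> (\<lambda>z. (Inf (snd z), Sup (snd z))) ` P1" "n \<in> (\<lambda>z. (Inf (snd z), Sup (snd z))) ` P1" "m \<noteq> n"
      then obtain z z' where "z \<in> P1" "z' \<in> P1" "m = (Inf (snd z), Sup (snd z))" "n = (Inf (snd z'), Sup (snd z'))" "z \<noteq> z'" by blast
      then show "(case m of (p, q) \<Rightarrow> {p<..<q}) \<inter> (case n of (p, q) \<Rightarrow> {p<..<q}) = {}"
        using inter[of "fst z" "snd z" "fst z'" "snd z'"] by (auto simp: P1_def)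
    qed
    have If: "finite I" using Pf by (simp add: I_def P1_def)
    have Iin: "a \<le> p \<and> p \<le> q \<and> q \<le> b \<and> {p<..<q} \<subseteq> U" if pqI: "(p, q) \<in> I" for p q
    proof -
      obtain x k where xk: "(x, k) \<in> P" "x \<in> N" "p = Inf k" "q = Sup k" using pqI by (auto simp: I_def P1_def)
      have "k \<subseteq> U" using fineD[OF P(2) xk(1)] xk(2) by (simp add: \<gamma>_def)
      moreover obtain p' q' where "k = {p'..q'}" "a \<le> p'" "p' \<le> x" "x \<le> q'" "q' \<le> b" using Pk[OF xk(1)] by blast
      ultimately show ?thesis using xk(3,4) by auto
    qed
    have "ennreal (\<Sum>(p, q)\<in>I. q - p) = (\<Sum>z\<in>I. emeasure lebesgue (case z of (p, q) \<Rightarrow> {p<..<q}))"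
      using Iin by (subst sum_ennreal[symmetric]) (auto intro!: sum.cong)
    also have "... = emeasure lebesgue (\<Union>z\<in>I. case z of (p, q) \<Rightarrow> {p<..<q})"
      by (rule sum_emeasure) (use disj If in auto)
    also have "... \<le> emeasure lebesgue U"
      by (rule emeasure_mono) (use Iin U(1) in "auto simp: subset_iff lebesgue_openin")
    also have "... < ennreal d" by (rule Ud)
    finally have "(\<Sum>(p, q)\<in>I. q - p) < d"
      by (metis d(1) ennreal_less_iff linorder_not_le order_less_imp_le sum_nonneg ennreal_leI leD)
    then have "(\<Sum>(p, q)\<in>I. norm (F q - F p)) < e"
      by (intro small_variationD[OF d(2)]) (use If Iin disj in auto)
    moreover have "(\<Sum>(p, q)\<in>I. norm (F q - F p)) = (\<Sum>z\<in>P1. \<bar>F (Sup (snd z)) - F (Inf (snd z))\<bar>)"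
      unfolding I_def by (subst sum.reindex[OF inj]) (simp add: case_prod_unfold)
    ultimately have bad: "(\<Sum>z\<in>P1. \<bar>F (Sup (snd z)) - F (Inf (snd z))\<bar>) < e" by simp
    have step: "(if z \<in> P1 then - \<bar>F (Sup (snd z)) - F (Inf (snd z))\<bar> else 0) - e * (Sup (snd z) - Inf (snd z))
        \<le> F (Sup (snd z)) - F (Inf (snd z))" if zP: "z \<in> P" for z
    proof -
      obtain x k where z: "z = (x, k)" by (cases z)
      obtain p q where k: "k = {p..q}" "a \<le> p" "p \<le> x" "x \<le> q" "q \<le> b" using Pk zP z by blast
      then have pq: "Inf k = p" "Sup k = q" by auto
      show ?thesis
      proof (cases "x \<in> N")
        case True
        then have "z \<in> P1 \<or> p = q" using zP pq k by (auto simp: P1_def z)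
        moreover have "0 \<le> e * (q - p)" using k `e > 0` by simp
        ultimately show ?thesis using pq by (auto simp: z)
      next
        case False
        then have x: "a < x" "x < b" using k by (auto simp: N_def)
        have "k \<subseteq> ball x (r x)" using fineD[OF P(2), of x k] zP False unfolding z \<gamma>_def by simp
        moreover have "p \<in> k" "q \<in> k" using k by auto
        ultimately have "p \<in> ball x (r x)" "q \<in> ball x (r x)" by blast+
        then have "- e * (q - x) \<le> F q - F x" "- e * (x - p) \<le> F x - F p"
          using r(2)[OF False x, of q] r(3)[OF False x, of p] k by (auto simp: dist_real_def)
        then have "- e * (q - p) \<le> F q - F p" by (simp add: algebra_simps)
        then show ?thesis using False by (auto simp: z P1_def pq)
      qed
    qed
    have "F b - F a = (\<Sum>z\<in>P. F (Sup (snd z)) - F (Inf (snd z)))"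
      using additive_tagged_division_1[OF `a \<le> b` P(1), of F] by (simp add: case_prod_unfold)
    also have "... \<ge> (\<Sum>z\<in>P. (if z \<in> P1 then - \<bar>F (Sup (snd z)) - F (Inf (snd z))\<bar> else 0) - e * (Sup (snd z) - Inf (snd z)))"
      by (rule sum_mono) (rule step)
    also have "(\<Sum>z\<in>P. (if z \<in> P1 then - \<bar>F (Sup (snd z)) - F (Inf (snd z))\<bar> else 0) - e * (Sup (snd z) - Inf (snd z)))
      = - (\<Sum>z\<in>P1. \<bar>F (Sup (snd z)) - F (Inf (snd z))\<bar>) - e * (\<Sum>z\<in>P. Sup (snd z) - Inf (snd z))"
    proof -
      have "(\<Sum>z\<in>P. (if z \<in> P1 then - \<bar>F (Sup (snd z)) - F (Inf (snd z))\<bar> else 0)) = (\<Sum>z\<in>P1. - \<bar>F (Sup (snd z)) - F (Inf (snd z))\<bar>)"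
        by (rule sum.mono_neutral_cong_right) (use Pf in "auto simp: P1_def")
      then show ?thesis by (subst sum_subtractf) (simp add: sum_distrib_left sum_negf)
    qed
    also have "(\<Sum>z\<in>P. Sup (snd z) - Inf (snd z)) = b - a"
      using additive_tagged_division_1[OF `a \<le> b` P(1), of "\<lambda>x. x"] by (simp add: case_prod_unfold)
    finally have "- e - e * (b - a) \<le> F b - F a" using bad by linarith
    then show ?thesis by (simp add: algebra_simps)
  qed
  have "F a - F b \<le> 0"
  proof (rule field_le_epsilon)
    fix \<eta> :: real assume "\<eta> > 0"
    have "1 + (b - a) > 0" using `a \<le> b` by simp
    then show "F a - F b \<le> 0 + \<eta>" using main[of "\<eta> / (1 + (b - a))"] `\<eta> > 0` by simp
  qed
  then show ?thesis by simp
qed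

lemma sum_increments_le:
  fixes th :: "real \<Rightarrow> real"
  assumes "finite I" "\<And>p q. (p, q) \<in> I \<Longrightarrow> a \<le> p \<and> p < q \<and> q \<le> b"
    and "disjoint_family_on (\<lambda>(p, q). {p<..<q}) I" "a \<le> b"
    and mono: "\<And>p q. a \<le> p \<Longrightarrow> p \<le> q \<Longrightarrow> q \<le> b \<Longrightarrow> th p \<le> th q"
  shows "(\<Sum>(p, q)\<in>I. th q - th p) \<le> th b - th a"
  using assms
proof (induction "card I" arbitrary: I b)
  case 0
  then show ?case by auto
next
  case (Suc n)
  then have "I \<noteq> {}" by auto
  then have "Max (snd ` I) \<in> snd ` I" using Suc.prems(1) by (intro Max_in) auto
  then obtain p q where pq: "(p, q) \<in> I" "q = Max (snd ` I)" by auto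
  have qmax: "q' \<le> q" if "(p', q') \<in> I" for p' q'
    unfolding pq(2) by (rule Max_ge) (use Suc.prems(1) that in force)+
  have less: "q' \<le> p" if "(p', q') \<in> I - {(p, q)}" for p' q'
  proof (rule ccontr)
    assume "\<not> q' \<le> p"
    moreover have "p' < q'" "p < q" using Suc.prems(2) that pq(1) by auto
    ultimately have "(max p p' + q') / 2 \<in> {p<..<q} \<inter> {p'<..<q'}"
      using qmax[of p' q'] that by (auto simp: max_def field_simps)
    moreover have "{p<..<q} \<inter> {p'<..<q'} = {}"
      using disjoint_family_onD[OF Suc.prems(3), of "(p, q)" "(p', q')"] that pq(1) by auto
    ultimately show False by blast
  qed
  have pq': "a \<le> p" "p < q" "q \<le> b" using Suc.prems(2)[OF pq(1)] by auto
  have "(\<Sum>(p, q)\<in>I - {(p, q)}. th q - th p) \<le> th p - th a"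
  proof (rule Suc.hyps(1))
    show "n = card (I - {(p, q)})" using Suc.hyps(2) pq(1) Suc.prems(1) by simp
    show "disjoint_family_on (\<lambda>(p, q). {p<..<q}) (I - {(p, q)})"
      by (rule disjoint_family_on_mono[OF _ Suc.prems(3)]) auto
    show "a \<le> p' \<and> p' < q' \<and> q' \<le> p" if "(p', q') \<in> I - {(p, q)}" for p' q'
      using less[OF that] Suc.prems(2)[of p' q'] that by auto
  qed (use Suc.prems pq' in auto)
  moreover have "(\<Sum>(p, q)\<in>I. th q - th p) = (th q - th p) + (\<Sum>(p, q)\<in>I - {(p, q)}. th q - th p)"
    using sum.remove[OF Suc.prems(1) pq(1), of "\<lambda>(p, q). th q - th p"] by simp
  moreover have "th q \<le> th b" using Suc.prems(5)[of q b] pq' by auto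
  ultimately show ?case by linarith
qed

text \<open>Truncating \<open>k\<close> splits its integral into a Lipschitz part and a part of small total variation.\<close>

lemma AC_integral_nonneg:
  fixes k :: "real \<Rightarrow> real"
  assumes int: "k integrable_on {a..b}" and nonneg: "\<And>t. t \<in> {a..b} \<Longrightarrow> 0 \<le> k t"
  shows "AC a b (\<lambda>t. integral {a..t} k)"
proof (cases "a \<le> b")
  case False
  then show ?thesis by (intro AC_empty) simp
next
  case True
  show ?thesis unfolding AC_iff_small_variation
  proof (intro allI impI)
    fix e :: real assume "e > 0"
    define kn where "kn = (\<lambda>n t. min (k t) (real n))"
    have ka: "k absolutely_integrable_on {a..b}"
      using int nonneg by (rule nonnegative_absolutely_integrable_1)
    have kn_int: "kn n integrable_on {a..b}" for n
      unfolding kn_def using absolutely_integrable_min_1[OF ka, of "\<lambda>_. real n"]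
      by (simp add: set_lebesgue_integral_eq_integral)
    have "(\<lambda>n. integral {a..b} (kn n)) \<longlonglongrightarrow> integral {a..b} k"
    proof (rule dominated_convergence(2)[OF kn_int int])
      show "norm (kn n t) \<le> k t" if "t \<in> {a..b}" for n t using nonneg[OF that] by (simp add: kn_def)
      show "(\<lambda>n. kn n t) \<longlonglongrightarrow> k t" for t
      proof (rule tendsto_eventually, rule eventually_sequentiallyI)
        fix n assume "nat \<lceil>k t\<rceil> \<le> n"
        then have "k t \<le> real n" by linarith
        then show "kn n t = k t" by (simp add: kn_def)
      qed
    qed
    then have "\<forall>\<^sub>F n in sequentially. dist (integral {a..b} (kn n)) (integral {a..b} k) < e / 2"
      using `e > 0` tendstoD by (metis half_gt_zero)
    then obtain n where n: "integral {a..b} k - integral {a..b} (kn n) < e / 2"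
      unfolding eventually_sequentially dist_real_def by (metis abs_less_iff minus_diff_eq order_refl)
    define th where "th = (\<lambda>t. integral {a..t} (\<lambda>s. k s - kn n s))"
    have sub: "h integrable_on {p..q}" if "h integrable_on {a..b}" "a \<le> p" "q \<le> b" for p q and h :: "real \<Rightarrow> real"
      using that by (meson atLeastatMost_subset_iff integrable_on_subinterval)
    have split: "integral {a..q} h - integral {a..p} h = integral {p..q} h"
      if "h integrable_on {a..b}" "a \<le> p" "p \<le> q" "q \<le> b" for p q and h :: "real \<Rightarrow> real"
      using Henstock_Kurzweil_Integration.integral_combine[of a p q h] sub[OF that(1), of a q] that by simp
    have rint: "(\<lambda>s. k s - kn n s) integrable_on {a..b}" by (rule integrable_diff[OF int kn_int])
    have thmono: "th p \<le> th q" if "a \<le> p" "p \<le> q" "q \<le> b" for p q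
    proof -
      have "0 \<le> integral {p..q} (\<lambda>s. k s - kn n s)"
        by (rule integral_nonneg[OF sub[OF rint]]) (use that in "auto simp: kn_def")
      then show ?thesis using split[OF rint that] by (simp add: th_def)
    qed
    have thtot: "th b - th a < e / 2"
      using n integral_diff[OF int kn_int] by (simp add: th_def)
    have incr: "norm (integral {a..q} k - integral {a..p} k) \<le> real n * (q - p) + (th q - th p)"
      if "a \<le> p" "p \<le> q" "q \<le> b" for p q
    proof -
      have "integral {p..q} k = integral {p..q} (\<lambda>s. kn n s + (k s - kn n s))" by simp
      also have "... = integral {p..q} (kn n) + integral {p..q} (\<lambda>s. k s - kn n s)"
        by (rule integral_add[OF sub[OF kn_int] sub[OF rint]]) (use that in auto)
      also have "integral {p..q} (kn n) \<le> integral {p..q} (\<lambda>s. real n)"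
        by (rule integral_le[OF sub[OF kn_int]]) (use that in "auto simp: kn_def")
      finally have "integral {p..q} k \<le> real n * (q - p) + (th q - th p)"
        using that split[OF rint that] by (simp add: th_def mult.commute)
      moreover have "0 \<le> integral {p..q} k"
        by (rule integral_nonneg[OF sub[OF int]]) (use that nonneg in auto)
      ultimately show ?thesis using split[OF int that] by simp
    qed
    define d where "d = e / (2 * (real n + 1))"
    have "d > 0" using `e > 0` by (simp add: d_def)
    show "\<exists>d>0. small_variation a b (\<lambda>t. integral {a..t} k) d e"
    proof (intro exI[of _ d] conjI small_variationI `d > 0`)
      fix I assume I: "finite I" "\<And>p q. (p, q) \<in> I \<Longrightarrow> a \<le> p \<and> p \<le> q \<and> q \<le> b"
        "disjoint_family_on (\<lambda>(p, q). {p<..<q}) I" "(\<Sum>(p, q)\<in>I. q - p) < d"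
      define I' where "I' = {z\<in>I. fst z < snd z}"
      have "(\<Sum>(p, q)\<in>I'. th q - th p) \<le> th b - th a"
        by (rule sum_increments_le) (use I True in "auto simp: I'_def thmono intro: disjoint_family_on_mono[of _ I]")
      moreover have "(\<Sum>(p, q)\<in>I'. th q - th p) = (\<Sum>(p, q)\<in>I. th q - th p)"
        by (rule sum.mono_neutral_left) (use I in "force simp: I'_def")+
      ultimately have *: "(\<Sum>(p, q)\<in>I. th q - th p) < e / 2" using thtot by simp
      have "(\<Sum>(p, q)\<in>I. norm (integral {a..q} k - integral {a..p} k)) \<le> (\<Sum>(p, q)\<in>I. real n * (q - p) + (th q - th p))"
      proof (rule sum_mono, clarify)
        fix p q assume "(p, q) \<in> I"
        then have "a \<le> p" "p \<le> q" "q \<le> b" using I by auto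
        then show "norm (integral {a..q} k - integral {a..p} k) \<le> real n * (q - p) + (th q - th p)"
          by (rule incr)
      qed
      also have "... = real n * (\<Sum>(p, q)\<in>I. q - p) + (\<Sum>(p, q)\<in>I. th q - th p)"
        by (simp add: sum_distrib_left sum.distrib case_prod_unfold)
      also have "... < real n * d + e / 2"
        using * I by (intro add_le_less_mono mult_left_mono) auto
      also have "... \<le> e" using `e > 0` by (simp add: d_def field_simps)
      finally show "(\<Sum>(p, q)\<in>I. norm (integral {a..q} k - integral {a..p} k)) < e" .
    qed
  qed
qed

lemma integral_increment:
  fixes h :: "real \<Rightarrow> 'a::banach"
  assumes "h integrable_on {a..b}" "a \<le> p" "p \<le> q" "q \<le> b"
  shows "integral {a..q} h - integral {a..p} h = integral {p..q} h"
proof -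
  have "h integrable_on {a..q}" using assms by (meson atLeastatMost_subset_iff integrable_on_subinterval order_refl)
  then show ?thesis using Henstock_Kurzweil_Integration.integral_combine[of a p q h] assms by (metis add_diff_cancel_left')
qed

lemma AC_integral:
  fixes h :: "real \<Rightarrow> 'a::euclidean_space"
  assumes h: "h integrable_on {a..b}" and k: "k integrable_on {a..b}"
    and dom: "\<And>t. t \<in> {a..b} \<Longrightarrow> norm (h t) \<le> k t"
  shows "AC a b (\<lambda>t. integral {a..t} h)"
proof -
  have AC: "AC a b (\<lambda>t. integral {a..t} k)"
    by (rule AC_integral_nonneg[OF k]) (use dom norm_ge_zero order_trans in blast)
  show ?thesis
  proof (rule AC_dominated[OF AC AC, of _ 1])
    fix p q assume pq: "a \<le> p" "p \<le> q" "q \<le> b"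
    have "norm (integral {p..q} h) \<le> integral {p..q} k"
    proof (rule integral_norm_bound_integral)
      show "h integrable_on {p..q}" "k integrable_on {p..q}"
        using h k pq by (meson atLeastatMost_subset_iff integrable_on_subinterval)+
    qed (use pq dom in auto)
    then show "norm (integral {a..q} h - integral {a..p} h) \<le> 1 * (norm (integral {a..q} k - integral {a..p} k) + norm (integral {a..q} k - integral {a..p} k))"
      using integral_increment[OF h pq] integral_increment[OF k pq] by simp
  qed
qed

lemma AE_right_derivative_integral:
  fixes k :: "real \<Rightarrow> 'a::euclidean_space"
  assumes "\<And>a b. k integrable_on {a..b}"
  shows "AE t in lebesgue. \<forall>e>0. \<exists>d>0. \<forall>h. 0 < h \<and> h < d \<longrightarrow> norm (integral {t..t + h} k - h *\<^sub>R k t) \<le> e * h"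
proof -
  obtain N where N: "negligible N"
    "\<And>x e. \<lbrakk>x \<notin> N; 0 < e\<rbrakk> \<Longrightarrow> \<exists>d>0. \<forall>h. 0 < h \<and> h < d \<longrightarrow>
       norm (integral (cbox x (x + h *\<^sub>R One)) k /\<^sub>R h ^ DIM(real) - k x) < e"
    using integrable_ccontinuous_explicit[of k] assms by (metis box_real(2))
  have "{t. \<not> (\<forall>e>0. \<exists>d>0. \<forall>h. 0 < h \<and> h < d \<longrightarrow> norm (integral {t..t + h} k - h *\<^sub>R k t) \<le> e * h)} \<subseteq> N"
  proof (rule subsetI, rule ccontr)
    fix t assume t: "t \<in> {t. \<not> (\<forall>e>0. \<exists>d>0. \<forall>h. 0 < h \<and> h < d \<longrightarrow> norm (integral {t..t + h} k - h *\<^sub>R k t) \<le> e * h)}" "t \<notin> N"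
    have "\<exists>d>0. \<forall>h. 0 < h \<and> h < d \<longrightarrow> norm (integral {t..t + h} k - h *\<^sub>R k t) \<le> e * h" if e: "e > 0" for e
    proof -
      obtain d where d: "d > 0" "\<And>h. 0 < h \<Longrightarrow> h < d \<Longrightarrow> norm (integral {t..t + h} k /\<^sub>R h - k t) < e"
        using N(2)[OF t(2) e] by auto
      have "norm (integral {t..t + h} k - h *\<^sub>R k t) \<le> e * h" if h: "0 < h" "h < d" for h
      proof -
        have "integral {t..t + h} k - h *\<^sub>R k t = h *\<^sub>R (integral {t..t + h} k /\<^sub>R h - k t)"
          using h by (simp add: scaleR_diff_right)
        then have "norm (integral {t..t + h} k - h *\<^sub>R k t) = h * norm (integral {t..t + h} k /\<^sub>R h - k t)"
          using h by simp
        also have "... \<le> h * e" using d(2)[OF h] h by (intro mult_left_mono) auto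
        finally show ?thesis by (simp add: mult.commute)
      qed
      then show ?thesis using d(1) by blast
    qed
    then show False using t(1) by blast
  qed
  then show ?thesis unfolding AE_lebesgue_iff_negligible using N(1) negligible_subset by blast
qed

text \<open>Left derivatives come from right derivatives for the reflected integrand.\<close>

lemma AE_derivative_integral:
  fixes k :: "real \<Rightarrow> 'a::euclidean_space"
  assumes k: "k integrable_on {a..b}"
  shows "AE t in lebesgue. a < t \<and> t < b \<longrightarrow> ((\<lambda>s. integral {a..s} k) has_vector_derivative k t) (at t)"
proof -
  define k' where "k' = (\<lambda>t. if t \<in> {a..b} then k t else 0)"
  have k': "k' integrable_on {p..q}" for p q
    unfolding k'_def using integrable_altD(1)[OF k, of p q] by simp
  have k'r: "(\<lambda>t. k' (- t)) integrable_on {p..q}" for p q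
    using k'[of "- q" "- p"] Henstock_Kurzweil_Integration.integrable_reflect_real[of k' "- p" "- q"] by simp
  have R: "AE t in lebesgue. \<forall>e>0. \<exists>d>0. \<forall>h. 0 < h \<and> h < d \<longrightarrow> norm (integral {t..t + h} k' - h *\<^sub>R k' t) \<le> e * h"
    by (rule AE_right_derivative_integral[OF k'])
  have "AE t in lebesgue. \<forall>e>0. \<exists>d>0. \<forall>h. 0 < h \<and> h < d \<longrightarrow>
      norm (integral {t..t + h} (\<lambda>t. k' (- t)) - h *\<^sub>R k' (- t)) \<le> e * h"
    by (rule AE_right_derivative_integral[OF k'r])
  then have L: "AE t in lebesgue. \<forall>e>0. \<exists>d>0. \<forall>h. 0 < h \<and> h < d \<longrightarrow>
      norm (integral {- t..- t + h} (\<lambda>t. k' (- t)) - h *\<^sub>R k' (- (- t))) \<le> e * h"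
    by (rule AE_lebesgue_image[where L = uminus and M = uminus]) (auto simp: linear_uminus)
  show ?thesis
    using R L
  proof eventually_elim
    case (elim t)
    show ?case
    proof
      assume t: "a < t \<and> t < b"
      define r where "r = min (t - a) (b - t)"
      have r: "r > 0" using t by (simp add: r_def)
      have eq: "integral {p..q} k' = integral {p..q} k" if "a \<le> p" "q \<le> b" for p q
        by (rule integral_cong) (use that in "auto simp: k'_def")
      have k't: "k' t = k t" using t by (simp add: k'_def)
      show "((\<lambda>s. integral {a..s} k) has_vector_derivative k t) (at t)"
        unfolding has_vector_derivative_def has_derivative_at_alt
      proof (intro conjI bounded_linear_scaleR_left allI impI)
        fix e :: real assume "e > 0"
        obtain d1 where d1: "d1 > 0" "\<And>h. 0 < h \<Longrightarrow> h < d1 \<Longrightarrow> norm (integral {t..t + h} k' - h *\<^sub>R k' t) \<le> e * h"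
          using elim(1) `e > 0` by blast
        obtain d2 where d2: "d2 > 0" "\<And>h. 0 < h \<Longrightarrow> h < d2 \<Longrightarrow>
            norm (integral {- t..- t + h} (\<lambda>t. k' (- t)) - h *\<^sub>R k' (- (- t))) \<le> e * h"
          using elim(2) `e > 0` by blast
        have "norm (integral {a..s} k - integral {a..t} k - (s - t) *\<^sub>R k t) \<le> e * norm (s - t)"
          if s: "norm (s - t) < min r (min d1 d2)" for s
        proof (cases s t rule: linorder_cases)
          case equal
          then show ?thesis by simp
        next
          case greater
          have "integral {a..s} k - integral {a..t} k = integral {t..s} k"
            by (rule integral_increment[OF k]) (use greater s t in "auto simp: r_def")
          also have "... = integral {t..s} k'" by (rule eq[symmetric]) (use greater s t in "auto simp: r_def")
          finally show ?thesis using d1(2)[of "s - t"] greater s k't by simp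
        next
          case less
          have "integral {a..t} k - integral {a..s} k = integral {s..t} k"
            by (rule integral_increment[OF k]) (use less s t in "auto simp: r_def")
          also have "... = integral {s..t} k'" by (rule eq[symmetric]) (use less s t in "auto simp: r_def")
          also have "... = integral {- t..- t + (t - s)} (\<lambda>t. k' (- t))"
            using Henstock_Kurzweil_Integration.integral_reflect_real[of t s k'] by simp
          finally have "norm (integral {a..t} k - integral {a..s} k - (t - s) *\<^sub>R k t) \<le> e * (t - s)"
            using d2(2)[of "t - s"] less s k't by simp
          moreover have "integral {a..t} k - integral {a..s} k - (t - s) *\<^sub>R k t =
              - (integral {a..s} k - integral {a..t} k - (s - t) *\<^sub>R k t)" by (simp add: algebra_simps)
          ultimately show ?thesis using less by (metis abs_of_neg diff_less_0_iff_less minus_diff_eq norm_minus_cancel real_norm_def)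
        qed
        then show "\<exists>d>0. \<forall>y. norm (y - t) < d \<longrightarrow>
            norm (integral {a..y} k - integral {a..t} k - (y - t) *\<^sub>R k t) \<le> e * norm (y - t)"
          using r d1(1) d2(1) by (intro exI[of _ "min r (min d1 d2)"]) auto
      qed
    qed
  qed
qed

section \<open>Filippov solutions as order-theoretic trajectories\<close>

text \<open>For fields that increase up to \<open>C t\<close> times the identity, the semicontinuous envelopes in Filippov's
  inclusion can be replaced by the values at strictly smaller and strictly larger points. Each half of the
  resulting condition is what one side of a comparison needs.\<close>

definition sub_trajectory ::
    "(real \<Rightarrow> real) \<Rightarrow> (real \<Rightarrow> real ^ 'd \<Rightarrow> real ^ 'd) \<Rightarrow> real \<Rightarrow> real \<Rightarrow> (real \<Rightarrow> real ^ 'd) \<Rightarrow> bool" where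
  "sub_trajectory C b a c y \<longleftrightarrow> AC a c y \<and>
     (AE t in lebesgue. a < t \<and> t < c \<longrightarrow> (\<exists>v. (y has_vector_derivative v) (at t) \<and>
        (\<forall>z. y t \<lless> z \<longrightarrow> v + C t *\<^sub>R y t \<le> b t z + C t *\<^sub>R z)))"

definition super_trajectory ::
    "(real \<Rightarrow> real) \<Rightarrow> (real \<Rightarrow> real ^ 'd \<Rightarrow> real ^ 'd) \<Rightarrow> real \<Rightarrow> real \<Rightarrow> (real \<Rightarrow> real ^ 'd) \<Rightarrow> bool" where
  "super_trajectory C b a c y \<longleftrightarrow> AC a c y \<and>
     (AE t in lebesgue. a < t \<and> t < c \<longrightarrow> (\<exists>v. (y has_vector_derivative v) (at t) \<and>
        (\<forall>z. z \<lless> y t \<longrightarrow> b t z + C t *\<^sub>R z \<le> v + C t *\<^sub>R y t)))"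

definition trajectory ::
    "(real \<Rightarrow> real) \<Rightarrow> (real \<Rightarrow> real ^ 'd \<Rightarrow> real ^ 'd) \<Rightarrow> real \<Rightarrow> real \<Rightarrow> (real \<Rightarrow> real ^ 'd) \<Rightarrow> bool" where
  "trajectory C b a c y \<longleftrightarrow> AC a c y \<and>
     (AE t in lebesgue. a < t \<and> t < c \<longrightarrow> (\<exists>v. (y has_vector_derivative v) (at t) \<and>
        (\<forall>z. z \<lless> y t \<longrightarrow> b t z + C t *\<^sub>R z \<le> v + C t *\<^sub>R y t) \<and>
        (\<forall>z. y t \<lless> z \<longrightarrow> v + C t *\<^sub>R y t \<le> b t z + C t *\<^sub>R z)))"

lemma trajectory_imp_sub: "trajectory C b a c y \<Longrightarrow> sub_trajectory C b a c y"
  and trajectory_imp_super: "trajectory C b a c y \<Longrightarrow> super_trajectory C b a c y"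
  unfolding trajectory_def sub_trajectory_def super_trajectory_def
  by (auto elim!: eventually_mono)

lemma trajectory_subinterval:
  assumes "trajectory C b a c y" "a \<le> a'" "c' \<le> c"
  shows "trajectory C b a' c' y"
  using assms unfolding trajectory_def
  by (auto intro: AC_subinterval elim!: eventually_mono)

text \<open>The value at a strictly smaller point bounds the field from below in a whole neighbourhood.\<close>

lemma lower_env_le_iff:
  fixes b :: "real ^ 'd \<Rightarrow> real ^ 'd"
  assumes mono: "mono (\<lambda>x. b x + C *\<^sub>R x)"
  shows "lower_env (\<lambda>z. b z $ i) y \<le> ereal v \<longleftrightarrow> (\<forall>z. z \<lless> y \<longrightarrow> b z $ i + C * z $ i \<le> v + C * y $ i)"
proof
  assume L: "lower_env (\<lambda>z. b z $ i) y \<le> ereal v"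
  show "\<forall>z. z \<lless> y \<longrightarrow> b z $ i + C * z $ i \<le> v + C * y $ i"
  proof (intro allI impI, rule ccontr)
    fix z assume z: "z \<lless> y" and "\<not> b z $ i + C * z $ i \<le> v + C * y $ i"
    then obtain r where r: "v < r" "r < b z $ i + C * z $ i - C * y $ i"
      using dense[of v "b z $ i + C * z $ i - C * y $ i"] by auto
    have "((\<lambda>w. b z $ i + C * z $ i - C * w $ i) \<longlongrightarrow> b z $ i + C * z $ i - C * y $ i) (nhds y)"
      by (intro tendsto_intros filterlim_ident)
    then have "\<forall>\<^sub>F w in nhds y. r < b z $ i + C * z $ i - C * w $ i" using r(2) by (rule order_tendstoD)
    moreover have "\<forall>\<^sub>F w in nhds y. z \<lless> w"
      using eventually_nhds_in_open[OF open_strictly_below(1)[of z]] z by simp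
    ultimately have "\<forall>\<^sub>F w in nhds y. ereal r \<le> ereal (b w $ i)"
    proof eventually_elim
      case (elim w)
      have "b z + C *\<^sub>R z \<le> b w + C *\<^sub>R w" using mono strictly_below_imp_le[OF elim(2)] by (simp add: mono_def)
      then have "b z $ i + C * z $ i \<le> b w $ i + C * w $ i" by (simp add: less_eq_vec_def)
      then show ?case using elim(1) by simp
    qed
    then have "ereal r \<le> lower_env (\<lambda>z. b z $ i) y" unfolding lower_env_def by (rule Liminf_bounded)
    then show False using L r(1) by (metis ereal_less_eq(3) leD order_trans)
  qed
next
  assume R: "\<forall>z. z \<lless> y \<longrightarrow> b z $ i + C * z $ i \<le> v + C * y $ i"
  show "lower_env (\<lambda>z. b z $ i) y \<le> ereal v"
  proof (rule ccontr)
    assume "\<not> ?thesis"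
    then obtain r where r: "ereal v < ereal r" "ereal r < lower_env (\<lambda>z. b z $ i) y"
      using ereal_dense2[of "ereal v"] by (auto simp: not_le)
    have ev: "\<forall>\<^sub>F w in nhds y. ereal r < ereal (b w $ i)"
      using r(2) unfolding lower_env_def by (rule less_LiminfD)
    have "((\<lambda>s::real. y - s *\<^sub>R 1) \<longlongrightarrow> y - 0 *\<^sub>R 1) (at_right 0)" by (intro tendsto_intros)
    then have "\<forall>\<^sub>F s::real in at_right 0. r < b (y - s *\<^sub>R 1) $ i"
      using ev by (auto simp: filterlim_iff)
    moreover have "((\<lambda>s::real. v + C * s) \<longlongrightarrow> v + C * 0) (at_right 0)" by (intro tendsto_intros)
    then have "\<forall>\<^sub>F s::real in at_right 0. v + C * s < r" using r(1) by (intro order_tendstoD) auto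
    moreover have "\<forall>\<^sub>F s::real in at_right 0. 0 < s" by (simp add: eventually_at_right_less)
    ultimately have "\<forall>\<^sub>F s::real in at_right 0. False"
    proof eventually_elim
      case (elim s)
      have "b (y - s *\<^sub>R 1) $ i + C * (y - s *\<^sub>R 1) $ i \<le> v + C * y $ i"
        using R strictly_below_shift(1)[OF elim(3), of y] by blast
      then show False using elim by (simp add: algebra_simps)
    qed
    then show False by (simp add: trivial_limit_at_right_real)
  qed
qed

lemma mono_reflect:
  fixes b :: "real ^ 'd \<Rightarrow> real ^ 'd"
  assumes "mono (\<lambda>x. b x + c *\<^sub>R x)"
  shows "mono (\<lambda>x. - b (- x) + c *\<^sub>R x)"
proof (rule monoI)
  fix x y :: "real ^ 'd" assume "x \<le> y"
  then have "- y \<le> - x" by (simp add: less_eq_vec_def)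
  then have "b (- y) + c *\<^sub>R (- y) \<le> b (- x) + c *\<^sub>R (- x)" using assms by (rule monoD[rotated])
  then show "- b (- x) + c *\<^sub>R x \<le> - b (- y) + c *\<^sub>R y" by (simp add: less_eq_vec_def algebra_simps)
qed

lemma lower_env_reflect:
  fixes h :: "real ^ 'd \<Rightarrow> real"
  shows "lower_env (\<lambda>z. - h (- z)) x = - upper_env h (- x)"
proof -
  have "upper_env h (- x) = Limsup (nhds x) (\<lambda>y. ereal (h (- y)))"
    unfolding upper_env_def filtermap_nhds_minus[symmetric] by (rule Limsup_filtermap_eq) simp
  then show ?thesis
    unfolding lower_env_def by (simp add: ereal_Liminf_uminus[of "nhds x" "\<lambda>y. ereal (h (- y))", simplified])
qed

lemma le_upper_env_iff:
  fixes b :: "real ^ 'd \<Rightarrow> real ^ 'd"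
  assumes mono: "mono (\<lambda>x. b x + C *\<^sub>R x)"
  shows "ereal v \<le> upper_env (\<lambda>z. b z $ i) y \<longleftrightarrow> (\<forall>z. y \<lless> z \<longrightarrow> v + C * y $ i \<le> b z $ i + C * z $ i)"
proof -
  have "ereal v \<le> upper_env (\<lambda>z. b z $ i) y \<longleftrightarrow> lower_env (\<lambda>z. (- b (- z)) $ i) (- y) \<le> ereal (- v)"
    using lower_env_reflect[of "\<lambda>z. b z $ i" "- y"] ereal_minus_le_minus[of "upper_env (\<lambda>z. b z $ i) y" "ereal v"] by simp
  also have "... \<longleftrightarrow> (\<forall>z. z \<lless> - y \<longrightarrow> (- b (- z)) $ i + C * z $ i \<le> - v + C * (- y) $ i)"
    by (rule lower_env_le_iff[OF mono_reflect[OF mono]])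
  also have "... \<longleftrightarrow> (\<forall>z. y \<lless> z \<longrightarrow> v + C * y $ i \<le> b z $ i + C * z $ i)"
  proof (intro iffI allI impI)
    fix z assume *: "\<forall>z. z \<lless> - y \<longrightarrow> (- b (- z)) $ i + C * z $ i \<le> - v + C * (- y) $ i" and z: "y \<lless> z"
    show "v + C * y $ i \<le> b z $ i + C * z $ i" using *[rule_format, of "- z"] z by (simp add: strictly_below_minus)
  next
    fix z assume *: "\<forall>z. y \<lless> z \<longrightarrow> v + C * y $ i \<le> b z $ i + C * z $ i" and z: "z \<lless> - y"
    then have "y \<lless> - z" using strictly_below_minus[of "- z" y] by simp
    then show "(- b (- z)) $ i + C * z $ i \<le> - v + C * (- y) $ i" using *[rule_format, of "- z"] by simp
  qed
  finally show ?thesis .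
qed

lemma filippov_solution_iff_trajectory:
  assumes mono: "AE t in lebesgue. s < t \<and> t < T \<longrightarrow> mono (\<lambda>x. b t x + C t *\<^sub>R x)"
  shows "filippov_solution T b s x y \<longleftrightarrow> trajectory C b s T y \<and> y s = x"
proof -
  let ?F = "\<lambda>t. \<exists>v. (y has_vector_derivative v) (at t within {s..T}) \<and>
        (\<forall>i. lower_env (\<lambda>z. b t z $ i) (y t) \<le> ereal (v $ i) \<and>
             ereal (v $ i) \<le> upper_env (\<lambda>z. b t z $ i) (y t))"
  let ?G = "\<lambda>t. \<exists>v. (y has_vector_derivative v) (at t) \<and>
        (\<forall>z. z \<lless> y t \<longrightarrow> b t z + C t *\<^sub>R z \<le> v + C t *\<^sub>R y t) \<and>
        (\<forall>z. y t \<lless> z \<longrightarrow> v + C t *\<^sub>R y t \<le> b t z + C t *\<^sub>R z)"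
  have fin: "AE t in lebesgue. t \<noteq> s \<and> t \<noteq> T"
    unfolding AE_lebesgue_iff_negligible by (rule negligible_subset[of "{s, T}"]) auto
  have at: "at t within {s..T} = at t" if "s < t" "t < T" for t
    using that by (intro at_within_interior) auto
  have "(AE t in lebesgue_on {s..T}. ?F t)
    \<longleftrightarrow> (AE t in lebesgue. t \<in> {s..T} \<longrightarrow> ?F t)"
    by (simp add: AE_restrict_space_iff)
  also have "... \<longleftrightarrow> (AE t in lebesgue. s < t \<and> t < T \<longrightarrow> ?G t)" (is "?A \<longleftrightarrow> ?B")
  proof -
    have *: "(t \<in> {s..T} \<longrightarrow> ?F t) \<longleftrightarrow>
       (s < t \<and> t < T \<longrightarrow> ?G t)"
      if t: "t \<noteq> s \<and> t \<noteq> T" "s < t \<and> t < T \<longrightarrow> mono (\<lambda>x. b t x + C t *\<^sub>R x)" for t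
    proof (cases "s < t \<and> t < T")
      case True
      then have "t \<in> {s..T}" by simp
      have m: "mono (\<lambda>x. b t x + C t *\<^sub>R x)" using t True by simp
      have "(\<forall>i. lower_env (\<lambda>z. b t z $ i) (y t) \<le> ereal (v $ i) \<and>
             ereal (v $ i) \<le> upper_env (\<lambda>z. b t z $ i) (y t)) \<longleftrightarrow>
        (\<forall>z. z \<lless> y t \<longrightarrow> b t z + C t *\<^sub>R z \<le> v + C t *\<^sub>R y t) \<and>
        (\<forall>z. y t \<lless> z \<longrightarrow> v + C t *\<^sub>R y t \<le> b t z + C t *\<^sub>R z)" for v
        unfolding lower_env_le_iff[OF m] le_upper_env_iff[OF m] by (auto simp: less_eq_vec_def)
      then show ?thesis using True `t \<in> {s..T}` at[of t] by simp
    qed (use t(1) in auto)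
    show ?thesis
    proof
      assume ?A then show ?B using fin mono by eventually_elim (use * in blast)
    next
      assume ?B then show ?A using fin mono by eventually_elim (use * in blast)
    qed
  qed
  finally show ?thesis unfolding filippov_solution_def trajectory_def by blast
qed

lemma AC_nondecreasing_vec:
  fixes w :: "real \<Rightarrow> real ^ 'n"
  assumes AC: "AC a c w"
    and deriv: "AE t in lebesgue. p < t \<and> t < q \<longrightarrow> (\<exists>v. 0 \<le> v \<and> (w has_vector_derivative v) (at t))"
    and pq: "a \<le> p" "p \<le> q" "q \<le> c"
  shows "w p \<le> w q"
  unfolding less_eq_vec_def
proof
  fix i
  show "w p $ i \<le> w q $ i"
  proof (rule AC_nondecreasing[OF _ pq(2)])
    show "AC p q (\<lambda>t. w t $ i)"
      by (rule AC_bounded_linear[OF AC_subinterval[OF AC pq(1,3)] bounded_linear_vec_nth])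
    show "AE t in lebesgue. p < t \<and> t < q \<longrightarrow> (\<exists>D\<ge>0. ((\<lambda>t. w t $ i) has_real_derivative D) (at t))"
      using deriv
    proof eventually_elim
      case (elim t)
      show ?case
      proof
        assume "p < t \<and> t < q"
        then obtain v where v: "0 \<le> v" "(w has_vector_derivative v) (at t)" using elim by blast
        have "((\<lambda>t. w t $ i) has_vector_derivative v $ i) (at t)"
          by (rule bounded_linear.has_vector_derivative[OF bounded_linear_vec_nth v(2)])
        then show "\<exists>D\<ge>0. ((\<lambda>t. w t $ i) has_real_derivative D) (at t)"
          using v(1) by (auto simp: has_real_derivative_iff_has_vector_derivative less_eq_vec_def)
      qed
    qed
  qed
qed

lemma AE_derivative_exp_integral:
  assumes "C integrable_on {a..c}"
  shows "AE t in lebesgue. a < t \<and> t < c \<longrightarrow>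
    ((\<lambda>t. exp (r * integral {a..t} C)) has_real_derivative (r * C t * exp (r * integral {a..t} C))) (at t)"
  using AE_derivative_integral[OF assms]
proof eventually_elim
  case (elim t)
  show ?case
  proof
    assume "a < t \<and> t < c"
    then have "((\<lambda>t. integral {a..t} C) has_real_derivative C t) (at t)"
      using elim by (simp add: has_real_derivative_iff_has_vector_derivative)
    from DERIV_fun_exp[OF DERIV_cmult[OF this, of r]]
    show "((\<lambda>t. exp (r * integral {a..t} C)) has_real_derivative (r * C t * exp (r * integral {a..t} C))) (at t)"
      by (simp add: mult_ac)
  qed
qed

lemma AC_exp_integral:
  fixes C :: "real \<Rightarrow> real"
  assumes "C integrable_on {a..c}" "\<And>t. t \<in> {a..c} \<Longrightarrow> 0 \<le> C t"
  shows "AC a c (\<lambda>t. exp (r * integral {a..t} C))"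
  by (intro AC_exp AC_bounded_linear[OF AC_integral_nonneg[OF assms] bounded_linear_mult_right])

text \<open>The two velocities are compared through the field at a single point between the trajectories, which
  needs no continuity of the field.\<close>

lemma trajectory_comparison:
  assumes sub: "sub_trajectory C b1 a c y1" and sup: "super_trajectory C b2 a c y2"
    and le: "AE t in lebesgue. a < t \<and> t < c \<longrightarrow> (\<forall>z. b1 t z \<le> b2 t z)"
    and C: "C integrable_on {a..c}" "\<And>t. t \<in> {a..c} \<Longrightarrow> 0 \<le> C t"
    and start: "y1 a \<lless> y2 a" and t: "t \<in> {a..c}"
  shows "exp (- integral {a..t} C) *\<^sub>R (y2 a - y1 a) \<le> y2 t - y1 t"
proof -
  define E where "E = (\<lambda>t. exp (1 * integral {a..t} C))"
  define w where "w = (\<lambda>t. E t *\<^sub>R (y2 t - y1 t))"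
  have E: "E t > 0" "E a = 1" for t by (auto simp: E_def)
  have AC: "AC a c w"
  proof -
    have "AC a c (\<lambda>t. y2 t + (- y1 t))"
      using sub sup AC_bounded_linear[OF _ bounded_linear_minus[OF bounded_linear_ident], of a c y1]
      by (intro AC_add) (auto simp: sub_trajectory_def super_trajectory_def)
    then show ?thesis unfolding w_def E_def
      by (intro AC_scaleR AC_exp_integral[OF C]) simp_all
  qed
  have deriv: "AE t in lebesgue. a < t \<and> t < c \<and> y1 t \<lless> y2 t \<longrightarrow> (\<exists>v. 0 \<le> v \<and> (w has_vector_derivative v) (at t))"
    using conjunct2[OF sub[unfolded sub_trajectory_def]] conjunct2[OF sup[unfolded super_trajectory_def]]
      le AE_derivative_exp_integral[OF C(1), of 1]
  proof eventually_elim
    case (elim t)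
    show ?case
    proof
      assume t: "a < t \<and> t < c \<and> y1 t \<lless> y2 t"
      obtain v1 where v1: "(y1 has_vector_derivative v1) (at t)"
        "\<And>z. y1 t \<lless> z \<Longrightarrow> v1 + C t *\<^sub>R y1 t \<le> b1 t z + C t *\<^sub>R z" using elim(1) t by blast
      obtain v2 where v2: "(y2 has_vector_derivative v2) (at t)"
        "\<And>z. z \<lless> y2 t \<Longrightarrow> b2 t z + C t *\<^sub>R z \<le> v2 + C t *\<^sub>R y2 t" using elim(2) t by blast
      obtain z where z: "y1 t \<lless> z" "z \<lless> y2 t" using t strictly_below_dense by blast
      have "v1 + C t *\<^sub>R y1 t \<le> b1 t z + C t *\<^sub>R z" by (rule v1(2)[OF z(1)])
      also have "... \<le> b2 t z + C t *\<^sub>R z" using elim(3) t by (intro add_right_mono) auto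
      also have "... \<le> v2 + C t *\<^sub>R y2 t" by (rule v2(2)[OF z(2)])
      finally have ge: "0 \<le> (v2 - v1) + C t *\<^sub>R (y2 t - y1 t)"
        by (simp add: algebra_simps less_eq_vec_def)
      have "(w has_vector_derivative (E t *\<^sub>R (v2 - v1) + (1 * C t * E t) *\<^sub>R (y2 t - y1 t))) (at t)"
        unfolding w_def
        by (rule has_vector_derivative_scaleR) (use elim(4) t v1 v2 in "auto simp: E_def intro: has_vector_derivative_diff")
      moreover have "E t *\<^sub>R (v2 - v1) + (1 * C t * E t) *\<^sub>R (y2 t - y1 t) = E t *\<^sub>R ((v2 - v1) + C t *\<^sub>R (y2 t - y1 t))"
        by (simp add: algebra_simps)
      moreover have "0 \<le> E t *\<^sub>R ((v2 - v1) + C t *\<^sub>R (y2 t - y1 t))"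
        using ge E(1)[of t] by (simp add: less_eq_vec_def)
      ultimately show "\<exists>v. 0 \<le> v \<and> (w has_vector_derivative v) (at t)" by metis
    qed
  qed
  define \<mu> where "\<mu> = Min (range (\<lambda>i. w a $ i))"
  have \<mu>: "\<mu> > 0" "\<mu> \<le> w a $ i" for i
    using start E by (auto simp: \<mu>_def w_def strictly_below_def)
  obtain d where d: "d > 0" "\<And>p q. a \<le> p \<Longrightarrow> p \<le> q \<Longrightarrow> q \<le> c \<Longrightarrow> q - p < d \<Longrightarrow> norm (w q - w p) < \<mu>"
    using AC_uniform[OF AC \<mu>(1)] by blast
  \<comment> \<open>Once the gap has its initial size it stays positive for a time \<open>d\<close> that does not depend on
    the starting time, and while it is positive it cannot shrink.\<close>
  have step: "w a \<le> w q" if p: "w a \<le> w p" and pq: "a \<le> p" "p \<le> q" "q \<le> c" "q - p < d" for p q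
  proof -
    have pos: "y1 s \<lless> y2 s" if s: "p \<le> s" "s \<le> q" for s
      unfolding strictly_below_def
    proof
      fix i
      have "\<bar>(w s - w p) $ i\<bar> \<le> norm (w s - w p)" by (rule component_le_norm_cart)
      also have "... < \<mu>" by (rule d(2)) (use s pq in auto)
      finally have "0 < w s $ i" using \<mu>(2)[of i] p by (auto simp: less_eq_vec_def abs_less_iff intro: less_le_trans dest: spec[of _ i])
      then show "y1 s $ i < y2 s $ i" using E(1)[of s] by (simp add: w_def zero_less_mult_iff)
    qed
    have "w p \<le> w q"
      by (rule AC_nondecreasing_vec[OF AC _ pq(1-3)])
        (use deriv pos pq in "auto elim!: eventually_mono")
    then show ?thesis using p by (rule order_trans[rotated])
  qed
  have "a \<le> a \<and> t \<le> c \<and> w a \<le> w a \<longrightarrow> w a \<le> w t"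
  proof (rule Bolzano[where P = "\<lambda>p q. a \<le> p \<and> q \<le> c \<and> w a \<le> w p \<longrightarrow> w a \<le> w q" and a = a and b = t])
    show "\<exists>d>0. \<forall>p q. p \<le> x \<and> x \<le> q \<and> q - p < d \<longrightarrow> (a \<le> p \<and> q \<le> c \<and> w a \<le> w p \<longrightarrow> w a \<le> w q)" for x
      using d(1) step by (intro exI[of _ d]) auto
  qed (use t in auto)
  then have "w a \<le> w t" using t by simp
  then have "exp (- integral {a..t} C) *\<^sub>R w a \<le> exp (- integral {a..t} C) *\<^sub>R w t"
    by (simp add: less_eq_vec_def)
  then show ?thesis by (simp add: w_def E_def flip: exp_add)
qed

lemma norm_le_card_times:
  fixes x :: "real ^ 'n"
  assumes "\<And>i. \<bar>x $ i\<bar> \<le> P"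
  shows "norm x \<le> real CARD('n) * P"
proof -
  have "norm x \<le> (\<Sum>i\<in>UNIV. \<bar>x $ i\<bar>)" by (rule norm_le_l1_cart)
  also have "... \<le> (\<Sum>i\<in>(UNIV :: 'n set). P)" using assms by (intro sum_mono) auto
  finally show ?thesis by simp
qed

text \<open>A negative multiple of the diagonal that grows at rate \<open>L * K\<close> moves down faster than the field can, so it
  is a sub-trajectory; a factor \<open>r > 1\<close> makes it start strictly below.\<close>

lemma lower_barrier:
  fixes y :: "real \<Rightarrow> real ^ 'd"
  assumes sup: "super_trajectory C b a c y"
    and mono: "\<And>t. mono (\<lambda>x. b t x + C t *\<^sub>R x)"
    and growth: "\<And>t x. norm (b t x) \<le> K t * (1 + norm x)"
    and C: "C integrable_on {a..c}" "\<And>t. t \<in> {a..c} \<Longrightarrow> 0 \<le> C t"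
    and K: "K integrable_on {a..c}" "\<And>t. 0 \<le> K t"
    and L: "1 + real CARD('d) \<le> L" and q: "1 \<le> q" "- q *\<^sub>R 1 \<le> y a" and t: "t \<in> {a..c}"
  shows "- (q * exp (L * integral {a..t} K)) *\<^sub>R 1 \<le> y t"
proof -
  define p where "p = (\<lambda>t. exp (L * integral {a..t} K))"
  have Kint: "0 \<le> integral {a..t} K" for t using K(2) by (cases "K integrable_on {a..t}") (auto intro: integral_nonneg simp: not_integrable_integral)
  have p: "1 \<le> p t" for t using L Kint[of t] by (simp add: p_def)
  have main: "- (r * q * p t) *\<^sub>R 1 \<le> y t" if r: "r > 1" for r
  proof -
    define w where "w = (\<lambda>t. p t *\<^sub>R (- (r * q) *\<^sub>R (1 :: real ^ 'd)))"
    have rq: "1 \<le> r * q" using r q(1) mult_mono[of 1 r 1 q] by simp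
    have "sub_trajectory C b a c w"
      unfolding sub_trajectory_def
    proof
      have "AC a c p"
        unfolding p_def by (rule AC_exp_integral) (use K in auto)
      then show "AC a c w" unfolding w_def
        by (rule AC_bounded_linear) (rule bounded_linear_scaleR_left)
      show "AE t in lebesgue. a < t \<and> t < c \<longrightarrow> (\<exists>v. (w has_vector_derivative v) (at t) \<and>
        (\<forall>z. w t \<lless> z \<longrightarrow> v + C t *\<^sub>R w t \<le> b t z + C t *\<^sub>R z))"
        using AE_derivative_exp_integral[OF K(1), of L]
      proof eventually_elim
        case (elim t)
        show ?case
        proof
          assume t: "a < t \<and> t < c"
          define v where "v = (L * K t * p t) *\<^sub>R (- (r * q) *\<^sub>R (1 :: real ^ 'd))"
          have "(w has_vector_derivative (p t *\<^sub>R 0 + (L * K t * p t) *\<^sub>R (- (r * q) *\<^sub>R (1 :: real ^ 'd)))) (at t)"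
            unfolding w_def by (rule has_vector_derivative_scaleR) (use elim t in "auto simp: p_def")
          then have "(w has_vector_derivative v) (at t)" by (simp add: v_def)
          moreover have "v + C t *\<^sub>R w t \<le> b t z + C t *\<^sub>R z" if z: "w t \<lless> z" for z
          proof -
            have P: "1 \<le> p t * (r * q)" using mult_mono[OF p[of t] rq] p[of t] by simp
            have "norm (w t) \<le> real CARD('d) * (p t * (r * q))"
              by (rule norm_le_card_times) (use P in "simp add: w_def abs_mult")
            then have "1 + norm (w t) \<le> L * (p t * (r * q))"
              using P L mult_right_mono[OF L, of "p t * (r * q)"] by (simp add: distrib_right)
            then have N: "norm (b t (w t)) \<le> K t * (L * (p t * (r * q)))"
              using growth[of t "w t"] mult_left_mono[OF _ K(2)[of t]] order_trans by blast
            have "v \<le> b t (w t)"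
              unfolding less_eq_vec_def
            proof
              fix i
              have "\<bar>b t (w t) $ i\<bar> \<le> K t * (L * (p t * (r * q)))" using N component_le_norm_cart order_trans by blast
              then show "v $ i \<le> b t (w t) $ i" by (simp add: v_def algebra_simps abs_le_iff)
            qed
            then have "v + C t *\<^sub>R w t \<le> b t (w t) + C t *\<^sub>R w t" by (rule add_right_mono)
            also have "... \<le> b t z + C t *\<^sub>R z" using monoD[OF mono[of t]] strictly_below_imp_le[OF z] by blast
            finally show ?thesis .
          qed
          ultimately show "\<exists>v. (w has_vector_derivative v) (at t) \<and> (\<forall>z. w t \<lless> z \<longrightarrow> v + C t *\<^sub>R w t \<le> b t z + C t *\<^sub>R z)"
            by blast
        qed
      qed
    qed
    moreover have start: "w a \<lless> y a"
      unfolding strictly_below_def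
    proof
      fix i
      have "- q \<le> y a $ i" using q(2) by (auto simp: less_eq_vec_def dest: spec[of _ i])
      moreover have "q < r * q" using r q(1) by simp
      ultimately show "w a $ i < y a $ i" by (simp add: w_def p_def)
    qed
    ultimately have "exp (- integral {a..t} C) *\<^sub>R (y a - w a) \<le> y t - w t"
      by (intro trajectory_comparison[OF _ sup _ C _ t]) auto
    moreover have "0 \<le> exp (- integral {a..t} C) *\<^sub>R (y a - w a)"
      using start by (simp add: less_eq_vec_def strictly_below_def less_imp_le)
    ultimately have "0 \<le> y t - w t" by (rule order_trans[rotated])
    then have "w t \<le> y t" by (simp add: less_eq_vec_def)
    then show ?thesis by (simp add: w_def mult_ac)
  qed
  show ?thesis
    unfolding less_eq_vec_def
  proof
    fix i
    show "(- (q * exp (L * integral {a..t} K)) *\<^sub>R (1 :: real ^ 'd)) $ i \<le> y t $ i"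
    proof (rule field_le_epsilon)
      fix e :: real assume "e > 0"
      have P: "0 < q * p t" using q(1) p[of t] by (intro mult_pos_pos) linarith+
      have "- ((1 + e / (q * p t)) * q * p t) \<le> y t $ i"
        using main[of "1 + e / (q * p t)"] P `e > 0` by (auto simp: less_eq_vec_def dest: spec[of _ i])
      moreover have "(1 + e / (q * p t)) * q * p t = q * p t + e / (q * p t) * (q * p t)"
        by (simp only: mult.assoc distrib_right mult_1)
      moreover have "e / r * r = e" if "0 < r" for r using that by simp
      from this[OF P] have "e / (q * p t) * (q * p t) = e" .
      ultimately show "(- (q * exp (L * integral {a..t} K)) *\<^sub>R (1 :: real ^ 'd)) $ i \<le> y t $ i + e"
        by (simp add: p_def)
    qed
  qed
qed

lemma super_trajectory_reflect:
  assumes "sub_trajectory C b a c y"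
  shows "super_trajectory C (\<lambda>t x. - b t (- x)) a c (\<lambda>t. - y t)"
  unfolding super_trajectory_def
proof
  show "AC a c (\<lambda>t. - y t)"
    using assms AC_bounded_linear[OF _ bounded_linear_minus[OF bounded_linear_ident]]
    by (auto simp: sub_trajectory_def)
  show "AE t in lebesgue. a < t \<and> t < c \<longrightarrow> (\<exists>v. ((\<lambda>t. - y t) has_vector_derivative v) (at t) \<and>
        (\<forall>z. z \<lless> - y t \<longrightarrow> - b t (- z) + C t *\<^sub>R z \<le> v + C t *\<^sub>R (- y t)))"
    using conjunct2[OF assms[unfolded sub_trajectory_def]]
  proof eventually_elim
    case (elim t)
    show ?case
    proof
      assume "a < t \<and> t < c"
      then obtain v where v: "(y has_vector_derivative v) (at t)"
        "\<And>z. y t \<lless> z \<Longrightarrow> v + C t *\<^sub>R y t \<le> b t z + C t *\<^sub>R z" using elim by blast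
      have "- b t (- z) + C t *\<^sub>R z \<le> - v + C t *\<^sub>R (- y t)" if "z \<lless> - y t" for z
      proof -
        have "y t \<lless> - z" using that strictly_below_minus[of "- z" "y t"] by (auto simp: strictly_below_def)
        from v(2)[OF this] show ?thesis by (simp add: less_eq_vec_def algebra_simps)
      qed
      then show "\<exists>v. ((\<lambda>t. - y t) has_vector_derivative v) (at t) \<and>
        (\<forall>z. z \<lless> - y t \<longrightarrow> - b t (- z) + C t *\<^sub>R z \<le> v + C t *\<^sub>R (- y t))"
        using has_vector_derivative_minus[OF v(1)] by blast
    qed
  qed
qed

lemma upper_barrier:
  fixes y :: "real \<Rightarrow> real ^ 'd"
  assumes sub: "sub_trajectory C b a c y"
    and mono: "\<And>t. mono (\<lambda>x. b t x + C t *\<^sub>R x)"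
    and growth: "\<And>t x. norm (b t x) \<le> K t * (1 + norm x)"
    and C: "C integrable_on {a..c}" "\<And>t. t \<in> {a..c} \<Longrightarrow> 0 \<le> C t"
    and K: "K integrable_on {a..c}" "\<And>t. 0 \<le> K t"
    and L: "1 + real CARD('d) \<le> L" and q: "1 \<le> q" "y a \<le> q *\<^sub>R 1" and t: "t \<in> {a..c}"
  shows "y t \<le> (q * exp (L * integral {a..t} K)) *\<^sub>R 1"
proof -
  have "- (q * exp (L * integral {a..t} K)) *\<^sub>R 1 \<le> - y t"
  proof (rule lower_barrier[OF super_trajectory_reflect[OF sub] mono_reflect[OF mono] _ C K L q(1) _ t])
    show "norm (- b t (- x)) \<le> K t * (1 + norm x)" for t x using growth[of t "- x"] by simp
    show "- q *\<^sub>R 1 \<le> - y a" using q(2) by (simp add: less_eq_vec_def)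
  qed
  then show ?thesis by (simp add: less_eq_vec_def)
qed

lemma trajectory_bound:
  fixes y :: "real \<Rightarrow> real ^ 'd"
  assumes tr: "trajectory C b a c y"
    and mono: "\<And>t. mono (\<lambda>x. b t x + C t *\<^sub>R x)"
    and growth: "\<And>t x. norm (b t x) \<le> K t * (1 + norm x)"
    and C: "C integrable_on {a..c}" "\<And>t. t \<in> {a..c} \<Longrightarrow> 0 \<le> C t"
    and K: "K integrable_on {a..c}" "\<And>t. 0 \<le> K t"
    and L: "1 + real CARD('d) \<le> L" and q: "1 \<le> q" "\<And>i. \<bar>y a $ i\<bar> \<le> q" and t: "t \<in> {a..c}"
  shows "\<bar>y t $ i\<bar> \<le> q * exp (L * integral {a..t} K)"
proof -
  have "- q *\<^sub>R 1 \<le> y a" "y a \<le> q *\<^sub>R 1"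
    using q(2) by (auto simp: less_eq_vec_def abs_le_iff minus_le_iff)
  from lower_barrier[OF trajectory_imp_super[OF tr] mono growth C K L q(1) this(1) t]
    upper_barrier[OF trajectory_imp_sub[OF tr] mono growth C K L q(1) this(2) t]
  show ?thesis by (auto simp: less_eq_vec_def abs_le_iff minus_le_iff)
qed

text \<open>The derivative of a trajectory is bounded by that of the barrier, so the barrier also controls
  the modulus of continuity.\<close>

lemma trajectory_increment:
  fixes y :: "real \<Rightarrow> real ^ 'd"
  assumes tr: "trajectory C b a c y"
    and mono: "\<And>t. mono (\<lambda>x. b t x + C t *\<^sub>R x)"
    and growth: "\<And>t x. norm (b t x) \<le> K t * (1 + norm x)"
    and C: "C integrable_on {a..c}" "\<And>t. t \<in> {a..c} \<Longrightarrow> 0 \<le> C t"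
    and K: "K integrable_on {a..c}" "\<And>t. 0 \<le> K t"
    and L: "1 + real CARD('d) \<le> L" and q: "1 \<le> q" "\<And>i. \<bar>y a $ i\<bar> \<le> q"
    and st: "a \<le> s" "s \<le> t" "t \<le> c"
  shows "\<bar>y t $ i - y s $ i\<bar> \<le> q * exp (L * integral {a..t} K) - q * exp (L * integral {a..s} K)"
proof -
  define p where "p = (\<lambda>t. q * exp (L * integral {a..t} K))"
  have Kint: "0 \<le> integral {a..t} K" for t using K(2) by (cases "K integrable_on {a..t}") (auto intro: integral_nonneg simp: not_integrable_integral)
  have p1: "1 \<le> p t" for t
  proof -
    have "1 * 1 \<le> q * exp (L * integral {a..t} K)"
      using L Kint[of t] q(1) by (intro mult_mono) auto
    then show ?thesis by (simp add: p_def)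
  qed
  have ACp: "AC a c (\<lambda>t. p t *\<^sub>R (1 :: real ^ 'd))"
    unfolding p_def
    by (intro AC_bounded_linear[OF _ bounded_linear_scaleR_left]
          AC_bounded_linear[OF _ bounded_linear_mult_right] AC_exp_integral) (use K in auto)
  have ACy: "AC a c y" using tr by (simp add: trajectory_def)
  have vbound: "AE t in lebesgue. a < t \<and> t < c \<longrightarrow> (\<exists>v. (y has_vector_derivative v) (at t) \<and> (\<forall>i. \<bar>v $ i\<bar> \<le> L * K t * p t))"
    using conjunct2[OF tr[unfolded trajectory_def]]
  proof eventually_elim
    case (elim t)
    show ?case
    proof
      assume t: "a < t \<and> t < c"
      then obtain v where v: "(y has_vector_derivative v) (at t)"
        "\<And>z. z \<lless> y t \<Longrightarrow> b t z + C t *\<^sub>R z \<le> v + C t *\<^sub>R y t"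
        "\<And>z. y t \<lless> z \<Longrightarrow> v + C t *\<^sub>R y t \<le> b t z + C t *\<^sub>R z" using elim by blast
      have "norm (y t) \<le> real CARD('d) * p t"
        by (rule norm_le_card_times) (use trajectory_bound[OF tr mono growth C K L q, of t] t in "auto simp: p_def")
      then have ny: "1 + norm (y t) \<le> L * p t"
        using p1[of t] L mult_right_mono[OF L, of "p t"] by (simp add: distrib_right)
      have "\<bar>v $ i\<bar> \<le> L * K t * p t" for i
      proof -
        have b: "\<bar>b t z $ i\<bar> \<le> K t * (1 + norm z)" for z using growth component_le_norm_cart order_trans by blast
        have "v $ i + C t * y t $ i \<le> K t * (1 + norm (y t)) + C t * y t $ i"
        proof (rule continuous_strict_limit(2)[of "\<lambda>z. K t * (1 + norm z) + C t * z $ i"])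
          show "v $ i + C t * y t $ i \<le> K t * (1 + norm z) + C t * z $ i" if "y t \<lless> z" for z
          proof -
            have "v $ i + C t * y t $ i \<le> b t z $ i + C t * z $ i" using v(3)[OF that] by (auto simp: less_eq_vec_def)
            then show ?thesis using b[of z] by linarith
          qed
        qed (intro continuous_intros)
        moreover have "- (K t * (1 + norm (y t))) + C t * y t $ i \<le> v $ i + C t * y t $ i"
        proof (rule continuous_strict_limit(3)[of "\<lambda>z. - (K t * (1 + norm z)) + C t * z $ i"])
          show "- (K t * (1 + norm z)) + C t * z $ i \<le> v $ i + C t * y t $ i" if "z \<lless> y t" for z
          proof -
            have "b t z $ i + C t * z $ i \<le> v $ i + C t * y t $ i" using v(2)[OF that] by (auto simp: less_eq_vec_def)
            then show ?thesis using b[of z] by linarith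
          qed
        qed (intro continuous_intros)
        moreover have "K t * (1 + norm (y t)) \<le> K t * (L * p t)" by (rule mult_left_mono[OF ny K(2)])
        ultimately show ?thesis by (simp add: abs_le_iff mult_ac)
      qed
      then show "\<exists>v. (y has_vector_derivative v) (at t) \<and> (\<forall>i. \<bar>v $ i\<bar> \<le> L * K t * p t)" using v(1) by blast
    qed
  qed
  have mono_pm: "p s *\<^sub>R 1 + \<sigma> *\<^sub>R y s \<le> p t *\<^sub>R 1 + \<sigma> *\<^sub>R y t" if \<sigma>: "\<bar>\<sigma>\<bar> = 1" for \<sigma> :: real
  proof (rule AC_nondecreasing_vec[OF _ _ st])
    show "AC a c (\<lambda>t. p t *\<^sub>R 1 + \<sigma> *\<^sub>R y t)"
      by (intro AC_add ACp AC_bounded_linear[OF ACy] bounded_linear_scaleR_right)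
    show "AE r in lebesgue. s < r \<and> r < t \<longrightarrow> (\<exists>v. 0 \<le> v \<and> ((\<lambda>t. p t *\<^sub>R 1 + \<sigma> *\<^sub>R y t) has_vector_derivative v) (at r))"
      using vbound AE_derivative_exp_integral[OF K(1), of L]
    proof eventually_elim
      case (elim r)
      show ?case
      proof
        assume r: "s < r \<and> r < t"
        then obtain v where v: "(y has_vector_derivative v) (at r)" "\<And>i. \<bar>v $ i\<bar> \<le> L * K r * p r"
          using elim(1) st by auto
        have "(p has_real_derivative L * K r * p r) (at r)"
          unfolding p_def using DERIV_cmult[OF elim(2)[rule_format], of q] r st by (simp add: mult_ac)
        then have "((\<lambda>t. p t *\<^sub>R (1 :: real ^ 'd) + \<sigma> *\<^sub>R y t) has_vector_derivative
            (p r *\<^sub>R 0 + (L * K r * p r) *\<^sub>R 1) + (\<sigma> *\<^sub>R v + 0 *\<^sub>R y r)) (at r)"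
          using v(1) by (intro has_vector_derivative_add has_vector_derivative_scaleR) auto
        moreover have "0 \<le> (p r *\<^sub>R 0 + (L * K r * p r) *\<^sub>R 1) + (\<sigma> *\<^sub>R v + 0 *\<^sub>R y r)"
          unfolding less_eq_vec_def
        proof
          fix i
          have "\<bar>\<sigma> * v $ i\<bar> \<le> L * K r * p r" using v(2)[of i] \<sigma> by (simp add: abs_mult)
          then show "0 $ i \<le> ((p r *\<^sub>R 0 + (L * K r * p r) *\<^sub>R 1) + (\<sigma> *\<^sub>R v + 0 *\<^sub>R y r)) $ i" by (simp add: abs_le_iff)
        qed
        ultimately show "\<exists>v. 0 \<le> v \<and> ((\<lambda>t. p t *\<^sub>R (1 :: real ^ 'd) + \<sigma> *\<^sub>R y t) has_vector_derivative v) (at r)" by blast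
      qed
    qed
  qed
  show ?thesis
    using mono_pm[of 1] mono_pm[of "- 1"]
    by (auto simp: less_eq_vec_def p_def abs_le_iff dest!: spec[of _ i])
qed

lemma AC_const: "AC a b (\<lambda>t. x)"
  unfolding abs_continuous_on_interval_def by (auto simp: case_prod_unfold intro!: exI[of _ 1])

lemma AC_FTC_le:
  fixes P k :: "real \<Rightarrow> real"
  assumes P: "AC a c P"
    and k: "k integrable_on {a..c}" "h integrable_on {a..c}" "\<And>t. t \<in> {a..c} \<Longrightarrow> \<bar>k t\<bar> \<le> h t"
    and deriv: "AE t in lebesgue. a < t \<and> t < c \<longrightarrow> (\<exists>D. (P has_real_derivative D) (at t) \<and> k t \<le> D)"
    and "a \<le> c"
  shows "integral {a..c} k \<le> P c - P a"
proof -
  have "AC a c (\<lambda>t. P t + - integral {a..t} k)"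
    by (intro AC_add P AC_bounded_linear[OF _ bounded_linear_minus[OF bounded_linear_ident]]
        AC_integral[OF k(1,2)]) (use k(3) in auto)
  moreover have "AE t in lebesgue. a < t \<and> t < c \<longrightarrow> (\<exists>D\<ge>0. ((\<lambda>t. P t + - integral {a..t} k) has_real_derivative D) (at t))"
    using deriv AE_derivative_integral[OF k(1)]
  proof eventually_elim
    case (elim t)
    show ?case
    proof
      assume t: "a < t \<and> t < c"
      then obtain D where D: "(P has_real_derivative D) (at t)" "k t \<le> D" using elim(1) by blast
      have "((\<lambda>t. integral {a..t} k) has_real_derivative k t) (at t)"
        using elim(2) t by (simp add: has_real_derivative_iff_has_vector_derivative)
      from DERIV_add[OF D(1) DERIV_minus[OF this]] D(2)
      show "\<exists>D\<ge>0. ((\<lambda>t. P t + - integral {a..t} k) has_real_derivative D) (at t)" by (intro exI[of _ "D - k t"]) auto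
    qed
  qed
  ultimately have "P a + - integral {a..a} k \<le> P c + - integral {a..c} k"
    by (rule AC_nondecreasing[OF _ `a \<le> c`])
  then show ?thesis by simp
qed

section \<open>Left-continuous regularisation of monotone fields\<close>

definition mono_below :: "(real ^ 'n \<Rightarrow> real ^ 'k) \<Rightarrow> bool" where
  "mono_below h \<longleftrightarrow> (\<forall>x y. x \<lless> y \<longrightarrow> h x \<le> h y)"

lemma mono_belowD: "mono_below h \<Longrightarrow> x \<lless> y \<Longrightarrow> h x \<le> h y"
  by (simp add: mono_below_def)

lemma mono_imp_mono_below: "mono h \<Longrightarrow> mono_below h"
  by (auto simp: mono_below_def mono_def strictly_below_imp_le)

definition left_sup :: "(real ^ 'n \<Rightarrow> real ^ 'k) \<Rightarrow> real ^ 'n \<Rightarrow> real ^ 'k" where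
  "left_sup h x = (\<chi> i. SUP z\<in>{z. z \<lless> x}. h z $ i)"

lemma strictly_below_nonempty: "{z :: real ^ 'n. z \<lless> x} \<noteq> {}"
  using strictly_below_shift(1)[of 1 x] by auto

lemma left_sup_bdd:
  assumes "mono_below h" shows "bdd_above ((\<lambda>z. h z $ i) ` {z. z \<lless> x})"
proof (rule bdd_aboveI2)
  fix z assume "z \<in> {z. z \<lless> x}"
  then show "h z $ i \<le> h x $ i"
    using mono_belowD[OF assms, of z x] by (simp add: less_eq_vec_def[of "h z"])
qed

lemma left_sup_upper: "mono_below h \<Longrightarrow> z \<lless> x \<Longrightarrow> h z \<le> left_sup h x"
  unfolding less_eq_vec_def[of "h z"] left_sup_def by (auto intro!: cSUP_upper left_sup_bdd)

lemma left_sup_least: "(\<And>z. z \<lless> x \<Longrightarrow> h z \<le> v) \<Longrightarrow> left_sup h x \<le> v"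
  unfolding less_eq_vec_def left_sup_def by (auto intro!: cSUP_least strictly_below_nonempty)

lemma left_sup_le: "mono_below h \<Longrightarrow> left_sup h x \<le> h x"
  by (rule left_sup_least) (rule mono_belowD)

lemma left_sup_ge_continuous:
  assumes h: "mono_below h" and c: "continuous_on UNIV c" and le: "\<And>z. c z \<le> h z $ i"
  shows "c x \<le> left_sup h x $ i"
proof (rule continuous_strict_limit(3)[OF c])
  fix z assume "z \<lless> x"
  then have "h z $ i \<le> left_sup h x $ i" using left_sup_upper[OF h] by (auto simp: less_eq_vec_def)
  then show "c z \<le> left_sup h x $ i" using le[of z] by linarith
qed

lemma less_left_sup_iff: "mono_below h \<Longrightarrow> a < left_sup h x $ i \<longleftrightarrow> (\<exists>z. z \<lless> x \<and> a < h z $ i)"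
  unfolding left_sup_def by (simp add: less_cSUP_iff[OF strictly_below_nonempty left_sup_bdd])

lemma left_sup_mono:
  assumes "mono_below h" "mono_below h'" "\<And>z. h z \<le> h' z" "x \<le> y" shows "left_sup h x \<le> left_sup h' y"
proof (rule left_sup_least)
  fix z assume "z \<lless> x"
  then have "h' z \<le> left_sup h' y" using assms(2,4) strictly_below_le_trans left_sup_upper by blast
  then show "h z \<le> left_sup h' y" using assms(3) order_trans by blast
qed

lemma left_sup_scaleR:
  assumes "mono_below h" "0 < r"
  shows "left_sup (\<lambda>z. r *\<^sub>R h ((1 / r) *\<^sub>R z)) x = r *\<^sub>R left_sup h ((1 / r) *\<^sub>R x)"
proof (rule antisym)
  have sc: "mono_below (\<lambda>z. r *\<^sub>R h ((1 / r) *\<^sub>R z))"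
    unfolding mono_below_def
  proof (intro allI impI)
    fix z w :: "real ^ 'a" assume "z \<lless> w"
    then have "(1 / r) *\<^sub>R z \<lless> (1 / r) *\<^sub>R w" using assms(2) by (intro strictly_below_scaleR) auto
    then have "h ((1 / r) *\<^sub>R z) \<le> h ((1 / r) *\<^sub>R w)" by (rule mono_belowD[OF assms(1)])
    then show "r *\<^sub>R h ((1 / r) *\<^sub>R z) \<le> r *\<^sub>R h ((1 / r) *\<^sub>R w)" using assms(2) by (simp add: less_eq_vec_def)
  qed
  show "left_sup (\<lambda>z. r *\<^sub>R h ((1 / r) *\<^sub>R z)) x \<le> r *\<^sub>R left_sup h ((1 / r) *\<^sub>R x)"
  proof (rule left_sup_least)
    fix z assume "z \<lless> x"
    then have "(1 / r) *\<^sub>R z \<lless> (1 / r) *\<^sub>R x" using assms(2) by (intro strictly_below_scaleR) auto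
    from left_sup_upper[OF assms(1) this] show "r *\<^sub>R h ((1 / r) *\<^sub>R z) \<le> r *\<^sub>R left_sup h ((1 / r) *\<^sub>R x)"
      using assms(2) by (simp add: less_eq_vec_def)
  qed
  have "left_sup h ((1 / r) *\<^sub>R x) \<le> (1 / r) *\<^sub>R left_sup (\<lambda>z. r *\<^sub>R h ((1 / r) *\<^sub>R z)) x"
  proof (rule left_sup_least)
    fix z assume "z \<lless> (1 / r) *\<^sub>R x"
    then have "r *\<^sub>R z \<lless> x" using strictly_below_scaleR[OF assms(2), of z "(1 / r) *\<^sub>R x"] assms(2) by simp
    from left_sup_upper[OF sc this] have "r *\<^sub>R h z \<le> left_sup (\<lambda>z. r *\<^sub>R h ((1 / r) *\<^sub>R z)) x" using assms(2) by simp
    then show "h z \<le> (1 / r) *\<^sub>R left_sup (\<lambda>z. r *\<^sub>R h ((1 / r) *\<^sub>R z)) x"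
      using assms(2) by (simp add: less_eq_vec_def field_simps)
  qed
  then show "r *\<^sub>R left_sup h ((1 / r) *\<^sub>R x) \<le> left_sup (\<lambda>z. r *\<^sub>R h ((1 / r) *\<^sub>R z)) x"
    using assms(2) by (simp add: less_eq_vec_def field_simps)
qed

lemma left_sup_tendsto:
  assumes H: "\<And>n. mono_below (H n)" and lim: "\<And>z. (\<lambda>n. H n z) \<longlonglongrightarrow> H' z" and le: "\<And>n z. H n z \<le> H' z"
    and H': "mono_below H'" and y: "y \<longlonglongrightarrow> y'" "\<And>n. y n \<le> y'"
  shows "(\<lambda>n. left_sup (H n) (y n)) \<longlonglongrightarrow> left_sup H' y'"
proof (rule vec_tendstoI)
  fix i
  show "(\<lambda>n. left_sup (H n) (y n) $ i) \<longlonglongrightarrow> left_sup H' y' $ i"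
  proof (rule order_tendstoI)
    fix a assume "a < left_sup H' y' $ i"
    then obtain z where z: "z \<lless> y'" "a < H' z $ i" using less_left_sup_iff[OF H'] by blast
    have "\<forall>\<^sub>F n in sequentially. z \<lless> y n"
      using topological_tendstoD[OF y(1) open_strictly_below(1)[of z]] z(1) by simp
    moreover have "\<forall>\<^sub>F n in sequentially. a < H n z $ i"
      using tendsto_vec_nth[OF lim[of z], of i] z(2) by (rule order_tendstoD(1))
    ultimately show "\<forall>\<^sub>F n in sequentially. a < left_sup (H n) (y n) $ i"
      by eventually_elim (use less_left_sup_iff[OF H] in blast)
  next
    fix a assume a: "left_sup H' y' $ i < a"
    have "left_sup (H n) (y n) $ i \<le> left_sup H' y' $ i" for n
      using left_sup_mono[OF H H' le y(2)] by (auto simp: less_eq_vec_def)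
    then show "\<forall>\<^sub>F n in sequentially. left_sup (H n) (y n) $ i < a"
      using a by (intro always_eventually allI) (rule le_less_trans)
  qed
qed

lemmas integrable_nth = integrable_linear[OF _ bounded_linear_vec_nth, unfolded o_def]
lemmas integral_nth = integral_linear[OF _ bounded_linear_vec_nth, unfolded o_def]

lemma borel_measurable_vecI:
  fixes f :: "'a \<Rightarrow> real ^ 'n"
  assumes "\<And>i. (\<lambda>x. f x $ i) \<in> borel_measurable M"
  shows "f \<in> borel_measurable M"
proof (subst borel_measurable_euclidean_space, rule ballI)
  fix b :: "real ^ 'n" assume "b \<in> Basis"
  then obtain i where "b = axis i 1" by (auto simp: Basis_vec_def)
  then show "(\<lambda>x. f x \<bullet> b) \<in> borel_measurable M" using assms[of i] by (simp add: inner_axis)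
qed

lemma borel_measurable_vec_nth':
  fixes f :: "'a \<Rightarrow> real ^ 'n"
  assumes "f \<in> borel_measurable M"
  shows "(\<lambda>x. f x $ i) \<in> borel_measurable M"
  by (rule borel_measurable_continuous_on[OF _ assms]) (intro continuous_intros)

lemma AE_countable_dense:
  assumes "AE x in lebesgue. P (x :: 'a :: euclidean_space)"
  obtains Q where "countable Q" "\<And>q. q \<in> Q \<Longrightarrow> P q" "\<And>S. open S \<Longrightarrow> S \<noteq> {} \<Longrightarrow> \<exists>q\<in>Q. q \<in> S"
proof -
  obtain \<B> :: "'a set set" where \<B>: "countable \<B>" "topological_basis \<B>" using ex_countable_basis by blast
  define pick where "pick = (\<lambda>S. SOME x. x \<in> S \<and> P x)"
  have pick: "pick S \<in> S" "P (pick S)" if "S \<in> \<B>" "S \<noteq> {}" for S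
  proof -
    have "\<exists>x. x \<in> S \<and> P x" using AE_dense[OF assms topological_basis_open[OF \<B>(2) that(1)] that(2)] by blast
    from someI_ex[OF this] show "pick S \<in> S" "P (pick S)" by (auto simp: pick_def)
  qed
  show ?thesis
  proof (rule that[of "pick ` {S \<in> \<B>. S \<noteq> {}}"])
    fix S :: "'a set" assume S: "open S" "S \<noteq> {}"
    then obtain x where "x \<in> S" by blast
    then obtain B where "B \<in> \<B>" "x \<in> B" "B \<subseteq> S" using topological_basisE[OF \<B>(2) S(1)] by blast
    then show "\<exists>q\<in>pick ` {S \<in> \<B>. S \<noteq> {}}. q \<in> S" using pick(1)[of B] by blast
  qed (use \<B> pick in auto)
qed

text \<open>The supremum over all points below can be taken over a countable dense set of good points;
  this makes the regularised field measurable along every measurable curve.\<close>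

lemma left_sup_measurable:
  fixes B :: "real \<Rightarrow> real ^ 'n \<Rightarrow> real ^ 'k"
  assumes mono: "\<And>t. mono_below (B t)" and meas: "AE q in lebesgue. (\<lambda>t. B t q) \<in> borel_measurable lebesgue"
    and y: "y \<in> borel_measurable lebesgue"
  shows "(\<lambda>t. left_sup (B t) (y t)) \<in> borel_measurable lebesgue"
proof (rule borel_measurable_vecI)
  fix i
  obtain Q where Q: "countable Q" "\<And>q. q \<in> Q \<Longrightarrow> (\<lambda>t. B t q) \<in> borel_measurable lebesgue"
    "\<And>S :: (real ^ 'n) set. open S \<Longrightarrow> S \<noteq> {} \<Longrightarrow> \<exists>q\<in>Q. q \<in> S"
    using AE_countable_dense[OF meas] by blast
  show "(\<lambda>t. left_sup (B t) (y t) $ i) \<in> borel_measurable lebesgue"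
    unfolding borel_measurable_iff_greater
  proof
    fix a :: real
    have "{t. a < left_sup (B t) (y t) $ i} = (\<Union>q\<in>Q. {t. q \<lless> y t} \<inter> {t. a < B t q $ i})"
    proof (intro equalityI subsetI)
      fix t assume "t \<in> {t. a < left_sup (B t) (y t) $ i}"
      then obtain z where z: "z \<lless> y t" "a < B t z $ i" using less_left_sup_iff[OF mono] by blast
      obtain w where w: "z \<lless> w" "w \<lless> y t" using z(1) strictly_below_dense by blast
      have "open ({w. z \<lless> w} \<inter> {w. w \<lless> y t})" using open_strictly_below by blast
      then obtain q where q: "q \<in> Q" "z \<lless> q" "q \<lless> y t" using Q(3)[of "{w. z \<lless> w} \<inter> {w. w \<lless> y t}"] w by blast
      have "B t z $ i \<le> B t q $ i" using mono_belowD[OF mono q(2)] by (simp add: less_eq_vec_def)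
      then show "t \<in> (\<Union>q\<in>Q. {t. q \<lless> y t} \<inter> {t. a < B t q $ i})" using q z by force
    next
      fix t assume "t \<in> (\<Union>q\<in>Q. {t. q \<lless> y t} \<inter> {t. a < B t q $ i})"
      then show "t \<in> {t. a < left_sup (B t) (y t) $ i}" using less_left_sup_iff[OF mono] by blast
    qed
    moreover have "{t. q \<lless> y t} \<in> sets lebesgue" for q
      using measurable_sets[OF y, of "{z. q \<lless> z}"] open_strictly_below(1)[of q] by (simp add: vimage_def)
    moreover have "{t. a < B t q $ i} \<in> sets lebesgue" if "q \<in> Q" for q
      using borel_measurable_vec_nth'[OF Q(2)[OF that], of i, unfolded borel_measurable_iff_greater] by simp
    ultimately show "{w \<in> space lebesgue. a < left_sup (B w) (y w) $ i} \<in> sets lebesgue"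
      using Q(1) by (auto intro!: sets.countable_UN')
  qed
qed

section \<open>The minimal trajectories of a monotone field\<close>

locale monotone_field =
  fixes B :: "real \<Rightarrow> real ^ 'd \<Rightarrow> real ^ 'd" and K :: "real \<Rightarrow> real" and T L :: real
  assumes mono: "\<And>t. mono (B t)"
    and growth: "\<And>t x. norm (B t x) \<le> K t * (1 + norm x)"
    and meas: "\<And>y. y \<in> borel_measurable lebesgue \<Longrightarrow> (\<lambda>t. left_sup (B t) (y t)) \<in> borel_measurable lebesgue"
    and K_nonneg: "\<And>t. 0 \<le> K t"
    and K_int: "K integrable_on {0..T}"
    and L: "1 + real CARD('d) \<le> L"
begin

lemma below: "mono_below (B t)"
  by (rule mono_imp_mono_below[OF mono])

lemma L_ge1: "1 \<le> L"
  using L by linarith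

lemma left_field_bound: "\<bar>left_sup (B t) x $ i\<bar> \<le> K t * (1 + norm x)"
proof -
  have B: "\<bar>B t z $ i\<bar> \<le> K t * (1 + norm z)" for z
    using growth[of t z] component_le_norm_cart[of "B t z" i] by linarith
  have "left_sup (B t) x $ i \<le> B t x $ i" using left_sup_le[OF below] by (auto simp: less_eq_vec_def)
  moreover have "- (K t * (1 + norm x)) \<le> left_sup (B t) x $ i"
  proof (rule left_sup_ge_continuous[OF below, of "\<lambda>z. - (K t * (1 + norm z))"])
    show "- (K t * (1 + norm z)) \<le> B t z $ i" for z using B[of z] by linarith
  qed (intro continuous_intros)
  ultimately show ?thesis using B[of x] by linarith
qed

definition barrier :: "real \<Rightarrow> real ^ 'd \<Rightarrow> real \<Rightarrow> real" where
  "barrier s x t = (1 + norm x) * exp (L * integral {s..t} K)"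

definition within_barrier :: "real \<Rightarrow> real ^ 'd \<Rightarrow> (real \<Rightarrow> real ^ 'd) \<Rightarrow> bool" where
  "within_barrier s x y \<longleftrightarrow> continuous_on {s..T} y \<and> (\<forall>t\<in>{s..T}. \<forall>i. \<bar>y t $ i\<bar> \<le> barrier s x t)"

lemma K_int_sub: "0 \<le> s \<Longrightarrow> t \<le> T \<Longrightarrow> K integrable_on {s..t}"
  using K_int by (meson atLeastatMost_subset_iff integrable_on_subinterval)

lemma K_integral_nonneg: "0 \<le> integral {s..t} K"
  using K_nonneg by (cases "K integrable_on {s..t}") (auto intro: integral_nonneg simp: not_integrable_integral)

lemma barrier_ge1: "1 \<le> barrier s x t"
proof -
  have "1 * 1 \<le> (1 + norm x) * exp (L * integral {s..t} K)"
    using K_integral_nonneg L_ge1 by (intro mult_mono) auto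
  then show ?thesis by (simp add: barrier_def)
qed

lemma AC_barrier: "0 \<le> s \<Longrightarrow> AC s T (barrier s x)"
  unfolding barrier_def
  by (intro AC_bounded_linear[OF _ bounded_linear_mult_right] AC_exp_integral K_int_sub) (use K_nonneg in auto)

lemma barrier_integral:
  assumes "0 \<le> s" "s \<le> t" "t \<le> T"
  shows "(\<lambda>r. L * K r * barrier s x r) integrable_on {s..t}"
    and "integral {s..t} (\<lambda>r. L * K r * barrier s x r) \<le> barrier s x t - barrier s x s"
proof -
  have Ka: "K absolutely_integrable_on {s..t}"
    by (rule nonnegative_absolutely_integrable_1[OF K_int_sub]) (use assms K_nonneg in auto)
  have AC: "AC s t (barrier s x)"
    using AC_barrier[OF assms(1)] AC_subinterval assms by blast
  have "(\<lambda>r. barrier s x r * K r) absolutely_integrable_on {s..t}"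
  proof (rule absolutely_integrable_bounded_measurable_product_real[OF _ _ _ Ka])
    show "barrier s x \<in> borel_measurable (lebesgue_on {s..t})"
      by (rule continuous_imp_measurable_on_sets_lebesgue[OF AC_imp_continuous_on[OF AC]]) auto
    show "bounded (barrier s x ` {s..t})"
      by (intro compact_imp_bounded compact_continuous_image AC_imp_continuous_on[OF AC]) auto
  qed auto
  then have "(\<lambda>r. L * (barrier s x r * K r)) integrable_on {s..t}"
    by (intro integrable_on_mult_right) (simp add: set_lebesgue_integral_eq_integral)
  then show int: "(\<lambda>r. L * K r * barrier s x r) integrable_on {s..t}" by (simp add: mult_ac)
  show "integral {s..t} (\<lambda>r. L * K r * barrier s x r) \<le> barrier s x t - barrier s x s"
  proof (rule AC_FTC_le[OF AC int int _ _ assms(2)])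
    show "\<bar>L * K r * barrier s x r\<bar> \<le> L * K r * barrier s x r" for r
      using K_nonneg[of r] barrier_ge1[of s x r] L_ge1 by simp
    show "AE r in lebesgue. s < r \<and> r < t \<longrightarrow> (\<exists>D. (barrier s x has_real_derivative D) (at r) \<and> L * K r * barrier s x r \<le> D)"
      using AE_derivative_exp_integral[OF K_int_sub[OF assms(1,3)], of L]
    proof eventually_elim
      case (elim r)
      show ?case
      proof
        assume "s < r \<and> r < t"
        with elim have "((\<lambda>t. exp (L * integral {s..t} K)) has_real_derivative (L * K r * exp (L * integral {s..r} K))) (at r)" by blast
        from DERIV_cmult[OF this, of "1 + norm x"]
        show "\<exists>D. (barrier s x has_real_derivative D) (at r) \<and> L * K r * barrier s x r \<le> D"
          unfolding barrier_def by (intro exI[of _ "(1 + norm x) * (L * K r * exp (L * integral {s..r} K))"]) (simp add: mult_ac)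
      qed
    qed
  qed
qed

lemma left_field_along:
  assumes s: "0 \<le> s" and y: "within_barrier s x y"
  shows "t \<in> {s..T} \<Longrightarrow> \<bar>left_sup (B t) (y t) $ i\<bar> \<le> L * K t * barrier s x t"
    and "t \<in> {s..T} \<Longrightarrow> norm (left_sup (B t) (y t)) \<le> real CARD('d) * (L * K t * barrier s x t)"
    and "t \<le> T \<Longrightarrow> (\<lambda>r. left_sup (B r) (y r)) integrable_on {s..t}"
proof -
  show b1: "\<bar>left_sup (B t) (y t) $ i\<bar> \<le> L * K t * barrier s x t" if "t \<in> {s..T}" for t i
  proof -
    have "norm (y t) \<le> real CARD('d) * barrier s x t"
      by (rule norm_le_card_times) (use y that in "auto simp: within_barrier_def")
    then have "1 + norm (y t) \<le> L * barrier s x t" using barrier_ge1[of s x t] mult_right_mono[OF L, of "barrier s x t"] by (simp add: distrib_right)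
    then have "K t * (1 + norm (y t)) \<le> K t * (L * barrier s x t)" by (rule mult_left_mono) (rule K_nonneg)
    then show ?thesis using left_field_bound[of t "y t" i] by (simp add: mult_ac)
  qed
  show b2: "norm (left_sup (B t) (y t)) \<le> real CARD('d) * (L * K t * barrier s x t)" if "t \<in> {s..T}" for t
    by (rule norm_le_card_times) (rule b1[OF that])
  show "(\<lambda>r. left_sup (B r) (y r)) integrable_on {s..t}" if "t \<le> T"
  proof (cases "s \<le> t")
    case True
    define y' where "y' = (\<lambda>r. y (max s (min T r)))"
    have "continuous_on UNIV y'" unfolding y'_def
    proof (rule continuous_on_compose2[of "{s..T}" y UNIV "\<lambda>r. max s (min T r)"])
      show "continuous_on {s..T} y" using y by (simp add: within_barrier_def)
    qed (use True that in "auto intro!: continuous_intros")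
    then have "y' \<in> borel_measurable lebesgue"
      by (simp add: borel_measurable_continuous_onI measurable_completion)
    from meas[OF this]
    have "(\<lambda>r. left_sup (B r) (y' r)) \<in> borel_measurable (lebesgue_on {s..t})"
      by (rule measurable_restrict_space1)
    then show ?thesis
    proof (rule measurable_bounded_by_integrable_imp_integrable[of "\<lambda>r. left_sup (B r) (y' r)", THEN integrable_eq])
      show "(\<lambda>r. real CARD('d) * (L * K r * barrier s x r)) integrable_on {s..t}"
        by (intro integrable_on_mult_right barrier_integral s True that)
      show "norm (left_sup (B r) (y' r)) \<le> real CARD('d) * (L * K r * barrier s x r)" if "r \<in> {s..t}" for r
        using b2[of r] that `t \<le> T` by (simp add: y'_def)
    qed (use that in "auto simp: y'_def")
  qed auto
qed

lemma integral_vec_nth: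
  fixes h :: "real \<Rightarrow> real ^ 'k"
  assumes "h integrable_on S" shows "integral S h $ i = integral S (\<lambda>t. h t $ i)"
  using integral_nth[where i=i, OF assms] by (simp add: o_def)

lemma within_barrier_step:
  assumes s: "0 \<le> s" and y: "within_barrier s x y"
  shows "within_barrier s x (\<lambda>t. x + integral {s..t} (\<lambda>r. left_sup (B r) (y r)))"
  unfolding within_barrier_def
proof (intro conjI ballI allI)
  show "continuous_on {s..T} (\<lambda>t. x + integral {s..t} (\<lambda>r. left_sup (B r) (y r)))"
    by (intro continuous_intros indefinite_integral_continuous_1 left_field_along(3)[OF s y]) auto
  fix t i assume t: "t \<in> {s..T}"
  let ?h = "\<lambda>r. left_sup (B r) (y r)"
  have int: "?h integrable_on {s..t}" using left_field_along(3)[OF s y] t by auto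
  have "norm (integral {s..t} (\<lambda>r. ?h r $ i)) \<le> integral {s..t} (\<lambda>r. L * K r * barrier s x r)"
  proof (rule integral_norm_bound_integral)
    show "(\<lambda>r. ?h r $ i) integrable_on {s..t}" using integrable_nth[where i=i, OF int] by (simp add: o_def)
  qed (use barrier_integral[OF s] t left_field_along(1)[OF s y] in auto)
  also have "... \<le> barrier s x t - (1 + norm x)" using barrier_integral(2)[OF s, of t x] t by (simp add: barrier_def)
  finally have "\<bar>integral {s..t} ?h $ i\<bar> \<le> barrier s x t - (1 + norm x)" using integral_vec_nth[OF int, of i] by simp
  then show "\<bar>(x + integral {s..t} ?h) $ i\<bar> \<le> barrier s x t" using component_le_norm_cart[of x i] by simp
qed

text \<open>The left-continuous regularisation lies between the values of the field at strictly smaller and at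
  strictly larger points, and a trajectory requires no more.\<close>

lemma integral_solution_trajectory:
  assumes s: "0 \<le> s" and y: "within_barrier s x y"
    and eq: "\<And>t. t \<in> {s..T} \<Longrightarrow> y t = x + integral {s..t} (\<lambda>r. left_sup (B r) (y r))"
  shows "trajectory (\<lambda>_. 0) B s T (\<lambda>t. x + integral {s..t} (\<lambda>r. left_sup (B r) (y r)))" (is "trajectory _ _ _ _ ?Y")
  unfolding trajectory_def
proof
  have int: "(\<lambda>r. left_sup (B r) (y r)) integrable_on {s..T}" by (rule left_field_along(3)[OF s y]) simp
  show "AC s T ?Y"
  proof (cases "s \<le> T")
    case True
    have "AC s T (\<lambda>t. integral {s..t} (\<lambda>r. left_sup (B r) (y r)))"
      by (rule AC_integral[OF int, of "\<lambda>r. real CARD('d) * (L * K r * barrier s x r)"])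
        (use barrier_integral(1)[OF s True] left_field_along(2)[OF s y] in "auto intro!: integrable_on_mult_right")
    from AC_add[OF AC_const this] show ?thesis .
  next
    case False
    then show ?thesis by (intro AC_empty) simp
  qed
  show "AE t in lebesgue. s < t \<and> t < T \<longrightarrow>
      (\<exists>v. (?Y has_vector_derivative v) (at t) \<and>
        (\<forall>z. z \<lless> ?Y t \<longrightarrow> B t z + 0 *\<^sub>R z \<le> v + 0 *\<^sub>R ?Y t) \<and>
        (\<forall>z. ?Y t \<lless> z \<longrightarrow> v + 0 *\<^sub>R ?Y t \<le> B t z + 0 *\<^sub>R z))"
    using AE_derivative_integral[OF int]
  proof eventually_elim
    case (elim t)
    show ?case
    proof
      assume t: "s < t \<and> t < T"
      have d: "(?Y has_vector_derivative left_sup (B t) (y t)) (at t)"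
        using has_vector_derivative_add[OF has_vector_derivative_const elim[rule_format, OF t]] by simp
      have yt: "?Y t = y t" using eq[of t] t by simp
      have "B t z \<le> left_sup (B t) (y t)" if "z \<lless> y t" for z by (rule left_sup_upper[OF below that])
      moreover have "left_sup (B t) (y t) \<le> B t z" if "y t \<lless> z" for z
        using left_sup_le[OF below, of t "y t"] monoD[OF mono strictly_below_imp_le[OF that]] order_trans by blast
      ultimately show "(\<exists>v. (?Y has_vector_derivative v) (at t) \<and>
        (\<forall>z. z \<lless> ?Y t \<longrightarrow> B t z + 0 *\<^sub>R z \<le> v + 0 *\<^sub>R ?Y t) \<and>
        (\<forall>z. ?Y t \<lless> z \<longrightarrow> v + 0 *\<^sub>R ?Y t \<le> B t z + 0 *\<^sub>R z))"
        using d unfolding yt by auto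
    qed
  qed
qed

end

context monotone_field
begin

lemma within_barrierI:
  assumes "0 \<le> s" and cont: "continuous_on {s..T} y"
    and lim: "\<And>t. t \<in> {s..T} \<Longrightarrow> (\<lambda>n. w n t) \<longlonglongrightarrow> y t" and w: "\<And>n. within_barrier s x (w n)"
  shows "within_barrier s x y"
  unfolding within_barrier_def
proof (intro conjI ballI allI cont)
  fix t i assume t: "t \<in> {s..T}"
  have "(\<lambda>n. \<bar>w n t $ i\<bar>) \<longlonglongrightarrow> \<bar>y t $ i\<bar>" by (intro tendsto_intros lim t)
  then show "\<bar>y t $ i\<bar> \<le> barrier s x t"
    by (rule LIMSEQ_le_const2) (use w t in "auto simp: within_barrier_def")
qed

lemma left_integral_tendsto:
  assumes s: "0 \<le> s" and H: "\<And>n. monotone_field (H n) K T L"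
    and le: "\<And>n r z. H n r z \<le> B r z" and Hlim: "\<And>r z. (\<lambda>n. H n r z) \<longlonglongrightarrow> B r z"
    and w: "\<And>n. within_barrier s x (w n)"
    and wlim: "\<And>r. r \<in> {s..T} \<Longrightarrow> (\<lambda>n. w n r) \<longlonglongrightarrow> y r" "\<And>n r. r \<in> {s..T} \<Longrightarrow> w n r \<le> y r"
    and t: "t \<in> {s..T}"
  shows "(\<lambda>r. left_sup (B r) (y r)) integrable_on {s..t}"
    and "(\<lambda>n. integral {s..t} (\<lambda>r. left_sup (H n r) (w n r))) \<longlonglongrightarrow> integral {s..t} (\<lambda>r. left_sup (B r) (y r))"
proof -
  have int: "(\<lambda>r. left_sup (H n r) (w n r)) integrable_on {s..t}" for n
    using monotone_field.left_field_along(3)[OF H s w] t by auto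
  have dom: "(\<lambda>r. real CARD('d) * (L * K r * barrier s x r)) integrable_on {s..t}"
    using barrier_integral(1)[OF s, of t x] t by (auto intro: integrable_on_mult_right)
  have bound: "norm (left_sup (H n r) (w n r)) \<le> real CARD('d) * (L * K r * barrier s x r)" if "r \<in> {s..t}" for n r
    using monotone_field.left_field_along(2)[OF H s w, of r n] that t by auto
  have lim: "(\<lambda>n. left_sup (H n r) (w n r)) \<longlonglongrightarrow> left_sup (B r) (y r)" if "r \<in> {s..t}" for r
    by (rule left_sup_tendsto) (use monotone_field.below[OF H] below Hlim le wlim that t in auto)
  show "(\<lambda>r. left_sup (B r) (y r)) integrable_on {s..t}"
    "(\<lambda>n. integral {s..t} (\<lambda>r. left_sup (H n r) (w n r))) \<longlonglongrightarrow> integral {s..t} (\<lambda>r. left_sup (B r) (y r))"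
    using dominated_convergence[OF int dom bound lim] by auto
qed

text \<open>The iteration starts below every path within the barrier, so it increases, and \<open>left_sup\<close> is continuous
  along increasing sequences; its limit therefore solves the integral equation.\<close>

primrec picard :: "real \<Rightarrow> real ^ 'd \<Rightarrow> nat \<Rightarrow> real \<Rightarrow> real ^ 'd" where
  "picard s x 0 = (\<lambda>t. - barrier s x t *\<^sub>R 1)"
| "picard s x (Suc n) = (\<lambda>t. x + integral {s..t} (\<lambda>r. left_sup (B r) (picard s x n r)))"

definition picard_limit :: "real \<Rightarrow> real ^ 'd \<Rightarrow> real \<Rightarrow> real ^ 'd" where
  "picard_limit s x t = (\<chi> i. SUP n. picard s x n t $ i)"

definition minimal_flow :: "real \<Rightarrow> real \<Rightarrow> real ^ 'd \<Rightarrow> real ^ 'd" where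
  "minimal_flow t s x = x + integral {s..t} (\<lambda>r. left_sup (B r) (picard_limit s x r))"

lemma picard_within: assumes "0 \<le> s" shows "within_barrier s x (picard s x n)"
proof (induction n)
  case 0
  have "continuous_on {s..T} (barrier s x)" by (rule AC_imp_continuous_on[OF AC_barrier[OF assms]])
  moreover have "0 \<le> barrier s x t" for t using barrier_ge1[of s x t] by linarith
  ultimately show ?case by (auto simp: within_barrier_def intro!: continuous_intros)
next
  case (Suc n)
  then show ?case using within_barrier_step[OF assms] by simp
qed

end

lemma integral_vec_mono:
  fixes h h' :: "real \<Rightarrow> real ^ 'k"
  assumes "h integrable_on S" "h' integrable_on S" "\<And>t. t \<in> S \<Longrightarrow> h t \<le> h' t"
  shows "integral S h \<le> integral S h'"
  unfolding less_eq_vec_def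
proof
  fix i
  have "integral S (\<lambda>t. h t $ i) \<le> integral S (\<lambda>t. h' t $ i)"
  proof (rule integral_le)
    show "(\<lambda>t. h t $ i) integrable_on S" "(\<lambda>t. h' t $ i) integrable_on S"
      using integrable_nth[where i=i, OF _] assms(1,2) by (auto simp: o_def)
    show "h t $ i \<le> h' t $ i" if "t \<in> S" for t using assms(3)[OF that] by (simp add: less_eq_vec_def)
  qed
  then show "integral S h $ i \<le> integral S h' $ i"
    using integral_nth[where i=i, OF assms(1)] integral_nth[where i=i, OF assms(2)]
    by (simp add: o_def)
qed

lemma picard_mono_field:
  assumes "monotone_field B K T L" "monotone_field B' K T L" and le: "\<And>r z. B r z \<le> B' r z" and s: "0 \<le> s"
    and t: "t \<in> {s..T}"
  shows "monotone_field.picard B K L s x n t \<le> monotone_field.picard B' K L s x n t"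
proof -
  interpret B: monotone_field B K T L by fact
  interpret B': monotone_field B' K T L by fact
  show ?thesis using t
  proof (induction n arbitrary: t)
    case (Suc n)
    have "integral {s..t} (\<lambda>r. left_sup (B r) (B.picard s x n r)) \<le> integral {s..t} (\<lambda>r. left_sup (B' r) (B'.picard s x n r))"
    proof (rule integral_vec_mono)
      show "left_sup (B r) (B.picard s x n r) \<le> left_sup (B' r) (B'.picard s x n r)" if "r \<in> {s..t}" for r
        using Suc that by (intro left_sup_mono B.below B'.below le) auto
    qed (use B.left_field_along(3)[OF s B.picard_within[OF s]] B'.left_field_along(3)[OF s B'.picard_within[OF s]] Suc.prems in auto)
    then show ?case by (simp add: add_left_mono)
  qed simp
qed

context monotone_field
begin

context
  fixes s :: real assumes s: "0 \<le> s"
begin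

lemma picard_increasing: "t \<in> {s..T} \<Longrightarrow> picard s x n t \<le> picard s x (Suc n) t"
proof (induction n arbitrary: t)
  case 0
  have "\<bar>picard s x (Suc 0) t $ i\<bar> \<le> barrier s x t" for i
    using picard_within[OF s, of x "Suc 0"] 0 by (auto simp: within_barrier_def simp del: picard.simps)
  then show ?case by (auto simp: less_eq_vec_def abs_le_iff simp del: picard.simps(2)) (metis minus_le_iff)
next
  case (Suc n)
  have "integral {s..t} (\<lambda>r. left_sup (B r) (picard s x n r)) \<le> integral {s..t} (\<lambda>r. left_sup (B r) (picard s x (Suc n) r))"
  proof (rule integral_vec_mono)
    show "left_sup (B r) (picard s x n r) \<le> left_sup (B r) (picard s x (Suc n) r)" if "r \<in> {s..t}" for r
      using Suc that by (intro left_sup_mono below) auto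
  qed (use left_field_along(3)[OF s picard_within[OF s]] Suc.prems in "auto simp del: picard.simps")
  then show ?case by (simp add: add_left_mono)
qed

lemma picard_bdd: "t \<in> {s..T} \<Longrightarrow> bdd_above (range (\<lambda>n. picard s x n t $ i))"
  using picard_within[OF s, of x] by (intro bdd_aboveI2[of _ _ "barrier s x t"]) (auto simp: within_barrier_def abs_le_iff)

lemma picard_tendsto: "t \<in> {s..T} \<Longrightarrow> (\<lambda>n. picard s x n t) \<longlonglongrightarrow> picard_limit s x t"
proof (rule vec_tendstoI)
  fix i assume t: "t \<in> {s..T}"
  have "incseq (\<lambda>n. picard s x n t $ i)"
    using picard_increasing[OF t] by (intro incseq_SucI) (simp add: less_eq_vec_def)
  from LIMSEQ_incseq_SUP[OF picard_bdd[OF t] this]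
  show "(\<lambda>n. picard s x n t $ i) \<longlonglongrightarrow> picard_limit s x t $ i" by (simp add: picard_limit_def)
qed

lemma picard_le_limit: "t \<in> {s..T} \<Longrightarrow> picard s x n t \<le> picard_limit s x t"
  unfolding less_eq_vec_def picard_limit_def by (auto intro!: cSUP_upper picard_bdd)

lemma minimal_flow_eq_limit: "t \<in> {s..T} \<Longrightarrow> minimal_flow t s x = picard_limit s x t"
proof -
  assume t: "t \<in> {s..T}"
  have mf: "monotone_field B K T L" by unfold_locales
  have "(\<lambda>n. integral {s..t} (\<lambda>r. left_sup (B r) (picard s x n r))) \<longlonglongrightarrow> integral {s..t} (\<lambda>r. left_sup (B r) (picard_limit s x r))"
    by (rule left_integral_tendsto[OF s mf _ _ picard_within[OF s] picard_tendsto picard_le_limit t]) auto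
  then have "(\<lambda>n. picard s x (Suc n) t) \<longlonglongrightarrow> minimal_flow t s x"
    unfolding minimal_flow_def picard.simps by (intro tendsto_intros)
  moreover have "(\<lambda>n. picard s x (Suc n) t) \<longlonglongrightarrow> picard_limit s x t"
    using picard_tendsto[OF t] by (rule LIMSEQ_Suc)
  ultimately show ?thesis by (rule LIMSEQ_unique)
qed

lemma picard_limit_within: "within_barrier s x (picard_limit s x)"
proof (rule within_barrierI[OF s _ picard_tendsto picard_within[OF s]])
  show "continuous_on {s..T} (picard_limit s x)"
  proof (cases "s \<le> T")
    case True
    have mf: "monotone_field B K T L" by unfold_locales
    have "(\<lambda>r. left_sup (B r) (picard_limit s x r)) integrable_on {s..T}"
      by (rule left_integral_tendsto(1)[OF s mf _ _ picard_within[OF s] picard_tendsto picard_le_limit]) (use True in auto)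
    then have "continuous_on {s..T} (\<lambda>t. minimal_flow t s x)"
      unfolding minimal_flow_def by (intro continuous_intros indefinite_integral_continuous_1)
    then show ?thesis by (rule continuous_on_eq) (rule minimal_flow_eq_limit)
  qed simp
qed

lemma minimal_flow_within: "within_barrier s x (\<lambda>t. minimal_flow t s x)"
  using picard_limit_within[of x] continuous_on_eq[of "{s..T}" "picard_limit s x" "\<lambda>t. minimal_flow t s x"]
    minimal_flow_eq_limit[of _ x] by (simp add: within_barrier_def)

lemma minimal_flow_integral_eq:
  "t \<in> {s..T} \<Longrightarrow> minimal_flow t s x = x + integral {s..t} (\<lambda>r. left_sup (B r) (minimal_flow r s x))"
  unfolding minimal_flow_def[of t] by (auto intro!: integral_cong simp: minimal_flow_eq_limit)

lemma minimal_flow_start: "minimal_flow s s x = x"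
  by (simp add: minimal_flow_def)

lemma minimal_flow_trajectory: "trajectory (\<lambda>_. 0) B s T (\<lambda>t. minimal_flow t s x)"
  unfolding minimal_flow_def
  by (rule integral_solution_trajectory[OF s picard_limit_within]) (simp add: minimal_flow_eq_limit[symmetric] minimal_flow_def)

end

end

lemma minimal_flow_mono_field:
  assumes B: "monotone_field B K T L" and B': "monotone_field B' K T L" and le: "\<And>r z. B r z \<le> B' r z" and s: "0 \<le> s"
    and t: "t \<in> {s..T}"
  shows "monotone_field.minimal_flow B K L t s x \<le> monotone_field.minimal_flow B' K L t s x"
  unfolding less_eq_vec_def monotone_field.minimal_flow_eq_limit[OF B s t] monotone_field.minimal_flow_eq_limit[OF B' s t]
    monotone_field.picard_limit_def[OF B] monotone_field.picard_limit_def[OF B']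
proof (simp, intro allI cSUP_mono)
  fix i
  show "bdd_above (range (\<lambda>n. monotone_field.picard B' K L s x n t $ i))" by (rule monotone_field.picard_bdd[OF B' s t])
  show "\<exists>m\<in>UNIV. monotone_field.picard B K L s x n t $ i \<le> monotone_field.picard B' K L s x m t $ i" for n
    using picard_mono_field[OF B B' le s t, of x n] by (auto simp: less_eq_vec_def)
qed simp

lemma minimal_flow_comparison:
  assumes B: "monotone_field B K T L" and B': "monotone_field B' K T L" and le: "\<And>r z. B r z \<le> B' r z" and s: "0 \<le> s"
    and t: "t \<in> {s..T}" and "x \<lless> y"
  shows "y - x \<le> monotone_field.minimal_flow B' K L t s y - monotone_field.minimal_flow B K L t s x"
proof -
  have "exp (- integral {s..t} (\<lambda>_. 0)) *\<^sub>R (monotone_field.minimal_flow B' K L s s y - monotone_field.minimal_flow B K L s s x)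
      \<le> monotone_field.minimal_flow B' K L t s y - monotone_field.minimal_flow B K L t s x"
    by (rule trajectory_comparison[OF trajectory_imp_sub[OF monotone_field.minimal_flow_trajectory[OF B s]]
        trajectory_imp_super[OF monotone_field.minimal_flow_trajectory[OF B' s]]])
      (use assms in "auto simp: monotone_field.minimal_flow_start")
  then show ?thesis by (simp add: monotone_field.minimal_flow_start[OF B s] monotone_field.minimal_flow_start[OF B' s])
qed

text \<open>The limit of the minimal flows of an increasing sequence of fields is a trajectory of the
  limit field, so it stays strictly above every trajectory that starts strictly below.\<close>

lemma minimal_flow_eventually_above:
  assumes H: "\<And>n. monotone_field (H n) K T L" and B: "monotone_field B K T L"
    and inc: "\<And>n r z. H n r z \<le> H (Suc n) r z" and Hlim: "\<And>r z. (\<lambda>n. H n r z) \<longlonglongrightarrow> B r z"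
    and s: "0 \<le> s" and t: "t \<in> {s..T}" and yx: "y \<lless> x"
  shows "\<forall>\<^sub>F n in sequentially. monotone_field.minimal_flow B K L t s y \<lless> monotone_field.minimal_flow (H n) K L t s x"
proof -
  interpret B: monotone_field B K T L by fact
  define m where "m = (\<lambda>n t. monotone_field.minimal_flow (H n) K L t s x)"
  have le: "H n r z \<le> B r z" for n r z
    unfolding less_eq_vec_def
  proof
    fix i
    have "incseq (\<lambda>n. H n r z $ i)" using inc by (intro incseq_SucI) (simp add: less_eq_vec_def)
    then show "H n r z $ i \<le> B r z $ i" by (rule incseq_le) (intro tendsto_intros Hlim)
  qed
  have within: "B.within_barrier s x (m n)" for n
    unfolding m_def by (rule monotone_field.minimal_flow_within[OF H s])
  have m_inc: "m n r \<le> m (Suc n) r" if "r \<in> {s..T}" for n r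
    unfolding m_def by (rule minimal_flow_mono_field[OF H H inc s that])
  define \<psi> where "\<psi> = (\<lambda>t. \<chi> i. SUP n. m n t $ i)"
  have bdd: "bdd_above (range (\<lambda>n. m n r $ i))" if "r \<in> {s..T}" for r i
    using within that by (intro bdd_aboveI2[of _ _ "B.barrier s x r"]) (auto simp: B.within_barrier_def abs_le_iff)
  have lim: "(\<lambda>n. m n r) \<longlonglongrightarrow> \<psi> r" if "r \<in> {s..T}" for r
  proof (rule vec_tendstoI)
    fix i
    have "incseq (\<lambda>n. m n r $ i)" using m_inc[OF that] by (intro incseq_SucI) (simp add: less_eq_vec_def)
    from LIMSEQ_incseq_SUP[OF bdd[OF that] this] show "(\<lambda>n. m n r $ i) \<longlonglongrightarrow> \<psi> r $ i" by (simp add: \<psi>_def)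
  qed
  have m_le: "m n r \<le> \<psi> r" if "r \<in> {s..T}" for n r
    unfolding less_eq_vec_def \<psi>_def by (auto intro!: cSUP_upper bdd that)
  have conv: "(\<lambda>r. left_sup (B r) (\<psi> r)) integrable_on {s..t}"
    "(\<lambda>n. integral {s..t} (\<lambda>r. left_sup (H n r) (m n r))) \<longlonglongrightarrow> integral {s..t} (\<lambda>r. left_sup (B r) (\<psi> r))"
    if t: "t \<in> {s..T}" for t
  proof -
    show "(\<lambda>r. left_sup (B r) (\<psi> r)) integrable_on {s..t}"
      by (rule B.left_integral_tendsto(1)[where w = m, OF s H le Hlim within _ _ t]) (use lim m_le in blast)+
    show "(\<lambda>n. integral {s..t} (\<lambda>r. left_sup (H n r) (m n r))) \<longlonglongrightarrow> integral {s..t} (\<lambda>r. left_sup (B r) (\<psi> r))"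
      by (rule B.left_integral_tendsto(2)[where w = m, OF s H le Hlim within _ _ t]) (use lim m_le in blast)+
  qed
  have eq: "\<psi> r = x + integral {s..r} (\<lambda>r. left_sup (B r) (\<psi> r))" if r: "r \<in> {s..T}" for r
  proof -
    have "m n r = x + integral {s..r} (\<lambda>r. left_sup (H n r) (m n r))" for n
      unfolding m_def by (rule monotone_field.minimal_flow_integral_eq[OF H s r])
    then have "(\<lambda>n. x + integral {s..r} (\<lambda>r. left_sup (H n r) (m n r))) = (\<lambda>n. m n r)" by (intro ext) (rule sym)
    then have "(\<lambda>n. m n r) \<longlonglongrightarrow> x + integral {s..r} (\<lambda>r. left_sup (B r) (\<psi> r))"
      using tendsto_add[OF tendsto_const[of x] conv(2)[OF r]] by simp
    then show ?thesis using lim[OF r] LIMSEQ_unique by blast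
  qed
  have within\<psi>: "B.within_barrier s x \<psi>"
  proof (rule B.within_barrierI[OF s _ lim within])
    have "(\<lambda>r. left_sup (B r) (\<psi> r)) integrable_on {s..T}" by (rule conv(1)) (use t in auto)
    then have "continuous_on {s..T} (\<lambda>t. x + integral {s..t} (\<lambda>r. left_sup (B r) (\<psi> r)))"
      by (intro continuous_intros indefinite_integral_continuous_1)
    then show "continuous_on {s..T} \<psi>" by (rule continuous_on_eq) (rule eq[symmetric])
  qed
  define \<psi>' where "\<psi>' = (\<lambda>t. x + integral {s..t} (\<lambda>r. left_sup (B r) (\<psi> r)))"
  have tr: "trajectory (\<lambda>_. 0) B s T \<psi>'"
    unfolding \<psi>'_def by (rule B.integral_solution_trajectory[OF s within\<psi> eq])
  have "exp (- integral {s..t} (\<lambda>_. 0)) *\<^sub>R (\<psi>' s - B.minimal_flow s s y) \<le> \<psi>' t - B.minimal_flow t s y"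
    by (rule trajectory_comparison[OF trajectory_imp_sub[OF B.minimal_flow_trajectory[OF s]] trajectory_imp_super[OF tr]])
      (use yx t in "auto simp: B.minimal_flow_start[OF s] \<psi>'_def")
  then have "x - y \<le> \<psi> t - B.minimal_flow t s y" using eq[OF t] by (simp add: \<psi>'_def B.minimal_flow_start[OF s])
  then have "B.minimal_flow t s y \<lless> \<psi> t"
    using yx by (auto simp: less_eq_vec_def strictly_below_def) (smt (verit))
  then show ?thesis
    using topological_tendstoD[OF lim[OF t] open_strictly_below(1)] by (simp add: m_def)
qed

section \<open>Shears that do not compress volume\<close>

lemma emeasure_real_diameter:
  fixes S :: "real set"
  assumes "\<And>s t. s \<in> S \<Longrightarrow> t \<in> S \<Longrightarrow> s < t \<Longrightarrow> ennreal (t - s) \<le> e" "S \<in> sets borel"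
  shows "emeasure lborel S \<le> e"
proof (cases "S = {} \<or> e = \<infinity>")
  case True
  then show ?thesis by auto
next
  case False
  then obtain r where r: "e = ennreal r" "r \<ge> 0" by (cases e) auto
  obtain s0 where s0: "s0 \<in> S" using False by blast
  have d: "t - s \<le> r" if "s \<in> S" "t \<in> S" for s t
    using assms(1)[OF that] r by (cases "s < t") (auto simp: ennreal_le_iff)
  have "bdd_below S" using d s0 by (intro bdd_belowI[of _ "s0 - r"]) (metis diff_le_eq add.commute)
  then have "S \<subseteq> {Inf S..Inf S + r}"
  proof (intro subsetI)
    fix t assume t: "t \<in> S" and "bdd_below S"
    have "t - r \<le> Inf S" by (rule cInf_greatest) (use s0 d[OF _ t] in "force simp: algebra_simps")+
    moreover have "Inf S \<le> t" using t `bdd_below S` by (rule cInf_lower)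
    ultimately show "t \<in> {Inf S..Inf S + r}" by simp
  qed
  then have "emeasure lborel S \<le> emeasure lborel {Inf S..Inf S + r}" by (rule emeasure_mono) simp
  then show ?thesis using r by simp
qed

text \<open>A map of the line that increases all distances on \<open>S\<close> cannot map \<open>S\<close> into a smaller set:
  it suffices to look at one connected component of an open superset of the target at a time.\<close>

lemma expanding_emeasure_le:
  fixes \<tau> :: "real \<Rightarrow> real"
  assumes exp: "\<And>s t. s \<in> S \<Longrightarrow> t \<in> S \<Longrightarrow> s < t \<Longrightarrow> t - s \<le> \<tau> t - \<tau> s"
    and S: "S \<in> sets borel" and \<tau>: "\<tau> \<in> borel_measurable borel" and A: "A \<in> sets borel" and sub: "\<tau> ` S \<subseteq> A"
  shows "emeasure lborel S \<le> emeasure lborel A"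
proof -
  have op: "emeasure lborel S \<le> emeasure lborel U" if U: "open U" "A \<subseteq> U" for U
  proof -
    have comp_open: "open I" if "I \<in> components U" for I using open_components[OF U(1) that] .
    have pw: "pairwise disjnt (components U)" using pairwise_disjoint_components[of U] by (simp add: pairwise_def disjnt_def)
    have cnt: "countable (components U)" by (rule countable_disjoint_open_subsets[OF comp_open pw])
    have disj: "disjoint_family_on (\<lambda>I. I) (components U)"
      using pw by (auto simp: disjoint_family_on_def pairwise_def disjnt_def)
    have disj': "disjoint_family_on (\<lambda>I. S \<inter> \<tau> -` I) (components U)"
      unfolding disjoint_family_on_def
    proof (intro ballI impI)
      fix I J assume "I \<in> components U" "J \<in> components U" "I \<noteq> J"
      then have "I \<inter> J = {}" using pw by (auto simp: pairwise_def disjnt_def)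
      then show "(S \<inter> \<tau> -` I) \<inter> (S \<inter> \<tau> -` J) = {}" by blast
    qed
    have m: "S \<inter> \<tau> -` I \<in> sets borel" if "I \<in> components U" for I
      using measurable_sets[OF \<tau> borel_open[OF comp_open[OF that]]] by (intro sets.Int S) simp
    have "S = (\<Union>I\<in>components U. S \<inter> \<tau> -` I)" 
    proof (intro equalityI subsetI)
      fix s assume "s \<in> S"
      then have "\<tau> s \<in> U" using sub U(2) by blast
      then have "\<tau> s \<in> \<Union>(components U)" by simp
      then show "s \<in> (\<Union>I\<in>components U. S \<inter> \<tau> -` I)" using `s \<in> S` by blast
    qed simp
    then have "emeasure lborel S = (\<integral>\<^sup>+I. emeasure lborel (S \<inter> \<tau> -` I) \<partial>count_space (components U))"
      using emeasure_UN_countable[of "components U" "\<lambda>I. S \<inter> \<tau> -` I" lborel] m cnt disj' by simp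
    also have "... \<le> (\<integral>\<^sup>+I. emeasure lborel I \<partial>count_space (components U))"
    proof (rule nn_integral_mono)
      fix I assume "I \<in> space (count_space (components U))"
      then have I: "I \<in> components U" by simp
      show "emeasure lborel (S \<inter> \<tau> -` I) \<le> emeasure lborel I"
      proof (rule emeasure_real_diameter[OF _ m[OF I]])
        fix s t assume st: "s \<in> S \<inter> \<tau> -` I" "t \<in> S \<inter> \<tau> -` I" "s < t"
        then have le: "t - s \<le> \<tau> t - \<tau> s" using exp by auto
        have "{\<tau> s..\<tau> t} \<subseteq> I"
          using connected_contains_Icc[OF in_components_connected[OF I]] st by auto
        then have "emeasure lborel {\<tau> s..\<tau> t} \<le> emeasure lborel I"
          using comp_open[OF I] by (intro emeasure_mono) auto
        moreover have "ennreal (t - s) \<le> emeasure lborel {\<tau> s..\<tau> t}" using le st by (simp add: ennreal_leI)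
        ultimately show "ennreal (t - s) \<le> emeasure lborel I" by (rule order_trans[rotated])
      qed
    qed
    also have "... = emeasure lborel (\<Union>I\<in>components U. I)"
      by (rule emeasure_UN_countable[symmetric]) (use comp_open cnt disj in auto)
    also have "(\<Union>I\<in>components U. I) = U" using Union_components[of U] by simp
    finally show ?thesis .
  qed
  show ?thesis
  proof (rule ennreal_le_epsilon)
    fix e :: real assume "e > 0"
    obtain U where U: "open U" "A \<subseteq> U" "emeasure lborel (U - A) < ennreal e"
      using outer_regular_lborel[OF A `e > 0`] by blast
    have "emeasure lborel U = emeasure lborel A + emeasure lborel (U - A)"
      using U A by (subst plus_emeasure) (auto simp: Un_absorb1)
    then show "emeasure lborel S \<le> emeasure lborel A + ennreal e"
      using op[OF U(1,2)] U(3) by (metis add_left_mono less_imp_le order_trans)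
  qed
qed

lemma emeasure_lborel_translate:
  fixes A :: "'a::euclidean_space set"
  assumes "A \<in> sets borel"
  shows "(\<integral>\<^sup>+x. indicator A (x + c) \<partial>lborel) = emeasure lborel A"
proof -
  have "emeasure lborel A = (\<integral>\<^sup>+x. indicator A x \<partial>distr lborel borel ((+) c))"
    using assms by (simp add: lborel_distr_plus)
  also have "... = (\<integral>\<^sup>+x. indicator A (c + x) \<partial>lborel)"
    using assms by (intro nn_integral_distr) auto
  finally show ?thesis by (simp add: add.commute)
qed

lemma emeasure_average:
  fixes A :: "'a::euclidean_space set" and J :: "real set"
  assumes A: "A \<in> sets borel" and J: "J \<in> sets borel"
  shows "(\<integral>\<^sup>+x. emeasure lborel {t\<in>J. x + t *\<^sub>R e \<in> A} \<partial>lborel) = emeasure lborel J * emeasure lborel A"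
proof -
  have [measurable]: "A \<in> sets borel" "J \<in> sets borel" by fact+
  have sec: "{t\<in>J. x + t *\<^sub>R e \<in> A} \<in> sets borel" for x
  proof -
    have "(\<lambda>t. x + t *\<^sub>R e) \<in> borel_measurable borel" by measurable
    from measurable_sets[OF this A] J show ?thesis by (auto simp: Collect_conj_eq vimage_def)
  qed
  have "(\<integral>\<^sup>+x. emeasure lborel {t\<in>J. x + t *\<^sub>R e \<in> A} \<partial>lborel)
      = (\<integral>\<^sup>+x. (\<integral>\<^sup>+t. indicator J t * indicator A (x + t *\<^sub>R e) \<partial>lborel) \<partial>lborel)"
  proof (rule nn_integral_cong)
    fix x :: 'a
    have "emeasure lborel {t\<in>J. x + t *\<^sub>R e \<in> A} = (\<integral>\<^sup>+t. indicator {t\<in>J. x + t *\<^sub>R e \<in> A} t \<partial>lborel)"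
      using sec by simp
    also have "... = (\<integral>\<^sup>+t. indicator J t * indicator A (x + t *\<^sub>R e) \<partial>lborel)"
      by (rule nn_integral_cong) (auto simp: indicator_def)
    finally show "emeasure lborel {t\<in>J. x + t *\<^sub>R e \<in> A} = (\<integral>\<^sup>+t. indicator J t * indicator A (x + t *\<^sub>R e) \<partial>lborel)" .
  qed
  also have "... = (\<integral>\<^sup>+t. (\<integral>\<^sup>+x. indicator J t * indicator A (x + t *\<^sub>R e) \<partial>lborel) \<partial>(lborel :: real measure))"
    by (rule lborel_pair.Fubini'[symmetric]) measurable
  also have "... = (\<integral>\<^sup>+t. indicator J t * emeasure lborel A \<partial>lborel)"
    by (rule nn_integral_cong) (simp add: nn_integral_cmult emeasure_lborel_translate[OF A])
  also have "... = emeasure lborel J * emeasure lborel A"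
    by (simp add: nn_integral_multc)
  finally show ?thesis .
qed

text \<open>Averaging over translations in direction \<open>e\<close> replaces Fubini in an adapted basis; the window
  for the target has to be longer by the size of the displacement, which is harmless for long windows.\<close>

lemma shear_emeasure_le:
  fixes h :: "'a::euclidean_space \<Rightarrow> real" and e :: 'a
  assumes h: "h \<in> borel_measurable borel" and mono: "\<And>x r. 0 \<le> r \<Longrightarrow> h x \<le> h (x + r *\<^sub>R e)"
    and A: "A \<in> sets borel"
  shows "emeasure lborel ((\<lambda>x. x + h x *\<^sub>R e) -` A) \<le> emeasure lborel A"
proof -
  define F where "F = (\<lambda>x. x + h x *\<^sub>R e)"
  have [measurable]: "h \<in> borel_measurable borel" "A \<in> sets borel" by fact+
  have F: "F \<in> borel_measurable borel" unfolding F_def by measurable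
  define E where "E = (\<lambda>n::nat. F -` A \<inter> {x. \<bar>h x\<bar> \<le> real n})"
  have FA: "F -` A \<in> sets borel" using measurable_sets[OF F A] by simp
  have E: "E n \<in> sets borel" for n
  proof -
    have "{x. \<bar>h x\<bar> \<le> real n} \<in> sets borel" by measurable
    then show ?thesis unfolding E_def using FA by auto
  qed
  have win: "ennreal (2 * l) * emeasure lborel (E n) \<le> ennreal (2 * l + 2 * real n) * emeasure lborel A" if "l > 0" for l n
  proof -
    have "emeasure lborel {-l..l} * emeasure lborel (E n) = (\<integral>\<^sup>+x. emeasure lborel {t\<in>{-l..l}. x + t *\<^sub>R e \<in> E n} \<partial>lborel)"
      by (rule emeasure_average[symmetric]) (use E in auto)
    also have "... \<le> (\<integral>\<^sup>+x. emeasure lborel {t\<in>{-(l + real n)..l + real n}. x + t *\<^sub>R e \<in> A} \<partial>lborel)"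
    proof (rule nn_integral_mono)
      fix x
      have line: "(\<lambda>t. x + t *\<^sub>R e) \<in> borel_measurable borel" by measurable
      show "emeasure lborel {t\<in>{-l..l}. x + t *\<^sub>R e \<in> E n} \<le> emeasure lborel {t\<in>{-(l + real n)..l + real n}. x + t *\<^sub>R e \<in> A}"
      proof (rule expanding_emeasure_le[where \<tau> = "\<lambda>t. t + h (x + t *\<^sub>R e)"])
        show "{t\<in>{-l..l}. x + t *\<^sub>R e \<in> E n} \<in> sets borel"
          using measurable_sets[OF line E[of n]] by (auto simp: Collect_conj_eq vimage_def)
        show "{t\<in>{-(l + real n)..l + real n}. x + t *\<^sub>R e \<in> A} \<in> sets borel"
          using measurable_sets[OF line A] by (auto simp: Collect_conj_eq vimage_def)
        show "t - s \<le> (t + h (x + t *\<^sub>R e)) - (s + h (x + s *\<^sub>R e))" if "s < t" for s t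
        proof -
          have "h (x + s *\<^sub>R e) \<le> h ((x + s *\<^sub>R e) + (t - s) *\<^sub>R e)" by (rule mono) (use that in simp)
          then show ?thesis by (simp add: algebra_simps)
        qed
        show "(\<lambda>t. t + h (x + t *\<^sub>R e)) ` {t\<in>{-l..l}. x + t *\<^sub>R e \<in> E n} \<subseteq> {t\<in>{-(l + real n)..l + real n}. x + t *\<^sub>R e \<in> A}"
          by (auto simp: E_def F_def algebra_simps abs_le_iff)
      qed measurable
    qed
    also have "... = emeasure lborel {-(l + real n)..l + real n} * emeasure lborel A"
      by (rule emeasure_average) (use A in auto)
    finally show ?thesis using that by (simp add: algebra_simps)
  qed
  have En: "emeasure lborel (E n) \<le> emeasure lborel A" for n
  proof (cases "emeasure lborel A")
    case (real a)
    have fin: "ennreal (2 * l) * emeasure lborel (E n) \<le> ennreal ((2 * l + 2 * real n) * a)" if "l > 0" for l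
      using win[OF that, of n] real that by (simp add: ennreal_mult)
    have "emeasure lborel (E n) \<noteq> \<infinity>"
      using fin[of 1] by (auto simp: ennreal_mult_top top_unique)
    then obtain r where r: "emeasure lborel (E n) = ennreal r" "r \<ge> 0" by (cases "emeasure lborel (E n)") auto
    have rl: "2 * l * r \<le> (2 * l + 2 * real n) * a" if "l > 0" for l
    proof -
      have "ennreal (2 * l * r) \<le> ennreal ((2 * l + 2 * real n) * a)"
        using fin[OF that] r that by (simp add: ennreal_mult)
      then show ?thesis using real that by (subst (asm) ennreal_le_iff) auto
    qed
    have "r \<le> a"
    proof (rule field_le_epsilon)
      fix \<epsilon> :: real assume \<epsilon>: "\<epsilon> > 0"
      define l where "l = (real n * a + 1) / \<epsilon>"
      have l: "l > 0" using \<epsilon> real by (simp add: l_def add_nonneg_pos)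
      have "l * r \<le> l * a + real n * a" using rl[OF l] by (simp add: algebra_simps)
      also have "... \<le> l * a + l * \<epsilon>" using \<epsilon> by (simp add: l_def)
      also have "... = l * (a + \<epsilon>)" by (simp add: algebra_simps)
      finally show "r \<le> a + \<epsilon>" using l by simp
    qed
    then show ?thesis using r real by (simp add: ennreal_leI)
  qed simp
  have "incseq E"
  proof (rule incseq_SucI)
    show "E n \<le> E (Suc n)" for n by (auto simp: E_def)
  qed
  then have "(SUP n. emeasure lborel (E n)) = emeasure lborel (\<Union>n. E n)"
    using E by (intro SUP_emeasure_incseq) auto
  moreover have "(\<Union>n. E n) = F -` A"
  proof -
    have "\<exists>n. \<bar>h x\<bar> \<le> real n" for x using real_arch_simple by blast
    then show ?thesis by (auto simp: E_def)
  qed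
  ultimately have "emeasure lborel (F -` A) = (SUP n. emeasure lborel (E n))" by simp
  also have "... \<le> emeasure lborel A" by (rule SUP_least) (rule En)
  finally show ?thesis by (simp add: F_def)
qed

section \<open>Measurability from continuity almost everywhere\<close>

lemma AE_isCont_measurable:
  fixes h :: "'a::euclidean_space \<Rightarrow> 'b::euclidean_space"
  assumes "AE x in lebesgue. isCont h x"
  shows "h \<in> borel_measurable lebesgue"
proof -
  define N where "N = {x. \<not> isCont h x}"
  have "N \<in> null_sets lebesgue"
    using assms by (simp add: N_def AE_lebesgue_iff_negligible negligible_iff_null_sets)
  moreover have "continuous_on (- N) h"
    by (auto simp: N_def continuous_on_eq_continuous_within intro: continuous_at_imp_continuous_within)
  then have "h \<in> borel_measurable (lebesgue_on (- N))"
    using `N \<in> null_sets lebesgue` by (intro continuous_imp_measurable_on_sets_lebesgue) (auto simp: null_sets_def Compl_in_sets_lebesgue)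
  ultimately show ?thesis using lebesgue_measurable_diff_null by blast
qed

lemma mono_below_AE_isCont:
  fixes h :: "real ^ 'n \<Rightarrow> real ^ 'k"
  assumes "mono_below h"
  shows "AE x in lebesgue. isCont h x"
proof -
  have "AE x in lebesgue. isCont (\<lambda>x. h x $ i) x" for i
    by (rule mono_AE_isCont_real) (use assms in "auto simp: mono_below_def less_eq_vec_def")
  then have "AE x in lebesgue. \<forall>i. isCont (\<lambda>x. h x $ i) x" by (simp add: AE_all_countable)
  then show ?thesis
    by eventually_elim (auto simp: isCont_def intro: vec_tendstoI)
qed

lemma emeasure_lebesgue_borel: "A \<in> sets borel \<Longrightarrow> emeasure lebesgue A = emeasure lborel A"
  by (simp add: main_part_sets)

text \<open>For an open target the preimage lies, up to a null set, in the lower limit of the preimages; other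
  targets are approximated from outside by open ones.\<close>

lemma noncompressing_limit:
  fixes \<phi> :: "'a::euclidean_space \<Rightarrow> 'a"
  assumes F: "\<And>n. F n \<in> borel_measurable borel"
    and Fle: "\<And>n A. A \<in> sets borel \<Longrightarrow> emeasure lborel (F n -` A) \<le> emeasure lborel A"
    and lim: "AE x in lebesgue. (\<lambda>n. F n x) \<longlonglongrightarrow> \<phi> x"
    and \<phi>: "\<phi> \<in> borel_measurable lebesgue"
  shows "\<phi> \<in> lebesgue \<rightarrow>\<^sub>M lebesgue"
    and "A \<in> sets lebesgue \<Longrightarrow> emeasure lebesgue (\<phi> -` A) \<le> emeasure lebesgue A"
proof -
  define N where "N = {x. \<not> (\<lambda>n. F n x) \<longlonglongrightarrow> \<phi> x}"
  have N: "N \<in> null_sets lebesgue"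
    using lim by (simp add: N_def AE_lebesgue_iff_negligible negligible_iff_null_sets)
  have op: "emeasure lebesgue (\<phi> -` U) \<le> emeasure lebesgue U" if U: "open U" for U
  proof -
    define E where "E = (\<lambda>n. \<Inter>k\<in>{n..}. F k -` U)"
    have E: "E n \<in> sets borel" for n
      unfolding E_def using measurable_sets[OF F borel_open[OF U]] by (intro sets.countable_INT') auto
    have "\<phi> -` U \<subseteq> N \<union> (\<Union>n. E n)"
    proof
      fix x assume x: "x \<in> \<phi> -` U"
      show "x \<in> N \<union> (\<Union>n. E n)"
      proof (cases "x \<in> N")
        case False
        then have "(\<lambda>n. F n x) \<longlonglongrightarrow> \<phi> x" by (simp add: N_def)
        then have "\<forall>\<^sub>F n in sequentially. F n x \<in> U" using U x by (auto dest: topological_tendstoD)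
        then show ?thesis by (auto simp: E_def eventually_sequentially)
      qed simp
    qed
    then have "emeasure lebesgue (\<phi> -` U) \<le> emeasure lebesgue (N \<union> (\<Union>n. E n))"
      using N E by (intro emeasure_mono) auto
    also have "... = emeasure lebesgue (\<Union>n. E n)"
      using emeasure_Un_null_set[of "\<Union>n. E n" lebesgue N] N E by (auto simp: Un_commute)
    also have "... = emeasure lborel (\<Union>n. E n)" by (rule emeasure_lebesgue_borel) (use E in auto)
    also have "... = (SUP n. emeasure lborel (E n))"
    proof (rule SUP_emeasure_incseq[symmetric])
      show "incseq E" unfolding incseq_def E_def by (auto intro: order_trans)
    qed (use E in auto)
    also have "... \<le> emeasure lborel U"
    proof (rule SUP_least)
      fix n
      have "emeasure lborel (E n) \<le> emeasure lborel (F n -` U)"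
        using measurable_sets[OF F borel_open[OF U], of n] by (intro emeasure_mono) (auto simp: E_def)
      also have "... \<le> emeasure lborel U" by (rule Fle) (use U in auto)
      finally show "emeasure lborel (E n) \<le> emeasure lborel U" .
    qed
    finally show ?thesis using U by (simp add: emeasure_lebesgue_borel)
  qed
  have null: "\<phi> -` M \<in> null_sets lebesgue" if M: "M \<in> null_sets lebesgue" for M
  proof -
    have "negligible (\<phi> -` M)"
      unfolding negligible_outer
    proof (intro allI impI)
      fix e :: real assume "e > 0"
      obtain U where U: "open U" "M \<subseteq> U" "(U - M) \<in> lmeasurable" "emeasure lebesgue (U - M) < ennreal e"
        using sets_lebesgue_outer_open[of M e] M `e > 0` by (auto simp: null_setsD2)
      have "emeasure lebesgue U < ennreal e"
        using U(3,4) M emeasure_Un_null_set[of "U - M" lebesgue M] U(2)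
        by (simp add: fmeasurableD Un_absorb2)
      then have lt: "emeasure lebesgue (\<phi> -` U) < ennreal e" using op[OF U(1)] by (rule order.strict_trans1[rotated])
      have m: "\<phi> -` U \<in> sets lebesgue" using measurable_sets[OF \<phi> borel_open[OF U(1)]] by simp
      have fin: "emeasure lebesgue (\<phi> -` U) \<noteq> top" using lt by auto
      then have "\<phi> -` U \<in> lmeasurable" using m by (intro fmeasurableI) (auto simp: less_top)
      moreover have "measure lebesgue (\<phi> -` U) < e"
        using lt unfolding emeasure_eq_ennreal_measure[OF fin] by (subst (asm) ennreal_less_iff) auto
      ultimately show "\<exists>T. \<phi> -` M \<subseteq> T \<and> T \<in> lmeasurable \<and> measure lebesgue T < e" using U(2) by blast
    qed
    then show ?thesis by (simp add: negligible_iff_null_sets)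
  qed
  have sets: "\<phi> -` A \<in> sets lebesgue" if A: "A \<in> sets lebesgue" for A
  proof -
    obtain S M M' where "A = S \<union> M" "M \<subseteq> M'" "M' \<in> null_sets lborel" "S \<in> sets lborel"
      using sets_completionE[OF A] by blast
    then have "M \<in> null_sets lebesgue" "S \<in> sets borel" "\<phi> -` A = \<phi> -` S \<union> \<phi> -` M"
      by (auto intro: null_sets_completion_subset null_sets_completionI)
    then show ?thesis using null[of M] measurable_sets[OF \<phi>, of S] by auto
  qed
  then show "\<phi> \<in> lebesgue \<rightarrow>\<^sub>M lebesgue" by (auto simp: measurable_def)
  show "emeasure lebesgue (\<phi> -` A) \<le> emeasure lebesgue A" if A: "A \<in> sets lebesgue"
  proof (rule ennreal_le_epsilon)
    fix e :: real assume "e > 0"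
    obtain U where U: "open U" "A \<subseteq> U" "(U - A) \<in> lmeasurable" "emeasure lebesgue (U - A) < ennreal e"
      using sets_lebesgue_outer_open[OF A `e > 0`] by blast
    have "emeasure lebesgue (\<phi> -` A) \<le> emeasure lebesgue (\<phi> -` U)"
      using U measurable_sets[OF \<phi> borel_open[OF U(1)]] by (intro emeasure_mono) auto
    also have "... \<le> emeasure lebesgue U" by (rule op[OF U(1)])
    also have "... = emeasure lebesgue A + emeasure lebesgue (U - A)"
      using U A by (subst plus_emeasure) (auto simp: Un_absorb1 fmeasurableD)
    also have "... \<le> emeasure lebesgue A + ennreal e" using U(4) by (intro add_left_mono) simp
    finally show "emeasure lebesgue (\<phi> -` A) \<le> emeasure lebesgue A + ennreal e" .
  qed
qed

section \<open>The minimal flow does not compress volume\<close>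

definition coords :: "'d::finite list" where
  "coords = (SOME xs. distinct xs \<and> set xs = UNIV)"

lemma coords: "distinct (coords :: 'd::finite list)" "set (coords :: 'd list) = UNIV"
proof -
  have "\<exists>xs :: 'd list. distinct xs \<and> set xs = UNIV" using finite_distinct_list[of "UNIV :: 'd set"] by auto
  from someI_ex[OF this] show "distinct (coords :: 'd list)" "set (coords :: 'd list) = UNIV" by (auto simp: coords_def)
qed

context monotone_field
begin

definition drift :: "real \<Rightarrow> real \<Rightarrow> 'd \<Rightarrow> real ^ 'd \<Rightarrow> real" where
  "drift a b i x = integral {a..b} (\<lambda>r. left_sup (B r) x $ i)"

text \<open>In each time step the coordinates move one after the other. Every single move is a shear, so no
  volume is lost; moving all coordinates at once could collapse a set of positive measure.\<close>

definition coord_step :: "real \<Rightarrow> real \<Rightarrow> 'd \<Rightarrow> real ^ 'd \<Rightarrow> real ^ 'd" where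
  "coord_step a b i x = x + drift a b i x *\<^sub>R axis i 1"

definition sweep :: "real \<Rightarrow> real \<Rightarrow> 'd list \<Rightarrow> real ^ 'd \<Rightarrow> real ^ 'd" where
  "sweep a b is = fold (coord_step a b) is"

lemma left_field_measurable: "(\<lambda>r. left_sup (B r) x $ i) \<in> borel_measurable lebesgue"
  by (intro borel_measurable_vec_nth' meas) simp

lemma K_times_integrable:
  assumes "0 \<le> a" "b \<le> T" shows "(\<lambda>r. K r * c) integrable_on {a..b}"
  by (rule integrable_on_mult_left[OF K_int_sub[OF assms]])

lemma left_field_integrable:
  assumes "0 \<le> a" "b \<le> T" shows "(\<lambda>r. left_sup (B r) x $ i) integrable_on {a..b}"
proof (rule measurable_bounded_by_integrable_imp_integrable)
  show "(\<lambda>r. left_sup (B r) x $ i) \<in> borel_measurable (lebesgue_on {a..b})"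
    by (rule measurable_restrict_space1[OF left_field_measurable])
  show "(\<lambda>r. K r * (1 + norm x)) integrable_on {a..b}" by (rule K_times_integrable[OF assms])
qed (use left_field_bound in auto)

lemma drift_bound:
  assumes "0 \<le> a" "b \<le> T" shows "\<bar>drift a b i x\<bar> \<le> (1 + norm x) * integral {a..b} K"
proof -
  have "norm (drift a b i x) \<le> integral {a..b} (\<lambda>r. K r * (1 + norm x))"
    unfolding drift_def
    by (rule integral_norm_bound_integral[OF left_field_integrable[OF assms] K_times_integrable[OF assms]])
      (use left_field_bound in auto)
  then show ?thesis by (simp add: mult.commute)
qed

lemma drift_mono:
  assumes "0 \<le> a" "b \<le> T" "x \<le> y" shows "drift a b i x \<le> drift a b i y"
  unfolding drift_def
  by (rule integral_le[OF left_field_integrable[OF assms(1,2)] left_field_integrable[OF assms(1,2)]])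
    (use left_sup_mono[OF below below order_refl assms(3)] in "auto simp: less_eq_vec_def")

lemma drift_lower_semicontinuous:
  assumes ab: "0 \<le> a" "b \<le> T" and q: "q < drift a b i x"
  shows "\<exists>z. z \<lless> x \<and> q < drift a b i z"
proof -
  define z where "z = (\<lambda>n::nat. x - (1 / (real n + 1)) *\<^sub>R 1)"
  have zx: "z n \<lless> x" for n unfolding z_def by (rule strictly_below_shift) simp
  have zn: "norm (z n) \<le> norm x + norm (1 :: real ^ 'd)" for n
  proof -
    have "norm (z n) \<le> norm x + norm ((1 / (real n + 1)) *\<^sub>R (1 :: real ^ 'd))"
      unfolding z_def by (rule norm_triangle_ineq4)
    also have "norm ((1 / (real n + 1)) *\<^sub>R (1 :: real ^ 'd)) \<le> 1 * norm (1 :: real ^ 'd)"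
      unfolding norm_scaleR by (rule mult_right_mono) auto
    finally show ?thesis by simp
  qed
  have zlim: "z \<longlonglongrightarrow> x" unfolding z_def by (rule strict_approximation)
  have "(\<lambda>n. drift a b i (z n)) \<longlonglongrightarrow> drift a b i x"
    unfolding drift_def
  proof (rule dominated_convergence(2)[OF left_field_integrable[OF ab] K_times_integrable[OF ab]])
    show "norm (left_sup (B r) (z n) $ i) \<le> K r * (1 + (norm x + norm (1 :: real ^ 'd)))" for n r
    proof -
      have "\<bar>left_sup (B r) (z n) $ i\<bar> \<le> K r * (1 + norm (z n))" by (rule left_field_bound)
      also have "... \<le> K r * (1 + (norm x + norm (1 :: real ^ 'd)))" using zn[of n] K_nonneg[of r] by (intro mult_left_mono) auto
      finally show ?thesis by simp
    qed
    show "(\<lambda>n. left_sup (B r) (z n) $ i) \<longlonglongrightarrow> left_sup (B r) x $ i" for r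
      by (rule tendsto_vec_nth[OF left_sup_tendsto[OF below tendsto_const order_refl below zlim strictly_below_imp_le[OF zx]]])
  qed
  then have "\<forall>\<^sub>F n in sequentially. q < drift a b i (z n)" using q by (rule order_tendstoD)
  then show ?thesis using zx by (auto simp: eventually_sequentially)
qed

lemma drift_borel:
  assumes "0 \<le> a" "b \<le> T" shows "drift a b i \<in> borel_measurable borel"
  unfolding borel_measurable_iff_greater
proof
  fix q
  have "open {x. q < drift a b i x}"
  proof (subst open_subopen, intro ballI)
    fix x assume "x \<in> {x. q < drift a b i x}"
    then obtain z where z: "z \<lless> x" "q < drift a b i z" using drift_lower_semicontinuous[OF assms] by blast
    have "{w. z \<lless> w} \<subseteq> {x. q < drift a b i x}"
      using z(2) drift_mono[OF assms strictly_below_imp_le] by (auto intro: less_le_trans)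
    then show "\<exists>U. open U \<and> x \<in> U \<and> U \<subseteq> {x. q < drift a b i x}" using z(1) open_strictly_below(1) by blast
  qed
  then show "{w \<in> space borel. q < drift a b i w} \<in> sets borel" by simp
qed

lemma coord_step_borel:
  assumes "0 \<le> a" "b \<le> T" shows "coord_step a b i \<in> borel_measurable borel"
proof -
  have [measurable]: "drift a b i \<in> borel_measurable borel" by (rule drift_borel[OF assms])
  show ?thesis unfolding coord_step_def by measurable
qed

lemma sweep_noncompressing:
  assumes "0 \<le> a" "b \<le> T"
  shows "sweep a b is \<in> borel_measurable borel \<and> (\<forall>A\<in>sets borel. emeasure lborel (sweep a b is -` A) \<le> emeasure lborel A)"
proof (induction "is")
  case Nil
  then show ?case by (simp add: sweep_def)
next
  case (Cons i "is")
  have eq: "sweep a b (i # is) = (\<lambda>x. sweep a b is (coord_step a b i x))" by (rule ext) (simp add: sweep_def)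
  have m: "sweep a b (i # is) \<in> borel_measurable borel"
    unfolding eq using coord_step_borel[OF assms] Cons by (auto intro: measurable_compose)
  moreover have "emeasure lborel (sweep a b (i # is) -` A) \<le> emeasure lborel A" if A: "A \<in> sets borel" for A
  proof -
    have S: "sweep a b is -` A \<in> sets borel" using measurable_sets[of "sweep a b is" borel borel A] Cons A by simp
    have "emeasure lborel (sweep a b (i # is) -` A) = emeasure lborel ((\<lambda>x. x + drift a b i x *\<^sub>R axis i 1) -` (sweep a b is -` A))"
      by (simp add: eq vimage_def coord_step_def)
    also have "... \<le> emeasure lborel (sweep a b is -` A)"
    proof (rule shear_emeasure_le[OF drift_borel[OF assms] _ S])
      show "drift a b i x \<le> drift a b i (x + r *\<^sub>R axis i 1)" if "0 \<le> r" for x r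
        by (rule drift_mono[OF assms]) (use that in "auto simp: less_eq_vec_def axis_def")
    qed
    also have "... \<le> emeasure lborel A" using Cons A by blast
    finally show ?thesis .
  qed
  ultimately show ?case by blast
qed

lemma sweep_growth:
  assumes "0 \<le> a" "b \<le> T"
  shows "1 + norm (sweep a b is x) \<le> (1 + norm x) * exp (real (length is) * integral {a..b} K)"
proof (induction "is" arbitrary: x)
  case Nil
  then show ?case by (simp add: sweep_def)
next
  case (Cons i "is")
  define k where "k = integral {a..b} K"
  have "norm (coord_step a b i x) \<le> norm x + \<bar>drift a b i x\<bar>"
    unfolding coord_step_def using norm_triangle_ineq[of x "drift a b i x *\<^sub>R axis i 1"] by simp
  then have "1 + norm (coord_step a b i x) \<le> (1 + norm x) * (1 + k)"
    using drift_bound[OF assms, of i x] by (simp add: k_def algebra_simps)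
  also have "... \<le> (1 + norm x) * exp k"
    using exp_ge_add_one_self[of k] by (intro mult_left_mono) auto
  finally have 1: "1 + norm (coord_step a b i x) \<le> (1 + norm x) * exp k" .
  have "1 + norm (sweep a b (i # is) x) = 1 + norm (sweep a b is (coord_step a b i x))" by (simp add: sweep_def)
  also have "... \<le> (1 + norm (coord_step a b i x)) * exp (real (length is) * k)" using Cons by (simp add: k_def)
  also have "... \<le> (1 + norm x) * exp k * exp (real (length is) * k)" using 1 by (intro mult_right_mono) auto
  also have "... = (1 + norm x) * exp (real (length (i # is)) * k)" by (simp add: algebra_simps flip: exp_add)
  finally show ?case by (simp add: k_def)
qed

text \<open>During a sweep each coordinate moves with the field evaluated at a point that mixes
  coordinates from before and after the sweep.\<close>

lemma sweep_mixed_points: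
  assumes "distinct is"
  shows "(\<forall>l. l \<notin> set is \<longrightarrow> sweep a b is x $ l = x $ l) \<and>
    (\<exists>mp. \<forall>i\<in>set is. sweep a b is x $ i = x $ i + drift a b i (mp i) \<and>
       (\<forall>l. mp i $ l = x $ l \<or> mp i $ l = sweep a b is x $ l))"
  using assms
proof (induction "is" arbitrary: x)
  case Nil
  then show ?case by (simp add: sweep_def)
next
  case (Cons j "is")
  define x' where "x' = coord_step a b j x"
  have x': "x' $ j = x $ j + drift a b j x" "\<And>l. l \<noteq> j \<Longrightarrow> x' $ l = x $ l"
    by (auto simp: x'_def coord_step_def axis_def)
  have sw: "sweep a b (j # is) x = sweep a b is x'" by (simp add: sweep_def x'_def)
  have j: "j \<notin> set is" "distinct is" using Cons.prems by auto
  obtain mp where fixed: "\<And>l. l \<notin> set is \<Longrightarrow> sweep a b is x' $ l = x' $ l"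
    and mp: "\<And>i. i \<in> set is \<Longrightarrow> sweep a b is x' $ i = x' $ i + drift a b i (mp i)"
      "\<And>i l. i \<in> set is \<Longrightarrow> mp i $ l = x' $ l \<or> mp i $ l = sweep a b is x' $ l"
    using Cons.IH[OF j(2), of x'] by blast
  define mp' where "mp' = mp(j := x)"
  have "sweep a b (j # is) x $ i = x $ i + drift a b i (mp' i) \<and>
      (\<forall>l. mp' i $ l = x $ l \<or> mp' i $ l = sweep a b (j # is) x $ l)" if "i \<in> set (j # is)" for i
  proof (cases "i = j")
    case True
    then show ?thesis using fixed[OF j(1)] x'(1) by (simp add: sw mp'_def)
  next
    case False
    then have i: "i \<in> set is" using that by simp
    have "mp i $ l = x $ l \<or> mp i $ l = sweep a b is x' $ l" for l
      using mp(2)[OF i, of l] fixed[OF j(1)] x'(2)[of l] by (cases "l = j") auto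
    then show ?thesis using mp(1)[OF i] x'(2)[OF False] False by (simp add: sw mp'_def)
  qed
  moreover have "sweep a b (j # is) x $ l = x $ l" if "l \<notin> set (j # is)" for l
    using fixed[of l] x'(2)[of l] that by (simp add: sw)
  ultimately show ?case by blast
qed

lemma gap_preserved: assumes "x + c *\<^sub>R 1 \<lless> y" "y - x \<le> y' - x'" shows "x' + c *\<^sub>R 1 \<lless> y'"
  unfolding strictly_below_def
proof
  fix i
  have "x $ i + c < y $ i" "y $ i - x $ i \<le> y' $ i - x' $ i" using assms by (simp_all add: strictly_below_def less_eq_vec_def)
  then show "(x' + c *\<^sub>R 1) $ i < y' $ i" by simp
qed

lemma gap_imp_le: assumes "x + c *\<^sub>R 1 \<lless> y" "0 < c" shows "x \<le> y"
  using strictly_below_trans[OF strictly_below_shift(2)[OF assms(2)] assms(1)] by (rule strictly_below_imp_le)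

text \<open>The interpolation of a sweep stays within \<open>e\<close> of all the mixed points. By monotonicity of the field
  it becomes a super-trajectory when lowered by \<open>2 * e\<close> and a sub-trajectory when raised by \<open>2 * e\<close>.\<close>

lemma sweep_comparison:
  assumes ab: "0 \<le> a" "a \<le> b" "b \<le> T" and w1: "w1 = sweep a b coords w0"
    and R: "\<And>l. \<bar>w0 $ l\<bar> \<le> R" "\<And>l. \<bar>w1 $ l\<bar> \<le> R" and e: "0 < e"
    and mesh: "(1 + real CARD('d) * R) * integral {a..b} K \<le> e"
    and Y: "trajectory (\<lambda>_. 0) B a b Y"
  shows "w0 + (2 * e) *\<^sub>R 1 \<lless> Y a \<Longrightarrow> Y a - w0 \<le> Y b - w1"
    and "Y a + (2 * e) *\<^sub>R 1 \<lless> w0 \<Longrightarrow> w0 - Y a \<le> w1 - Y b"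
proof -
  obtain mp where *: "\<forall>i\<in>set coords. w1 $ i = w0 $ i + drift a b i (mp i) \<and> (\<forall>l. mp i $ l = w0 $ l \<or> mp i $ l = w1 $ l)"
    using sweep_mixed_points[OF coords(1), of a b w0] unfolding w1 by blast
  then have mp: "w1 $ i = w0 $ i + drift a b i (mp i)" "mp i $ l = w0 $ l \<or> mp i $ l = w1 $ l" for i l
    unfolding coords(2) by blast+
  define R' where "R' = 1 + real CARD('d) * R"
  have mpR: "norm (mp i) \<le> real CARD('d) * R" for i
    by (rule norm_le_card_times) (use mp(2)[of i] R in metis)
  have R'0: "0 \<le> R'" using order_trans[OF norm_ge_zero mpR] by (simp add: R'_def)
  define G where "G = (\<lambda>r. \<chi> i. left_sup (B r) (mp i) $ i)"
  have Gi: "\<bar>G r $ i\<bar> \<le> K r * R'" for r i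
  proof -
    have "\<bar>left_sup (B r) (mp i) $ i\<bar> \<le> K r * (1 + norm (mp i))" by (rule left_field_bound)
    also have "... \<le> K r * R'" using mpR[of i] K_nonneg[of r] by (intro mult_left_mono) (auto simp: R'_def)
    finally show ?thesis by (simp add: G_def)
  qed
  have Gn: "norm (G r) \<le> real CARD('d) * (K r * R')" for r by (rule norm_le_card_times[OF Gi])
  have dom: "(\<lambda>r. real CARD('d) * (K r * R')) integrable_on {p..q}" if "a \<le> p" "q \<le> b" for p q
    using K_times_integrable[of p q R'] ab that by (auto intro: integrable_on_mult_right)
  have Gint: "G integrable_on {p..q}" if "a \<le> p" "q \<le> b" for p q
  proof (rule measurable_bounded_by_integrable_imp_integrable[OF _ dom[OF that] Gn])
    have "G \<in> borel_measurable lebesgue"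
      unfolding G_def by (rule borel_measurable_vecI) (simp add: left_field_measurable)
    then show "G \<in> borel_measurable (lebesgue_on {p..q})" by (rule measurable_restrict_space1)
  qed auto
  define v where "v = (\<lambda>r. w0 + integral {a..r} G)"
  have va: "v a = w0" by (simp add: v_def)
  have Gnth: "integral {p..q} G $ i = integral {p..q} (\<lambda>r. left_sup (B r) (mp i) $ i)" if "a \<le> p" "q \<le> b" for p q i
    using integral_vec_nth[OF Gint[OF that], of i] by (simp add: G_def)
  have vb: "v b = w1" using mp(1) Gnth[of a b] ab by (simp add: v_def vec_eq_iff drift_def)
  have Gsmall: "\<bar>integral {p..q} G $ i\<bar> \<le> e" if pq: "a \<le> p" "p \<le> q" "q \<le> b" for p q i
  proof -
    have "norm (integral {p..q} (\<lambda>r. G r $ i)) \<le> integral {p..q} (\<lambda>r. K r * R')"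
      by (rule integral_norm_bound_integral[OF _ K_times_integrable])
        (use integrable_nth[where i=i, OF Gint[OF pq(1,3)]] Gi pq ab in "auto simp: o_def")
    also have "... = R' * integral {p..q} K" by (simp add: mult.commute)
    also have "... \<le> R' * integral {a..b} K"
      by (intro mult_left_mono integral_subset_le K_int_sub) (use pq ab K_nonneg R'0 in auto)
    also have "... \<le> e" using mesh by (simp add: R'_def)
    finally show ?thesis using integral_vec_nth[OF Gint[OF pq(1,3)], of i] by simp
  qed
  have near: "\<bar>mp i $ l - v r $ l\<bar> \<le> e" if r: "a \<le> r" "r \<le> b" for i l r
  proof -
    have "\<bar>v r $ l - w0 $ l\<bar> \<le> e" using Gsmall[of a r l] r by (simp add: v_def)
    moreover have "\<bar>w1 $ l - v r $ l\<bar> \<le> e"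
      using Gsmall[of r b l] r integral_increment[OF Gint[of a b], of r b] by (simp add: v_def vb[symmetric] flip: vector_minus_component)
    ultimately show ?thesis using mp(2)[of i l] by (auto simp: abs_minus_commute)
  qed
  have ACv: "AC a b v"
    unfolding v_def
    by (intro AC_add AC_const AC_integral[OF Gint dom Gn]) auto
  have dv: "AE r in lebesgue. a < r \<and> r < b \<longrightarrow> (v has_vector_derivative G r) (at r)"
    using AE_derivative_integral[OF Gint[of a b, OF order_refl order_refl]]
  proof eventually_elim
    case (elim r)
    then show ?case unfolding v_def using has_vector_derivative_add[OF has_vector_derivative_const, of _ "G r" "at r" w0] by simp
  qed
  have shift: "AC a b (\<lambda>r. v r + c)" for c
    by (intro AC_add ACv AC_const)
  have dshift: "((\<lambda>r. v r + c) has_vector_derivative G r) (at r)" if "(v has_vector_derivative G r) (at r)" for c r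
    using has_vector_derivative_add[OF that has_vector_derivative_const, of c] by simp
  have sub: "sub_trajectory (\<lambda>_. 0) B a b (\<lambda>r. v r + (2 * e) *\<^sub>R 1)"
    unfolding sub_trajectory_def
  proof (intro conjI shift)
    show "AE t in lebesgue. a < t \<and> t < b \<longrightarrow> (\<exists>va. ((\<lambda>r. v r + (2 * e) *\<^sub>R 1) has_vector_derivative va) (at t) \<and>
      (\<forall>z. v t + (2 * e) *\<^sub>R 1 \<lless> z \<longrightarrow> va + 0 *\<^sub>R (v t + (2 * e) *\<^sub>R 1) \<le> B t z + 0 *\<^sub>R z))"
      using dv
    proof eventually_elim
      case (elim t)
      have "G t \<le> B t z" if t: "a < t \<and> t < b" and z: "v t + (2 * e) *\<^sub>R 1 \<lless> z" for z
        unfolding less_eq_vec_def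
      proof
        fix i
        have "mp i \<le> z"
          unfolding less_eq_vec_def
        proof
          fix l
          have "mp i $ l \<le> v t $ l + e" using near[of t i l] t by (simp add: abs_le_iff)
          also have "... \<le> z $ l" using z e by (auto simp: strictly_below_def dest!: spec[of _ l])
          finally show "mp i $ l \<le> z $ l" .
        qed
        then have "left_sup (B t) (mp i) \<le> B t z" using left_sup_le[OF below] monoD[OF mono] order_trans by blast
        then show "G t $ i \<le> B t z $ i" by (simp add: G_def less_eq_vec_def)
      qed
      then show ?case using dshift elim by auto
    qed
  qed
  have sup: "super_trajectory (\<lambda>_. 0) B a b (\<lambda>r. v r + - ((2 * e) *\<^sub>R 1))"
    unfolding super_trajectory_def
  proof (intro conjI shift)
    show "AE t in lebesgue. a < t \<and> t < b \<longrightarrow> (\<exists>va. ((\<lambda>r. v r + - ((2 * e) *\<^sub>R 1)) has_vector_derivative va) (at t) \<and>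
      (\<forall>z. z \<lless> v t + - ((2 * e) *\<^sub>R 1) \<longrightarrow> B t z + 0 *\<^sub>R z \<le> va + 0 *\<^sub>R (v t + - ((2 * e) *\<^sub>R 1))))"
      using dv
    proof eventually_elim
      case (elim t)
      have "B t z \<le> G t" if t: "a < t \<and> t < b" and z: "z \<lless> v t + - ((2 * e) *\<^sub>R 1)" for z
        unfolding less_eq_vec_def
      proof
        fix i
        have "z \<lless> mp i"
          unfolding strictly_below_def
        proof
          fix l
          have "z $ l < v t $ l - e" using z e by (auto simp: strictly_below_def dest!: spec[of _ l])
          also have "... \<le> mp i $ l" using near[of t i l] t by (simp add: abs_le_iff)
          finally show "z $ l < mp i $ l" .
        qed
        then have "B t z \<le> left_sup (B t) (mp i)" by (rule left_sup_upper[OF below])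
        then show "B t z $ i \<le> G t $ i" by (simp add: G_def less_eq_vec_def)
      qed
      then show ?case using dshift[of t "- ((2 * e) *\<^sub>R 1)"] elim by auto
    qed
  qed
  show "Y a - w0 \<le> Y b - w1" if "w0 + (2 * e) *\<^sub>R 1 \<lless> Y a"
    using trajectory_comparison[OF sub trajectory_imp_super[OF Y], of b] that ab by (simp add: va vb algebra_simps less_eq_vec_def integrable_0)
  show "w0 - Y a \<le> w1 - Y b" if "Y a + (2 * e) *\<^sub>R 1 \<lless> w0"
  proof -
    have "Y a \<lless> w0 - (2 * e) *\<^sub>R 1" using that by (simp add: strictly_below_def less_diff_eq)
    then show ?thesis
      using trajectory_comparison[OF trajectory_imp_sub[OF Y] sup, of b] ab by (simp add: va vb algebra_simps less_eq_vec_def integrable_0)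
  qed
qed

definition node :: "nat \<Rightarrow> real \<Rightarrow> real \<Rightarrow> nat \<Rightarrow> real" where
  "node N s t k = s + (t - s) * (real k / real N)"

primrec scheme :: "nat \<Rightarrow> real \<Rightarrow> real \<Rightarrow> nat \<Rightarrow> real ^ 'd \<Rightarrow> real ^ 'd" where
  "scheme N s t 0 = (\<lambda>x. x)"
| "scheme N s t (Suc k) = (\<lambda>x. sweep (node N s t k) (node N s t (Suc k)) coords (scheme N s t k x))"

lemma node_bounds:
  assumes "s \<le> t" "k \<le> N" "0 < N" shows "s \<le> node N s t k" "node N s t k \<le> t"
proof -
  have "0 \<le> (t - s) * (real k / real N)" using assms by simp
  moreover have "(t - s) * (real k / real N) \<le> (t - s) * 1"
    using assms by (intro mult_left_mono) (auto simp: divide_le_eq)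
  ultimately show "s \<le> node N s t k" "node N s t k \<le> t" by (auto simp: node_def)
qed

lemma node_Suc: "node N s t (Suc k) = node N s t k + (t - s) / real N"
  by (simp add: node_def add_divide_distrib distrib_left)

lemma node_ends: "node N s t 0 = s" "0 < N \<Longrightarrow> node N s t N = t"
  by (auto simp: node_def)

context
  fixes s t :: real and N :: nat
  assumes st: "0 \<le> s" "s \<le> t" "t \<le> T" and N: "0 < N"
begin

lemma node_le_Suc: "node N s t k \<le> node N s t (Suc k)"
  using st N by (simp add: node_Suc)

lemma node_range: assumes "k \<le> N" shows "0 \<le> node N s t k" "node N s t k \<le> T"
  using node_bounds[OF st(2) assms N] st by auto

lemma scheme_noncompressing:
  "k \<le> N \<Longrightarrow> scheme N s t k \<in> borel_measurable borel \<and> (\<forall>A\<in>sets borel. emeasure lborel (scheme N s t k -` A) \<le> emeasure lborel A)"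
proof (induction k)
  case 0
  then show ?case by simp
next
  case (Suc k)
  let ?S = "sweep (node N s t k) (node N s t (Suc k)) coords"
  have S: "?S \<in> borel_measurable borel" "\<And>A. A \<in> sets borel \<Longrightarrow> emeasure lborel (?S -` A) \<le> emeasure lborel A"
    using sweep_noncompressing[OF node_range(1)[of k] node_range(2)[of "Suc k"], of coords] Suc.prems by auto
  have IH: "scheme N s t k \<in> borel_measurable borel" "\<And>A. A \<in> sets borel \<Longrightarrow> emeasure lborel (scheme N s t k -` A) \<le> emeasure lborel A"
    using Suc by auto
  have "emeasure lborel (scheme N s t (Suc k) -` A) \<le> emeasure lborel A" if A: "A \<in> sets borel" for A
  proof -
    have "?S -` A \<in> sets borel" using measurable_sets[OF S(1) A] by simp
    then have "emeasure lborel (scheme N s t k -` (?S -` A)) \<le> emeasure lborel (?S -` A)" by (rule IH(2))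
    also have "... \<le> emeasure lborel A" by (rule S(2)[OF A])
    finally show ?thesis by (simp add: vimage_def)
  qed
  moreover have "scheme N s t (Suc k) \<in> borel_measurable borel"
    using measurable_compose[OF IH(1) S(1)] by simp
  ultimately show ?case by blast
qed

lemma scheme_growth:
  "k \<le> N \<Longrightarrow> 1 + norm (scheme N s t k x) \<le> (1 + norm x) * exp (real (length (coords :: 'd list)) * integral {s..node N s t k} K)"
proof (induction k)
  case 0
  then show ?case by (simp add: node_ends)
next
  case (Suc k)
  let ?c = "real (length (coords :: 'd list))"
  let ?a = "node N s t k" and ?b = "node N s t (Suc k)"
  have "1 + norm (scheme N s t (Suc k) x) \<le> (1 + norm (scheme N s t k x)) * exp (?c * integral {?a..?b} K)"
    using sweep_growth[OF node_range(1)[of k] node_range(2)[of "Suc k"], of coords] Suc.prems by simp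
  also have "... \<le> (1 + norm x) * exp (?c * integral {s..?a} K) * exp (?c * integral {?a..?b} K)"
    using Suc by (intro mult_right_mono) auto
  also have "... = (1 + norm x) * exp (?c * (integral {s..?a} K + integral {?a..?b} K))"
    by (simp add: distrib_left exp_add mult.assoc)
  also have "integral {s..?a} K + integral {?a..?b} K = integral {s..?b} K"
    by (rule Henstock_Kurzweil_Integration.integral_combine)
      (use node_bounds[OF st(2) _ N] Suc.prems node_le_Suc st K_int_sub[of s ?b] node_range[of "Suc k"] in auto)
  finally show ?case .
qed

end

text \<open>The gap never falls below its initial size, so the one-step comparison applies at every step.\<close>

lemma scheme_comparison:
  assumes st: "0 \<le> s" "s \<le> t" "t \<le> T" and N: "0 < N" and e: "0 < e"
    and Y: "trajectory (\<lambda>_. 0) B s T Y"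
    and R: "R = (1 + norm x) * exp (real (length (coords :: 'd list)) * integral {s..T} K)"
    and mesh: "\<And>p q. s \<le> p \<Longrightarrow> p \<le> q \<Longrightarrow> q \<le> T \<Longrightarrow> q - p \<le> (t - s) / real N \<Longrightarrow> (1 + real CARD('d) * R) * integral {p..q} K \<le> e"
  shows "x + (2 * e) *\<^sub>R 1 \<lless> Y s \<Longrightarrow> scheme N s t N x \<le> Y t"
    and "Y s + (2 * e) *\<^sub>R 1 \<lless> x \<Longrightarrow> Y t \<le> scheme N s t N x"
proof -
  let ?w = "\<lambda>k. scheme N s t k x" and ?n = "node N s t"
  have n: "s \<le> ?n k" "?n k \<le> t" if "k \<le> N" for k using node_bounds[OF st(2) that N] by auto
  have bound: "\<bar>?w k $ l\<bar> \<le> R" if "k \<le> N" for k l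
  proof -
    have "norm (?w k) \<le> (1 + norm x) * exp (real (length (coords :: 'd list)) * integral {s..?n k} K)"
      using scheme_growth[OF st N that, of x] by linarith
    also have "... \<le> R" unfolding R
      using n[OF that] st K_nonneg by (intro mult_left_mono integral_subset_le K_int_sub) (auto intro!: mult_left_mono integral_subset_le K_int_sub)
    finally show ?thesis using component_le_norm_cart order_trans by blast
  qed
  have step: "?w k + (2 * e) *\<^sub>R 1 \<lless> Y (?n k) \<Longrightarrow> Y (?n k) - ?w k \<le> Y (?n (Suc k)) - ?w (Suc k)"
    "Y (?n k) + (2 * e) *\<^sub>R 1 \<lless> ?w k \<Longrightarrow> ?w k - Y (?n k) \<le> ?w (Suc k) - Y (?n (Suc k))"
    if k: "Suc k \<le> N" for k
  proof -
    have ab: "0 \<le> ?n k" "?n k \<le> ?n (Suc k)" "?n (Suc k) \<le> T"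
      using n[of k] n[of "Suc k"] k st node_le_Suc[OF st N] by auto
    have w1: "?w (Suc k) = sweep (?n k) (?n (Suc k)) coords (?w k)" by simp
    have tr: "trajectory (\<lambda>_. 0) B (?n k) (?n (Suc k)) Y"
      by (rule trajectory_subinterval[OF Y]) (use n[of k] k ab in auto)
    have m: "(1 + real CARD('d) * R) * integral {?n k..?n (Suc k)} K \<le> e"
      by (rule mesh) (use n[of k] k ab in "auto simp: node_Suc")
    note sc = sweep_comparison[OF ab w1 bound bound e m tr]
    show "?w k + (2 * e) *\<^sub>R 1 \<lless> Y (?n k) \<Longrightarrow> Y (?n k) - ?w k \<le> Y (?n (Suc k)) - ?w (Suc k)"
      by (rule sc(1)) (use k in auto)
    show "Y (?n k) + (2 * e) *\<^sub>R 1 \<lless> ?w k \<Longrightarrow> ?w k - Y (?n k) \<le> ?w (Suc k) - Y (?n (Suc k))"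
      by (rule sc(2)) (use k in auto)
  qed
  show "?w N \<le> Y t" if start: "x + (2 * e) *\<^sub>R 1 \<lless> Y s"
  proof -
    have "k \<le> N \<Longrightarrow> ?w k + (2 * e) *\<^sub>R 1 \<lless> Y (?n k)" for k
    proof (induction k)
      case 0
      then show ?case using start by (simp add: node_ends)
    next
      case (Suc k)
      then have "?w k + (2 * e) *\<^sub>R 1 \<lless> Y (?n k)" by simp
      from gap_preserved[OF this step(1)[OF Suc.prems this]] show ?case .
    qed
    from this[of N] have "?w N + (2 * e) *\<^sub>R 1 \<lless> Y t" using N by (simp add: node_ends)
    then show ?thesis by (rule gap_imp_le) (use e in simp)
  qed
  show "Y t \<le> ?w N" if start: "Y s + (2 * e) *\<^sub>R 1 \<lless> x"
  proof -
    have "k \<le> N \<Longrightarrow> Y (?n k) + (2 * e) *\<^sub>R 1 \<lless> ?w k" for k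
    proof (induction k)
      case 0
      then show ?case using start by (simp add: node_ends)
    next
      case (Suc k)
      then have "Y (?n k) + (2 * e) *\<^sub>R 1 \<lless> ?w k" by simp
      from gap_preserved[OF this step(2)[OF Suc.prems this]] show ?case .
    qed
    from this[of N] have "Y t + (2 * e) *\<^sub>R 1 \<lless> ?w N" using N by (simp add: node_ends)
    then show ?thesis by (rule gap_imp_le) (use e in simp)
  qed
qed

lemma mesh_eventually:
  assumes st: "0 \<le> s" "s \<le> t" "t \<le> T" and e: "0 < e" and c: "0 \<le> c"
  shows "\<forall>\<^sub>F N in sequentially. \<forall>p q. s \<le> p \<longrightarrow> p \<le> q \<longrightarrow> q \<le> T \<longrightarrow> q - p \<le> (t - s) / real N \<longrightarrow> c * integral {p..q} K \<le> e"
proof -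
  have AC: "AC s T (\<lambda>t. integral {s..t} K)"
    by (rule AC_integral_nonneg[OF K_int_sub]) (use st K_nonneg in auto)
  have "0 < e / (c + 1)" using e c by simp
  from AC_uniform[OF AC this] obtain d where d: "d > 0"
    "\<And>p q. s \<le> p \<Longrightarrow> p \<le> q \<Longrightarrow> q \<le> T \<Longrightarrow> q - p < d \<Longrightarrow> norm (integral {s..q} K - integral {s..p} K) < e / (c + 1)" by blast
  have "(\<lambda>N. (t - s) / real N) \<longlonglongrightarrow> 0" by (rule lim_const_over_n)
  then have "\<forall>\<^sub>F N in sequentially. (t - s) / real N < d" using d(1) by (rule order_tendstoD)
  then show ?thesis
  proof eventually_elim
    case (elim N)
    show ?case
    proof (intro allI impI)
      fix p q assume pq: "s \<le> p" "p \<le> q" "q \<le> T" "q - p \<le> (t - s) / real N"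
      have "integral {p..q} K \<le> e / (c + 1)"
        using d(2)[OF pq(1-3)] pq(4) elim integral_increment[OF K_int_sub[OF st(1) order_refl] pq(1-3)] by auto
      then have "c * integral {p..q} K \<le> c * (e / (c + 1))" using c by (rule mult_left_mono)
      also have "... \<le> e" using c e by (simp add: field_simps)
      finally show "c * integral {p..q} K \<le> e" .
    qed
  qed
qed

lemma scheme_eventually:
  assumes st: "0 \<le> s" "s \<le> t" "t \<le> T"
  shows "x \<lless> y \<Longrightarrow> \<forall>\<^sub>F N in sequentially. scheme N s t N x \<le> minimal_flow t s y"
    and "y \<lless> x \<Longrightarrow> \<forall>\<^sub>F N in sequentially. minimal_flow t s y \<le> scheme N s t N x"
proof -
  define R where "R = (1 + norm x) * exp (real (length (coords :: 'd list)) * integral {s..T} K)"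
  have R0: "0 \<le> 1 + real CARD('d) * R" by (simp add: R_def)
  show "\<forall>\<^sub>F N in sequentially. scheme N s t N x \<le> minimal_flow t s y" if xy: "x \<lless> y"
  proof -
    obtain r where r: "r > 0" "x + r *\<^sub>R 1 \<lless> y" using strictly_below_gap[OF xy] by blast
    have "r / 2 > 0" using r by simp
    from mesh_eventually[OF st this R0] eventually_gt_at_top[of 0]
    show ?thesis
    proof eventually_elim
      case (elim N)
      show ?case
        by (rule scheme_comparison(1)[OF st elim(2) `r / 2 > 0` minimal_flow_trajectory[OF st(1)] R_def])
          (use elim(1) r in "auto simp: minimal_flow_start[OF st(1)]")
    qed
  qed
  show "\<forall>\<^sub>F N in sequentially. minimal_flow t s y \<le> scheme N s t N x" if yx: "y \<lless> x"
  proof -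
    obtain r where r: "r > 0" "y + r *\<^sub>R 1 \<lless> x" using strictly_below_gap[OF yx] by blast
    have "r / 2 > 0" using r by simp
    from mesh_eventually[OF st this R0] eventually_gt_at_top[of 0]
    show ?thesis
    proof eventually_elim
      case (elim N)
      show ?case
        by (rule scheme_comparison(2)[OF st elim(2) `r / 2 > 0` minimal_flow_trajectory[OF st(1)] R_def])
          (use elim(1) r in "auto simp: minimal_flow_start[OF st(1)]")
    qed
  qed
qed

lemma minimal_flow_mono_below:
  assumes "0 \<le> s" "t \<in> {s..T}" shows "mono_below (minimal_flow t s)"
  unfolding mono_below_def
proof (intro allI impI)
  fix x y :: "real ^ 'd" assume xy: "x \<lless> y"
  have mf: "monotone_field B K T L" by unfold_locales
  have "y - x \<le> minimal_flow t s y - minimal_flow t s x"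
    by (rule minimal_flow_comparison[OF mf mf order_refl assms xy])
  then have "0 \<le> minimal_flow t s y - minimal_flow t s x"
    using xy by (auto simp: less_eq_vec_def strictly_below_def) (smt (verit))
  then show "minimal_flow t s x \<le> minimal_flow t s y" by (simp add: less_eq_vec_def)
qed

theorem minimal_flow_noncompressing:
  assumes s: "0 \<le> s" and t: "t \<in> {s..T}"
  shows "minimal_flow t s \<in> lebesgue \<rightarrow>\<^sub>M lebesgue"
    and "A \<in> sets lebesgue \<Longrightarrow> emeasure lebesgue (minimal_flow t s -` A) \<le> emeasure lebesgue A"
proof -
  have st: "0 \<le> s" "s \<le> t" "t \<le> T" using s t by auto
  have cont: "AE x in lebesgue. isCont (minimal_flow t s) x"
    by (rule mono_below_AE_isCont[OF minimal_flow_mono_below[OF s t]])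
  have "AE x in lebesgue. (\<lambda>N. scheme (Suc N) s t (Suc N) x) \<longlonglongrightarrow> minimal_flow t s x"
    using cont
  proof eventually_elim
    case (elim x)
    have "(\<lambda>N. scheme N s t N x) \<longlonglongrightarrow> minimal_flow t s x"
      by (rule tendsto_of_strict_squeeze[OF elim scheme_eventually(2)[OF st] scheme_eventually(1)[OF st]])
    then show ?case by (rule LIMSEQ_Suc)
  qed
  note lim = this
  note nc = noncompressing_limit[OF _ _ lim AE_isCont_measurable[OF cont]]
  show "minimal_flow t s \<in> lebesgue \<rightarrow>\<^sub>M lebesgue"
    by (rule nc(1)) (use scheme_noncompressing[OF st zero_less_Suc order_refl] in auto)
  show "A \<in> sets lebesgue \<Longrightarrow> emeasure lebesgue (minimal_flow t s -` A) \<le> emeasure lebesgue A"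
    by (rule nc(2)) (use scheme_noncompressing[OF st zero_less_Suc order_refl] in auto)
qed

end

section \<open>Flows of fields that are increasing up to a multiple of the identity\<close>

locale one_sided_field =
  fixes b :: "real \<Rightarrow> real ^ 'd \<Rightarrow> real ^ 'd" and C K :: "real \<Rightarrow> real" and T L :: real
  assumes mono: "\<And>t. mono (\<lambda>x. b t x + C t *\<^sub>R x)"
    and growth: "\<And>t x. norm (b t x) \<le> K t * (1 + norm x)"
    and meas: "AE q in lebesgue. (\<lambda>t. b t q) \<in> borel_measurable lebesgue"
    and K_nonneg: "\<And>t. 0 \<le> K t" and K_int: "\<And>t. K integrable_on {0..t}"
    and C_nonneg: "\<And>t. 0 \<le> C t" and C_int: "\<And>t. C integrable_on {0..t}"
    and C_meas: "C \<in> borel_measurable lebesgue"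
    and L: "1 + real CARD('d) \<le> L"
begin

definition E :: "real \<Rightarrow> real" where "E t = exp (integral {0..t} C)"

text \<open>The field of \<open>E t *\<^sub>R y t\<close> when \<open>y\<close> follows \<open>b\<close>; the factor \<open>E\<close> absorbs the term with \<open>C\<close>.\<close>

definition straight :: "real \<Rightarrow> real ^ 'd \<Rightarrow> real ^ 'd" where
  "straight t z = E t *\<^sub>R (b t ((1 / E t) *\<^sub>R z) + C t *\<^sub>R ((1 / E t) *\<^sub>R z))"

definition rate :: "real \<Rightarrow> real" where "rate t = E t * K t + C t"

lemma E_pos: "0 < E t" and E_ge1: "1 \<le> E t"
proof -
  have "0 \<le> integral {0..t} C" by (rule integral_nonneg[OF C_int]) (rule C_nonneg)
  then show "1 \<le> E t" by (simp add: E_def)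
qed (simp add: E_def)

lemma E_mono: "r \<le> t \<Longrightarrow> E r \<le> E t"
  unfolding E_def by (cases "0 \<le> r") (auto intro!: integral_subset_le integral_nonneg C_int C_nonneg)

lemma E_measurable: "E \<in> borel_measurable lebesgue"
  using borel_measurable_mono[of E] E_mono by (simp add: mono_def measurable_completion)

lemma below: "mono_below (\<lambda>x. b t x + C t *\<^sub>R x)"
  by (rule mono_imp_mono_below[OF mono])

lemma straight_eq: "straight t = (\<lambda>z. E t *\<^sub>R (\<lambda>x. b t x + C t *\<^sub>R x) ((1 / E t) *\<^sub>R z))"
  by (simp add: straight_def fun_eq_iff)

lemma straight_monotone_field: "monotone_field straight rate T L"
proof
  show "mono (straight t)" for t
  proof (rule monoI)
    fix x y :: "real ^ 'd" assume "x \<le> y"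
    then have "(1 / E t) *\<^sub>R x \<le> (1 / E t) *\<^sub>R y" using E_pos[of t] by (auto simp: less_eq_vec_def divide_right_mono)
    from monoD[OF mono this] show "straight t x \<le> straight t y"
      unfolding straight_def using E_pos[of t] by (simp add: less_eq_vec_def)
  qed
  show "norm (straight t x) \<le> rate t * (1 + norm x)" for t x
  proof -
    have "norm (straight t x) = E t * norm (b t ((1 / E t) *\<^sub>R x) + C t *\<^sub>R ((1 / E t) *\<^sub>R x))"
      unfolding straight_def by (simp only: norm_scaleR abs_of_pos[OF E_pos])
    also have "... \<le> E t * (norm (b t ((1 / E t) *\<^sub>R x)) + norm (C t *\<^sub>R ((1 / E t) *\<^sub>R x)))"
      by (rule mult_left_mono[OF norm_triangle_ineq less_imp_le[OF E_pos]])
    also have "... \<le> E t * (K t * (1 + norm ((1 / E t) *\<^sub>R x)) + norm (C t *\<^sub>R ((1 / E t) *\<^sub>R x)))"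
      by (intro mult_left_mono add_right_mono growth less_imp_le[OF E_pos])
    also have "... = E t * K t + K t * norm x + C t * norm x"
      using E_pos[of t] C_nonneg[of t] by (simp add: field_simps)
    also have "... \<le> E t * K t + E t * K t * norm x + C t * norm x + C t"
    proof -
      have "1 * K t * norm x \<le> E t * K t * norm x" by (intro mult_right_mono E_ge1 K_nonneg) auto
      then show ?thesis using C_nonneg[of t] by simp
    qed
    finally show ?thesis by (simp add: rate_def algebra_simps)
  qed
  show "(\<lambda>t. left_sup (straight t) (y t)) \<in> borel_measurable lebesgue" if y: "y \<in> borel_measurable lebesgue" for y
  proof -
    have "AE q in lebesgue. (\<lambda>t. b t q + C t *\<^sub>R q) \<in> borel_measurable lebesgue"
      using meas by eventually_elim (intro borel_measurable_add borel_measurable_scaleR C_meas borel_measurable_const)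
    moreover have "(\<lambda>t. (1 / E t) *\<^sub>R y t) \<in> borel_measurable lebesgue"
      by (intro borel_measurable_scaleR borel_measurable_divide borel_measurable_const E_measurable y)
    ultimately have "(\<lambda>t. left_sup (\<lambda>x. b t x + C t *\<^sub>R x) ((1 / E t) *\<^sub>R y t)) \<in> borel_measurable lebesgue"
      by (rule left_sup_measurable[OF below])
    then have "(\<lambda>t. E t *\<^sub>R left_sup (\<lambda>x. b t x + C t *\<^sub>R x) ((1 / E t) *\<^sub>R y t)) \<in> borel_measurable lebesgue"
      by (intro borel_measurable_scaleR E_measurable)
    then show ?thesis unfolding straight_eq left_sup_scaleR[OF below E_pos] .
  qed
  show "0 \<le> rate t" for t using E_pos[of t] K_nonneg[of t] C_nonneg[of t] by (simp add: rate_def)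
  show "rate integrable_on {0..T}"
  proof -
    have "(\<lambda>t. E t * K t) absolutely_integrable_on {0..T}"
    proof (rule absolutely_integrable_bounded_measurable_product_real)
      show "E \<in> borel_measurable (lebesgue_on {0..T})" by (rule measurable_restrict_space1[OF E_measurable])
      show "bounded (E ` {0..T})"
        by (rule boundedI[of _ "E T"]) (use E_mono E_pos less_imp_le in "auto simp: abs_of_pos")
      show "K absolutely_integrable_on {0..T}" by (rule nonnegative_absolutely_integrable_1[OF K_int K_nonneg])
    qed auto
    then show ?thesis unfolding rate_def by (intro integrable_add C_int) (simp add: set_lebesgue_integral_eq_integral)
  qed
qed (rule L)

sublocale S: monotone_field straight rate T L by (rule straight_monotone_field)

definition flow :: "real \<Rightarrow> real \<Rightarrow> real ^ 'd \<Rightarrow> real ^ 'd" where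
  "flow t s x = (1 / E t) *\<^sub>R S.minimal_flow t s (E s *\<^sub>R x)"

lemma flow_start: "0 \<le> s \<Longrightarrow> flow s s x = x"
  using E_pos[of s] by (simp add: flow_def S.minimal_flow_start)

lemma flow_trajectory:
  assumes s: "0 \<le> s" shows "trajectory C b s T (\<lambda>t. flow t s x)"
proof -
  define Z where "Z = (\<lambda>t. S.minimal_flow t s (E s *\<^sub>R x))"
  have Z: "trajectory (\<lambda>_. 0) straight s T Z" unfolding Z_def by (rule S.minimal_flow_trajectory[OF s])
  have iE: "1 / E t = exp (- 1 * integral {0..t} C)" for t by (simp add: E_def exp_minus inverse_eq_divide)
  have fl: "(\<lambda>t. flow t s x) = (\<lambda>t. exp (- 1 * integral {0..t} C) *\<^sub>R Z t)" by (simp add: flow_def Z_def iE)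
  show ?thesis
    unfolding trajectory_def
  proof
    have "AC 0 T (\<lambda>t. exp (- 1 * integral {0..t} C))"
      by (rule AC_exp_integral[OF C_int C_nonneg])
    then have "AC s T (\<lambda>t. exp (- 1 * integral {0..t} C))"
      using s by (rule AC_subinterval) simp
    then show "AC s T (\<lambda>t. flow t s x)"
      unfolding fl using conjunct1[OF Z[unfolded trajectory_def]] by (intro AC_scaleR)
    show "AE t in lebesgue. s < t \<and> t < T \<longrightarrow> (\<exists>v. ((\<lambda>t. flow t s x) has_vector_derivative v) (at t) \<and>
        (\<forall>z. z \<lless> flow t s x \<longrightarrow> b t z + C t *\<^sub>R z \<le> v + C t *\<^sub>R flow t s x) \<and>
        (\<forall>z. flow t s x \<lless> z \<longrightarrow> v + C t *\<^sub>R flow t s x \<le> b t z + C t *\<^sub>R z))"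
      using conjunct2[OF Z[unfolded trajectory_def]] AE_derivative_exp_integral[OF C_int[of T], of "- 1"]
    proof eventually_elim
      case (elim t)
      show ?case
      proof
        assume t: "s < t \<and> t < T"
        obtain V where V: "(Z has_vector_derivative V) (at t)"
          "\<And>z. z \<lless> Z t \<Longrightarrow> straight t z \<le> V" "\<And>z. Z t \<lless> z \<Longrightarrow> V \<le> straight t z"
          using elim(1) t by auto
        define v where "v = (1 / E t) *\<^sub>R (V - C t *\<^sub>R Z t)"
        have "((\<lambda>t. flow t s x) has_vector_derivative (exp (- 1 * integral {0..t} C) *\<^sub>R V + (- 1 * C t * exp (- 1 * integral {0..t} C)) *\<^sub>R Z t)) (at t)"
          unfolding fl by (rule has_vector_derivative_scaleR[OF elim(2)[rule_format] V(1)]) (use t s in auto)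
        moreover have "exp (- 1 * integral {0..t} C) *\<^sub>R V + (- 1 * C t * exp (- 1 * integral {0..t} C)) *\<^sub>R Z t = v"
          unfolding v_def iE by (simp add: algebra_simps)
        ultimately have d: "((\<lambda>t. flow t s x) has_vector_derivative v) (at t)" by simp
        have fz: "flow t s x = (1 / E t) *\<^sub>R Z t" by (simp add: flow_def Z_def)
        have vV: "v + C t *\<^sub>R flow t s x = (1 / E t) *\<^sub>R V" by (simp add: v_def fz algebra_simps)
        have zZ: "E t *\<^sub>R flow t s x = Z t" using E_pos[of t] by (simp add: fz)
        have st: "straight t (E t *\<^sub>R z) = E t *\<^sub>R (b t z + C t *\<^sub>R z)" for z
          using E_pos[of t] by (simp add: straight_def)
        have "b t z + C t *\<^sub>R z \<le> (1 / E t) *\<^sub>R V" if "z \<lless> flow t s x" for z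
          using V(2)[of "E t *\<^sub>R z"] strictly_below_scaleR[OF E_pos[of t] that] E_pos[of t]
          by (simp add: zZ st less_eq_vec_def field_simps)
        moreover have "(1 / E t) *\<^sub>R V \<le> b t z + C t *\<^sub>R z" if "flow t s x \<lless> z" for z
          using V(3)[of "E t *\<^sub>R z"] strictly_below_scaleR[OF E_pos[of t] that] E_pos[of t]
          by (simp add: zZ st less_eq_vec_def field_simps)
        ultimately show "\<exists>v. ((\<lambda>t. flow t s x) has_vector_derivative v) (at t) \<and>
        (\<forall>z. z \<lless> flow t s x \<longrightarrow> b t z + C t *\<^sub>R z \<le> v + C t *\<^sub>R flow t s x) \<and>
        (\<forall>z. flow t s x \<lless> z \<longrightarrow> v + C t *\<^sub>R flow t s x \<le> b t z + C t *\<^sub>R z)" using d vV by auto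
      qed
    qed
  qed
qed

lemma C_int_sub: "0 \<le> s \<Longrightarrow> C integrable_on {s..t}"
  using C_int[of t] by (meson atLeastatMost_subset_iff integrable_on_subinterval order_refl)

lemma K_int_sub: "0 \<le> s \<Longrightarrow> K integrable_on {s..t}"
  using K_int[of t] by (meson atLeastatMost_subset_iff integrable_on_subinterval order_refl)

end

lemma strict_trajectory_comparison:
  assumes sub: "sub_trajectory C b1 s T y1" and sup: "super_trajectory C b2 s T y2"
    and le: "AE t in lebesgue. s < t \<and> t < T \<longrightarrow> (\<forall>z. b1 t z \<le> b2 t z)"
    and C: "C integrable_on {s..T}" "\<And>t. 0 \<le> C t"
    and start: "y1 s \<lless> y2 s" and t: "t \<in> {s..T}"
  shows "y1 t \<lless> y2 t"
proof -
  have *: "exp (- integral {s..t} C) *\<^sub>R (y2 s - y1 s) \<le> y2 t - y1 t"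
    by (rule trajectory_comparison[OF sub sup le C start t])
  show ?thesis
    unfolding strictly_below_def
  proof
    fix i
    have "0 < exp (- integral {s..t} C) * (y2 s $ i - y1 s $ i)" using start by (simp add: strictly_below_def)
    also have "... \<le> y2 t $ i - y1 t $ i" using * by (simp add: less_eq_vec_def)
    finally show "y1 t $ i < y2 t $ i" by simp
  qed
qed

context one_sided_field
begin

lemma trajectory_strict:
  assumes "0 \<le> s" "trajectory C b s T y1" "trajectory C b s T y2" "y1 s \<lless> y2 s" "t \<in> {s..T}"
  shows "y1 t \<lless> y2 t"
  by (rule strict_trajectory_comparison[OF trajectory_imp_sub[OF assms(2)] trajectory_imp_super[OF assms(3)] _ C_int_sub C_nonneg assms(4,5)])
    (use assms(1) in auto)

lemma flow_strict:
  assumes "0 \<le> s" "x \<lless> y" "t \<in> {s..T}" shows "flow t s x \<lless> flow t s y"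
  by (rule trajectory_strict[OF assms(1) flow_trajectory[OF assms(1)] flow_trajectory[OF assms(1)] _ assms(3)])
    (simp add: flow_start assms)

lemma flow_mono_below: "0 \<le> s \<Longrightarrow> t \<in> {s..T} \<Longrightarrow> mono_below (flow t s)"
  by (simp add: mono_below_def flow_strict strictly_below_imp_le)

text \<open>Every trajectory lies between the flows of points strictly below and strictly above its
  starting point; these two bounds agree where the flow is continuous.\<close>

lemma AE_unique_trajectory:
  assumes s: "0 \<le> s"
  shows "AE x in lebesgue. \<forall>y. trajectory C b s T y \<and> y s = x \<longrightarrow> (\<forall>t\<in>{s..T}. y t = flow t s x)"
proof -
  have "AE x in lebesgue. \<forall>r::rat. of_rat r \<in> {s..T} \<longrightarrow> isCont (flow (of_rat r) s) x"
    unfolding AE_all_countable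
  proof
    fix r :: rat
    show "AE x in lebesgue. of_rat r \<in> {s..T} \<longrightarrow> isCont (flow (of_rat r) s) x"
    proof (cases "(of_rat r :: real) \<in> {s..T}")
      case True
      then have "AE x in lebesgue. isCont (flow (of_rat r) s) x"
        by (intro mono_below_AE_isCont flow_mono_below s)
      then show ?thesis by eventually_elim simp
    next
      case False
      then show ?thesis by (intro AE_I2) blast
    qed
  qed
  then show ?thesis
  proof eventually_elim
    case (elim x)
    show ?case
    proof (intro allI impI ballI)
      fix y t assume y: "trajectory C b s T y \<and> y s = x" and t: "t \<in> {s..T}"
      have rat: "y r = flow r s x" if r: "r \<in> {s..T}" "r \<in> \<rat>" for r
      proof -
        have cont: "isCont (flow r s) x" using elim r by (auto elim!: Rats_cases)
        have "flow r s z \<lless> y r" if "z \<lless> x" for z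
          by (rule trajectory_strict[OF s flow_trajectory[OF s] _ _ r(1)]) (use y that in "auto simp: flow_start[OF s]")
        moreover have "y r \<lless> flow r s z" if "x \<lless> z" for z
          by (rule trajectory_strict[OF s _ flow_trajectory[OF s] _ r(1)]) (use y that in "auto simp: flow_start[OF s]")
        ultimately have "(\<lambda>_::nat. y r) \<longlonglongrightarrow> flow r s x"
          by (intro tendsto_of_strict_squeeze[OF cont]) (auto intro: strictly_below_imp_le)
        then show ?thesis by (simp add: LIMSEQ_const_iff)
      qed
      show "y t = flow t s x"
      proof (cases "t = s")
        case True
        then show ?thesis using y by (simp add: flow_start[OF s])
      next
        case False
        then have "s < t" using t by simp
        have "continuous_on {s..T} y" "continuous_on {s..T} (\<lambda>t. flow t s x)"
          using y flow_trajectory[OF s, of x] AC_imp_continuous_on unfolding trajectory_def by blast+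
        then have cont: "continuous_on {s..T} (\<lambda>r. dist (y r) (flow r s x))" by (intro continuous_intros)
        show ?thesis
        proof (rule ccontr)
          assume "y t \<noteq> flow t s x"
          then have pos: "0 < dist (y t) (flow t s x)" by simp
          have "((\<lambda>r. dist (y r) (flow r s x)) \<longlongrightarrow> dist (y t) (flow t s x)) (at t within {s..T})"
            using cont t by (simp add: continuous_on_def)
          then have "\<forall>\<^sub>F r in at t within {s..T}. 0 < dist (y r) (flow r s x)" using pos by (rule order_tendstoD)
          then obtain d where d: "d > 0" "\<And>r. r \<in> {s..T} \<Longrightarrow> r \<noteq> t \<Longrightarrow> dist r t < d \<Longrightarrow> 0 < dist (y r) (flow r s x)"
            unfolding eventually_at by blast
          obtain r where r: "r \<in> \<rat>" "max s (t - d) < r" "r < t"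
            using Rats_dense_in_real[of "max s (t - d)" t] `s < t` d(1) by auto
          then have "r \<in> {s..T}" "r \<noteq> t" "dist r t < d" using t by (auto simp: dist_real_def)
          then show False using d(2)[of r] rat[of r] r(1) by simp
        qed
      qed
    qed
  qed
qed

lemma flow_noncompressing:
  assumes s: "s \<in> {0..T}" and t: "t \<in> {s..T}"
  shows "flow t s \<in> lebesgue \<rightarrow>\<^sub>M lebesgue"
    and "A \<in> sets lebesgue \<Longrightarrow> emeasure lebesgue (flow t s -` A) \<le> ennreal (E T ^ CARD('d)) * emeasure lebesgue A"
proof -
  have s0: "0 \<le> s" using s by simp
  have eq: "flow t s = (\<lambda>x. (1 / E t) *\<^sub>R S.minimal_flow t s (E s *\<^sub>R x))" by (simp add: flow_def fun_eq_iff)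
  have M: "S.minimal_flow t s \<in> lebesgue \<rightarrow>\<^sub>M lebesgue" by (rule S.minimal_flow_noncompressing[OF s0 t])
  have sc: "(\<lambda>x. c *\<^sub>R x) \<in> lebesgue \<rightarrow>\<^sub>M lebesgue" for c by (rule lebesgue_measurable_scaling)
  show "flow t s \<in> lebesgue \<rightarrow>\<^sub>M lebesgue"
    unfolding eq by (rule measurable_compose[OF measurable_compose[OF sc M] sc])
  show "emeasure lebesgue (flow t s -` A) \<le> ennreal (E T ^ CARD('d)) * emeasure lebesgue A" if A: "A \<in> sets lebesgue"
  proof -
    have pre: "emeasure lebesgue ((\<lambda>x. c *\<^sub>R x) -` X) = ennreal ((1 / c) ^ CARD('d)) * emeasure lebesgue X"
      if "c > 0" for c and X :: "(real ^ 'd) set"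
    proof -
      have "(\<lambda>x. c *\<^sub>R x) -` X = (\<lambda>x. (1 / c) *\<^sub>R x + 0) ` X"
      proof (intro equalityI subsetI)
        fix x assume "x \<in> (\<lambda>x. c *\<^sub>R x) -` X"
        then show "x \<in> (\<lambda>x. (1 / c) *\<^sub>R x + 0) ` X" using `c > 0` by (intro image_eqI[of _ _ "c *\<^sub>R x"]) auto
      qed (use `c > 0` in auto)
      then show ?thesis using emeasure_lebesgue_affine[of "1 / c" 0 X] `c > 0` by simp
    qed
    define A1 where "A1 = (\<lambda>z. (1 / E t) *\<^sub>R z) -` A"
    define A2 where "A2 = S.minimal_flow t s -` A1"
    have A1: "A1 \<in> sets lebesgue" using measurable_sets[OF sc A] by (simp add: A1_def)
    have "emeasure lebesgue (flow t s -` A) = emeasure lebesgue ((\<lambda>x. E s *\<^sub>R x) -` A2)"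
      by (simp add: eq A1_def A2_def vimage_def)
    also have "... = ennreal ((1 / E s) ^ CARD('d)) * emeasure lebesgue A2" by (rule pre[OF E_pos])
    also have "... \<le> ennreal ((1 / E s) ^ CARD('d)) * emeasure lebesgue A1"
      unfolding A2_def by (intro mult_left_mono S.minimal_flow_noncompressing[OF s0 t] A1) simp
    also have "emeasure lebesgue A1 = ennreal ((1 / (1 / E t)) ^ CARD('d)) * emeasure lebesgue A"
      unfolding A1_def by (rule pre) (use E_pos[of t] in simp)
    also have "ennreal ((1 / E s) ^ CARD('d)) * (ennreal ((1 / (1 / E t)) ^ CARD('d)) * emeasure lebesgue A)
        = ennreal ((E t / E s) ^ CARD('d)) * emeasure lebesgue A"
      using E_pos[of s] E_pos[of t] by (simp add: mult.assoc[symmetric] ennreal_mult[symmetric] power_divide)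
    also have "... \<le> ennreal (E T ^ CARD('d)) * emeasure lebesgue A"
    proof (intro mult_right_mono ennreal_leI power_mono)
      have "E t \<le> E T" using t by (intro E_mono) simp
      moreover have "E t / E s \<le> E t / 1" using E_ge1[of s] E_pos[of t] E_pos[of s] by (intro divide_left_mono) auto
      ultimately show "E t / E s \<le> E T" by simp
      show "0 \<le> E t / E s" using E_pos[of s] E_pos[of t] by simp
    qed simp
    finally show ?thesis .
  qed
qed

end

text \<open>Straightening preserves increasing convergence of fields, which reduces this to minimal flows.\<close>

lemma flow_eventually_above:
  assumes H: "\<And>n. one_sided_field (H n) C K L" and b: "one_sided_field b C K L"
    and inc: "\<And>n r z. H n r z \<le> H (Suc n) r z" and lim: "\<And>r z. (\<lambda>n. H n r z) \<longlonglongrightarrow> b r z"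
    and s: "0 \<le> s" and t: "t \<in> {s..T}" and yx: "y \<lless> x"
  shows "\<forall>\<^sub>F n in sequentially. one_sided_field.flow b C K L t s y \<lless> one_sided_field.flow (H n) C K L t s x"
proof -
  interpret b: one_sided_field b C K T L by fact
  note flow_H = one_sided_field.flow_def[OF H] and st_H = one_sided_field.straight_def[OF H]
  have "\<forall>\<^sub>F n in sequentially. b.S.minimal_flow t s (b.E s *\<^sub>R y) \<lless>
      monotone_field.minimal_flow (one_sided_field.straight (H n) C) b.rate L t s (b.E s *\<^sub>R x)"
  proof (rule minimal_flow_eventually_above[OF _ b.straight_monotone_field _ _ s t])
    show "monotone_field (one_sided_field.straight (H n) C) b.rate T L" for n
      by (rule one_sided_field.straight_monotone_field[OF H])
    show "one_sided_field.straight (H n) C r z \<le> one_sided_field.straight (H (Suc n)) C r z" for n r z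
      unfolding st_H using inc[of n r "(1 / b.E r) *\<^sub>R z"] b.E_pos[of r] by (simp add: less_eq_vec_def)
    show "(\<lambda>n. one_sided_field.straight (H n) C r z) \<longlonglongrightarrow> b.straight r z" for r z
      unfolding st_H b.straight_def by (intro tendsto_intros lim)
    show "b.E s *\<^sub>R y \<lless> b.E s *\<^sub>R x" by (rule strictly_below_scaleR[OF b.E_pos yx])
  qed
  then show ?thesis
    unfolding flow_H b.flow_def
    by eventually_elim (rule strictly_below_scaleR, use b.E_pos[of t] in auto)
qed

section \<open>Decreasing maps\<close>

definition antimono_below :: "(real ^ 'n \<Rightarrow> real ^ 'k) \<Rightarrow> bool" where
  "antimono_below h \<longleftrightarrow> (\<forall>x y. x \<lless> y \<longrightarrow> h y \<le> h x)"

definition left_inf :: "(real ^ 'n \<Rightarrow> real ^ 'k) \<Rightarrow> real ^ 'n \<Rightarrow> real ^ 'k" where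
  "left_inf h x = - left_sup (\<lambda>z. - h z) x"

lemma vec_minus_le_iff: "- x \<le> y \<longleftrightarrow> - y \<le> (x :: real ^ 'n)" "x \<le> - y \<longleftrightarrow> y \<le> - (x :: real ^ 'n)"
  by (auto simp: less_eq_vec_def minus_le_iff le_minus_iff)

lemma vec_minus_le_minus: "- x \<le> - y \<longleftrightarrow> y \<le> (x :: real ^ 'n)"
  by (auto simp: less_eq_vec_def)

lemma antimono_below_minus: "antimono_below h \<longleftrightarrow> mono_below (\<lambda>z. - h z)"
  by (simp add: antimono_below_def mono_below_def vec_minus_le_minus)

lemma antimono_belowD: "antimono_below h \<Longrightarrow> x \<lless> y \<Longrightarrow> h y \<le> h x"
  by (simp add: antimono_below_def)

lemma antimono_imp_antimono_below: "antimono h \<Longrightarrow> antimono_below h"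
  by (auto simp: antimono_below_def antimono_def strictly_below_imp_le)

lemma left_inf_lower: "antimono_below h \<Longrightarrow> z \<lless> x \<Longrightarrow> left_inf h x \<le> h z"
  unfolding left_inf_def using left_sup_upper[of "\<lambda>z. - h z" z x] by (simp add: antimono_below_minus vec_minus_le_iff)

lemma left_inf_greatest: "(\<And>z. z \<lless> x \<Longrightarrow> v \<le> h z) \<Longrightarrow> v \<le> left_inf h x"
  unfolding left_inf_def using left_sup_least[of x "\<lambda>z. - h z" "- v"] by (simp add: vec_minus_le_iff vec_minus_le_minus)

lemma left_inf_ge: "antimono_below h \<Longrightarrow> h x \<le> left_inf h x"
  by (rule left_inf_greatest) (rule antimono_belowD)

lemma left_inf_le_continuous:
  fixes h :: "real ^ 'n \<Rightarrow> real ^ 'k"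
  assumes h: "antimono_below h" and c: "continuous_on UNIV c" and le: "\<And>z. h z $ i \<le> c z"
  shows "left_inf h x $ i \<le> c x"
proof (rule continuous_strict_limit(1)[OF c])
  fix z assume "z \<lless> x"
  then have "left_inf h x $ i \<le> h z $ i" using left_inf_lower[OF h] by (auto simp: less_eq_vec_def)
  then show "left_inf h x $ i \<le> c z" using le[of z] by linarith
qed

lemma left_inf_ge_pointwise:
  assumes h: "antimono_below h" and le: "c \<le> h x $ i"
  shows "c \<le> left_inf h x $ i"
  using left_inf_ge[OF h, of x] le by (auto simp: less_eq_vec_def intro: order_trans)

lemma left_inf_antimono: assumes "antimono_below h" shows "antimono (left_inf h)"
proof (rule antimonoI)
  fix x y :: "real ^ 'a" assume "x \<le> y"
  then show "left_inf h y \<le> left_inf h x"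
    by (intro left_inf_greatest left_inf_lower assms) (rule strictly_below_le_trans)
qed

lemma left_inf_upper_semicontinuous:
  assumes h: "antimono_below h" shows "upper_semicontinuous (left_inf h)"
  unfolding upper_semicontinuous_def
proof (intro allI)
  fix i x
  show "upper_env (\<lambda>y. left_inf h y $ i) x \<le> ereal (left_inf h x $ i)"
  proof (rule dense_ge)
    fix r assume "ereal (left_inf h x $ i) < r"
    then obtain q where q: "ereal (left_inf h x $ i) < ereal q" "ereal q < r" using ereal_dense2 by blast
    define e where "e = q - left_inf h x $ i"
    have "e > 0" using q(1) by (simp add: e_def)
    have "- (left_inf h x $ i) - e < left_sup (\<lambda>z. - h z) x $ i"
      using `e > 0` by (simp add: left_inf_def)
    then obtain z where z: "z \<lless> x" "h z $ i < left_inf h x $ i + e"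
      using less_left_sup_iff[of "\<lambda>z. - h z"] h by (auto simp: antimono_below_minus)
    have "\<forall>\<^sub>F w in nhds x. z \<lless> w" using eventually_nhds_in_open[OF open_strictly_below(1)[of z]] z(1) by simp
    then have "\<forall>\<^sub>F w in nhds x. ereal (left_inf h w $ i) \<le> ereal (left_inf h x $ i + e)"
    proof eventually_elim
      case (elim w)
      then show ?case using left_inf_lower[OF h elim] z(2) by (auto simp: less_eq_vec_def dest!: spec[of _ i])
    qed
    then have "upper_env (\<lambda>y. left_inf h y $ i) x \<le> ereal (left_inf h x $ i + e)"
      unfolding upper_env_def by (intro Limsup_bounded)
    then show "upper_env (\<lambda>y. left_inf h y $ i) x \<le> r" using q(2) by (simp add: e_def)
  qed
qed

lemma antimono_below_AE_isCont:
  fixes h :: "real ^ 'n \<Rightarrow> real ^ 'k"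
  assumes "antimono_below h" shows "AE x in lebesgue. isCont h x"
proof -
  have "AE x in lebesgue. isCont (\<lambda>x. - h x) x"
    using assms by (intro mono_below_AE_isCont) (simp add: antimono_below_minus)
  then show ?thesis
  proof eventually_elim
    case (elim x)
    then show ?case using continuous_minus[of "at x" "\<lambda>x. - h x"] by simp
  qed
qed

lemma left_inf_measurable:
  fixes B :: "real \<Rightarrow> real ^ 'n \<Rightarrow> real ^ 'k"
  assumes "\<And>t. antimono_below (B t)" and "AE q in lebesgue. (\<lambda>t. B t q) \<in> borel_measurable lebesgue"
    and y: "y \<in> borel_measurable lebesgue"
  shows "(\<lambda>t. left_inf (B t) (y t)) \<in> borel_measurable lebesgue"
  unfolding left_inf_def
proof (intro borel_measurable_uminus left_sup_measurable y)
  show "AE q in lebesgue. (\<lambda>t. - B t q) \<in> borel_measurable lebesgue"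
    using assms(2) by eventually_elim (intro borel_measurable_uminus)
qed (use assms(1) in "simp add: antimono_below_minus")

text \<open>Where the inequality fails it also fails on an open set of points strictly below, since \<open>u\<close> is not
  smaller there and \<open>h\<close> is continuous.\<close>

lemma antimono_le_continuous:
  fixes u :: "real ^ 'n \<Rightarrow> real ^ 'k" and h :: "real ^ 'n \<Rightarrow> real"
  assumes u: "antimono u" and h: "continuous_on UNIV h" and ae: "AE x in lebesgue. u x $ i \<le> h x"
  shows "u x $ i \<le> h x"
proof (rule ccontr)
  assume "\<not> u x $ i \<le> h x"
  then have "h x < u x $ i" by simp
  then have "open {w. h w < u x $ i}" "x \<in> {w. h w < u x $ i}"
    using h by (auto intro: open_Collect_less continuous_intros)
  then obtain e where e: "e > 0" "ball x e \<subseteq> {w. h w < u x $ i}" by (meson openE)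
  define r where "r = e / (2 * norm (1 :: real ^ 'n))"
  have n1: "0 < norm (1 :: real ^ 'n)" by (simp add: vec_eq_iff)
  then have r: "r > 0" using e(1) by (simp add: r_def)
  have "norm (r *\<^sub>R (1 :: real ^ 'n)) < e" using e(1) n1 by (simp add: r_def)
  then have "x - r *\<^sub>R 1 \<in> ball x e" by (simp add: dist_norm)
  then have "x - r *\<^sub>R 1 \<in> ball x e \<inter> {w. w \<lless> x}" using strictly_below_shift(1)[OF r] by simp
  then obtain w where w: "w \<in> ball x e" "w \<lless> x" "u w $ i \<le> h w"
    using AE_dense[OF ae, of "ball x e \<inter> {w. w \<lless> x}"] open_strictly_below(2)[of x] by blast
  have "u x \<le> u w" using u strictly_below_imp_le[OF w(2)] by (rule antimonoD)
  then have "u x $ i \<le> u w $ i" by (simp add: less_eq_vec_def)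
  then show False using w e(2) by auto
qed

section \<open>Measurability of superpositions\<close>

lemma caratheodory_measurable:
  fixes h :: "real \<Rightarrow> 'b::euclidean_space \<Rightarrow> 'c::euclidean_space"
  assumes meas: "\<And>u. (\<lambda>t. h t u) \<in> borel_measurable lebesgue" and cont: "\<And>t. continuous_on UNIV (h t)"
    and v: "v \<in> borel_measurable lebesgue"
  shows "(\<lambda>t. h t (v t)) \<in> borel_measurable lebesgue"
proof -
  have "\<exists>F. (\<forall>k. simple_function lebesgue (F k)) \<and> (\<forall>t. (\<lambda>k. F k t) \<longlonglongrightarrow> v t)"
    using borel_measurable_implies_sequence_metric[OF v, of 0]
    by (elim ex_forward) (simp del: all_simps)
  then obtain F where F': "(\<forall>k. simple_function lebesgue (F k)) \<and> (\<forall>t. (\<lambda>k. F k t) \<longlonglongrightarrow> v t)"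
    by (rule exE)
  have F: "simple_function lebesgue (F k)" "(\<lambda>k. F k t) \<longlonglongrightarrow> v t" for k t
    using F' by simp_all
  show ?thesis
  proof (rule borel_measurable_LIMSEQ_metric)
    fix k
    show "(\<lambda>t. h t (F k t)) \<in> borel_measurable lebesgue"
    proof (rule measurable_compose_countable'[where I = "range (F k)"])
      show "countable (range (F k))" using simple_functionD(1)[OF F(1)[of k]] by (simp add: countable_finite)
      then show "F k \<in> lebesgue \<rightarrow>\<^sub>M count_space (range (F k))"
        using simple_functionD(2)[OF F(1)[of k]] by (subst measurable_count_space_eq_countable) auto
    qed (rule meas)
  next
    fix t
    have "isCont (h t) (v t)" using cont[of t] by (simp add: continuous_on_eq_continuous_at)
    then show "(\<lambda>k. h t (F k t)) \<longlonglongrightarrow> h t (v t)" by (rule isCont_tendsto_compose) (rule F(2))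
  qed
qed

section \<open>The depth of a point below the origin\<close>

text \<open>The size of the negative part, cut off at \<open>1\<close>. Unlike the norm it is decreasing, so it can bound
  decreasing maps of linear growth from above and be compared along trajectories.\<close>

definition depth :: "real ^ 'n \<Rightarrow> real" where
  "depth x = Max (insert 1 (range (\<lambda>i. - x $ i)))"

lemma depth_ge1: "1 \<le> depth x" and depth_ge: "- x $ i \<le> depth x"
  unfolding depth_def by (rule Max_ge; simp)+

lemma depth_le: "1 \<le> p \<Longrightarrow> (\<And>i. - x $ i \<le> p) \<Longrightarrow> depth x \<le> p"
  by (auto simp: depth_def)

lemma depth_le_norm: "depth x \<le> 1 + norm x"
proof (rule depth_le)
  show "- x $ i \<le> 1 + norm x" for i using component_le_norm_cart[of x i] by linarith
qed simp

lemma depth_antimono: "x \<le> y \<Longrightarrow> depth y \<le> depth x"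
proof (rule depth_le[OF depth_ge1])
  fix i assume "x \<le> y"
  then have "- y $ i \<le> - x $ i" by (simp add: less_eq_vec_def)
  also have "... \<le> depth x" by (rule depth_ge)
  finally show "- y $ i \<le> depth x" .
qed

lemma depth_continuous: "continuous_on UNIV depth"
proof (rule continuous_onI)
  fix x :: "real ^ 'n" and e :: real assume "e > 0"
  have *: "depth y \<le> depth x + dist y x" for x y :: "real ^ 'n"
  proof (rule depth_le)
    show "1 \<le> depth x + dist y x" using depth_ge1[of x] zero_le_dist[of y x] by linarith
    show "- y $ i \<le> depth x + dist y x" for i
      using depth_ge[of x i] component_le_norm_cart[of "y - x" i] by (simp add: dist_norm abs_le_iff)
  qed
  show "\<exists>d>0. \<forall>x'\<in>UNIV. dist x' x < d \<longrightarrow> dist (depth x') (depth x) \<le> e"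
  proof (intro exI[of _ e] conjI ballI impI `e > 0`)
    fix x' assume "dist x' x < e"
    then show "dist (depth x') (depth x) \<le> e"
      using *[of x' x] *[of x x'] by (simp add: dist_real_def abs_le_iff dist_commute)
  qed
qed

lemma antimono_upper_depth:
  fixes u :: "real ^ 'n \<Rightarrow> real ^ 'k"
  assumes u: "antimono u" and bound: "\<And>x i. \<bar>u x $ i\<bar> \<le> M * (1 + norm x)" and M: "0 \<le> M"
  shows "u x $ i \<le> M * (1 + real CARD('n)) * depth x"
proof -
  define y where "y = (\<chi> i. min (x $ i) 0)"
  have "y \<le> x" by (simp add: y_def less_eq_vec_def)
  then have "u x \<le> u y" using u by (rule antimonoD[rotated])
  then have "u x $ i \<le> u y $ i" by (simp add: less_eq_vec_def)
  also have "... \<le> M * (1 + norm y)" using bound[of y i] by linarith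
  also have "norm y \<le> real CARD('n) * depth x"
    by (rule norm_le_card_times) (use depth_ge[of x] depth_ge1[of x] in "auto simp: y_def min_def intro: order_trans")
  then have "M * (1 + norm y) \<le> M * (depth x + real CARD('n) * depth x)"
    using M depth_ge1[of x] by (intro mult_left_mono) auto
  finally show ?thesis by (simp add: algebra_simps)
qed

lemma antimono_lower_depth:
  fixes u :: "real ^ 'n \<Rightarrow> real ^ 'k"
  assumes u: "antimono u" and bound: "\<And>x i. \<bar>u x $ i\<bar> \<le> M * (1 + norm x)" and M: "0 \<le> M"
  shows "- (M * (1 + real CARD('n)) * depth (- x)) \<le> u x $ i"
proof -
  have "antimono (\<lambda>x. - u (- x))"
  proof (rule antimonoI)
    fix x y :: "real ^ 'n" assume "x \<le> y"
    then have "u (- x) \<le> u (- y)" by (intro antimonoD[OF u]) (simp add: vec_minus_le_minus)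
    then show "- u (- y) \<le> - u (- x)" by (simp add: vec_minus_le_minus)
  qed
  from antimono_upper_depth[OF this _ M, of "- x" i] bound[of "- _"] show ?thesis by simp
qed

lemma component_le_1_norm: "\<bar>x $ i\<bar> \<le> 1 + norm (x :: real ^ 'n)"
  using component_le_norm_cart[of x i] by linarith

section \<open>The value of the linear problem along the flow\<close>

text \<open>The hypotheses of the problem in normalised form: they hold at all times, and the terminal value
  lies between barriers.\<close>

locale coupled_system =
  fixes f :: "real \<Rightarrow> real ^ 'd \<Rightarrow> real ^ 'm \<Rightarrow> real ^ 'd" and g :: "real \<Rightarrow> real ^ 'd \<Rightarrow> real ^ 'm \<Rightarrow> real ^ 'm"
    and C K :: "real \<Rightarrow> real" and T L A :: real and uT :: "real ^ 'd \<Rightarrow> real ^ 'm"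
  assumes T: "0 < T"
    and f_mono: "\<And>t x y u. x \<le> y \<Longrightarrow> f t x u + C t *\<^sub>R x \<le> f t y u + C t *\<^sub>R y"
    and f_antimono: "\<And>t x u v. u \<le> v \<Longrightarrow> f t x v \<le> f t x u"
    and g_mono: "\<And>t x u v. u \<le> v \<Longrightarrow> g t x u + C t *\<^sub>R u \<le> g t x v + C t *\<^sub>R v"
    and g_antimono: "\<And>t x y u. x \<le> y \<Longrightarrow> g t y u \<le> g t x u"
    and f_bound: "\<And>t x u. norm (f t x u) \<le> K t * (1 + norm x)"
    and g_bound: "\<And>t x u. norm (g t x u) \<le> K t * (1 + norm u)"
    and f_cont: "\<And>t x. continuous_on UNIV (f t x)"
    and g_cont: "\<And>t x. continuous_on UNIV (g t x)"
    and f_meas: "AE q in lebesgue. \<forall>u. (\<lambda>t. f t q u) \<in> borel_measurable lebesgue"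
    and g_meas: "AE q in lebesgue. \<forall>u. (\<lambda>t. g t q u) \<in> borel_measurable lebesgue"
    and K_nonneg: "\<And>t. 0 \<le> K t" and K_int: "\<And>t. K integrable_on {0..t}"
    and C_nonneg: "\<And>t. 0 \<le> C t" and C_int: "\<And>t. C integrable_on {0..t}"
    and C_meas: "C \<in> borel_measurable lebesgue"
    and L: "1 + real CARD('d) + real CARD('m) \<le> L"
    and uT_antimono: "antimono uT" and A: "1 \<le> A"
    and uT_upper: "\<And>x i. uT x $ i \<le> A * depth x" and uT_lower: "\<And>x i. - (A * depth (- x)) \<le> uT x $ i"
begin

definition vel :: "(real \<Rightarrow> real ^ 'd \<Rightarrow> real ^ 'm) \<Rightarrow> real \<Rightarrow> real ^ 'd \<Rightarrow> real ^ 'd" where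
  "vel u t x = f t x (u t x)"

definition src :: "(real \<Rightarrow> real ^ 'd \<Rightarrow> real ^ 'm) \<Rightarrow> real \<Rightarrow> real ^ 'd \<Rightarrow> real ^ 'm" where
  "src u t x = g t x (u t x) + C t *\<^sub>R u t x"

definition admissible :: "(real \<Rightarrow> real ^ 'd \<Rightarrow> real ^ 'm) \<Rightarrow> bool" where
  "admissible u \<longleftrightarrow> (\<forall>t. antimono (u t)) \<and> (AE q in lebesgue. (\<lambda>t. u t q) \<in> borel_measurable lebesgue) \<and>
     (\<exists>M\<ge>0. \<forall>t\<in>{0..T}. \<forall>x i. \<bar>u t x $ i\<bar> \<le> M * (1 + norm x))"

abbreviation "Phi u \<equiv> one_sided_field.flow (vel u) C K L"

definition w :: "real \<Rightarrow> real \<Rightarrow> real" where "w t s = exp (- integral {t..s} C)"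

definition G :: "real \<Rightarrow> real" where "G t = C t + L * K t"

text \<open>The left-continuous regularisation of the source is measurable along every continuous path, and along
  almost every trajectory it agrees with the source almost always.\<close>

definition val :: "(real \<Rightarrow> real ^ 'd \<Rightarrow> real ^ 'm) \<Rightarrow> real \<Rightarrow> real ^ 'd \<Rightarrow> real ^ 'm" where
  "val u t x = w t T *\<^sub>R uT (Phi u T t x)
     + integral {t..T} (\<lambda>s. w t s *\<^sub>R left_inf (src u s) (Phi u s t x))"

lemma L_d: "1 + real CARD('d) \<le> L" and L_m: "1 + real CARD('m) \<le> L" and L_1: "1 \<le> L"
  using L by linarith+

lemma C_sub: "0 \<le> s \<Longrightarrow> C integrable_on {s..t}"
  using C_int[of t] by (meson atLeastatMost_subset_iff integrable_on_subinterval order_refl)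

lemma K_sub: "0 \<le> s \<Longrightarrow> K integrable_on {s..t}"
  using K_int[of t] by (meson atLeastatMost_subset_iff integrable_on_subinterval order_refl)

lemma G_nonneg: "0 \<le> G t"
  using C_nonneg K_nonneg L_1 by (simp add: G_def)

lemma G_sub: "0 \<le> s \<Longrightarrow> G integrable_on {s..t}"
  unfolding G_def by (intro integrable_add C_sub integrable_on_mult_right K_sub)

lemma w_pos: "0 < w t s" and w_le1: "w t s \<le> 1"
proof -
  have "0 \<le> integral {t..s} C"
    using C_nonneg by (cases "C integrable_on {t..s}") (auto intro: integral_nonneg simp: not_integrable_integral)
  then show "w t s \<le> 1" by (simp add: w_def)
qed (simp add: w_def)

lemma w_continuous: "0 \<le> t \<Longrightarrow> continuous_on {t..T} (w t)"
  unfolding w_def by (intro continuous_intros indefinite_integral_continuous_1 C_sub)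

lemma w_split: "0 \<le> r \<Longrightarrow> r \<le> t \<Longrightarrow> t \<le> s \<Longrightarrow> w r s = w r t * w t s"
  unfolding w_def using Henstock_Kurzweil_Integration.integral_combine[OF _ _ C_sub, of r t s]
  by (simp flip: exp_add)

lemma vel_mono:
  assumes "antimono (u t)" shows "mono (\<lambda>x. vel u t x + C t *\<^sub>R x)"
proof (rule monoI)
  fix x y :: "real ^ 'd" assume xy: "x \<le> y"
  have "vel u t x + C t *\<^sub>R x \<le> f t y (u t x) + C t *\<^sub>R y" unfolding vel_def by (rule f_mono[OF xy])
  also have "... \<le> vel u t y + C t *\<^sub>R y"
    unfolding vel_def by (intro add_right_mono f_antimono antimonoD[OF assms xy])
  finally show "vel u t x + C t *\<^sub>R x \<le> vel u t y + C t *\<^sub>R y" .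
qed

lemma src_antimono:
  assumes "antimono (u t)" shows "antimono (src u t)"
proof (rule antimonoI)
  fix x y :: "real ^ 'd" assume xy: "x \<le> y"
  have "src u t y \<le> g t y (u t x) + C t *\<^sub>R u t x" unfolding src_def by (rule g_mono[OF antimonoD[OF assms xy]])
  also have "... \<le> src u t x" unfolding src_def by (intro add_right_mono g_antimono xy)
  finally show "src u t y \<le> src u t x" .
qed

lemma src_mono: "u t x \<le> v t x \<Longrightarrow> src u t x \<le> src v t x"
  unfolding src_def by (rule g_mono)

lemma vel_antimono: "u t x \<le> v t x \<Longrightarrow> vel v t x \<le> vel u t x"
  unfolding vel_def by (rule f_antimono)

lemma vel_growth: "norm (vel u t x) \<le> K t * (1 + norm x)"
  unfolding vel_def by (rule f_bound)

lemma vel_src_measurable: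
  assumes "AE q in lebesgue. (\<lambda>t. u t q) \<in> borel_measurable lebesgue"
  shows "AE q in lebesgue. (\<lambda>t. vel u t q) \<in> borel_measurable lebesgue"
    and "AE q in lebesgue. (\<lambda>t. src u t q) \<in> borel_measurable lebesgue"
proof -
  show "AE q in lebesgue. (\<lambda>t. vel u t q) \<in> borel_measurable lebesgue"
    using f_meas assms
  proof eventually_elim
    case (elim q)
    show ?case unfolding vel_def
      by (rule caratheodory_measurable[where h = "\<lambda>t. f t q" and v = "\<lambda>t. u t q"]) (use elim f_cont in blast)+
  qed
  show "AE q in lebesgue. (\<lambda>t. src u t q) \<in> borel_measurable lebesgue"
    using g_meas assms
  proof eventually_elim
    case (elim q)
    have "(\<lambda>t. g t q (u t q)) \<in> borel_measurable lebesgue"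
      by (rule caratheodory_measurable[where h = "\<lambda>t. g t q" and v = "\<lambda>t. u t q"]) (use elim g_cont in blast)+
    then show ?case unfolding src_def
      by (intro borel_measurable_add borel_measurable_scaleR C_meas elim(2))
  qed
qed

lemma admissible_antimono: "admissible u \<Longrightarrow> antimono (u t)"
  by (simp add: admissible_def)

lemma field: assumes u: "admissible u" shows "one_sided_field (vel u) C K L"
proof
  show "mono (\<lambda>x. vel u t x + C t *\<^sub>R x)" for t by (rule vel_mono[OF admissible_antimono[OF u]])
  show "AE q in lebesgue. (\<lambda>t. vel u t q) \<in> borel_measurable lebesgue"
    by (rule vel_src_measurable) (use u in "simp add: admissible_def")
qed (rule vel_growth K_nonneg K_int C_nonneg C_int C_meas L_d)+

lemma Phi_strict:
  assumes "admissible u" "0 \<le> t" "x \<lless> y" "s \<in> {t..T}" shows "Phi u s t x \<lless> Phi u s t y"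
  by (rule one_sided_field.flow_strict[OF field]) (use assms in auto)

lemma Phi_trajectory: "admissible u \<Longrightarrow> 0 \<le> t \<Longrightarrow> trajectory C (vel u) t T (\<lambda>s. Phi u s t x)"
  by (rule one_sided_field.flow_trajectory[OF field])

lemma Phi_start: "admissible u \<Longrightarrow> 0 \<le> t \<Longrightarrow> Phi u t t x = x"
  by (rule one_sided_field.flow_start[OF field])

lemma src_below: "antimono (u t) \<Longrightarrow> antimono_below (src u t)"
  by (intro antimono_imp_antimono_below src_antimono)

subsection \<open>Bounds along trajectories\<close>

context
  fixes u t y
  assumes u: "\<And>t. antimono (u t)" and t: "0 \<le> t" and y: "trajectory C (vel u) t T y"
begin

lemma path_bound:
  assumes "s \<in> {t..T}" shows "\<bar>y s $ i\<bar> \<le> (1 + norm (y t)) * exp (L * integral {t..s} K)"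
  by (rule trajectory_bound[OF y vel_mono[OF u] vel_growth C_sub[OF t] C_nonneg K_sub[OF t] K_nonneg L_d _ _ assms])
    (auto intro: component_le_1_norm)

lemma path_increment:
  assumes "t \<le> r" "r \<le> s" "s \<le> T"
  shows "\<bar>y s $ i - y r $ i\<bar> \<le> (1 + norm (y t)) * exp (L * integral {t..s} K) - (1 + norm (y t)) * exp (L * integral {t..r} K)"
  by (rule trajectory_increment[OF y vel_mono[OF u] vel_growth C_sub[OF t] C_nonneg K_sub[OF t] K_nonneg L_d _ _ assms])
    (auto intro: component_le_1_norm)

lemma depth_along:
  assumes s: "s \<in> {t..T}"
  shows "depth (y s) \<le> depth (y t) * exp (L * integral {t..s} K)"
    and "depth (- y s) \<le> depth (- y t) * exp (L * integral {t..s} K)"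
proof -
  have e1: "1 \<le> exp (L * integral {t..s} K)"
    using L_1 integral_nonneg[OF K_sub[OF t] K_nonneg, of s] by simp
  have ge1: "1 \<le> depth z * exp (L * integral {t..s} K)" for z :: "real ^ 'd"
    using mult_mono[OF depth_ge1 e1, of z] depth_ge1[of z] by simp
  have "- (depth (y t) * exp (L * integral {t..s} K)) *\<^sub>R 1 \<le> y s"
    by (rule lower_barrier[OF trajectory_imp_super[OF y] vel_mono[OF u] vel_growth C_sub[OF t] C_nonneg K_sub[OF t] K_nonneg L_d depth_ge1 _ s])
      (use depth_ge[of "y t"] in "auto simp: less_eq_vec_def minus_le_iff")
  then show "depth (y s) \<le> depth (y t) * exp (L * integral {t..s} K)"
    by (intro depth_le ge1) (auto simp: less_eq_vec_def minus_le_iff)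
  have "y s \<le> (depth (- y t) * exp (L * integral {t..s} K)) *\<^sub>R 1"
    by (rule upper_barrier[OF trajectory_imp_sub[OF y] vel_mono[OF u] vel_growth C_sub[OF t] C_nonneg K_sub[OF t] K_nonneg L_d depth_ge1 _ s])
      (use depth_ge[of "- y t"] in "auto simp: less_eq_vec_def")
  then show "depth (- y s) \<le> depth (- y t) * exp (L * integral {t..s} K)"
    by (intro depth_le ge1) (auto simp: less_eq_vec_def)
qed

end

lemma src_bound:
  assumes M: "0 \<le> M" "\<And>x i. \<bar>u t x $ i\<bar> \<le> M * (1 + norm x)"
  shows "\<bar>src u t x $ i\<bar> \<le> G t * ((1 + real CARD('m) * M + M) * (1 + norm x))"
proof -
  have n: "norm (u t x) \<le> real CARD('m) * (M * (1 + norm x))" by (rule norm_le_card_times) (rule M(2))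
  have "\<bar>src u t x $ i\<bar> \<le> \<bar>g t x (u t x) $ i\<bar> + C t * \<bar>u t x $ i\<bar>"
    using C_nonneg[of t] by (simp add: src_def abs_mult order_trans[OF abs_triangle_ineq])
  also have "\<bar>g t x (u t x) $ i\<bar> \<le> K t * (1 + norm (u t x))" using component_le_norm_cart g_bound order_trans by blast
  also have "K t * (1 + norm (u t x)) \<le> K t * (1 + real CARD('m) * (M * (1 + norm x)))"
    using n K_nonneg[of t] by (intro mult_left_mono) auto
  also have "K t * (1 + real CARD('m) * (M * (1 + norm x))) \<le> (L * K t) * ((1 + real CARD('m) * M + M) * (1 + norm x))"
  proof (rule mult_mono)
    show "K t \<le> L * K t" using L_1 K_nonneg[of t] mult_right_mono[of 1 L "K t"] by simp
    show "1 + real CARD('m) * (M * (1 + norm x)) \<le> (1 + real CARD('m) * M + M) * (1 + norm x)"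
      using M(1) by (simp add: algebra_simps)
  qed (use M(1) L_1 K_nonneg[of t] in auto)
  also have "C t * \<bar>u t x $ i\<bar> \<le> C t * ((1 + real CARD('m) * M + M) * (1 + norm x))"
  proof (rule mult_left_mono[OF _ C_nonneg])
    have "\<bar>u t x $ i\<bar> \<le> M * (1 + norm x)" by (rule M(2))
    also have "... \<le> (1 + real CARD('m) * M + M) * (1 + norm x)" using M(1) by (intro mult_right_mono) auto
    finally show "\<bar>u t x $ i\<bar> \<le> (1 + real CARD('m) * M + M) * (1 + norm x)" .
  qed
  finally show ?thesis by (simp add: G_def algebra_simps)
qed

lemma left_src_bound:
  assumes u: "antimono (u t)" and M: "0 \<le> M" "\<And>x i. \<bar>u t x $ i\<bar> \<le> M * (1 + norm x)"
  shows "\<bar>left_inf (src u t) x $ i\<bar> \<le> G t * ((1 + real CARD('m) * M + M) * (1 + norm x))"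
proof -
  have b: "\<bar>src u t z $ i\<bar> \<le> G t * ((1 + real CARD('m) * M + M) * (1 + norm z))" for z
    by (rule src_bound[where u = u and t = t, OF M])
  have below: "antimono_below (src u t)" by (rule src_below[of u t, OF u])
  have "left_inf (src u t) x $ i \<le> G t * ((1 + real CARD('m) * M + M) * (1 + norm x))"
    by (rule left_inf_le_continuous[OF below, of "\<lambda>z. G t * ((1 + real CARD('m) * M + M) * (1 + norm z))"])
      (use b in "auto simp: abs_le_iff intro!: continuous_intros")
  moreover have "- (G t * ((1 + real CARD('m) * M + M) * (1 + norm x))) \<le> left_inf (src u t) x $ i"
    by (rule left_inf_ge_pointwise[OF below]) (use b[of x] in linarith)
  ultimately show ?thesis by linarith
qed

definition span :: real where "span = 1 + real CARD('d) * exp (L * integral {0..T} K)"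

lemma path_norm:
  assumes "\<And>t. antimono (u t)" "0 \<le> t" "trajectory C (vel u) t T y" "s \<in> {t..T}"
  shows "1 + norm (y s) \<le> span * (1 + norm (y t))"
proof -
  have "integral {t..s} K \<le> integral {0..T} K"
    by (rule integral_subset_le) (use assms(2,4) K_sub K_nonneg in auto)
  then have e: "exp (L * integral {t..s} K) \<le> exp (L * integral {0..T} K)" using L_1 by simp
  have "\<bar>y s $ i\<bar> \<le> (1 + norm (y t)) * exp (L * integral {0..T} K)" for i
    using path_bound[OF assms, of i] mult_left_mono[OF e, of "1 + norm (y t)"] by simp
  then have "norm (y s) \<le> real CARD('d) * ((1 + norm (y t)) * exp (L * integral {0..T} K))" by (rule norm_le_card_times)
  then show ?thesis by (simp add: span_def algebra_simps add_increasing)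
qed

lemma left_src_path_measurable:
  assumes u: "admissible u" and y: "continuous_on {t..T} y" and t: "0 \<le> t" "t \<le> T"
  shows "(\<lambda>s. w t s *\<^sub>R left_inf (src u s) (y s)) \<in> borel_measurable (lebesgue_on {t..T})"
proof -
  define y' where "y' = (\<lambda>r. y (max t (min T r)))"
  have "continuous_on UNIV y'" unfolding y'_def
  proof (rule continuous_on_compose2[of "{t..T}" y UNIV "\<lambda>r. max t (min T r)"])
    show "continuous_on {t..T} y" by (rule y)
  qed (use t in "auto intro!: continuous_intros")
  then have "y' \<in> borel_measurable lebesgue"
    by (simp add: borel_measurable_continuous_onI measurable_completion)
  then have "(\<lambda>s. left_inf (src u s) (y' s)) \<in> borel_measurable lebesgue"
    using u by (intro left_inf_measurable src_below vel_src_measurable) (auto simp: admissible_def)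
  then have "(\<lambda>s. left_inf (src u s) (y' s)) \<in> borel_measurable (lebesgue_on {t..T})" by (rule measurable_restrict_space1)
  moreover have "w t \<in> borel_measurable (lebesgue_on {t..T})"
    by (rule continuous_imp_measurable_on_sets_lebesgue[OF w_continuous]) (use t in auto)
  ultimately have "(\<lambda>s. w t s *\<^sub>R left_inf (src u s) (y' s)) \<in> borel_measurable (lebesgue_on {t..T})"
    by (intro borel_measurable_scaleR)
  then show "(\<lambda>s. w t s *\<^sub>R left_inf (src u s) (y s)) \<in> borel_measurable (lebesgue_on {t..T})"
    by (rule measurable_cong[THEN iffD1, rotated]) (auto simp: y'_def)
qed

end

lemma integral_zero_AE:
  fixes h :: "real \<Rightarrow> real"
  assumes "h integrable_on S" "S \<in> sets lebesgue" "\<And>x. x \<in> S \<Longrightarrow> 0 \<le> h x" "integral S h = 0"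
  shows "AE x in lebesgue. x \<in> S \<longrightarrow> h x = 0"
proof -
  have abs: "set_integrable lebesgue S h" using nonnegative_absolutely_integrable_1[OF assms(1,3)] by simp
  then have "(LINT x:S|lebesgue. h x) = 0" using assms(4) by (simp add: set_lebesgue_integral_eq_integral(2))
  then have "AE x in lebesgue. indicator S x *\<^sub>R h x = 0"
    using abs assms(3) unfolding set_integrable_def set_lebesgue_integral_def
    by (subst (asm) integral_nonneg_eq_0_iff_AE) (auto simp: indicator_def)
  then show ?thesis by eventually_elim (auto simp: indicator_def)
qed

lemma integral_mono_AE:
  fixes h k :: "real \<Rightarrow> real"
  assumes "h integrable_on S" "k integrable_on S" "AE x in lebesgue. x \<in> S \<longrightarrow> h x \<le> k x"
  shows "integral S h \<le> integral S k"
proof -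
  define N where "N = {x. \<not> (x \<in> S \<longrightarrow> h x \<le> k x)}"
  have N: "negligible N" using assms(3) by (simp add: N_def AE_lebesgue_iff_negligible)
  define h' where "h' = (\<lambda>x. if x \<in> N then k x else h x)"
  have "h' integrable_on S" by (rule integrable_spike[OF assms(1) N]) (auto simp: h'_def)
  moreover have "integral S h' = integral S h" by (rule integral_spike[OF N]) (auto simp: h'_def)
  moreover have "integral S h' \<le> integral S k"
    by (rule integral_le[OF calculation(1) assms(2)]) (auto simp: h'_def N_def)
  ultimately show ?thesis by simp
qed

context coupled_system
begin

definition bounded_by :: "real \<Rightarrow> (real \<Rightarrow> real ^ 'd \<Rightarrow> real ^ 'm) \<Rightarrow> bool" where
  "bounded_by M u \<longleftrightarrow> 0 \<le> M \<and> (\<forall>t\<in>{0..T}. \<forall>x i. \<bar>u t x $ i\<bar> \<le> M * (1 + norm x))"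

lemma admissible_bounded: "admissible u \<Longrightarrow> \<exists>M. bounded_by M u"
  by (auto simp: admissible_def bounded_by_def)

definition lc :: "real \<Rightarrow> real" where
  "lc M = (1 + real CARD('m) * M + M) * span"

lemma span_ge1: "1 \<le> span" by (simp add: span_def)

lemma lc_nonneg: "0 \<le> M \<Longrightarrow> 0 \<le> lc M"
  using span_ge1 by (simp add: lc_def)

lemma path_left_src_bound:
  assumes u: "admissible u" and M: "bounded_by M u" and t: "0 \<le> t" and s: "s \<in> {t..T}"
    and y: "trajectory C (vel u) t T y"
  shows "\<bar>left_inf (src u s) (y s) $ i\<bar> \<le> G s * (lc M * (1 + norm (y t)))"
proof -
  have "\<bar>left_inf (src u s) (y s) $ i\<bar> \<le> G s * ((1 + real CARD('m) * M + M) * (1 + norm (y s)))"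
    by (rule left_src_bound[where u = u and t = s]) (use admissible_antimono[OF u] M s t in "auto simp: bounded_by_def")
  also have "... \<le> G s * ((1 + real CARD('m) * M + M) * (span * (1 + norm (y t))))"
    by (intro mult_left_mono path_norm[OF admissible_antimono[OF u] t y s] G_nonneg)
      (use M in "auto simp: bounded_by_def")
  finally show ?thesis by (simp add: lc_def mult_ac)
qed

lemma path_integrable:
  assumes u: "admissible u" and t: "0 \<le> t" "t \<le> T" and y: "trajectory C (vel u) t T y" and ab: "t \<le> a" "b \<le> T"
  shows "(\<lambda>s. w t s *\<^sub>R left_inf (src u s) (y s)) absolutely_integrable_on {a..b}"
proof -
  obtain M where M: "bounded_by M u" using admissible_bounded[OF u] by blast
  have c: "continuous_on {t..T} y" using y by (simp add: trajectory_def AC_imp_continuous_on)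
  have "(\<lambda>s. w t s *\<^sub>R left_inf (src u s) (y s)) absolutely_integrable_on {t..T}"
  proof (rule measurable_bounded_by_integrable_imp_absolutely_integrable[OF left_src_path_measurable[OF u c t]])
    show "(\<lambda>s. real CARD('m) * (G s * (lc M * (1 + norm (y t))))) integrable_on {t..T}"
      by (intro integrable_on_mult_right integrable_on_mult_left G_sub t)
    show "norm (w t s *\<^sub>R left_inf (src u s) (y s)) \<le> real CARD('m) * (G s * (lc M * (1 + norm (y t))))"
      if s: "s \<in> {t..T}" for s
    proof (rule norm_le_card_times)
      fix i
      have "w t s * \<bar>left_inf (src u s) (y s) $ i\<bar> \<le> 1 * \<bar>left_inf (src u s) (y s) $ i\<bar>"
        by (rule mult_right_mono[OF w_le1]) simp
      also have "... \<le> G s * (lc M * (1 + norm (y t)))" using path_left_src_bound[OF u M t(1) s y, of i] by simp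
      finally show "\<bar>(w t s *\<^sub>R left_inf (src u s) (y s)) $ i\<bar> \<le> G s * (lc M * (1 + norm (y t)))"
        using w_pos[of t s] by (simp add: abs_mult)
    qed
  qed auto
  then show ?thesis by (rule absolutely_integrable_on_subinterval) (use ab in auto)
qed

lemmas path_integrable_HK = path_integrable[THEN set_lebesgue_integral_eq_integral(1)]

lemma Phi_compare:
  assumes u: "admissible u" and v: "admissible v" and le: "\<And>s z. s \<in> {0..T} \<Longrightarrow> u s z \<le> v s z"
    and t: "0 \<le> t" and x: "x' \<lless> x" and s: "s \<in> {t..T}"
  shows "Phi v s t x' \<lless> Phi u s t x"
proof (rule strict_trajectory_comparison[OF trajectory_imp_sub[OF Phi_trajectory[OF v t]] trajectory_imp_super[OF Phi_trajectory[OF u t]] _ C_sub[OF t] C_nonneg _ s])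
  show "AE r in lebesgue. t < r \<and> r < T \<longrightarrow> (\<forall>z. vel v r z \<le> vel u r z)"
    using le t by (intro AE_I2) (auto intro!: vel_antimono)
qed (simp add: Phi_start u v t x)

lemma left_src_compare:
  assumes u: "antimono (u s)" and v: "antimono (v s)" and le: "\<And>z. u s z \<le> v s z" and z: "z' \<le> z"
  shows "left_inf (src u s) z \<le> left_inf (src v s) z'"
proof (rule left_inf_greatest)
  fix z0 assume "z0 \<lless> z'"
  then have "z0 \<lless> z" using z by (rule strictly_below_le_trans)
  then have "left_inf (src u s) z \<le> src u s z0" by (rule left_inf_lower[OF src_below[of u s, OF u]])
  also have "... \<le> src v s z0" by (rule src_mono[of u s z0 v, OF le])
  finally show "left_inf (src u s) z \<le> src v s z0" .
qed

text \<open>A larger \<open>v\<close> lowers the trajectories and thereby raises the decreasing terminal value and source; the source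
  moreover increases in \<open>v\<close>.\<close>

lemma val_compare:
  assumes u: "admissible u" and v: "admissible v" and le: "\<And>s z. s \<in> {0..T} \<Longrightarrow> u s z \<le> v s z"
    and t: "t \<in> {0..T}" and x: "x' \<lless> x"
  shows "val u t x \<le> val v t x'"
  unfolding val_def
proof (rule add_mono)
  have t0: "0 \<le> t" "t \<le> T" using t by auto
  have cmp: "Phi v s t x' \<lless> Phi u s t x" if "s \<in> {t..T}" for s by (rule Phi_compare[OF u v le t0(1) x that])
  have "uT (Phi u T t x) \<le> uT (Phi v T t x')"
    using cmp[of T] t0 by (intro antimonoD[OF uT_antimono] strictly_below_imp_le) auto
  then show "w t T *\<^sub>R uT (Phi u T t x) \<le> w t T *\<^sub>R uT (Phi v T t x')"
    using w_pos[of t T] by (simp add: less_eq_vec_def)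
  show "integral {t..T} (\<lambda>s. w t s *\<^sub>R left_inf (src u s) (Phi u s t x)) \<le> integral {t..T} (\<lambda>s. w t s *\<^sub>R left_inf (src v s) (Phi v s t x'))"
  proof (rule integral_vec_mono)
    show "w t s *\<^sub>R left_inf (src u s) (Phi u s t x) \<le> w t s *\<^sub>R left_inf (src v s) (Phi v s t x')" if s: "s \<in> {t..T}" for s
    proof -
      have "left_inf (src u s) (Phi u s t x) \<le> left_inf (src v s) (Phi v s t x')"
        using s t0 by (intro left_src_compare admissible_antimono u v le strictly_below_imp_le cmp) auto
      then show ?thesis using w_pos[of t s] by (simp add: less_eq_vec_def)
    qed
  qed (use path_integrable_HK[OF u t0 Phi_trajectory[OF u t0(1)] order_refl order_refl]
      path_integrable_HK[OF v t0 Phi_trajectory[OF v t0(1)] order_refl order_refl] in auto)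
qed

lemma val_below: "admissible u \<Longrightarrow> t \<in> {0..T} \<Longrightarrow> antimono_below (val u t)"
  unfolding antimono_below_def by (auto intro: val_compare)

text \<open>Along almost every trajectory the source agrees at almost every time with its left-continuous
  regularisation: the source at a point is squeezed between the regularisations at that point and
  at any strictly larger point, and the integrals of these depend continuously on almost every
  starting point.\<close>

lemma AE_src_eq_left:
  assumes u: "admissible u" and t: "t \<in> {0..T}"
  shows "AE x in lebesgue. AE s in lebesgue. s \<in> {t..T} \<longrightarrow> src u s (Phi u s t x) = left_inf (src u s) (Phi u s t x)"
proof -
  have t0: "0 \<le> t" "t \<le> T" using t by auto
  define h where "h = (\<lambda>x s. w t s *\<^sub>R left_inf (src u s) (Phi u s t x))"
  have hint: "h x integrable_on {t..T}" for x
    unfolding h_def by (rule path_integrable_HK[OF u t0 Phi_trajectory[OF u t0(1)] order_refl order_refl])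
  have hle: "h y s \<le> w t s *\<^sub>R src u s (Phi u s t x)" if "x \<lless> y" "s \<in> {t..T}" for x y s
  proof -
    have "left_inf (src u s) (Phi u s t y) \<le> src u s (Phi u s t x)"
      by (rule left_inf_lower[OF src_below[of u s, OF admissible_antimono[OF u]] Phi_strict[OF u t0(1) that]])
    then show ?thesis using w_pos[of t s] by (simp add: h_def less_eq_vec_def)
  qed
  have hge: "w t s *\<^sub>R src u s (Phi u s t x) \<le> h x s" for x s
    using left_inf_ge[OF src_below[of u s, OF admissible_antimono[OF u]]] w_pos[of t s] by (simp add: h_def less_eq_vec_def)
  have hmono: "h y s \<le> h x s" if "x \<lless> y" "s \<in> {t..T}" for x y s
    using hle[OF that] hge[of s x] by (rule order_trans)
  have "antimono_below (\<lambda>x. integral {t..T} (h x))"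
    unfolding antimono_below_def by (intro allI impI integral_vec_mono hint hmono)
  then have "AE x in lebesgue. isCont (\<lambda>x. integral {t..T} (h x)) x" by (rule antimono_below_AE_isCont)
  then show ?thesis
  proof eventually_elim
    case (elim x)
    define xk where "xk = (\<lambda>k::nat. x + (1 / (real k + 1)) *\<^sub>R 1)"
    have "xk \<longlonglongrightarrow> x" unfolding xk_def by (rule strict_approximation)
    then have lim: "(\<lambda>k. integral {t..T} (h (xk k))) \<longlonglongrightarrow> integral {t..T} (h x)"
      by (rule isCont_tendsto_compose[OF elim])
    have xk: "x \<lless> xk k" for k unfolding xk_def by (rule strictly_below_shift) simp
    have xk_dec: "xk (Suc k) \<lless> xk k" for k
      by (auto simp: xk_def strictly_below_def field_simps)
    have "AE s in lebesgue. s \<in> {t..T} \<longrightarrow> src u s (Phi u s t x) $ i = left_inf (src u s) (Phi u s t x) $ i" for i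
    proof -
      define D where "D = (\<lambda>k s. h x s $ i - h (xk k) s $ i)"
      define \<Delta> where "\<Delta> = (\<lambda>s. INF k. D k s)"
      have comp: "(\<lambda>s. h z s $ i) integrable_on {t..T}" for z
        using integrable_nth[where i=i, OF hint] by (simp add: o_def)
      have Dint: "D k integrable_on {t..T}" for k unfolding D_def by (intro integrable_diff comp)
      have D0: "0 \<le> D k s" if "s \<in> {t..T}" for k s
        using hmono[OF xk that] by (simp add: D_def less_eq_vec_def)
      have Ddec: "D (Suc k) s \<le> D k s" if "s \<in> {t..T}" for k s
        using hmono[OF xk_dec that] by (simp add: D_def less_eq_vec_def)
      have Dlim: "(\<lambda>k. D k s) \<longlonglongrightarrow> \<Delta> s" if "s \<in> {t..T}" for s
        unfolding \<Delta>_def by (intro LIMSEQ_decseq_INF decseq_SucI Ddec that bdd_belowI2[of _ 0] D0)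
      have DD0: "D k s \<le> D 0 s" if "s \<in> {t..T}" for k s
        using decseqD[OF decseq_SucI[of "\<lambda>k. D k s"], OF Ddec[OF that], of 0 k] by simp
      have dc: "\<Delta> integrable_on {t..T}" "(\<lambda>k. integral {t..T} (D k)) \<longlonglongrightarrow> integral {t..T} \<Delta>"
        using dominated_convergence[OF Dint Dint[of 0] _ Dlim] D0 DD0 by auto
      have "integral {t..T} (D k) = integral {t..T} (h x) $ i - integral {t..T} (h (xk k)) $ i" for k
        unfolding D_def by (simp add: integral_diff comp monotone_field.integral_vec_nth[OF _ hint] integral_nth[OF hint])
      moreover have "(\<lambda>k. integral {t..T} (h x) $ i - integral {t..T} (h (xk k)) $ i) \<longlonglongrightarrow> integral {t..T} (h x) $ i - integral {t..T} (h x) $ i"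
        by (intro tendsto_intros lim)
      ultimately have "(\<lambda>k. integral {t..T} (D k)) \<longlonglongrightarrow> 0" by simp
      then have "integral {t..T} \<Delta> = 0" using dc(2) LIMSEQ_unique by blast
      moreover have "0 \<le> \<Delta> s" if "s \<in> {t..T}" for s
        unfolding \<Delta>_def by (rule cINF_greatest) (use D0 that in auto)
      ultimately have "AE s in lebesgue. s \<in> {t..T} \<longrightarrow> \<Delta> s = 0" by (intro integral_zero_AE dc(1)) auto
      then show ?thesis
      proof eventually_elim
        case (elim s)
        show ?case
        proof
          assume s: "s \<in> {t..T}"
          have "h x s $ i - w t s * src u s (Phi u s t x) $ i \<le> \<Delta> s"
            unfolding \<Delta>_def by (rule cINF_greatest) (use hle[OF xk s] in "auto simp: D_def less_eq_vec_def")
          then have "h x s $ i \<le> w t s * src u s (Phi u s t x) $ i" using elim s by simp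
          moreover have "w t s * src u s (Phi u s t x) $ i \<le> h x s $ i" using hge[of s x] by (auto simp: less_eq_vec_def)
          ultimately show "src u s (Phi u s t x) $ i = left_inf (src u s) (Phi u s t x) $ i"
            using w_pos[of t s] by (simp add: h_def)
        qed
      qed
    qed
    then have "AE s in lebesgue. \<forall>i. s \<in> {t..T} \<longrightarrow> src u s (Phi u s t x) $ i = left_inf (src u s) (Phi u s t x) $ i"
      unfolding AE_all_countable by blast
    then show ?case by eventually_elim (auto simp: vec_eq_iff)
  qed
qed

section \<open>Solutions along characteristics\<close>

text \<open>The representation formula along one trajectory, without reference to a flow.\<close>

definition represents :: "(real \<Rightarrow> real ^ 'd \<Rightarrow> real ^ 'm) \<Rightarrow> real \<Rightarrow> (real \<Rightarrow> real ^ 'd) \<Rightarrow> bool" where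
  "represents u t y \<longleftrightarrow> trajectory C (vel u) t T y \<and> (\<lambda>s. w t s *\<^sub>R src u s (y s)) absolutely_integrable_on {t..T} \<and>
     u t (y t) = w t T *\<^sub>R uT (y T) + integral {t..T} (\<lambda>s. w t s *\<^sub>R src u s (y s))"

definition char_solution :: "(real \<Rightarrow> real ^ 'd \<Rightarrow> real ^ 'm) \<Rightarrow> bool" where
  "char_solution u \<longleftrightarrow> (\<forall>t\<in>{0..T}. AE x in lebesgue. \<exists>y. represents u t y \<and> y t = x)"

text \<open>The mechanism of \<open>val_compare\<close>, with an arbitrary trajectory that represents \<open>u\<close> in place of a flow.\<close>

lemma char_solution_le:
  assumes sol: "char_solution u" and u: "\<And>s. s \<in> {0..T} \<Longrightarrow> antimono (u s)" and v: "admissible v"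
    and le: "AE s in lebesgue. s \<in> {0..T} \<longrightarrow> (\<forall>z. u s z \<le> v s z)" and t: "t \<in> {0..T}"
  shows "u t x \<le> left_inf (val v t) x"
proof (rule left_inf_greatest)
  fix x' assume x': "x' \<lless> x"
  have t0: "0 \<le> t" "t \<le> T" using t by auto
  obtain x1 where x1: "x' \<lless> x1" "x1 \<lless> x" and "\<exists>y. represents u t y \<and> y t = x1"
  proof -
    have "open ({z. x' \<lless> z} \<inter> {z. z \<lless> x})" using open_strictly_below by blast
    moreover have "{z. x' \<lless> z} \<inter> {z. z \<lless> x} \<noteq> {}" using strictly_below_dense[OF x'] by blast
    ultimately show ?thesis using AE_dense[OF sol[unfolded char_solution_def, rule_format, OF t]] that by blast
  qed
  then obtain y where y: "trajectory C (vel u) t T y" "y t = x1"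
    and int: "(\<lambda>s. w t s *\<^sub>R src u s (y s)) integrable_on {t..T}"
    and eq: "u t x1 = w t T *\<^sub>R uT (y T) + integral {t..T} (\<lambda>s. w t s *\<^sub>R src u s (y s))"
    using set_lebesgue_integral_eq_integral(1) unfolding represents_def by blast
  have cmp: "Phi v s t x' \<lless> y s" if s: "s \<in> {t..T}" for s
  proof (rule strict_trajectory_comparison[OF trajectory_imp_sub[OF Phi_trajectory[OF v t0(1)]] trajectory_imp_super[OF y(1)] _ C_sub[OF t0(1)] C_nonneg _ s])
    show "AE r in lebesgue. t < r \<and> r < T \<longrightarrow> (\<forall>z. vel v r z \<le> vel u r z)"
      using le by eventually_elim (use t0 in "auto intro!: vel_antimono")
  qed (simp add: Phi_start v t0 y x1)
  have "u t x \<le> u t x1" using u[OF t] strictly_below_imp_le[OF x1(2)] by (rule antimonoD)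
  also have "... \<le> val v t x'"
    unfolding eq val_def
  proof (rule add_mono)
    have "uT (y T) \<le> uT (Phi v T t x')"
      using cmp[of T] t0 by (intro antimonoD[OF uT_antimono] strictly_below_imp_le) auto
    then show "w t T *\<^sub>R uT (y T) \<le> w t T *\<^sub>R uT (Phi v T t x')" using w_pos[of t T] by (simp add: less_eq_vec_def)
    note int2 = path_integrable_HK[OF v t0 Phi_trajectory[OF v t0(1)] order_refl order_refl, of x']
    show "integral {t..T} (\<lambda>s. w t s *\<^sub>R src u s (y s)) \<le> integral {t..T} (\<lambda>s. w t s *\<^sub>R left_inf (src v s) (Phi v s t x'))"
      unfolding less_eq_vec_def
    proof
      fix i
      have "integral {t..T} (\<lambda>s. (w t s *\<^sub>R src u s (y s)) $ i) \<le> integral {t..T} (\<lambda>s. (w t s *\<^sub>R left_inf (src v s) (Phi v s t x')) $ i)"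
      proof (rule integral_mono_AE)
        show "(\<lambda>s. (w t s *\<^sub>R src u s (y s)) $ i) integrable_on {t..T}"
          "(\<lambda>s. (w t s *\<^sub>R left_inf (src v s) (Phi v s t x')) $ i) integrable_on {t..T}"
          using integrable_nth[where i=i, OF int] integrable_nth[where i=i, OF int2] by (auto simp: o_def)
        show "AE s in lebesgue. s \<in> {t..T} \<longrightarrow> (w t s *\<^sub>R src u s (y s)) $ i \<le> (w t s *\<^sub>R left_inf (src v s) (Phi v s t x')) $ i"
          using le
        proof eventually_elim
          case (elim s)
          show ?case
          proof
            assume s: "s \<in> {t..T}"
            have "src u s (y s) \<le> src v s (y s)" using elim s t0 by (intro src_mono) auto
            also have "... \<le> left_inf (src v s) (Phi v s t x')"
            proof (rule left_inf_greatest)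
              fix z assume "z \<lless> Phi v s t x'"
              then have "z \<le> y s" using cmp[OF s] strictly_below_trans strictly_below_imp_le by blast
              then show "src v s (y s) \<le> src v s z" by (rule antimonoD[OF src_antimono[of v s, OF admissible_antimono[OF v]]])
            qed
            finally show "(w t s *\<^sub>R src u s (y s)) $ i \<le> (w t s *\<^sub>R left_inf (src v s) (Phi v s t x')) $ i"
              using w_pos[of t s] by (simp add: less_eq_vec_def)
          qed
        qed
      qed
      then show "integral {t..T} (\<lambda>s. w t s *\<^sub>R src u s (y s)) $ i \<le> integral {t..T} (\<lambda>s. w t s *\<^sub>R left_inf (src v s) (Phi v s t x')) $ i"
        using integral_nth[where i=i, OF int] integral_nth[where i=i, OF int2] by (simp add: o_def)
    qed
  qed
  finally show "u t x \<le> val v t x'" .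
qed

text \<open>By \<open>AE_src_eq_left\<close> the regularised source in \<open>val\<close> may be replaced by the source itself along
  almost every trajectory.\<close>

lemma val_fixed_point_char_solution:
  assumes u: "admissible u" and fix_pt: "\<And>t. t \<in> {0..T} \<Longrightarrow> AE x in lebesgue. u t x = val u t x"
  shows "char_solution u"
  unfolding char_solution_def
proof
  fix t assume t: "t \<in> {0..T}"
  then have t0: "0 \<le> t" "t \<le> T" by auto
  show "AE x in lebesgue. \<exists>y. represents u t y \<and> y t = x"
    using fix_pt[OF t] AE_src_eq_left[OF u t]
  proof eventually_elim
    case (elim x)
    define N where "N = {s. \<not> (s \<in> {t..T} \<longrightarrow> src u s (Phi u s t x) = left_inf (src u s) (Phi u s t x))}"
    have N: "negligible N" using elim(2) by (simp add: N_def AE_lebesgue_iff_negligible)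
    have eq: "w t s *\<^sub>R src u s (Phi u s t x) = w t s *\<^sub>R left_inf (src u s) (Phi u s t x)" if "s \<in> {t..T} - N" for s
      using that by (auto simp: N_def)
    have "(\<lambda>s. w t s *\<^sub>R src u s (Phi u s t x)) absolutely_integrable_on {t..T}"
      by (rule absolutely_integrable_spike[OF path_integrable[OF u t0 Phi_trajectory[OF u t0(1)] order_refl order_refl] N]) (rule eq)
    moreover have "integral {t..T} (\<lambda>s. w t s *\<^sub>R src u s (Phi u s t x)) = integral {t..T} (\<lambda>s. w t s *\<^sub>R left_inf (src u s) (Phi u s t x))"
      by (rule integral_spike[OF N]) (simp only: eq)
    ultimately show ?case
      using elim(1) Phi_trajectory[OF u t0(1), of x] Phi_start[OF u t0(1), of x]
      by (intro exI[of _ "\<lambda>s. Phi u s t x"]) (simp add: represents_def val_def)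
  qed
qed

end

section \<open>Joint continuity in time and space\<close>

lemma AE_lebesgue_lborel: "(AE x in lebesgue. P x) \<longleftrightarrow> (AE x in lborel. P x)"
  by (rule AE_completion_iff)

lemma AE_lebesgue_sections:
  fixes P :: "real \<times> 'a::euclidean_space \<Rightarrow> bool"
  assumes "AE z in lebesgue. P z"
  shows "AE t in lebesgue. AE x in lebesgue. P (t, x)" and "AE x in lebesgue. AE t in lebesgue. P (t, x)"
proof -
  have "AE z in lborel \<Otimes>\<^sub>M (lborel :: 'a measure). P z"
    using assms unfolding AE_lebesgue_lborel lborel_prod .
  from lborel_pair.AE_pair[OF this]
  show "AE t in lebesgue. AE x in lebesgue. P (t, x)" by (simp add: AE_lebesgue_lborel)
  have "AE z in lborel. P z" using assms by (simp add: AE_lebesgue_lborel)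
  then obtain N where N: "N \<in> null_sets lborel" "{z. \<not> P z} \<subseteq> N" by (auto simp: eventually_ae_filter)
  have Nm: "N \<in> sets borel" using N(1) by (simp add: null_sets_def)
  have "AE z in lborel. z \<notin> N" using N(1) by (rule AE_not_in)
  then have "AE z in lborel \<Otimes>\<^sub>M (lborel :: 'a measure). z \<notin> N" unfolding lborel_prod .
  from lborel_pair.AE_pair[OF this] have "AE t in lborel. AE x in lborel. (t, x) \<notin> N" .
  moreover have "{z \<in> space (lborel \<Otimes>\<^sub>M lborel). z \<notin> N} \<in> sets (lborel \<Otimes>\<^sub>M (lborel :: 'a measure))"
    unfolding lborel_prod using Nm by (simp add: Collect_neg_eq)
  ultimately have "AE x in lborel. AE t in lborel. (t, x) \<notin> N"
    by (subst lborel_pair.AE_commute[symmetric]) (simp_all add: case_prod_unfold)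
  then have "AE x in lborel. AE t in lborel. P (t, x)"
  proof eventually_elim
    case (elim x)
    then show ?case by eventually_elim (use N(2) in blast)
  qed
  then show "AE x in lebesgue. AE t in lebesgue. P (t, x)" by (simp add: AE_lebesgue_lborel)
qed

lemma AE_isCont_of_slices:
  fixes U :: "real \<times> 'a::euclidean_space \<Rightarrow> 'b::euclidean_space"
  assumes "\<And>t. t \<in> {0<..<T} \<Longrightarrow> AE x in lebesgue. isCont U (t, x)"
  shows "AE z in lebesgue. fst z \<in> {0<..<T} \<longrightarrow> isCont U z"
proof -
  have "{z. isCont U z} \<in> sets borel" by (rule isCont_borel)
  moreover have "{z :: real \<times> 'a. fst z \<in> {0<..<T}} \<in> sets borel"
  proof -
    have "{z :: real \<times> 'a. fst z \<in> {0<..<T}} = {0<..<T} \<times> UNIV" by auto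
    moreover have "open ({0<..<T} \<times> (UNIV :: 'a set))" by (intro open_Times) auto
    ultimately show ?thesis by simp
  qed
  ultimately have "- ({z. fst z \<in> {0<..<T}} - {z. isCont U z}) \<in> sets borel" by auto
  then have m: "{z :: real \<times> 'a. fst z \<in> {0<..<T} \<longrightarrow> isCont U z} \<in> sets borel"
    by (rule back_subst[of "\<lambda>S. S \<in> sets borel"]) auto
  have slice: "AE x in lborel. t \<in> {0<..<T} \<longrightarrow> isCont U (t, x)" for t
  proof (cases "t \<in> {0<..<T}")
    case True
    then show ?thesis using assms[OF True] by (simp add: AE_lebesgue_lborel)
  next
    case False
    then show ?thesis by (intro AE_I2) blast
  qed
  have m': "{z \<in> space (lborel \<Otimes>\<^sub>M lborel). fst z \<in> {0<..<T} \<longrightarrow> isCont U z} \<in> sets (lborel \<Otimes>\<^sub>M (lborel :: 'a measure))"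
    unfolding lborel_prod using m by simp
  have "AE z in lborel \<Otimes>\<^sub>M (lborel :: 'a measure). fst z \<in> {0<..<T} \<longrightarrow> isCont U z"
    by (rule lborel_pair.AE_pair_measure[OF m']) (use slice in simp)
  then have "AE z in lborel. fst z \<in> {0<..<T} \<longrightarrow> isCont U z" by (simp only: lborel_prod)
  then show "AE z in lebesgue. fst z \<in> {0<..<T} \<longrightarrow> isCont U z" by (rule AE_completion)
qed

definition jointly_continuous :: "real \<Rightarrow> (real \<Rightarrow> real ^ 'd \<Rightarrow> real ^ 'm) \<Rightarrow> bool" where
  "jointly_continuous T u \<longleftrightarrow> (\<forall>t\<in>{0..T}. \<forall>x. isCont (u t) x \<longrightarrow>
     continuous (at (t, x) within {0..T} \<times> UNIV) (\<lambda>(t, x). u t x))"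

lemma jointly_continuous_AE:
  fixes u :: "real \<Rightarrow> real ^ 'd \<Rightarrow> real ^ 'm"
  assumes jc: "jointly_continuous T u" and u: "\<And>t. t \<in> {0..T} \<Longrightarrow> antimono (u t)"
  shows "AE z in lebesgue. fst z \<in> {0<..<T} \<longrightarrow> isCont (\<lambda>(t, x). u t x) z"
    and "AE q in lebesgue. (\<lambda>t. if t \<in> {0..T} then u t q else 0) \<in> borel_measurable lebesgue"
proof -
  have slice: "AE x in lebesgue. isCont (\<lambda>(t, x). u t x) (t, x)" if t: "t \<in> {0<..<T}" for t
  proof -
    have "t \<in> {0..T}" using t by auto
    have "AE x in lebesgue. isCont (u t) x"
      using t by (intro antimono_AE_isCont u) auto
    then show ?thesis
    proof eventually_elim
      case (elim x)
      have 1: "continuous (at (t, x) within {0..T} \<times> UNIV) (\<lambda>(t, x). u t x)"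
        by (rule jc[unfolded jointly_continuous_def, rule_format, OF `t \<in> {0..T}` elim])
      have "interior ({0..T} \<times> (UNIV :: (real ^ 'd) set)) = {0<..<T} \<times> UNIV"
        by (simp only: interior_Times interior_UNIV interior_atLeastAtMost_real)
      then have "(t, x) \<in> interior ({0..T} \<times> (UNIV :: (real ^ 'd) set))"
        using t by (simp only: mem_Times_iff fst_conv snd_conv UNIV_I simp_thms)
      from 1[unfolded at_within_interior[OF this]] show ?case .
    qed
  qed
  show "AE z in lebesgue. fst z \<in> {0<..<T} \<longrightarrow> isCont (\<lambda>(t, x). u t x) z"
    by (rule AE_isCont_of_slices[OF slice])
  have "AE q in lebesgue. AE t in lebesgue. t \<in> {0<..<T} \<longrightarrow> isCont (\<lambda>(t, x). u t x) (t, q)"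
    using AE_lebesgue_sections(2)[OF AE_isCont_of_slices[OF slice]] by simp
  then show "AE q in lebesgue. (\<lambda>t. if t \<in> {0..T} then u t q else 0) \<in> borel_measurable lebesgue"
  proof eventually_elim
    case (elim q)
    show ?case
    proof (rule AE_isCont_measurable)
      have "AE t in lebesgue. t \<noteq> 0 \<and> t \<noteq> T"
        unfolding AE_lebesgue_iff_negligible by (rule negligible_subset[of "{0, T}"]) auto
      then show "AE t in lebesgue. isCont (\<lambda>t. if t \<in> {0..T} then u t q else 0) t"
        using elim
      proof eventually_elim
        case (elim t)
        show ?case
        proof (cases "t \<in> {0<..<T}")
          case True
          then have c: "isCont (\<lambda>(t, x). u t x) (t, q)" using elim by blast
          have "isCont (\<lambda>s. (s, q)) t" by (intro continuous_intros)
          then have "isCont (\<lambda>s. u s q) t" using isCont_o2[where f = "\<lambda>s. (s, q)" and g = "\<lambda>(t, x). u t x" and a = t] c by simp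
          moreover have "\<forall>\<^sub>F s in nhds t. (if s \<in> {0..T} then u s q else 0) = u s q"
            by (rule eventually_mono[OF eventually_nhds_in_open[of "{0<..<T}"]]) (use True in auto)
          ultimately show ?thesis by (subst isCont_cong)
        next
          case False
          then have "t \<in> {..<0} \<union> {T<..}" using elim(1) by auto
          then have "\<forall>\<^sub>F s in nhds t. (if s \<in> {0..T} then u s q else 0) = 0"
            by (intro eventually_mono[OF eventually_nhds_in_open[of "{..<0} \<union> {T<..}"]]) auto
          then show ?thesis by (subst isCont_cong) auto
        qed
      qed
    qed
  qed
qed

context coupled_system
begin

lemma val_step:
  assumes u: "admissible u" and M: "bounded_by M u" and t: "0 \<le> t1" "t1 \<le> t2" "t2 \<le> T"
  shows "Phi u t2 t1 x \<lless> y \<Longrightarrow> w t1 t2 *\<^sub>R val u t2 y \<le> val u t1 x + (lc M * (1 + norm x) * integral {t1..t2} G) *\<^sub>R 1"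
    and "y \<lless> Phi u t2 t1 x \<Longrightarrow> val u t1 x \<le> w t1 t2 *\<^sub>R val u t2 y + (lc M * (1 + norm x) * integral {t1..t2} G) *\<^sub>R 1"
proof -
  define Y where "Y = (\<lambda>s. Phi u s t1 x)"
  define Z where "Z = (\<lambda>s. Phi u s t2 y)"
  have t': "0 \<le> t2" "t1 \<le> T" using t by auto
  have Y: "trajectory C (vel u) t1 T Y" unfolding Y_def by (rule Phi_trajectory[OF u t(1)])
  have Y2: "trajectory C (vel u) t2 T Y" by (rule trajectory_subinterval[OF Y t(2)]) simp
  have Z: "trajectory C (vel u) t2 T Z" unfolding Z_def by (rule Phi_trajectory[OF u t'(1)])
  have Yt1: "Y t1 = x" unfolding Y_def by (rule Phi_start[OF u t(1)])
  have Zt2: "Z t2 = y" unfolding Z_def by (rule Phi_start[OF u t'(1)])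
  define h where "h = (\<lambda>s. w t1 s *\<^sub>R left_inf (src u s) (Y s))"
  have hint: "h integrable_on {a..b}" if "t1 \<le> a" "b \<le> T" for a b
    unfolding h_def by (rule path_integrable_HK[OF u t(1) t'(2) Y that])
  have h2: "integral {t2..T} h = w t1 t2 *\<^sub>R integral {t2..T} (\<lambda>s. w t2 s *\<^sub>R left_inf (src u s) (Y s))"
  proof -
    have "integral {t2..T} h = integral {t2..T} (\<lambda>s. w t1 t2 *\<^sub>R (w t2 s *\<^sub>R left_inf (src u s) (Y s)))"
    proof (rule integral_cong)
      fix s assume "s \<in> {t2..T}"
      then have "w t1 s = w t1 t2 * w t2 s" by (intro w_split t) simp
      then show "h s = w t1 t2 *\<^sub>R (w t2 s *\<^sub>R left_inf (src u s) (Y s))" by (simp only: h_def scaleR_scaleR)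
    qed
    then show ?thesis by (simp only: integral_cmul)
  qed
  have valx: "val u t1 x = w t1 t2 *\<^sub>R (w t2 T *\<^sub>R uT (Y T) + integral {t2..T} (\<lambda>s. w t2 s *\<^sub>R left_inf (src u s) (Y s))) + integral {t1..t2} h"
  proof -
    have "integral {t1..T} h = integral {t1..t2} h + integral {t2..T} h"
      using Henstock_Kurzweil_Integration.integral_combine[OF t(2,3) hint[of t1 T]] by simp
    moreover have "val u t1 x = w t1 T *\<^sub>R uT (Y T) + integral {t1..T} h" by (simp only: val_def h_def Y_def)
    moreover note h2 w_split[OF t]
    ultimately show ?thesis by (simp add: scaleR_add_right)
  qed
  have small: "\<bar>integral {t1..t2} h $ i\<bar> \<le> lc M * (1 + norm x) * integral {t1..t2} G" for i
  proof -
    have "norm (integral {t1..t2} (\<lambda>s. h s $ i)) \<le> integral {t1..t2} (\<lambda>s. G s * (lc M * (1 + norm x)))"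
    proof (rule integral_norm_bound_integral)
      show "(\<lambda>s. h s $ i) integrable_on {t1..t2}"
        using integrable_nth[where i=i, OF hint[of t1 t2]] t by (simp add: o_def)
      show "(\<lambda>s. G s * (lc M * (1 + norm x))) integrable_on {t1..t2}"
        by (intro integrable_on_mult_left G_sub t)
      show "norm (h s $ i) \<le> G s * (lc M * (1 + norm x))" if s: "s \<in> {t1..t2}" for s
      proof -
        have "w t1 s * \<bar>left_inf (src u s) (Y s) $ i\<bar> \<le> 1 * \<bar>left_inf (src u s) (Y s) $ i\<bar>"
          by (rule mult_right_mono[OF w_le1]) simp
        also have "... \<le> G s * (lc M * (1 + norm x))"
          using path_left_src_bound[OF u M t(1) _ Y, of s i] s t by (simp add: Yt1)
        finally show ?thesis using w_pos[of t1 s] by (simp add: h_def abs_mult)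
      qed
    qed
    also have "... = lc M * (1 + norm x) * integral {t1..t2} G" by (simp add: mult.commute)
    finally show ?thesis using integral_nth[where i=i, OF hint[of t1 t2]] t by (simp add: o_def)
  qed
  have valy: "val u t2 y = w t2 T *\<^sub>R uT (Z T) + integral {t2..T} (\<lambda>s. w t2 s *\<^sub>R left_inf (src u s) (Z s))"
    by (simp add: val_def Z_def)
  have mono: "w t2 T *\<^sub>R uT (Y2 T) + integral {t2..T} (\<lambda>s. w t2 s *\<^sub>R left_inf (src u s) (Y2 s))
      \<le> w t2 T *\<^sub>R uT (Y1 T) + integral {t2..T} (\<lambda>s. w t2 s *\<^sub>R left_inf (src u s) (Y1 s))"
    if tr: "trajectory C (vel u) t2 T Y1" "trajectory C (vel u) t2 T Y2" and lt: "Y1 t2 \<lless> Y2 t2" for Y1 Y2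
  proof (rule add_mono)
    have cmp: "Y1 s \<lless> Y2 s" if "s \<in> {t2..T}" for s
      by (rule strict_trajectory_comparison[OF trajectory_imp_sub[OF tr(1)] trajectory_imp_super[OF tr(2)] _ C_sub[OF t'(1)] C_nonneg lt that]) simp
    have "uT (Y2 T) \<le> uT (Y1 T)"
      using cmp[of T] t by (intro antimonoD[OF uT_antimono] strictly_below_imp_le) auto
    then show "w t2 T *\<^sub>R uT (Y2 T) \<le> w t2 T *\<^sub>R uT (Y1 T)" using w_pos[of t2 T] by (simp add: less_eq_vec_def)
    show "integral {t2..T} (\<lambda>s. w t2 s *\<^sub>R left_inf (src u s) (Y2 s)) \<le> integral {t2..T} (\<lambda>s. w t2 s *\<^sub>R left_inf (src u s) (Y1 s))"
    proof (rule integral_vec_mono)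
      show "w t2 s *\<^sub>R left_inf (src u s) (Y2 s) \<le> w t2 s *\<^sub>R left_inf (src u s) (Y1 s)" if s: "s \<in> {t2..T}" for s
      proof -
        have "left_inf (src u s) (Y2 s) \<le> left_inf (src u s) (Y1 s)"
          by (intro left_src_compare admissible_antimono u order_refl strictly_below_imp_le cmp s)
        then show ?thesis using w_pos[of t2 s] by (simp add: less_eq_vec_def)
      qed
    qed (use path_integrable_HK[OF u t'(1) t(3) tr(1) order_refl order_refl] path_integrable_HK[OF u t'(1) t(3) tr(2) order_refl order_refl] in auto)
  qed
  show "w t1 t2 *\<^sub>R val u t2 y \<le> val u t1 x + (lc M * (1 + norm x) * integral {t1..t2} G) *\<^sub>R 1" if "Phi u t2 t1 x \<lless> y"
  proof -
    have "val u t2 y \<le> w t2 T *\<^sub>R uT (Y T) + integral {t2..T} (\<lambda>s. w t2 s *\<^sub>R left_inf (src u s) (Y s))"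
      unfolding valy by (rule mono[OF Y2 Z]) (use that in "simp add: Zt2 Y_def")
    then show ?thesis
      unfolding valx less_eq_vec_def
    proof (intro allI)
      fix i assume "\<forall>i. val u t2 y $ i \<le> (w t2 T *\<^sub>R uT (Y T) + integral {t2..T} (\<lambda>s. w t2 s *\<^sub>R left_inf (src u s) (Y s))) $ i"
      then have "w t1 t2 * val u t2 y $ i \<le> w t1 t2 * (w t2 T *\<^sub>R uT (Y T) + integral {t2..T} (\<lambda>s. w t2 s *\<^sub>R left_inf (src u s) (Y s))) $ i"
        using w_pos[of t1 t2] by (intro mult_left_mono) auto
      then show "(w t1 t2 *\<^sub>R val u t2 y) $ i \<le> (w t1 t2 *\<^sub>R (w t2 T *\<^sub>R uT (Y T) + integral {t2..T} (\<lambda>s. w t2 s *\<^sub>R left_inf (src u s) (Y s))) + integral {t1..t2} h + (lc M * (1 + norm x) * integral {t1..t2} G) *\<^sub>R 1) $ i"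
        using small[of i] by (simp add: abs_le_iff)
    qed
  qed
  show "val u t1 x \<le> w t1 t2 *\<^sub>R val u t2 y + (lc M * (1 + norm x) * integral {t1..t2} G) *\<^sub>R 1" if "y \<lless> Phi u t2 t1 x"
  proof -
    have "w t2 T *\<^sub>R uT (Y T) + integral {t2..T} (\<lambda>s. w t2 s *\<^sub>R left_inf (src u s) (Y s)) \<le> val u t2 y"
      unfolding valy by (rule mono[OF Z Y2]) (use that in "simp add: Zt2 Y_def")
    then show ?thesis
      unfolding valx less_eq_vec_def
    proof (intro allI)
      fix i assume "\<forall>i. (w t2 T *\<^sub>R uT (Y T) + integral {t2..T} (\<lambda>s. w t2 s *\<^sub>R left_inf (src u s) (Y s))) $ i \<le> val u t2 y $ i"
      then have "w t1 t2 * (w t2 T *\<^sub>R uT (Y T) + integral {t2..T} (\<lambda>s. w t2 s *\<^sub>R left_inf (src u s) (Y s))) $ i \<le> w t1 t2 * val u t2 y $ i"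
        using w_pos[of t1 t2] by (intro mult_left_mono) auto
      then show "(w t1 t2 *\<^sub>R (w t2 T *\<^sub>R uT (Y T) + integral {t2..T} (\<lambda>s. w t2 s *\<^sub>R left_inf (src u s) (Y s))) + integral {t1..t2} h) $ i \<le> (w t1 t2 *\<^sub>R val u t2 y + (lc M * (1 + norm x) * integral {t1..t2} G) *\<^sub>R 1) $ i"
        using small[of i] by (simp add: abs_le_iff)
    qed
  qed
qed

text \<open>Over short times trajectories from a bounded set move little, the weight is close to \<open>1\<close> and
  the source contributes little.\<close>

lemma short_time_modulus:
  assumes "0 < r" "0 \<le> R"
  obtains \<eta> where "0 < \<eta>"
    "\<And>a b. 0 \<le> a \<Longrightarrow> a \<le> b \<Longrightarrow> b \<le> T \<Longrightarrow> b - a < \<eta> \<Longrightarrow> R * (exp (L * integral {a..b} K) - 1) < r"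
    "\<And>a b. 0 \<le> a \<Longrightarrow> a \<le> b \<Longrightarrow> b \<le> T \<Longrightarrow> b - a < \<eta> \<Longrightarrow> R * integral {a..b} G < r"
    "\<And>a b. 0 \<le> a \<Longrightarrow> a \<le> b \<Longrightarrow> b \<le> T \<Longrightarrow> b - a < \<eta> \<Longrightarrow> R * (1 - w a b) < r"
proof -
  define e where "e = r / (R + 1)"
  have e: "e > 0" using assms by (simp add: e_def)
  have Re: "R * z < r" if "0 \<le> z" "z < e" for z
  proof -
    have "R * z \<le> R * e" using that assms by (intro mult_left_mono) auto
    also have "... < r" using assms by (simp add: e_def field_simps)
    finally show ?thesis .
  qed
  have AC1: "AC 0 T (\<lambda>t. exp (L * integral {0..t} K))"
    by (rule AC_exp_integral[OF K_int K_nonneg])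
  have AC2: "AC 0 T (\<lambda>t. integral {0..t} G)"
    by (rule AC_integral_nonneg[OF G_sub G_nonneg]) simp
  obtain d1 where d1: "d1 > 0" "\<And>p q. 0 \<le> p \<Longrightarrow> p \<le> q \<Longrightarrow> q \<le> T \<Longrightarrow> q - p < d1 \<Longrightarrow> norm (exp (L * integral {0..q} K) - exp (L * integral {0..p} K)) < e"
    using AC_uniform[OF AC1 e] by blast
  obtain d2 where d2: "d2 > 0" "\<And>p q. 0 \<le> p \<Longrightarrow> p \<le> q \<Longrightarrow> q \<le> T \<Longrightarrow> q - p < d2 \<Longrightarrow> norm (integral {0..q} G - integral {0..p} G) < e"
    using AC_uniform[OF AC2 e] by blast
  show ?thesis
  proof (rule that[of "min d1 d2"])
    fix a b assume ab: "0 \<le> a" "a \<le> b" "b \<le> T" "b - a < min d1 d2"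
    have Gi: "0 \<le> integral {a..b} G" by (rule integral_nonneg[OF G_sub[OF ab(1)] G_nonneg])
    have Ki: "0 \<le> integral {a..b} K" "0 \<le> integral {0..a} K" by (auto intro!: integral_nonneg K_sub K_nonneg ab)
    have "integral {0..b} G - integral {0..a} G = integral {a..b} G"
      by (rule integral_increment[OF G_sub ab(1,2) order_refl]) simp
    then have G1: "integral {a..b} G < e" using d2(2)[OF ab(1-3)] ab(4) by simp
    then show "R * integral {a..b} G < r" by (rule Re[OF Gi])
    have "integral {0..b} K = integral {0..a} K + integral {a..b} K"
      using integral_increment[OF K_int ab(1,2) order_refl] by simp
    then have "exp (L * integral {0..b} K) - exp (L * integral {0..a} K) = exp (L * integral {0..a} K) * (exp (L * integral {a..b} K) - 1)"
      by (simp add: algebra_simps flip: exp_add)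
    moreover have "1 * (exp (L * integral {a..b} K) - 1) \<le> exp (L * integral {0..a} K) * (exp (L * integral {a..b} K) - 1)"
      using Ki L_1 by (intro mult_right_mono) auto
    ultimately have "exp (L * integral {a..b} K) - 1 < e" using d1(2)[OF ab(1-3)] ab(4) by simp
    then show "R * (exp (L * integral {a..b} K) - 1) < r" using Ki L_1 by (intro Re) auto
    have "integral {a..b} C \<le> integral {a..b} G"
      by (rule integral_le[OF C_sub[OF ab(1)] G_sub[OF ab(1)]]) (use K_nonneg L_1 in "simp add: G_def")
    moreover have "1 - w a b \<le> integral {a..b} C"
      unfolding w_def using exp_ge_add_one_self[of "- integral {a..b} C"] by simp
    ultimately show "R * (1 - w a b) < r" using G1 w_le1[of a b] by (intro Re) auto
  qed (use d1 d2 in auto)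
qed

text \<open>Each of the two lies below the other after an arbitrarily small strict shift: a form of equality almost
  everywhere that can be used at every point.\<close>

definition interlaced :: "(real \<Rightarrow> real ^ 'd \<Rightarrow> real ^ 'm) \<Rightarrow> (real \<Rightarrow> real ^ 'd \<Rightarrow> real ^ 'm) \<Rightarrow> bool" where
  "interlaced u v \<longleftrightarrow> (\<forall>t\<in>{0..T}. \<forall>y z. y \<lless> z \<longrightarrow> u t z \<le> val v t y \<and> val v t z \<le> u t y)"

text \<open>Between nearby times trajectories move less than the strict shift, so the values at the two times can be
  compared through \<open>val_step\<close> at strictly shifted points.\<close>

lemma interlaced_jointly_continuous:
  assumes v: "admissible v" and uv: "interlaced u v" and Mu: "bounded_by Mu u"
  shows "jointly_continuous T u"
  unfolding jointly_continuous_def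
proof (intro ballI allI impI)
  fix t x assume t: "t \<in> {0..T}" and cont: "isCont (u t) x"
  obtain M where M: "bounded_by M v" using admissible_bounded[OF v] by blast
  show "continuous (at (t, x) within {0..T} \<times> UNIV) (\<lambda>(t, x). u t x)"
    unfolding continuous_within
  proof (rule vec_tendstoI)
    fix i
    show "((\<lambda>z. (case z of (t, x) \<Rightarrow> u t x) $ i) \<longlongrightarrow> (case (t, x) of (t, x) \<Rightarrow> u t x) $ i) (at (t, x) within {0..T} \<times> UNIV)"
    proof (rule tendstoI)
      fix e :: real assume "e > 0"
      then have e4: "e / 4 > 0" by simp
      have "isCont (\<lambda>x. u t x $ i) x" using cont by (intro continuous_intros)
      then obtain \<delta> where \<delta>: "\<delta> > 0" "\<And>z. norm (z - x) < \<delta> \<Longrightarrow> \<bar>u t z $ i - u t x $ i\<bar> < e / 4"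
        using e4 unfolding continuous_at_eps_delta dist_norm real_norm_def by metis
      define n1 where "n1 = norm (1 :: real ^ 'd)"
      have n1: "0 < n1" by (simp add: n1_def vec_eq_iff)
      define r where "r = \<delta> / (4 * n1)"
      have r: "r > 0" using \<delta>(1) n1 by (simp add: r_def)
      have shift: "norm (c *\<^sub>R (1 :: real ^ 'd)) \<le> \<delta>" if "\<bar>c\<bar> \<le> 4 * r" for c
        using mult_right_mono[OF that, of n1] n1 by (simp add: n1_def[symmetric] r_def)
      define q where "q = (\<lambda>c. x + (c * r) *\<^sub>R (1 :: real ^ 'd))"
      have q_lt: "q c \<lless> q c'" if "c < c'" for c c' using that r by (simp add: q_def strictly_below_def)
      have qn: "norm (q c) \<le> norm x + \<delta>" if "\<bar>c\<bar> \<le> 4" for c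
        using norm_triangle_ineq[of x "(c * r) *\<^sub>R (1 :: real ^ 'd)"] shift[of "c * r"] that r by (simp add: q_def abs_mult)
      have uq: "\<bar>u t (q c) $ i - u t x $ i\<bar> < e / 4" if "\<bar>c\<bar> \<le> 3" for c
      proof (rule \<delta>(2))
        have "norm ((c * r) *\<^sub>R (1 :: real ^ 'd)) = \<bar>c\<bar> * (r * n1)" using r by (simp add: abs_mult n1_def)
        also have "... \<le> 3 * (r * n1)" using that r n1 by (intro mult_right_mono) auto
        also have "... < \<delta>" using \<delta>(1) n1 by (simp add: r_def)
        finally show "norm (q c - x) < \<delta>" by (simp add: q_def)
      qed
      define R where "R = 1 + norm x + \<delta>"
      have R: "1 \<le> R" using \<delta>(1) by (simp add: R_def add_nonneg_nonneg)
      have Rc: "0 \<le> lc M * R" using lc_nonneg M R by (simp add: bounded_by_def)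
      have RB: "0 \<le> Mu * R" using Mu R by (simp add: bounded_by_def)
      have R0: "0 \<le> R" using R by simp
      obtain \<eta>1 where \<eta>1: "\<eta>1 > 0" "\<And>a b. 0 \<le> a \<Longrightarrow> a \<le> b \<Longrightarrow> b \<le> T \<Longrightarrow> b - a < \<eta>1 \<Longrightarrow> R * (exp (L * integral {a..b} K) - 1) < r"
        using short_time_modulus[OF r R0] by metis
      obtain \<eta>2 where \<eta>2: "\<eta>2 > 0" "\<And>a b. 0 \<le> a \<Longrightarrow> a \<le> b \<Longrightarrow> b \<le> T \<Longrightarrow> b - a < \<eta>2 \<Longrightarrow> lc M * R * integral {a..b} G < e / 4"
        using short_time_modulus[OF e4 Rc] by metis
      obtain \<eta>3 where \<eta>3: "\<eta>3 > 0" "\<And>a b. 0 \<le> a \<Longrightarrow> a \<le> b \<Longrightarrow> b \<le> T \<Longrightarrow> b - a < \<eta>3 \<Longrightarrow> Mu * R * (1 - w a b) < e / 4"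
        using short_time_modulus[OF e4 RB] by metis
      define d where "d = min (min \<eta>1 \<eta>2) (min \<eta>3 (min r \<delta>))"
      have d: "d > 0" using \<eta>1 \<eta>2 \<eta>3 r \<delta> by (simp add: d_def)
      have move: "\<bar>Phi v b a z $ j - z $ j\<bar> < r"
        if "0 \<le> a" "a \<le> b" "b \<le> T" "b - a < d" "1 + norm z \<le> R" for a b z j
      proof -
        have "\<bar>Phi v b a z $ j - Phi v a a z $ j\<bar> \<le> (1 + norm (Phi v a a z)) * exp (L * integral {a..b} K) - (1 + norm (Phi v a a z)) * exp (L * integral {a..a} K)"
          by (rule path_increment[OF admissible_antimono[OF v] that(1) Phi_trajectory[OF v that(1)]]) (use that in auto)
        also have "... = (1 + norm z) * (exp (L * integral {a..b} K) - 1)"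
          by (simp add: Phi_start[OF v that(1)] algebra_simps)
        also have "... \<le> R * (exp (L * integral {a..b} K) - 1)"
          using that(5) L_1 integral_nonneg[OF K_sub[OF that(1)] K_nonneg, of b] by (intro mult_right_mono) auto
        also have "... < r" using \<eta>1(2)[OF that(1-3)] that(4) by (simp add: d_def)
        finally show ?thesis by (simp add: Phi_start[OF v that(1)])
      qed
      have slack: "lc M * (1 + norm z) * integral {a..b} G < e / 4"
        if "0 \<le> a" "a \<le> b" "b \<le> T" "b - a < d" "1 + norm z \<le> R" for a b and z :: "real ^ 'd"
      proof -
        have "0 \<le> lc M" using M lc_nonneg by (simp add: bounded_by_def)
        with that(5) have "lc M * (1 + norm z) \<le> lc M * R" by (rule mult_left_mono)
        then have "lc M * (1 + norm z) * integral {a..b} G \<le> lc M * R * integral {a..b} G"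
          by (rule mult_right_mono) (rule integral_nonneg[OF G_sub[OF that(1)] G_nonneg])
        also have "... < e / 4" using \<eta>2(2)[OF that(1-3)] that(4) by (simp add: d_def)
        finally show ?thesis .
      qed
      have weight: "\<bar>c - w a b * c\<bar> < e / 4" if "0 \<le> a" "a \<le> b" "b \<le> T" "b - a < d" "\<bar>c\<bar> \<le> Mu * R" for a b c
      proof -
        have "c - w a b * c = c * (1 - w a b)" by (simp add: algebra_simps)
        then have "\<bar>c - w a b * c\<bar> = \<bar>c\<bar> * (1 - w a b)" using w_le1[of a b] by (simp add: abs_mult)
        also have "... \<le> Mu * R * (1 - w a b)" using that(5) w_le1[of a b] by (intro mult_right_mono) auto
        also have "... < e / 4" using \<eta>3(2)[OF that(1-3)] that(4) by (simp add: d_def)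
        finally show ?thesis .
      qed
      have qR: "1 + norm (q c) \<le> R" if "\<bar>c\<bar> \<le> 4" for c using qn[OF that] by (simp add: R_def)
      have up: "w a b * val v b (q c') $ i < val v a (q c) $ i + e / 4"
        and lo: "val v a (q c') $ i < w a b * val v b (q c) $ i + e / 4"
        if ab: "0 \<le> a" "a \<le> b" "b \<le> T" "b - a < d" and c: "\<bar>c\<bar> \<le> 4" "\<bar>c'\<bar> \<le> 4" "c + 1 \<le> c'" for a b c c'
      proof -
        have rc: "c * r + r \<le> c' * r" using mult_right_mono[OF c(3), of r] r by (simp add: distrib_right)
        have "Phi v b a (q c) \<lless> q c'" "q c \<lless> Phi v b a (q c')"
          unfolding strictly_below_def
        proof safe
          fix j
          have "\<bar>Phi v b a (q c) $ j - q c $ j\<bar> < r" by (rule move[OF ab qR[OF c(1)]])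
          then show "Phi v b a (q c) $ j < q c' $ j" using rc by (simp add: q_def abs_less_iff)
          have "\<bar>Phi v b a (q c') $ j - q c' $ j\<bar> < r" by (rule move[OF ab qR[OF c(2)]])
          then show "q c $ j < Phi v b a (q c') $ j" using rc by (simp add: q_def abs_less_iff)
        qed
        from val_step(1)[OF v M ab(1-3) this(1)] val_step(2)[OF v M ab(1-3) this(2)]
        have "w a b * val v b (q c') $ i \<le> val v a (q c) $ i + lc M * (1 + norm (q c)) * integral {a..b} G"
          "val v a (q c') $ i \<le> w a b * val v b (q c) $ i + lc M * (1 + norm (q c')) * integral {a..b} G"
          by (auto simp: less_eq_vec_def dest: spec[of _ i])
        with slack[OF ab qR[OF c(1)]] slack[OF ab qR[OF c(2)]]
        show "w a b * val v b (q c') $ i < val v a (q c) $ i + e / 4" "val v a (q c') $ i < w a b * val v b (q c) $ i + e / 4"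
          by linarith+
      qed
      have main: "\<bar>u t' x' $ i - u t x $ i\<bar> < e" if t': "t' \<in> {0..T}" and dt: "\<bar>t' - t\<bar> < d" and dx: "norm (x' - x) < d" for t' x'
      proof -
        have x'q: "q (- 1) \<lless> x'" "x' \<lless> q 1"
        proof -
          have "\<bar>x' $ j - x $ j\<bar> < r" for j
            using component_le_norm_cart[of "x' - x" j] dx by (simp add: d_def)
          then show "q (- 1) \<lless> x'" "x' \<lless> q 1" by (auto simp: q_def strictly_below_def abs_less_iff) (smt (verit))+
        qed
        have bu: "\<bar>u s z $ i\<bar> \<le> Mu * R" if "s \<in> {0..T}" "1 + norm z \<le> R" for s z
        proof -
          have "\<bar>u s z $ i\<bar> \<le> Mu * (1 + norm z)" using Mu that(1) by (auto simp: bounded_by_def)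
          also have "... \<le> Mu * R" using that(2) Mu by (intro mult_left_mono) (auto simp: bounded_by_def)
          finally show ?thesis .
        qed
        have x'R: "1 + norm x' \<le> R" using norm_triangle_ineq[of x "x' - x"] dx by (simp add: R_def d_def)
        have inter: "u s z $ i \<le> val v s y $ i" "val v s z $ i \<le> u s y $ i" if "s \<in> {0..T}" "y \<lless> z" for s y z
          using uv that by (auto simp: interlaced_def less_eq_vec_def)
        have up1: "val v t (q (- 2)) $ i \<le> u t (q (- 3)) $ i" and lo1: "u t (q 3) $ i \<le> val v t (q 2) $ i"
          using inter[OF t q_lt[of "- 3" "- 2"]] inter[OF t q_lt[of 2 3]] by auto
        have up2: "u t' x' $ i \<le> val v t' (q (- 1)) $ i" and lo2: "val v t' (q 1) $ i \<le> u t' x' $ i"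
          using inter[OF t' x'q(1)] inter[OF t' x'q(2)] by auto
        show ?thesis
        proof (cases "t \<le> t'")
          case True
          have ab: "0 \<le> t" "t \<le> t'" "t' \<le> T" "t' - t < d" using t t' True dt by auto
          have "w t t' * val v t' (q (- 1)) $ i < val v t (q (- 2)) $ i + e / 4" by (rule up[OF ab]) simp_all
          moreover have "w t t' * u t' x' $ i \<le> w t t' * val v t' (q (- 1)) $ i" using up2 w_pos[of t t'] by (intro mult_left_mono) auto
          ultimately have 1: "w t t' * u t' x' $ i < u t (q (- 3)) $ i + e / 4" using up1 by linarith
          have "val v t (q 2) $ i < w t t' * val v t' (q 1) $ i + e / 4" by (rule lo[OF ab]) simp_all
          moreover have "w t t' * val v t' (q 1) $ i \<le> w t t' * u t' x' $ i" using lo2 w_pos[of t t'] by (intro mult_left_mono) auto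
          ultimately have 2: "u t (q 3) $ i < w t t' * u t' x' $ i + e / 4" using lo1 by linarith
          have 3: "\<bar>u t' x' $ i - w t t' * u t' x' $ i\<bar> < e / 4" by (rule weight[OF ab bu[OF t' x'R]])
          have 5: "\<bar>u t (q (- 3)) $ i - u t x $ i\<bar> < e / 4" "\<bar>u t (q 3) $ i - u t x $ i\<bar> < e / 4" by (rule uq; simp)+
          show ?thesis using 1 2 3 5 unfolding abs_less_iff by linarith
        next
          case False
          have ab: "0 \<le> t'" "t' \<le> t" "t \<le> T" "t - t' < d" using t t' False dt by auto
          have "val v t' (q (- 1)) $ i < w t' t * val v t (q (- 2)) $ i + e / 4" by (rule lo[OF ab]) simp_all
          moreover have "w t' t * val v t (q (- 2)) $ i \<le> w t' t * u t (q (- 3)) $ i" using up1 w_pos[of t' t] by (intro mult_left_mono) auto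
          ultimately have 1: "u t' x' $ i < w t' t * u t (q (- 3)) $ i + e / 4" using up2 by linarith
          have 3: "\<bar>u t (q (- 3)) $ i - w t' t * u t (q (- 3)) $ i\<bar> < e / 4" by (rule weight[OF ab bu[OF t qR]]) simp
          have "w t' t * val v t (q 2) $ i < val v t' (q 1) $ i + e / 4" by (rule up[OF ab]) simp_all
          moreover have "w t' t * u t (q 3) $ i \<le> w t' t * val v t (q 2) $ i" using lo1 w_pos[of t' t] by (intro mult_left_mono) auto
          ultimately have 2: "w t' t * u t (q 3) $ i < u t' x' $ i + e / 4" using lo2 by linarith
          have 4: "\<bar>u t (q 3) $ i - w t' t * u t (q 3) $ i\<bar> < e / 4" by (rule weight[OF ab bu[OF t qR]]) simp
          have 5: "\<bar>u t (q (- 3)) $ i - u t x $ i\<bar> < e / 4" "\<bar>u t (q 3) $ i - u t x $ i\<bar> < e / 4" by (rule uq; simp)+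
          show ?thesis using 1 2 3 4 5 unfolding abs_less_iff by linarith
        qed
      qed
      show "\<forall>\<^sub>F z in at (t, x) within {0..T} \<times> UNIV. dist ((case z of (t, x) \<Rightarrow> u t x) $ i) ((case (t, x) of (t, x) \<Rightarrow> u t x) $ i) < e"
        unfolding eventually_at
      proof (intro exI[of _ d] conjI ballI impI d)
        fix z assume z: "z \<in> {0..T} \<times> (UNIV :: (real ^ 'd) set)" "z \<noteq> (t, x) \<and> dist z (t, x) < d"
        obtain t' x' where z': "z = (t', x')" by (cases z)
        have "dist t' t \<le> dist z (t, x)" "dist x' x \<le> dist z (t, x)"
          using dist_fst_le[of z "(t, x)"] dist_snd_le[of z "(t, x)"] by (auto simp: z')
        then show "dist ((case z of (t, x) \<Rightarrow> u t x) $ i) ((case (t, x) of (t, x) \<Rightarrow> u t x) $ i) < e"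
          using main[of t' x'] z by (simp add: z' dist_real_def dist_norm)
      qed
    qed
  qed
qed

end

lemma AE_eq_of_strict_comparison:
  fixes h1 h2 :: "real ^ 'n \<Rightarrow> real ^ 'k"
  assumes "\<And>x y. x \<lless> y \<Longrightarrow> h1 y \<le> h2 x" "\<And>x y. x \<lless> y \<Longrightarrow> h2 y \<le> h1 x"
  shows "AE x in lebesgue. h1 x = h2 x"
proof -
  have "AE x in lebesgue. - h2 x $ i \<le> - h1 x $ i \<and> - h1 x $ i \<le> - h2 x $ i" for i
  proof (intro AE_conjI)
    show "AE x in lebesgue. - h2 x $ i \<le> - h1 x $ i"
      by (rule AE_le_of_strict_comparison) (use assms(1) in "simp add: less_eq_vec_def")
    show "AE x in lebesgue. - h1 x $ i \<le> - h2 x $ i"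
      by (rule AE_le_of_strict_comparison) (use assms(2) in "simp add: less_eq_vec_def")
  qed
  then have "AE x in lebesgue. \<forall>i. - h2 x $ i \<le> - h1 x $ i \<and> - h1 x $ i \<le> - h2 x $ i"
    unfolding AE_all_countable by blast
  then show ?thesis
  proof eventually_elim
    case (elim x)
    then show ?case unfolding vec_eq_iff by (metis antisym neg_le_iff_le)
  qed
qed

lemma left_inf_idem:
  assumes h: "antimono_below h" shows "left_inf (left_inf h) x \<le> left_inf h x"
proof (rule left_inf_greatest)
  fix z assume "z \<lless> x"
  then obtain z1 where z: "z \<lless> z1" "z1 \<lless> x" using strictly_below_dense by blast
  have "left_inf (left_inf h) x \<le> left_inf h z1"
    by (rule left_inf_lower[OF antimono_imp_antimono_below[OF left_inf_antimono[OF h]] z(2)])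
  also have "... \<le> h z" by (rule left_inf_lower[OF h z(1)])
  finally show "left_inf (left_inf h) x \<le> h z" .
qed

context coupled_system
begin

section \<open>A priori bounds\<close>

definition rho :: "real \<Rightarrow> real" where "rho t = A * exp (2 * L * integral {t..T} K)"

lemma rho_pos: "0 < rho t" using A by (simp add: rho_def)

lemma rho_ge1: assumes "0 \<le> t" shows "1 \<le> rho t"
proof -
  have "1 \<le> exp (2 * L * integral {t..T} K)"
    using L_1 integral_nonneg[OF K_sub[OF assms] K_nonneg, of T] by simp
  then show ?thesis using mult_mono[OF A, of 1 "exp (2 * L * integral {t..T} K)"] A by (simp add: rho_def)
qed

lemma rho_le: assumes "t \<in> {0..T}" shows "rho t \<le> rho 0"
proof -
  have "integral {t..T} K \<le> integral {0..T} K"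
    by (rule integral_subset_le) (use assms K_sub K_nonneg in auto)
  then show ?thesis using A L_1 by (simp add: rho_def mult_left_mono)
qed

lemma rho_weight:
  assumes "0 \<le> t" "t \<le> s" "s \<le> T"
  shows "w t s * (rho s * exp (L * integral {t..s} K)) = rho t * exp (- integral {t..s} G)"
proof -
  have K: "integral {t..T} K = integral {t..s} K + integral {s..T} K"
    using Henstock_Kurzweil_Integration.integral_combine[OF assms(2,3) K_sub[OF assms(1)]] by simp
  have G: "integral {t..s} G = integral {t..s} C + L * integral {t..s} K"
    unfolding G_def by (simp add: integral_add C_sub[OF assms(1)] K_sub[OF assms(1)] integrable_on_mult_right)
  show ?thesis unfolding w_def rho_def K G by (simp add: algebra_simps flip: exp_add)
qed

lemma G_exp_integral:
  assumes t: "0 \<le> t" "t \<le> T"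
  shows "(\<lambda>s. G s * exp (- integral {t..s} G)) integrable_on {t..T}"
    and "integral {t..T} (\<lambda>s. G s * exp (- integral {t..s} G)) \<le> 1 - exp (- integral {t..T} G)"
proof -
  have Gm: "G \<in> borel_measurable (lebesgue_on {t..T})" by (rule integrable_imp_measurable[OF G_sub[OF t(1)]])
  have "continuous_on {t..T} (\<lambda>s. exp (- integral {t..s} G))"
    by (intro continuous_intros indefinite_integral_continuous_1 G_sub t)
  then have em: "(\<lambda>s. exp (- integral {t..s} G)) \<in> borel_measurable (lebesgue_on {t..T})"
    by (rule continuous_imp_measurable_on_sets_lebesgue) auto
  have b: "\<bar>G s * exp (- integral {t..s} G)\<bar> \<le> G s" for s
  proof -
    have "exp (- integral {t..s} G) \<le> 1" using integral_nonneg[OF G_sub[OF t(1)] G_nonneg, of s] by simp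
    then show ?thesis using G_nonneg[of s] by (simp add: abs_mult mult_left_le)
  qed
  show i: "(\<lambda>s. G s * exp (- integral {t..s} G)) integrable_on {t..T}"
    by (rule measurable_bounded_by_integrable_imp_integrable[OF borel_measurable_times[OF Gm em] G_sub[OF t(1)]])
      (use b in auto)
  have "integral {t..T} (\<lambda>s. G s * exp (- integral {t..s} G)) \<le> - exp (- 1 * integral {t..T} G) - (- exp (- 1 * integral {t..t} G))"
  proof (rule AC_FTC_le[OF _ i G_sub[OF t(1)] b _ t(2)])
    show "AC t T (\<lambda>s. - exp (- 1 * integral {t..s} G))"
      by (rule AC_bounded_linear[OF AC_exp_integral bounded_linear_minus[OF bounded_linear_ident]])
        (use G_sub[OF t(1)] G_nonneg in auto)
    show "AE s in lebesgue. t < s \<and> s < T \<longrightarrow> (\<exists>D. ((\<lambda>s. - exp (- 1 * integral {t..s} G)) has_real_derivative D) (at s) \<and> G s * exp (- integral {t..s} G) \<le> D)"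
      using AE_derivative_exp_integral[OF G_sub[OF t(1)], of T "- 1"]
    proof eventually_elim
      case (elim s)
      show ?case
      proof
        assume "t < s \<and> s < T"
        with elim have "((\<lambda>t'. exp (- 1 * integral {t..t'} G)) has_real_derivative (- 1 * G s * exp (- 1 * integral {t..s} G))) (at s)" by blast
        from DERIV_minus[OF this] show "\<exists>D. ((\<lambda>s. - exp (- 1 * integral {t..s} G)) has_real_derivative D) (at s) \<and> G s * exp (- integral {t..s} G) \<le> D"
          by (intro exI[of _ "G s * exp (- integral {t..s} G)"]) simp
      qed
    qed
  qed
  then show "integral {t..T} (\<lambda>s. G s * exp (- integral {t..s} G)) \<le> 1 - exp (- integral {t..T} G)" by simp
qed

text \<open>The weight \<open>rho\<close> is chosen so that the barriers \<open>\<alpha> * rho t * depth x\<close> are preserved by the linear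
  problem, and even contracted towards \<open>\<alpha> = 1\<close>.\<close>

lemma value_bound:
  assumes t: "0 \<le> t" "t \<le> T" and \<alpha>: "1 \<le> \<alpha>" and D: "0 \<le> D"
    and a: "a \<le> A * (D * exp (L * integral {t..T} K))"
    and kint: "(\<lambda>s. w t s * k s) integrable_on {t..T}"
    and k: "AE s in lebesgue. s \<in> {t..T} \<longrightarrow> k s \<le> G s * (\<alpha> * (rho s * (D * exp (L * integral {t..s} K))))"
  shows "w t T * a + integral {t..T} (\<lambda>s. w t s * k s) \<le> D * (rho t * (\<alpha> - (\<alpha> - 1) * exp (- integral {t..T} G)))"
proof -
  define E where "E = (\<lambda>s. exp (- integral {t..s} G))"
  have rT: "rho T = A" by (simp add: rho_def)
  have "w t T * a \<le> w t T * (A * (D * exp (L * integral {t..T} K)))" using a w_pos[of t T] by (intro mult_left_mono) auto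
  also have "... = D * (w t T * (rho T * exp (L * integral {t..T} K)))" by (simp add: rT)
  also have "... = D * (rho t * E T)" by (subst rho_weight) (use t in "simp_all add: E_def")
  finally have 1: "w t T * a \<le> D * (rho t * E T)" .
  have "integral {t..T} (\<lambda>s. w t s * k s) \<le> integral {t..T} (\<lambda>s. (D * (rho t * \<alpha>)) * (G s * E s))"
  proof (rule integral_mono_AE[OF kint])
    show "(\<lambda>s. (D * (rho t * \<alpha>)) * (G s * E s)) integrable_on {t..T}"
      unfolding E_def by (intro integrable_on_mult_right G_exp_integral t)
    show "AE s in lebesgue. s \<in> {t..T} \<longrightarrow> w t s * k s \<le> (D * (rho t * \<alpha>)) * (G s * E s)"
      using k
    proof eventually_elim
      case (elim s)
      show ?case
      proof
        assume s: "s \<in> {t..T}"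
        have "w t s * k s \<le> w t s * (G s * (\<alpha> * (rho s * (D * exp (L * integral {t..s} K)))))"
          using elim s w_pos[of t s] by (intro mult_left_mono) auto
        also have "... = (D * \<alpha> * G s) * (w t s * (rho s * exp (L * integral {t..s} K)))" by (simp add: mult_ac)
        also have "... = (D * (rho t * \<alpha>)) * (G s * E s)"
          by (subst rho_weight) (use t s in "simp_all add: E_def mult_ac")
        finally show "w t s * k s \<le> (D * (rho t * \<alpha>)) * (G s * E s)" .
      qed
    qed
  qed
  also have "... = (D * (rho t * \<alpha>)) * integral {t..T} (\<lambda>s. G s * E s)" by simp
  also have "... \<le> (D * (rho t * \<alpha>)) * (1 - E T)"
    unfolding E_def using D \<alpha> rho_pos[of t] by (intro mult_left_mono G_exp_integral t) auto
  finally have 2: "integral {t..T} (\<lambda>s. w t s * k s) \<le> (D * (rho t * \<alpha>)) * (1 - E T)" .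
  have "exp (- integral {t..T} G) = E T" by (simp add: E_def)
  then show ?thesis using 1 2 by (simp add: algebra_simps)
qed

lemma src_le:
  assumes "1 \<le> c" "\<And>j. u s z $ j \<le> c" shows "src u s z $ i \<le> G s * c"
proof -
  have "u s z \<le> c *\<^sub>R 1" using assms(2) by (simp add: less_eq_vec_def)
  from g_mono[OF this, of s z] have "src u s z $ i \<le> (g s z (c *\<^sub>R 1) + C s *\<^sub>R (c *\<^sub>R 1)) $ i"
    unfolding src_def less_eq_vec_def by blast
  also have "... = g s z (c *\<^sub>R 1) $ i + C s * c" by simp
  also have "g s z (c *\<^sub>R 1) $ i \<le> K s * (1 + norm (c *\<^sub>R (1 :: real ^ 'm)))"
    using component_le_norm_cart[of "g s z (c *\<^sub>R 1)" i] g_bound[of s z "c *\<^sub>R 1"] by linarith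
  also have "... \<le> K s * (L * c)"
  proof (rule mult_left_mono[OF _ K_nonneg])
    have "norm (c *\<^sub>R (1 :: real ^ 'm)) \<le> real CARD('m) * c" by (rule norm_le_card_times) (use assms(1) in simp)
    then have "1 + norm (c *\<^sub>R (1 :: real ^ 'm)) \<le> (1 + real CARD('m)) * c" using assms(1) unfolding distrib_right mult_1 by linarith
    also have "... \<le> L * c" using assms(1) L_m by (intro mult_right_mono) auto
    finally show "1 + norm (c *\<^sub>R (1 :: real ^ 'm)) \<le> L * c" .
  qed
  finally show ?thesis by (simp add: G_def algebra_simps)
qed

lemma src_ge:
  assumes "1 \<le> c" "\<And>j. - c \<le> u s z $ j" shows "- (G s * c) \<le> src u s z $ i"
proof -
  have "- c *\<^sub>R 1 \<le> u s z" using assms(2) by (simp add: less_eq_vec_def)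
  from g_mono[OF this, of s z] have "(g s z (- c *\<^sub>R 1) + C s *\<^sub>R (- c *\<^sub>R 1)) $ i \<le> src u s z $ i"
    unfolding src_def less_eq_vec_def by blast
  moreover have "(g s z (- c *\<^sub>R 1) + C s *\<^sub>R (- c *\<^sub>R 1)) $ i = g s z (- c *\<^sub>R 1) $ i - C s * c" by simp
  moreover have "- (K s * (1 + norm (- c *\<^sub>R (1 :: real ^ 'm)))) \<le> g s z (- c *\<^sub>R 1) $ i"
    using component_le_norm_cart[of "g s z (- c *\<^sub>R 1)" i] g_bound[of s z "- c *\<^sub>R 1"] by linarith
  moreover have "K s * (1 + norm (- c *\<^sub>R (1 :: real ^ 'm))) \<le> K s * (L * c)"
  proof (rule mult_left_mono[OF _ K_nonneg])
    have "norm (- c *\<^sub>R (1 :: real ^ 'm)) \<le> real CARD('m) * c" by (rule norm_le_card_times) (use assms(1) in simp)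
    then have "1 + norm (- c *\<^sub>R (1 :: real ^ 'm)) \<le> (1 + real CARD('m)) * c" using assms(1) unfolding distrib_right mult_1 by linarith
    also have "... \<le> L * c" using assms(1) L_m by (intro mult_right_mono) auto
    finally show "1 + norm (- c *\<^sub>R (1 :: real ^ 'm)) \<le> L * c" .
  qed
  ultimately show ?thesis by (simp add: G_def algebra_simps)
qed

definition in_strip :: "(real \<Rightarrow> real ^ 'd \<Rightarrow> real ^ 'm) \<Rightarrow> bool" where
  "in_strip u \<longleftrightarrow> (\<forall>t\<in>{0..T}. \<forall>x i. - (rho t * depth (- x)) \<le> u t x $ i \<and> u t x $ i \<le> rho t * depth x)"

lemma in_strip_bounded: assumes "in_strip u" shows "bounded_by (rho 0) u"
  unfolding bounded_by_def
proof (intro conjI ballI allI)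
  fix t x i assume t: "t \<in> {0..T}"
  have r: "rho t * depth z \<le> rho 0 * (1 + norm z)" for z :: "real ^ 'd"
    by (rule mult_mono[OF rho_le[OF t] depth_le_norm]) (use rho_pos[of 0] depth_ge1[of z] in auto)
  have "- (rho t * depth (- x)) \<le> u t x $ i" "u t x $ i \<le> rho t * depth x"
    using assms t by (auto simp: in_strip_def)
  then show "\<bar>u t x $ i\<bar> \<le> rho 0 * (1 + norm x)"
    using r[of x] r[of "- x"] by (simp add: abs_le_iff)
qed (use rho_pos[of 0] in simp)

lemma mult_depth_ge1: "1 \<le> c \<Longrightarrow> 1 \<le> c * depth z"
  using mult_mono[OF _ depth_ge1, of 1 c z] by simp

lemma val_in_strip:
  assumes u: "admissible u" and strip: "in_strip u" and t: "t \<in> {0..T}"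
  shows "val u t x $ i \<le> rho t * depth x" and "- (rho t * depth (- x)) \<le> val u t x $ i"
proof -
  have t0: "0 \<le> t" "t \<le> T" using t by auto
  define Y where "Y = (\<lambda>s. Phi u s t x)"
  have Y: "trajectory C (vel u) t T Y" unfolding Y_def by (rule Phi_trajectory[OF u t0(1)])
  have Yt: "Y t = x" unfolding Y_def by (rule Phi_start[OF u t0(1)])
  define k where "k = (\<lambda>s. left_inf (src u s) (Y s) $ i)"
  have hint: "(\<lambda>s. w t s *\<^sub>R left_inf (src u s) (Y s)) integrable_on {t..T}"
    by (rule path_integrable_HK[OF u t0 Y]) auto
  have kint: "(\<lambda>s. w t s * k s) integrable_on {t..T}"
    using integrable_nth[where i=i, OF hint] by (simp add: o_def k_def)
  have veq: "val u t x $ i = w t T * uT (Y T) $ i + integral {t..T} (\<lambda>s. w t s * k s)"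
    using integral_nth[where i=i, OF hint] by (simp add: val_def o_def k_def Y_def)
  note along = depth_along[OF admissible_antimono[OF u] t0(1) Y, unfolded Yt]
  have below: "antimono_below (src u s)" for s by (rule src_below[of u s, OF admissible_antimono[OF u]])
  have kle: "k s \<le> G s * (rho s * depth (Y s))" "- (G s * (rho s * depth (- Y s))) \<le> k s" if s: "s \<in> {t..T}" for s
  proof -
    have s': "s \<in> {0..T}" "1 \<le> rho s" using s t0 rho_ge1 by auto
    show "k s \<le> G s * (rho s * depth (Y s))" unfolding k_def
    proof (rule left_inf_le_continuous[OF below, of "\<lambda>z. G s * (rho s * depth z)"])
      show "continuous_on UNIV (\<lambda>z. G s * (rho s * depth z))" by (intro continuous_intros depth_continuous)
      show "src u s z $ i \<le> G s * (rho s * depth z)" for z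
        by (rule src_le[OF mult_depth_ge1]) (use strip s' in "auto simp: in_strip_def")
    qed
    show "- (G s * (rho s * depth (- Y s))) \<le> k s" unfolding k_def
    proof (rule left_inf_ge_pointwise[OF below])
      show "- (G s * (rho s * depth (- Y s))) \<le> src u s (Y s) $ i"
        by (rule src_ge[OF mult_depth_ge1]) (use strip s' in "auto simp: in_strip_def")
    qed
  qed
  have "w t T * uT (Y T) $ i + integral {t..T} (\<lambda>s. w t s * k s) \<le> depth x * (rho t * (1 - (1 - 1) * exp (- integral {t..T} G)))"
  proof (rule value_bound[OF t0 order_refl _ _ kint])
    show "uT (Y T) $ i \<le> A * (depth x * exp (L * integral {t..T} K))"
      by (rule order_trans[OF uT_upper mult_left_mono[OF along(1)]]) (use t0 A in auto)
    show "AE s in lebesgue. s \<in> {t..T} \<longrightarrow> k s \<le> G s * (1 * (rho s * (depth x * exp (L * integral {t..s} K))))"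
    proof (intro AE_I2 impI)
      fix s assume s: "s \<in> {t..T}"
      have "G s * (rho s * depth (Y s)) \<le> G s * (rho s * (depth x * exp (L * integral {t..s} K)))"
        by (intro mult_left_mono along(1) s G_nonneg less_imp_le[OF rho_pos])
      then show "k s \<le> G s * (1 * (rho s * (depth x * exp (L * integral {t..s} K))))" using kle(1)[OF s] by simp
    qed
  qed (use depth_ge1[of x] in simp)
  then show "val u t x $ i \<le> rho t * depth x" by (simp add: veq mult_ac)
  have "w t T * (- uT (Y T) $ i) + integral {t..T} (\<lambda>s. w t s * (- k s)) \<le> depth (- x) * (rho t * (1 - (1 - 1) * exp (- integral {t..T} G)))"
  proof (rule value_bound[OF t0 order_refl])
    have "- uT (Y T) $ i \<le> A * depth (- Y T)" using uT_lower[of "Y T" i] by simp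
    also have "... \<le> A * (depth (- x) * exp (L * integral {t..T} K))"
      by (rule mult_left_mono[OF along(2)]) (use t0 A in auto)
    finally show "- uT (Y T) $ i \<le> A * (depth (- x) * exp (L * integral {t..T} K))" .
    show "AE s in lebesgue. s \<in> {t..T} \<longrightarrow> - k s \<le> G s * (1 * (rho s * (depth (- x) * exp (L * integral {t..s} K))))"
    proof (intro AE_I2 impI)
      fix s assume s: "s \<in> {t..T}"
      have "G s * (rho s * depth (- Y s)) \<le> G s * (rho s * (depth (- x) * exp (L * integral {t..s} K)))"
        by (intro mult_left_mono along(2) s G_nonneg less_imp_le[OF rho_pos])
      then show "- k s \<le> G s * (1 * (rho s * (depth (- x) * exp (L * integral {t..s} K))))" using kle(2)[OF s] by simp
    qed
    show "(\<lambda>s. w t s * (- k s)) integrable_on {t..T}" using integrable_neg[OF kint] by simp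
  qed (use depth_ge1[of "- x"] in simp)
  then show "- (rho t * depth (- x)) \<le> val u t x $ i" by (simp add: veq mult_ac)
qed

end

context coupled_system
begin

section \<open>Monotone iteration\<close>

lemma admissibleI:
  assumes "\<And>t. antimono (u t)" "in_strip u" "AE q in lebesgue. (\<lambda>t. u t q) \<in> borel_measurable lebesgue"
  shows "admissible u"
  unfolding admissible_def using assms in_strip_bounded[OF assms(2)] unfolding bounded_by_def by blast

definition top_barrier :: "real \<Rightarrow> real ^ 'd \<Rightarrow> real ^ 'm" where
  "top_barrier t x = (if t \<in> {0..T} then (rho t * depth x) *\<^sub>R 1 else 0)"

lemma in_strip_top_barrier: "in_strip top_barrier"
proof -
  have "- (rho t * depth (- x)) \<le> rho t * depth x" for t and x :: "real ^ 'd"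
    using mult_nonneg_nonneg[OF less_imp_le[OF rho_pos[of t]], of "depth x"] mult_nonneg_nonneg[OF less_imp_le[OF rho_pos[of t]], of "depth (- x)"]
      depth_ge1[of x] depth_ge1[of "- x"] by linarith
  then show ?thesis by (simp add: in_strip_def top_barrier_def)
qed

lemma admissible_top_barrier: "admissible top_barrier"
proof (rule admissibleI)
  show "antimono (top_barrier t)" for t
  proof (rule antimonoI)
    fix x y :: "real ^ 'd" assume "x \<le> y"
    then have "rho t * depth y \<le> rho t * depth x" using rho_pos[of t] by (intro mult_left_mono depth_antimono) auto
    then show "top_barrier t y \<le> top_barrier t x" by (simp add: top_barrier_def less_eq_vec_def)
  qed
  have c: "continuous_on {0..T} rho"
    unfolding rho_def by (intro continuous_intros indefinite_integral_continuous_1' K_int)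
  have "continuous_on {0..T} (\<lambda>t. (rho t * depth q) *\<^sub>R (1 :: real ^ 'm))" for q :: "real ^ 'd"
    by (intro continuous_on_scaleR continuous_on_mult c continuous_on_const)
  then have "(\<lambda>t. (rho t * depth q) *\<^sub>R (1 :: real ^ 'm)) \<in> borel_measurable (lebesgue_on {0..T})" for q :: "real ^ 'd"
    by (rule continuous_imp_measurable_on_sets_lebesgue) auto
  then have "(\<lambda>t. top_barrier t q) \<in> borel_measurable lebesgue" for q
    unfolding top_barrier_def by (subst borel_measurable_if) auto
  then show "AE q in lebesgue. (\<lambda>t. top_barrier t q) \<in> borel_measurable lebesgue" by simp
qed (rule in_strip_top_barrier)

text \<open>The regularisation makes the iterates upper semicontinuous at every point.\<close>

definition regularized_val :: "(real \<Rightarrow> real ^ 'd \<Rightarrow> real ^ 'm) \<Rightarrow> real \<Rightarrow> real ^ 'd \<Rightarrow> real ^ 'm" where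
  "regularized_val u t x = (if t \<in> {0..T} then left_inf (val u t) x else 0)"

lemma regularized_val:
  assumes u: "admissible u" and strip: "in_strip u"
  shows "admissible (regularized_val u)" and "in_strip (regularized_val u)"
proof -
  have anti: "antimono (regularized_val u t)" for t
  proof (cases "t \<in> {0..T}")
    case True
    then show ?thesis using left_inf_antimono[OF val_below[OF u True]] by (simp add: antimono_def regularized_val_def)
  next
    case False
    then have "regularized_val u t = (\<lambda>_. 0)" by (auto simp: regularized_val_def fun_eq_iff)
    then show ?thesis by (simp add: antimono_def)
  qed
  show strip': "in_strip (regularized_val u)"
    unfolding in_strip_def
  proof (intro ballI allI conjI)
    fix t x i assume t: "t \<in> {0..T}"
    have "- (rho t * depth (- x)) \<le> left_inf (val u t) x $ i"
      by (rule left_inf_ge_pointwise[OF val_below[OF u t]]) (rule val_in_strip[OF u strip t])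
    then show "- (rho t * depth (- x)) \<le> regularized_val u t x $ i" using t by (simp add: regularized_val_def)
    have "left_inf (val u t) x $ i \<le> rho t * depth x"
      by (rule left_inf_le_continuous[OF val_below[OF u t], of "\<lambda>x. rho t * depth x"])
        (intro continuous_intros depth_continuous val_in_strip[OF u strip t])+
    then show "regularized_val u t x $ i \<le> rho t * depth x" using t by (simp add: regularized_val_def)
  qed
  have inter: "interlaced (regularized_val u) u"
    unfolding interlaced_def
  proof (intro ballI allI impI conjI)
    fix t y z assume t: "t \<in> {0..T}" and yz: "(y :: real ^ 'd) \<lless> z"
    show "regularized_val u t z \<le> val u t y" using left_inf_lower[OF val_below[OF u t] yz] t by (simp add: regularized_val_def)
    have "val u t z \<le> val u t y" by (rule antimono_belowD[OF val_below[OF u t] yz])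
    also have "... \<le> left_inf (val u t) y" by (rule left_inf_ge[OF val_below[OF u t]])
    finally show "val u t z \<le> regularized_val u t y" using t by (simp add: regularized_val_def)
  qed
  have "jointly_continuous T (regularized_val u)"
    by (rule interlaced_jointly_continuous[OF u inter in_strip_bounded[OF strip']])
  from jointly_continuous_AE(2)[OF this anti]
  have "AE q in lebesgue. (\<lambda>t. regularized_val u t q) \<in> borel_measurable lebesgue"
    by (simp add: regularized_val_def cong: if_cong)
  with anti strip' show "admissible (regularized_val u)" by (rule admissibleI)
qed

primrec iter :: "nat \<Rightarrow> real \<Rightarrow> real ^ 'd \<Rightarrow> real ^ 'm" where
  "iter 0 = top_barrier"
| "iter (Suc n) = regularized_val (iter n)"

lemma iter_admissible: "admissible (iter n)" and iter_in_strip: "in_strip (iter n)"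
proof -
  have "admissible (iter n) \<and> in_strip (iter n)"
    by (induction n) (simp_all add: admissible_top_barrier in_strip_top_barrier regularized_val)
  then show "admissible (iter n)" "in_strip (iter n)" by simp_all
qed

lemma iter_outside: "t \<notin> {0..T} \<Longrightarrow> iter n t x = 0"
  by (cases n) (auto simp: top_barrier_def regularized_val_def)

lemma iter_decreasing: "iter (Suc n) t x \<le> iter n t x"
proof (cases "t \<in> {0..T}")
  case False
  show ?thesis unfolding iter_outside[OF False] by (rule order_refl)
next
  case True
  then show ?thesis
  proof (induction n arbitrary: t x)
    case 0
    then show ?case using iter_in_strip[of "Suc 0"] by (auto simp: in_strip_def top_barrier_def less_eq_vec_def)
  next
    case (Suc n)
    have "left_inf (val (iter (Suc n)) t) x \<le> left_inf (val (iter n) t) x"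
    proof (rule left_inf_greatest)
      fix z assume "z \<lless> x"
      then obtain z1 where z: "z \<lless> z1" "z1 \<lless> x" using strictly_below_dense by blast
      have "left_inf (val (iter (Suc n)) t) x \<le> val (iter (Suc n)) t z1"
        by (rule left_inf_lower[OF val_below[OF iter_admissible Suc.prems] z(2)])
      also have "... \<le> val (iter n) t z"
        by (rule val_compare[OF iter_admissible iter_admissible Suc.IH Suc.prems z(1)])
      finally show "left_inf (val (iter (Suc n)) t) x \<le> val (iter n) t z" .
    qed
    then show ?case using Suc.prems by (simp add: regularized_val_def)
  qed
qed

definition maximal :: "real \<Rightarrow> real ^ 'd \<Rightarrow> real ^ 'm" where
  "maximal t x = (\<chi> i. INF n. iter n t x $ i)"

lemma maximal_limit: "(\<lambda>n. iter n t x) \<longlonglongrightarrow> maximal t x"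
proof (rule vec_tendstoI)
  fix i
  have "bdd_below (range (\<lambda>n. iter n t x $ i))"
  proof (cases "t \<in> {0..T}")
    case True
    then show ?thesis using iter_in_strip by (intro bdd_belowI2[of _ "- (rho t * depth (- x))"]) (auto simp: in_strip_def)
  next
    case False
    then show ?thesis by (simp add: iter_outside)
  qed
  then show "(\<lambda>n. iter n t x $ i) \<longlonglongrightarrow> maximal t x $ i"
    unfolding maximal_def using iter_decreasing
    by (simp add: LIMSEQ_decseq_INF decseq_SucI less_eq_vec_def)
qed

lemma vec_limit_le:
  fixes X :: "nat \<Rightarrow> real ^ 'n"
  assumes "X \<longlonglongrightarrow> a"
  shows "(\<And>n. X n \<le> b) \<Longrightarrow> a \<le> b" and "(\<And>n. b \<le> X n) \<Longrightarrow> b \<le> a"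
  using LIMSEQ_le_const2[OF tendsto_vec_nth[OF assms]] LIMSEQ_le_const[OF tendsto_vec_nth[OF assms]]
  by (simp_all add: less_eq_vec_def)

lemma maximal_le_iter: "maximal t x \<le> iter n t x"
proof (rule vec_limit_le(1)[OF LIMSEQ_ignore_initial_segment[OF maximal_limit]])
  fix k
  show "iter (k + n) t x \<le> iter n t x"
  proof (induction k)
    case (Suc k)
    show ?case using order_trans[OF iter_decreasing[of "k + n"] Suc] by simp
  qed simp
qed

lemma maximal_greatest: "(\<And>n. v \<le> iter n t x) \<Longrightarrow> v \<le> maximal t x"
  by (rule vec_limit_le(2)[OF maximal_limit])

lemma maximal_antimono: "antimono (maximal t)"
proof (rule antimonoI, rule maximal_greatest)
  fix x y :: "real ^ 'd" and n assume "x \<le> y"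
  have "maximal t y \<le> iter n t y" by (rule maximal_le_iter)
  also have "... \<le> iter n t x" by (rule antimonoD[OF admissible_antimono[OF iter_admissible] `x \<le> y`])
  finally show "maximal t y \<le> iter n t x" .
qed

lemma maximal_in_strip: "in_strip maximal"
  unfolding in_strip_def
proof (intro ballI allI conjI)
  fix t x i assume t: "t \<in> {0..T}"
  have lim: "(\<lambda>n. iter n t x $ i) \<longlonglongrightarrow> maximal t x $ i" by (rule tendsto_vec_nth[OF maximal_limit])
  show "- (rho t * depth (- x)) \<le> maximal t x $ i"
    by (rule LIMSEQ_le_const[OF lim]) (use iter_in_strip t in "auto simp: in_strip_def")
  show "maximal t x $ i \<le> rho t * depth x"
    by (rule LIMSEQ_le_const2[OF lim]) (use iter_in_strip t in "auto simp: in_strip_def")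
qed

lemma maximal_admissible: "admissible maximal"
proof (rule admissibleI[OF maximal_antimono maximal_in_strip])
  have "AE q in lebesgue. \<forall>n. (\<lambda>t. iter n t q) \<in> borel_measurable lebesgue"
    unfolding AE_all_countable using iter_admissible by (simp add: admissible_def)
  then show "AE q in lebesgue. (\<lambda>t. maximal t q) \<in> borel_measurable lebesgue"
  proof eventually_elim
    case (elim q)
    show ?case by (rule borel_measurable_LIMSEQ_metric[OF _ maximal_limit]) (use elim in blast)
  qed
qed

lemma maximal_upper_semicontinuous: assumes t: "t \<in> {0..T}" shows "upper_semicontinuous (maximal t)"
proof -
  have b: "antimono_below (maximal t)" by (rule antimono_imp_antimono_below[OF maximal_antimono])
  have "left_inf (maximal t) x = maximal t x" for x
  proof (rule antisym)
    show "left_inf (maximal t) x \<le> maximal t x"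
    proof (rule vec_limit_le(2)[OF LIMSEQ_Suc[OF maximal_limit]])
      fix n
      have below: "antimono_below (val (iter n) t)" by (rule val_below[OF iter_admissible t])
      have eq: "iter (Suc n) t = left_inf (val (iter n) t)" using t by (simp add: regularized_val_def fun_eq_iff)
      have "left_inf (maximal t) x \<le> left_inf (iter (Suc n) t) x"
      proof (rule left_inf_greatest)
        fix z assume "z \<lless> x"
        then have "left_inf (maximal t) x \<le> maximal t z" by (rule left_inf_lower[OF b])
        also have "... \<le> iter (Suc n) t z" by (rule maximal_le_iter)
        finally show "left_inf (maximal t) x \<le> iter (Suc n) t z" .
      qed
      also have "... \<le> iter (Suc n) t x" unfolding eq by (rule left_inf_idem[OF below])
      finally show "left_inf (maximal t) x \<le> iter (Suc n) t x" .
    qed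
  qed (rule left_inf_ge[OF b])
  then have "left_inf (maximal t) = maximal t" by (rule ext)
  then show ?thesis using left_inf_upper_semicontinuous[OF b] by simp
qed

lemma vel_iter_limit: "(\<lambda>n. vel (iter n) s z) \<longlonglongrightarrow> vel maximal s z"
  and src_iter_limit: "(\<lambda>n. src (iter n) s z) \<longlonglongrightarrow> src maximal s z"
proof -
  have f: "isCont (f s z) v" and g: "isCont (g s z) v" for v
    using f_cont[of s z] g_cont[of s z] by (simp_all add: continuous_on_eq_continuous_at)
  show "(\<lambda>n. vel (iter n) s z) \<longlonglongrightarrow> vel maximal s z"
    unfolding vel_def by (rule isCont_tendsto_compose[OF f maximal_limit])
  show "(\<lambda>n. src (iter n) s z) \<longlonglongrightarrow> src maximal s z"
    unfolding src_def by (intro tendsto_add tendsto_scaleR tendsto_const isCont_tendsto_compose[OF g] maximal_limit)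
qed

text \<open>The flows of the iterates, started slightly higher, end up above the flow of the limit, where the
  terminal value and the source are smaller. Dominated convergence applies to \<open>max (a n) b\<close>, whose limit is
  \<open>b\<close>, although \<open>a n\<close> itself need not converge.\<close>

lemma maximal_le_val:
  assumes t: "t \<in> {0..T}" and yz: "y \<lless> z"
  shows "maximal t z \<le> val maximal t y"
proof -
  have t0: "0 \<le> t" "t \<le> T" using t by auto
  obtain y1 where y1: "y \<lless> y1" "y1 \<lless> z" using strictly_below_dense[OF yz] by blast
  define X where "X = (\<lambda>n s. Phi (iter n) s t y1)"
  define Y where "Y = (\<lambda>s. Phi maximal s t y)"
  have X: "trajectory C (vel (iter n)) t T (X n)" for n unfolding X_def by (rule Phi_trajectory[OF iter_admissible t0(1)])
  have Y: "trajectory C (vel maximal) t T Y" unfolding Y_def by (rule Phi_trajectory[OF maximal_admissible t0(1)])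
  have above: "\<forall>\<^sub>F n in sequentially. Y s \<lless> X n s" if "s \<in> {t..T}" for s
    unfolding X_def Y_def
    by (rule flow_eventually_above[OF field[OF iter_admissible] field[OF maximal_admissible] _ vel_iter_limit t0(1) that y1(1)])
      (rule vel_antimono[where u = "iter (Suc n)" and v = "iter n" for n, OF iter_decreasing])
  show ?thesis unfolding less_eq_vec_def
  proof
    fix i
    define a where "a = (\<lambda>n s. w t s * left_inf (src (iter n) s) (X n s) $ i)"
    define b where "b = (\<lambda>s. w t s * left_inf (src maximal s) (Y s) $ i)"
    have aI: "(\<lambda>s. w t s *\<^sub>R left_inf (src (iter n) s) (X n s)) integrable_on {t..T}" for n
      by (rule path_integrable_HK[OF iter_admissible t0 X]) auto
    have bI: "(\<lambda>s. w t s *\<^sub>R left_inf (src maximal s) (Y s)) integrable_on {t..T}"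
      by (rule path_integrable_HK[OF maximal_admissible t0 Y]) auto
    have aint: "a n integrable_on {t..T}" for n
      using integrable_nth[where i=i, OF aI] by (simp add: o_def a_def)
    have bint: "b integrable_on {t..T}"
      using integrable_nth[where i=i, OF bI] by (simp add: o_def b_def)
    have aval: "val (iter n) t y1 $ i = w t T * uT (X n T) $ i + integral {t..T} (a n)" for n
      using integral_nth[where i=i, OF aI[of n]] by (simp add: val_def o_def a_def X_def)
    have bval: "val maximal t y $ i = w t T * uT (Y T) $ i + integral {t..T} b"
      using integral_nth[where i=i, OF bI] by (simp add: val_def o_def b_def Y_def)
    define c where "c = lc (rho 0) * (1 + norm y1) + lc (rho 0) * (1 + norm y)"
    have lc0: "0 \<le> lc (rho 0)" by (rule lc_nonneg) (rule less_imp_le[OF rho_pos])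
    have bound: "\<bar>w t s * r\<bar> \<le> G s * c" if "\<bar>r\<bar> \<le> G s * (lc (rho 0) * (1 + norm q))" "q = y \<or> q = y1" for s r and q :: "real ^ 'd"
    proof -
      have "lc (rho 0) * (1 + norm q) \<le> c"
        using that(2) mult_nonneg_nonneg[OF lc0, of "1 + norm y"] mult_nonneg_nonneg[OF lc0, of "1 + norm y1"] by (auto simp: c_def)
      then have "G s * (lc (rho 0) * (1 + norm q)) \<le> G s * c" by (rule mult_left_mono) (rule G_nonneg)
      then have "\<bar>r\<bar> \<le> G s * c" using that(1) by linarith
      moreover have "w t s * \<bar>r\<bar> \<le> 1 * \<bar>r\<bar>" by (rule mult_right_mono[OF w_le1]) simp
      ultimately show ?thesis using w_pos[of t s] by (simp add: abs_mult)
    qed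
    have abd: "\<bar>a n s\<bar> \<le> G s * c" if s: "s \<in> {t..T}" for n s
      unfolding a_def using path_left_src_bound[OF iter_admissible in_strip_bounded[OF iter_in_strip] t0(1) s X, of n i]
      by (intro bound[of _ s y1]) (simp_all add: X_def Phi_start[OF iter_admissible t0(1)])
    have bbd: "\<bar>b s\<bar> \<le> G s * c" if s: "s \<in> {t..T}" for s
      unfolding b_def using path_left_src_bound[OF maximal_admissible in_strip_bounded[OF maximal_in_strip] t0(1) s Y, of i]
      by (intro bound[of _ s y]) (simp_all add: Y_def Phi_start[OF maximal_admissible t0(1)])
    have lim: "(\<lambda>n. max (a n s) (b s)) \<longlonglongrightarrow> b s" if s: "s \<in> {t..T}" for s
    proof (rule tendsto_sandwich[of "\<lambda>_. b s" _ _ "\<lambda>n. max (w t s * src (iter n) s (Y s) $ i) (b s)"])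
      show "\<forall>\<^sub>F n in sequentially. max (a n s) (b s) \<le> max (w t s * src (iter n) s (Y s) $ i) (b s)"
        using above[OF s]
      proof eventually_elim
        case (elim n)
        have "left_inf (src (iter n) s) (X n s) \<le> src (iter n) s (Y s)"
          by (rule left_inf_lower[OF src_below[of "iter n" s, OF admissible_antimono[OF iter_admissible]] elim])
        then have "a n s \<le> w t s * src (iter n) s (Y s) $ i"
          unfolding a_def using w_pos[of t s] by (intro mult_left_mono) (auto simp: less_eq_vec_def)
        then show ?case by simp
      qed
      have "src maximal s (Y s) \<le> left_inf (src maximal s) (Y s)"
        by (rule left_inf_ge[OF src_below[of maximal s, OF maximal_antimono]])
      then have "w t s * src maximal s (Y s) $ i \<le> b s"
        unfolding b_def using w_pos[of t s] by (intro mult_left_mono) (auto simp: less_eq_vec_def)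
      then have "max (w t s * src maximal s (Y s) $ i) (b s) = b s" by simp
      moreover have "(\<lambda>n. max (w t s * src (iter n) s (Y s) $ i) (b s)) \<longlonglongrightarrow> max (w t s * src maximal s (Y s) $ i) (b s)"
        by (intro tendsto_max tendsto_mult tendsto_const tendsto_vec_nth src_iter_limit)
      ultimately show "(\<lambda>n. max (w t s * src (iter n) s (Y s) $ i) (b s)) \<longlonglongrightarrow> b s" by simp
    qed auto
    have Gc: "(\<lambda>s. G s * c) integrable_on {t..T}" by (intro integrable_on_mult_left G_sub t0)
    have maxint: "(\<lambda>s. max (a n s) (b s)) integrable_on {t..T}" for n
    proof (rule measurable_bounded_by_integrable_imp_integrable[OF _ Gc])
      show "(\<lambda>s. max (a n s) (b s)) \<in> borel_measurable (lebesgue_on {t..T})"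
        by (intro borel_measurable_max integrable_imp_measurable aint bint)
      show "norm (max (a n s) (b s)) \<le> G s * c" if "s \<in> {t..T}" for s
        using abd[OF that, of n] bbd[OF that] by (auto simp: max_def)
    qed auto
    have dc: "(\<lambda>n. integral {t..T} (\<lambda>s. max (a n s) (b s))) \<longlonglongrightarrow> integral {t..T} b"
    proof (rule dominated_convergence(2)[OF maxint Gc _ lim])
      show "norm (max (a n s) (b s)) \<le> G s * c" if "s \<in> {t..T}" for n s
        using abd[OF that, of n] bbd[OF that] by (auto simp: max_def)
    qed
    have "\<forall>\<^sub>F n in sequentially. maximal t z $ i \<le> w t T * uT (Y T) $ i + integral {t..T} (\<lambda>s. max (a n s) (b s))"
      using above[of T]
    proof (rule eventually_mono)
      fix n assume "Y T \<lless> X n T"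
      then have "uT (X n T) \<le> uT (Y T)" by (intro antimonoD[OF uT_antimono] strictly_below_imp_le)
      then have 1: "w t T * uT (X n T) $ i \<le> w t T * uT (Y T) $ i"
        using w_pos[of t T] by (intro mult_left_mono) (auto simp: less_eq_vec_def)
      have 2: "integral {t..T} (a n) \<le> integral {t..T} (\<lambda>s. max (a n s) (b s))"
        by (rule integral_le[OF aint maxint]) simp
      have "maximal t z \<le> iter (Suc n) t z" by (rule maximal_le_iter)
      also have "... \<le> val (iter n) t y1"
        using left_inf_lower[OF val_below[OF iter_admissible t] y1(2)] t by (simp add: regularized_val_def)
      finally have "maximal t z $ i \<le> val (iter n) t y1 $ i" by (simp add: less_eq_vec_def)
      then show "maximal t z $ i \<le> w t T * uT (Y T) $ i + integral {t..T} (\<lambda>s. max (a n s) (b s))"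
        using 1 2 aval[of n] by linarith
    qed (use t0 in auto)
    then show "maximal t z $ i \<le> val maximal t y $ i"
      unfolding bval by (rule tendsto_lowerbound[OF tendsto_add[OF tendsto_const dc]]) simp
  qed
qed

lemma val_le_maximal:
  assumes t: "t \<in> {0..T}" and yz: "y \<lless> z"
  shows "val maximal t z \<le> maximal t y"
proof (rule vec_limit_le(2)[OF LIMSEQ_Suc[OF maximal_limit]])
  fix n
  have "val maximal t z \<le> left_inf (val (iter n) t) y"
  proof (rule left_inf_greatest)
    fix y' assume "y' \<lless> y"
    then have "y' \<lless> z" using yz by (rule strictly_below_trans)
    then show "val maximal t z \<le> val (iter n) t y'"
      by (rule val_compare[OF maximal_admissible iter_admissible maximal_le_iter t])
  qed
  then show "val maximal t z \<le> iter (Suc n) t y" using t by (simp add: regularized_val_def)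
qed

lemma maximal_jointly_continuous: "jointly_continuous T maximal"
  by (rule interlaced_jointly_continuous[OF maximal_admissible _ in_strip_bounded[OF maximal_in_strip]])
    (simp add: interlaced_def maximal_le_val val_le_maximal)

lemma maximal_char_solution: "char_solution maximal"
  by (rule val_fixed_point_char_solution[OF maximal_admissible AE_eq_of_strict_comparison[OF maximal_le_val val_le_maximal]])

section \<open>Maximality\<close>

text \<open>The part of the solution that comes from the terminal value obeys the bound with \<open>\<alpha> = 1\<close>, which
  lowers \<open>\<alpha>\<close> by a fixed proportion of \<open>\<alpha> - 1\<close>.\<close>

lemma char_solution_contraction:
  assumes sol: "char_solution v" and anti: "\<And>t. antimono (v t)" and \<alpha>: "1 \<le> \<alpha>"
    and le: "AE t in lebesgue. t \<in> {0..T} \<longrightarrow> (\<forall>x i. v t x $ i \<le> \<alpha> * (rho t * depth x))"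
    and t: "t \<in> {0..T}"
  shows "v t x $ i \<le> (\<alpha> - (\<alpha> - 1) * exp (- integral {0..T} G)) * (rho t * depth x)"
proof -
  have t0: "0 \<le> t" "t \<le> T" using t by auto
  show ?thesis
  proof (rule antimono_le_continuous[OF anti, of "\<lambda>x. (\<alpha> - (\<alpha> - 1) * exp (- integral {0..T} G)) * (rho t * depth x)"])
    show "continuous_on UNIV (\<lambda>x. (\<alpha> - (\<alpha> - 1) * exp (- integral {0..T} G)) * (rho t * depth x))"
      by (intro continuous_intros depth_continuous)
    show "AE x in lebesgue. v t x $ i \<le> (\<alpha> - (\<alpha> - 1) * exp (- integral {0..T} G)) * (rho t * depth x)"
      using sol[unfolded char_solution_def, rule_format, OF t]
    proof eventually_elim
      case (elim x)
      then obtain y where y: "trajectory C (vel v) t T y" "y t = x"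
        and int: "(\<lambda>s. w t s *\<^sub>R src v s (y s)) integrable_on {t..T}"
        and eq: "v t x = w t T *\<^sub>R uT (y T) + integral {t..T} (\<lambda>s. w t s *\<^sub>R src v s (y s))"
        using set_lebesgue_integral_eq_integral(1) unfolding represents_def by blast
      note along = depth_along(1)[OF anti t0(1) y(1), unfolded y(2)]
      have "w t T * uT (y T) $ i + integral {t..T} (\<lambda>s. w t s * src v s (y s) $ i) \<le> depth x * (rho t * (\<alpha> - (\<alpha> - 1) * exp (- integral {t..T} G)))"
      proof (rule value_bound[OF t0 \<alpha>])
        show "uT (y T) $ i \<le> A * (depth x * exp (L * integral {t..T} K))"
          by (rule order_trans[OF uT_upper mult_left_mono[OF along]]) (use t0 A in auto)
        show "(\<lambda>s. w t s * src v s (y s) $ i) integrable_on {t..T}"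
          using integrable_nth[where i=i, OF int] by (simp add: o_def)
        show "AE s in lebesgue. s \<in> {t..T} \<longrightarrow> src v s (y s) $ i \<le> G s * (\<alpha> * (rho s * (depth x * exp (L * integral {t..s} K))))"
          using le
        proof eventually_elim
          case (elim s)
          show ?case
          proof
            assume s: "s \<in> {t..T}"
            then have s': "s \<in> {0..T}" using t0 by auto
            then have "1 \<le> rho s" using rho_ge1[of s] by simp
            then have "1 \<le> \<alpha> * rho s" using mult_mono[OF \<alpha>, of 1 "rho s"] \<alpha> by simp
            then have "1 \<le> \<alpha> * rho s * depth (y s)" by (rule mult_depth_ge1)
            moreover have "\<alpha> * rho s * depth (y s) = \<alpha> * (rho s * depth (y s))" by simp
            ultimately have "src v s (y s) $ i \<le> G s * (\<alpha> * (rho s * depth (y s)))"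
              using elim s' by (intro src_le) auto
            also have "... \<le> G s * (\<alpha> * (rho s * (depth x * exp (L * integral {t..s} K))))"
              using \<alpha> by (intro mult_left_mono along s G_nonneg less_imp_le[OF rho_pos]) auto
            finally show "src v s (y s) $ i \<le> G s * (\<alpha> * (rho s * (depth x * exp (L * integral {t..s} K))))" .
          qed
        qed
      qed (use depth_ge1[of x] in simp)
      also have "... \<le> depth x * (rho t * (\<alpha> - (\<alpha> - 1) * exp (- integral {0..T} G)))"
      proof -
        have "integral {t..T} G \<le> integral {0..T} G"
          by (rule integral_subset_le) (use t0 G_sub G_nonneg in auto)
        then show ?thesis using \<alpha> depth_ge1[of x] rho_pos[of t] by (intro mult_left_mono diff_left_mono) auto
      qed
      finally show ?case
        using integral_nth[where i=i, OF int] unfolding eq by (simp add: o_def mult_ac)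
    qed
  qed
qed

lemma char_solution_le_top_barrier:
  assumes sol: "char_solution v" and anti: "\<And>t. antimono (v t)" and B: "0 \<le> B"
    and bound: "AE t in lebesgue. t \<in> {0..T} \<longrightarrow> (\<forall>x i. \<bar>v t x $ i\<bar> \<le> B * (1 + norm x))"
    and t: "t \<in> {0..T}"
  shows "v t x $ i \<le> rho t * depth x"
proof -
  define q where "q = 1 - exp (- integral {0..T} G)"
  have q: "0 \<le> q" "q < 1" using integral_nonneg[OF G_sub G_nonneg, of 0 T] by (simp_all add: q_def)
  define \<beta> where "\<beta> = B * (1 + real CARD('d))"
  have \<beta>: "0 \<le> \<beta>" using B by (simp add: \<beta>_def)
  have start: "AE t in lebesgue. t \<in> {0..T} \<longrightarrow> (\<forall>x i. v t x $ i \<le> (1 + \<beta>) * (rho t * depth x))"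
    using bound
  proof eventually_elim
    case (elim t)
    show ?case
    proof (intro impI allI)
      fix x i assume t: "t \<in> {0..T}"
      have "v t x $ i \<le> \<beta> * depth x"
        unfolding \<beta>_def by (rule antimono_upper_depth[OF anti _ B]) (use elim t in auto)
      also have "... \<le> (1 + \<beta>) * (rho t * depth x)"
        using \<beta> depth_ge1[of x] rho_ge1[of t] t mult_right_mono[of 1 "rho t" "depth x"] by (intro mult_mono) auto
      finally show "v t x $ i \<le> (1 + \<beta>) * (rho t * depth x)" .
    qed
  qed
  have eq: "(1 + \<beta> * q ^ n) - ((1 + \<beta> * q ^ n) - 1) * exp (- integral {0..T} G) = 1 + \<beta> * q ^ Suc n" for n
    by (simp add: q_def algebra_simps)
  have ge1: "1 \<le> 1 + \<beta> * q ^ n" for n using \<beta> q by simp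
  note step = char_solution_contraction[OF sol anti ge1, unfolded eq]
  have all: "AE t in lebesgue. t \<in> {0..T} \<longrightarrow> (\<forall>x i. v t x $ i \<le> (1 + \<beta> * q ^ n) * (rho t * depth x))" for n
  proof (induction n)
    case 0
    then show ?case using start by simp
  next
    case (Suc n)
    show ?case using step[OF Suc] by (intro AE_I2) blast
  qed
  have "v t x $ i \<le> (1 + \<beta> * q ^ Suc n) * (rho t * depth x)" for n
    by (rule step[OF all t])
  moreover have "(\<lambda>n. (1 + \<beta> * q ^ Suc n) * (rho t * depth x)) \<longlonglongrightarrow> (1 + \<beta> * 0) * (rho t * depth x)"
    using q by (intro tendsto_intros LIMSEQ_Suc LIMSEQ_power_zero) auto
  ultimately have "v t x $ i \<le> (1 + \<beta> * 0) * (rho t * depth x)" by (intro LIMSEQ_le_const) auto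
  then show ?thesis by simp
qed

theorem char_solution_le_maximal:
  assumes sol: "char_solution v" and anti: "\<And>t. antimono (v t)" and B: "0 \<le> B"
    and bound: "AE t in lebesgue. t \<in> {0..T} \<longrightarrow> (\<forall>x i. \<bar>v t x $ i\<bar> \<le> B * (1 + norm x))"
    and t: "t \<in> {0..T}"
  shows "v t x \<le> maximal t x"
proof (rule maximal_greatest)
  fix n show "v t x \<le> iter n t x"
    using t
  proof (induction n arbitrary: t x)
    case 0
    then show ?case
      using char_solution_le_top_barrier[OF sol anti B bound] by (simp add: top_barrier_def less_eq_vec_def)
  next
    case (Suc n)
    have "AE s in lebesgue. s \<in> {0..T} \<longrightarrow> (\<forall>z. v s z \<le> iter n s z)"
      using Suc.IH by (intro AE_I2) blast
    from char_solution_le[OF sol anti iter_admissible this Suc.prems, of x]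
    show ?case using Suc.prems by (simp add: regularized_val_def)
  qed
qed

end

section \<open>Reflection\<close>

lemma trajectory_reflect:
  assumes "trajectory C b a c y"
  shows "trajectory C (\<lambda>t x. - b t (- x)) a c (\<lambda>t. - y t)"
  unfolding trajectory_def
proof
  show "AC a c (\<lambda>t. - y t)"
    using assms AC_bounded_linear[OF _ bounded_linear_minus[OF bounded_linear_ident]]
    by (auto simp: trajectory_def)
  have "AE t in lebesgue. a < t \<and> t < c \<longrightarrow> (\<exists>v. (y has_vector_derivative v) (at t) \<and>
        (\<forall>z. z \<lless> y t \<longrightarrow> b t z + C t *\<^sub>R z \<le> v + C t *\<^sub>R y t) \<and>
        (\<forall>z. y t \<lless> z \<longrightarrow> v + C t *\<^sub>R y t \<le> b t z + C t *\<^sub>R z))"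
    using assms by (simp add: trajectory_def)
  then show "AE t in lebesgue. a < t \<and> t < c \<longrightarrow> (\<exists>v. ((\<lambda>t. - y t) has_vector_derivative v) (at t) \<and>
        (\<forall>z. z \<lless> - y t \<longrightarrow> - b t (- z) + C t *\<^sub>R z \<le> v + C t *\<^sub>R (- y t)) \<and>
        (\<forall>z. - y t \<lless> z \<longrightarrow> v + C t *\<^sub>R (- y t) \<le> - b t (- z) + C t *\<^sub>R z))"
  proof eventually_elim
    case (elim t)
    show ?case
    proof
      assume "a < t \<and> t < c"
      with elim obtain v where v: "(y has_vector_derivative v) (at t)"
        "\<And>z. z \<lless> y t \<Longrightarrow> b t z + C t *\<^sub>R z \<le> v + C t *\<^sub>R y t"
        "\<And>z. y t \<lless> z \<Longrightarrow> v + C t *\<^sub>R y t \<le> b t z + C t *\<^sub>R z" by blast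
      have "((\<lambda>t. - y t) has_vector_derivative - v) (at t)" by (rule has_vector_derivative_minus[OF v(1)])
      moreover have "- b t (- z) + C t *\<^sub>R z \<le> - v + C t *\<^sub>R (- y t)" if "z \<lless> - y t" for z
      proof -
        have "y t \<lless> - z" using that by (simp add: strictly_below_def less_minus_iff)
        from v(3)[OF this] show ?thesis by (auto simp: less_eq_vec_def algebra_simps)
      qed
      moreover have "- v + C t *\<^sub>R (- y t) \<le> - b t (- z) + C t *\<^sub>R z" if "- y t \<lless> z" for z
      proof -
        have "- z \<lless> y t" using that by (simp add: strictly_below_def minus_less_iff)
        from v(2)[OF this] show ?thesis by (auto simp: less_eq_vec_def algebra_simps)
      qed
      ultimately show "\<exists>v. ((\<lambda>t. - y t) has_vector_derivative v) (at t) \<and>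
        (\<forall>z. z \<lless> - y t \<longrightarrow> - b t (- z) + C t *\<^sub>R z \<le> v + C t *\<^sub>R (- y t)) \<and>
        (\<forall>z. - y t \<lless> z \<longrightarrow> v + C t *\<^sub>R (- y t) \<le> - b t (- z) + C t *\<^sub>R z)" by blast
    qed
  qed
qed

definition reflect :: "(real \<Rightarrow> real ^ 'd \<Rightarrow> real ^ 'm) \<Rightarrow> real \<Rightarrow> real ^ 'd \<Rightarrow> real ^ 'm" where
  "reflect u t x = - u t (- x)"

lemma antimono_reflect: "antimono (u t) \<Longrightarrow> antimono (reflect u t)"
  unfolding antimono_def reflect_def by (simp add: vec_minus_le_minus)

lemma lower_semicontinuous_reflect:
  assumes "upper_semicontinuous (u t)" shows "lower_semicontinuous (reflect u t)"
  unfolding lower_semicontinuous_def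
proof (intro allI)
  fix i x
  have env: "lower_env (\<lambda>y. reflect u t y $ i) x = - upper_env (\<lambda>y. u t y $ i) (- x)"
    using lower_env_reflect[of "\<lambda>y. u t y $ i" x] by (simp add: reflect_def)
  have "- ereal (u t (- x) $ i) \<le> - upper_env (\<lambda>y. u t y $ i) (- x)"
    using assms unfolding upper_semicontinuous_def ereal_minus_le_minus by blast
  then show "ereal (reflect u t x $ i) \<le> lower_env (\<lambda>y. reflect u t y $ i) x"
    unfolding env by (simp add: reflect_def)
qed

lemma jointly_continuous_reflect:
  fixes u :: "real \<Rightarrow> real ^ 'd \<Rightarrow> real ^ 'm"
  assumes "jointly_continuous T u" shows "jointly_continuous T (reflect u)"
  unfolding jointly_continuous_def
proof (intro ballI allI impI)
  fix t x assume t: "t \<in> {0..T}" and c: "isCont (reflect u t) x"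
  have "isCont (\<lambda>z. - reflect u t (- z)) (- x)"
    by (intro continuous_minus isCont_o2[where f = uminus and g = "reflect u t"]) (use c in "auto intro: continuous_intros")
  then have "isCont (u t) (- x)" by (simp add: reflect_def)
  then have lim: "((\<lambda>(t, x). u t x) \<longlongrightarrow> u t (- x)) (at (t, - x) within {0..T} \<times> UNIV)"
    using assms t unfolding jointly_continuous_def continuous_within by fastforce
  have fl: "filterlim (\<lambda>z. (fst z, - snd z)) (at (t, - x) within {0..T} \<times> UNIV) (at (t, x) within {0..T} \<times> UNIV)"
    unfolding filterlim_at
  proof
    show "((\<lambda>z. (fst z, - snd z)) \<longlongrightarrow> (t, - x)) (at (t, x) within {0..T} \<times> UNIV)"
      by (auto intro!: tendsto_eq_intros)
    show "\<forall>\<^sub>F z in at (t, x) within {0..T} \<times> UNIV. (fst z, - snd z) \<in> {0..T} \<times> UNIV \<and> (fst z, - snd z) \<noteq> (t, - x)"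
      unfolding eventually_at_filter by (rule eventually_mono[OF eventually_True]) auto
  qed
  have "((\<lambda>z. - (case (fst z, - snd z) of (t, x) \<Rightarrow> u t x)) \<longlongrightarrow> - u t (- x)) (at (t, x) within {0..T} \<times> UNIV)"
    by (intro tendsto_minus filterlim_compose[OF lim fl])
  then show "continuous (at (t, x) within {0..T} \<times> UNIV) (\<lambda>(t, x). reflect u t x)"
    by (simp add: continuous_within reflect_def case_prod_unfold)
qed

context coupled_system
begin

lemma reflected_system:
  "coupled_system (\<lambda>t x u. - f t (- x) (- u)) (\<lambda>t x u. - g t (- x) (- u)) C K T L A (\<lambda>x. - uT (- x))"
proof
  show "0 < T" by (rule T)
  show "- f t (- x) (- u) + C t *\<^sub>R x \<le> - f t (- y) (- u) + C t *\<^sub>R y" if "x \<le> y" for t x y u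
    using f_mono[of "- y" "- x" t "- u"] that by (auto simp: less_eq_vec_def algebra_simps)
  show "- f t (- x) (- v) \<le> - f t (- x) (- u)" if "u \<le> v" for t x u v
    using f_antimono[of "- v" "- u" t "- x"] that by (simp add: vec_minus_le_minus)
  show "- g t (- x) (- u) + C t *\<^sub>R u \<le> - g t (- x) (- v) + C t *\<^sub>R v" if "u \<le> v" for t x u v
    using g_mono[of "- v" "- u" t "- x"] that by (auto simp: less_eq_vec_def algebra_simps)
  show "- g t (- y) (- u) \<le> - g t (- x) (- u)" if "x \<le> y" for t x y u
    using g_antimono[of "- y" "- x" t "- u"] that by (simp add: vec_minus_le_minus)
  show "norm (- f t (- x) (- u)) \<le> K t * (1 + norm x)" for t x u using f_bound[of t "- x" "- u"] by simp
  show "norm (- g t (- x) (- u)) \<le> K t * (1 + norm u)" for t x u using g_bound[of t "- x" "- u"] by simp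
  show "continuous_on UNIV (\<lambda>u. - f t (- x) (- u))" for t x
    by (intro continuous_on_minus continuous_on_compose2[OF f_cont]) (auto intro: continuous_intros)
  show "continuous_on UNIV (\<lambda>u. - g t (- x) (- u))" for t x
    by (intro continuous_on_minus continuous_on_compose2[OF g_cont]) (auto intro: continuous_intros)
  have lin: "linear (uminus :: real ^ 'd \<Rightarrow> _)" by (rule linear_uminus)
  show "AE q in lebesgue. \<forall>u. (\<lambda>t. - f t (- q) (- u)) \<in> borel_measurable lebesgue"
    using AE_lebesgue_image[OF f_meas lin minus_minus] by eventually_elim (auto intro: borel_measurable_uminus)
  show "AE q in lebesgue. \<forall>u. (\<lambda>t. - g t (- q) (- u)) \<in> borel_measurable lebesgue"
    using AE_lebesgue_image[OF g_meas lin minus_minus] by eventually_elim (auto intro: borel_measurable_uminus)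
  show "antimono (\<lambda>x. - uT (- x))"
    using uT_antimono unfolding antimono_def by (simp add: vec_minus_le_minus)
  show "(- uT (- x)) $ i \<le> A * depth x" for x i using uT_lower[of "- x" i] by simp
  show "- (A * depth (- x)) \<le> (- uT (- x)) $ i" for x i using uT_upper[of "- x" i] by simp
qed (rule K_nonneg K_int C_nonneg C_int C_meas L A)+

lemma char_solution_reflect:
  assumes u: "char_solution u"
  shows "coupled_system.char_solution (\<lambda>t x u. - f t (- x) (- u)) (\<lambda>t x u. - g t (- x) (- u)) C T (\<lambda>x. - uT (- x)) (reflect u)"
proof -
  interpret R: coupled_system "\<lambda>t x u. - f t (- x) (- u)" "\<lambda>t x u. - g t (- x) (- u)" C K T L A "\<lambda>x. - uT (- x)"
    by (rule reflected_system)
  have vel: "R.vel (reflect u) = (\<lambda>t x. - vel u t (- x))" by (simp add: R.vel_def vel_def reflect_def fun_eq_iff)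
  have src: "R.src (reflect u) t x = - src u t (- x)" for t x by (simp add: R.src_def src_def reflect_def)
  show ?thesis unfolding R.char_solution_def
  proof
    fix t assume t: "t \<in> {0..T}"
    have "AE x in lebesgue. \<exists>y. represents u t y \<and> y t = x" by (rule u[unfolded char_solution_def, rule_format, OF t])
    from AE_lebesgue_image[OF this linear_uminus minus_minus]
    show "AE x in lebesgue. \<exists>y. R.represents (reflect u) t y \<and> y t = x"
    proof eventually_elim
      case (elim x)
      then obtain y where y: "trajectory C (vel u) t T y" "y t = - x"
        and int: "(\<lambda>s. w t s *\<^sub>R src u s (y s)) absolutely_integrable_on {t..T}"
        and eq: "u t (y t) = w t T *\<^sub>R uT (y T) + integral {t..T} (\<lambda>s. w t s *\<^sub>R src u s (y s))"
        unfolding represents_def by blast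
      have ieq: "(\<lambda>s. R.w t s *\<^sub>R R.src (reflect u) s (- y s)) = (\<lambda>s. - (w t s *\<^sub>R src u s (y s)))"
        by (simp add: src)
      show ?case
        unfolding R.represents_def
      proof (intro exI[of _ "\<lambda>s. - y s"] conjI)
        show "trajectory C (R.vel (reflect u)) t T (\<lambda>s. - y s)" unfolding vel by (rule trajectory_reflect[OF y(1)])
        show "- y t = x" by (simp add: y(2))
        show "(\<lambda>s. R.w t s *\<^sub>R R.src (reflect u) s (- y s)) absolutely_integrable_on {t..T}"
          unfolding ieq using absolutely_integrable_linear[OF int bounded_linear_minus[OF bounded_linear_ident]] by (simp add: o_def)
        show "reflect u t (- y t) = R.w t T *\<^sub>R - uT (- (- y T)) + integral {t..T} (\<lambda>s. R.w t s *\<^sub>R R.src (reflect u) s (- y s))"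
          unfolding ieq using eq by (simp add: reflect_def)
      qed
    qed
  qed
qed

definition growth_bounded :: "(real \<Rightarrow> real ^ 'd \<Rightarrow> real ^ 'm) \<Rightarrow> bool" where
  "growth_bounded v \<longleftrightarrow> (\<exists>B\<ge>0. AE t in lebesgue. t \<in> {0..T} \<longrightarrow> (\<forall>x i. \<bar>v t x $ i\<bar> \<le> B * (1 + norm x)))"

text \<open>Reflecting space and values turns the system into one of the same form and exchanges the order,
  so the reflected maximal solution of the reflected system is the minimal one.\<close>

lemma extremal_char_solutions:
  obtains u_plus u_minus where "admissible u_plus" "admissible u_minus" "char_solution u_plus" "char_solution u_minus"
    "\<And>t x. t \<notin> {0..T} \<Longrightarrow> u_plus t x = 0" "\<And>t x. t \<notin> {0..T} \<Longrightarrow> u_minus t x = 0"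
    "jointly_continuous T u_plus" "jointly_continuous T u_minus"
    "\<And>t. t \<in> {0..T} \<Longrightarrow> upper_semicontinuous (u_plus t)" "\<And>t. t \<in> {0..T} \<Longrightarrow> lower_semicontinuous (u_minus t)"
    "\<And>v t x. char_solution v \<Longrightarrow> (\<And>t. antimono (v t)) \<Longrightarrow> growth_bounded v \<Longrightarrow> t \<in> {0..T} \<Longrightarrow>
       u_minus t x \<le> v t x \<and> v t x \<le> u_plus t x"
proof -
  interpret R: coupled_system "\<lambda>t x u. - f t (- x) (- u)" "\<lambda>t x u. - g t (- x) (- u)" C K T L A "\<lambda>x. - uT (- x)"
    by (rule reflected_system)
  have adm: "admissible (reflect R.maximal)"
    unfolding admissible_def
  proof (intro conjI allI)
    show "antimono (reflect R.maximal t)" for t by (rule antimono_reflect[of R.maximal t, OF R.maximal_antimono])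
    have "AE q in lebesgue. (\<lambda>t. R.maximal t (- q)) \<in> borel_measurable lebesgue"
      by (rule AE_lebesgue_image[OF _ linear_uminus minus_minus]) (use R.maximal_admissible in "simp add: R.admissible_def")
    then show "AE q in lebesgue. (\<lambda>t. reflect R.maximal t q) \<in> borel_measurable lebesgue"
      unfolding reflect_def by eventually_elim (rule borel_measurable_uminus)
    obtain M where M: "0 \<le> M" "\<And>t x i. t \<in> {0..T} \<Longrightarrow> \<bar>R.maximal t x $ i\<bar> \<le> M * (1 + norm x)"
      using R.maximal_admissible unfolding R.admissible_def by blast
    have "\<bar>reflect R.maximal t x $ i\<bar> \<le> M * (1 + norm x)" if "t \<in> {0..T}" for t x i
      using M(2)[OF that, of "- x" i] by (simp add: reflect_def)
    with M(1) show "\<exists>M\<ge>0. \<forall>t\<in>{0..T}. \<forall>x i. \<bar>reflect R.maximal t x $ i\<bar> \<le> M * (1 + norm x)" by blast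
  qed
  have out: "maximal t x = 0" if "t \<notin> {0..T}" for t x
    using maximal_limit[of t x] unfolding iter_outside[OF that] by (simp add: LIMSEQ_const_iff)
  have Rout: "R.maximal t x = 0" if "t \<notin> {0..T}" for t x
    using R.maximal_limit[of t x] unfolding R.iter_outside[OF that] by (simp add: LIMSEQ_const_iff)
  have Rsol: "char_solution (reflect R.maximal)"
    using R.char_solution_reflect[OF R.maximal_char_solution] by simp
  show ?thesis
  proof (rule that[of maximal "reflect R.maximal"])
    show "reflect R.maximal t x = 0" if "t \<notin> {0..T}" for t x using Rout[OF that] by (simp add: reflect_def)
    show "lower_semicontinuous (reflect R.maximal t)" if "t \<in> {0..T}" for t
      by (rule lower_semicontinuous_reflect[of R.maximal t, OF R.maximal_upper_semicontinuous[OF that]])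
    show "reflect R.maximal t x \<le> v t x \<and> v t x \<le> maximal t x"
      if v: "char_solution v" "\<And>t. antimono (v t)" "growth_bounded v" and t: "t \<in> {0..T}" for v t x
    proof -
      obtain B where B: "0 \<le> B" and bound: "AE t in lebesgue. t \<in> {0..T} \<longrightarrow> (\<forall>x i. \<bar>v t x $ i\<bar> \<le> B * (1 + norm x))"
        using v(3) by (auto simp: growth_bounded_def)
      have "AE t in lebesgue. t \<in> {0..T} \<longrightarrow> (\<forall>x i. \<bar>reflect v t x $ i\<bar> \<le> B * (1 + norm x))"
        using bound
      proof eventually_elim
        case (elim t)
        show ?case
        proof (intro impI allI)
          fix x i assume "t \<in> {0..T}"
          with elim have "\<bar>v t (- x) $ i\<bar> \<le> B * (1 + norm (- x))" by blast
          then show "\<bar>reflect v t x $ i\<bar> \<le> B * (1 + norm x)" by (simp add: reflect_def)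
        qed
      qed
      from R.char_solution_le_maximal[OF char_solution_reflect[OF v(1)] antimono_reflect[of v, OF v(2)] B this t, of "- x"]
      have "reflect v t (- x) \<le> R.maximal t (- x)" .
      then have "reflect R.maximal t x \<le> v t x" by (simp add: reflect_def vec_minus_le_iff)
      moreover have "v t x \<le> maximal t x" by (rule char_solution_le_maximal[OF v(1,2) B bound t])
      ultimately show ?thesis by blast
    qed
    show "jointly_continuous T (reflect R.maximal)" by (rule jointly_continuous_reflect[OF R.maximal_jointly_continuous])
    show "upper_semicontinuous (maximal t)" if "t \<in> {0..T}" for t by (rule maximal_upper_semicontinuous[OF that])
    show "admissible maximal" "admissible (reflect R.maximal)" "char_solution maximal" "char_solution (reflect R.maximal)"
      "jointly_continuous T maximal"
      by (fact maximal_admissible adm maximal_char_solution Rsol maximal_jointly_continuous)+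
  qed (rule out)
qed

end

section \<open>Solutions along characteristics and solutions by representation\<close>

lemma AE_lebesgue_on: "S \<in> sets lebesgue \<Longrightarrow> (AE t in lebesgue_on S. P t) \<longleftrightarrow> (AE t in lebesgue. t \<in> S \<longrightarrow> P t)"
  by (subst AE_restrict_space_iff) auto

lemma slab_lebesgue: "{a..b :: real} \<times> (UNIV :: 'a::euclidean_space set) \<in> sets lebesgue"
proof -
  have "closed ({a..b} \<times> (UNIV :: 'a set))" by (intro closed_Times) auto
  then show ?thesis by (intro sets_completionI_sets) simp
qed

lemma filippov_solution_cong_AE:
  assumes "AE t in lebesgue. t \<in> {s..T} \<longrightarrow> b t = b' t"
  shows "filippov_solution T b s x y \<longleftrightarrow> filippov_solution T b' s x y"
proof -
  have "AE t in lebesgue_on {s..T}. b t = b' t" using assms by (simp add: AE_lebesgue_on)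
  then have "(AE t in lebesgue_on {s..T}. \<exists>v. (y has_vector_derivative v) (at t within {s..T}) \<and>
        (\<forall>i. lower_env (\<lambda>z. b t z $ i) (y t) \<le> ereal (v $ i) \<and> ereal (v $ i) \<le> upper_env (\<lambda>z. b t z $ i) (y t)))
    \<longleftrightarrow> (AE t in lebesgue_on {s..T}. \<exists>v. (y has_vector_derivative v) (at t within {s..T}) \<and>
        (\<forall>i. lower_env (\<lambda>z. b' t z $ i) (y t) \<le> ereal (v $ i) \<and> ereal (v $ i) \<le> upper_env (\<lambda>z. b' t z $ i) (y t)))"
    by (rule eventually_subst[OF eventually_mono]) simp
  then show ?thesis by (simp only: filippov_solution_def)
qed

lemma absolutely_integrable_AE_eq:
  fixes h k :: "real \<Rightarrow> 'a::euclidean_space"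
  assumes h: "h absolutely_integrable_on {a..b}" and eq: "AE s in lebesgue. s \<in> {a..b} \<longrightarrow> k s = h s"
  shows "k absolutely_integrable_on {a..b}" and "(LINT s:{a..b}|lebesgue. k s) = integral {a..b} h"
    and "integral {a..b} k = integral {a..b} h"
proof -
  define N where "N = {s. \<not> (s \<in> {a..b} \<longrightarrow> k s = h s)}"
  have N: "negligible N" using eq by (simp add: N_def AE_lebesgue_iff_negligible)
  show k: "k absolutely_integrable_on {a..b}"
    by (rule absolutely_integrable_spike[OF h N]) (auto simp: N_def)
  show "integral {a..b} k = integral {a..b} h" by (rule integral_spike[OF N]) (auto simp: N_def)
  then show "(LINT s:{a..b}|lebesgue. k s) = integral {a..b} h"
    using set_lebesgue_integral_eq_integral(2)[OF k] by simp
qed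

lemma jointly_continuous_measurable:
  fixes u :: "real \<Rightarrow> real ^ 'd \<Rightarrow> real ^ 'm"
  assumes jc: "jointly_continuous T u" and u: "\<And>t. t \<in> {0..T} \<Longrightarrow> antimono (u t)" and out: "\<And>t x. t \<notin> {0..T} \<Longrightarrow> u t x = 0"
  shows "AE z in lebesgue. isCont (\<lambda>(t, x). u t x) z"
    and "(\<lambda>(t, x). u t x) \<in> borel_measurable lebesgue"
proof -
  have "negligible {z :: real \<times> (real ^ 'd). z \<bullet> (1, 0) = c}" for c
    by (rule negligible_standard_hyperplane) (simp add: Basis_prod_def)
  then have "AE z in lebesgue. fst (z :: real \<times> (real ^ 'd)) \<noteq> c" for c
    unfolding AE_lebesgue_iff_negligible by (simp add: inner_prod_def)
  moreover have "AE z in lebesgue. fst z \<in> {0<..<T} \<longrightarrow> isCont (\<lambda>(t, x). u t x) z"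
    by (rule jointly_continuous_AE(1)[OF jc]) (rule u)
  ultimately have "AE z in lebesgue. fst z \<noteq> 0 \<and> fst z \<noteq> T \<and> (fst z \<in> {0<..<T} \<longrightarrow> isCont (\<lambda>(t, x). u t x) z)"
    by (intro AE_conjI)
  then show ae: "AE z in lebesgue. isCont (\<lambda>(t, x). u t x) z"
  proof eventually_elim
    case (elim z)
    show ?case
    proof (cases "fst z \<in> {0<..<T}")
      case True
      then show ?thesis using elim by blast
    next
      case False
      then have "z \<in> ({..<0} \<union> {T<..}) \<times> UNIV" using elim by (cases z) auto
      moreover have "open (({..<0} \<union> {T<..}) \<times> (UNIV :: (real ^ 'd) set))" by (intro open_Times) auto
      ultimately have "\<forall>\<^sub>F z in nhds z. z \<in> ({..<0} \<union> {T<..}) \<times> (UNIV :: (real ^ 'd) set)" by (rule eventually_nhds_in_open[rotated])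
      then have "\<forall>\<^sub>F z in nhds z. (\<lambda>(t, x). u t x) z = 0" by (rule eventually_mono) (auto simp: out)
      then show ?thesis by (subst isCont_cong) auto
    qed
  qed
  show "(\<lambda>(t, x). u t x) \<in> borel_measurable lebesgue" by (rule AE_isCont_measurable[OF ae])
qed

lemma antimono_AE_bound:
  fixes u :: "real ^ 'n \<Rightarrow> real ^ 'k"
  assumes u: "antimono u" and ae: "AE x in lebesgue. norm (u x /\<^sub>R (1 + norm x)) \<le> B"
  shows "\<bar>u x $ i\<bar> \<le> B * (1 + norm x)"
proof -
  have ae': "AE x in lebesgue. \<bar>u x $ i\<bar> \<le> B * (1 + norm x)"
    using ae
  proof eventually_elim
    case (elim x)
    have p: "0 < 1 + norm x" by (simp add: add_pos_nonneg)
    have "norm (u x) \<le> B * (1 + norm x)" using elim p by (simp add: divide_simps mult.commute)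
    then show ?case using component_le_norm_cart[of "u x" i] by linarith
  qed
  have c: "continuous_on UNIV (\<lambda>x :: real ^ 'n. B * (1 + norm x))" by (intro continuous_intros)
  have "u x $ i \<le> B * (1 + norm x)"
    by (rule antimono_le_continuous[OF u c]) (use ae' in "eventually_elim, linarith")
  moreover have "(- u (- (- x))) $ i \<le> B * (1 + norm (- x))"
  proof (rule antimono_le_continuous[OF _ c])
    show "antimono (\<lambda>x. - u (- x))" using u unfolding antimono_def by (simp add: vec_minus_le_minus)
    show "AE x in lebesgue. (- u (- x)) $ i \<le> B * (1 + norm x)"
      using AE_lebesgue_image[OF ae' linear_uminus minus_minus] by eventually_elim (simp add: abs_le_iff)
  qed
  ultimately show ?thesis by (simp add: abs_le_iff)
qed

context coupled_system
begin

text \<open>The coefficients \<open>f0\<close>, \<open>g0\<close>, \<open>C0\<close> of the original problem agree with the normalised ones only at almost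
  every time; no integral or trajectory notices the difference.\<close>

context
  fixes f0 :: "real \<Rightarrow> real ^ 'd \<Rightarrow> real ^ 'm \<Rightarrow> real ^ 'd" and g0 :: "real \<Rightarrow> real ^ 'd \<Rightarrow> real ^ 'm \<Rightarrow> real ^ 'm"
    and C0 :: "real \<Rightarrow> real"
  assumes same: "AE t in lebesgue. t \<in> {0..T} \<longrightarrow> f0 t = f t \<and> g0 t = g t \<and> C0 t = C t"
begin

lemma same_weight:
  assumes "0 \<le> t" "s \<le> T"
  shows "exp (LINT r:{t..s}|lebesgue. - C0 r) = w t s"
proof -
  have "(\<lambda>r. - C r) absolutely_integrable_on {t..s}"
    using absolutely_integrable_linear[OF nonnegative_absolutely_integrable_1[OF C_sub[OF assms(1)] C_nonneg] bounded_linear_minus[OF bounded_linear_ident]]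
    by (simp add: o_def)
  moreover have "AE r in lebesgue. r \<in> {t..s} \<longrightarrow> - C0 r = - C r"
    using same by eventually_elim (use assms in auto)
  ultimately have "(LINT r:{t..s}|lebesgue. - C0 r) = integral {t..s} (\<lambda>r. - C r)"
    by (rule absolutely_integrable_AE_eq(2))
  then show ?thesis by (simp add: w_def)
qed

lemma same_integrand:
  assumes t: "0 \<le> t" and uv: "\<And>t x. t \<in> {0..T} \<Longrightarrow> u t x = v t x"
  shows "AE s in lebesgue. s \<in> {t..T} \<longrightarrow>
    exp (LINT r:{t..s}|lebesgue. - C0 r) *\<^sub>R (g0 s (y s) (u s (y s)) + C0 s *\<^sub>R u s (y s)) = w t s *\<^sub>R src v s (y s)"
  using same by eventually_elim (use t uv in "simp add: same_weight src_def")

lemma same_trajectory: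
  assumes t: "0 \<le> t" and uv: "\<And>t x. t \<in> {0..T} \<Longrightarrow> u t x = v t x" and v: "\<And>t. antimono (v t)"
  shows "filippov_solution T (\<lambda>t x. f0 t x (u t x)) t x y \<longleftrightarrow> trajectory C (vel v) t T y \<and> y t = x"
proof -
  have "AE s in lebesgue. s \<in> {t..T} \<longrightarrow> (\<lambda>x. f0 s x (u s x)) = vel v s"
    using same by eventually_elim (use t uv in "auto simp: vel_def fun_eq_iff")
  then have "filippov_solution T (\<lambda>t x. f0 t x (u t x)) t x y \<longleftrightarrow> filippov_solution T (vel v) t x y"
    by (rule filippov_solution_cong_AE)
  also have "... \<longleftrightarrow> trajectory C (vel v) t T y \<and> y t = x"
    by (rule filippov_solution_iff_trajectory) (use vel_mono[of v, OF v] in simp)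
  finally show ?thesis .
qed

lemma nonlinear_solution_imp_char_solution:
  assumes sol: "nonlinear_solution T f0 g0 C0 uT u"
  defines "v \<equiv> \<lambda>t x. if t \<in> {0..T} then u t x else 0"
  shows "char_solution v" "antimono (v t)" "growth_bounded v"
proof -
  have uv: "u t x = v t x" if "t \<in> {0..T}" for t x using that by (simp add: v_def)
  show anti: "antimono (v t)" for t
  proof (cases "t \<in> {0..T}")
    case True
    then have "v t = u t" by (simp add: v_def fun_eq_iff)
    then show ?thesis using sol True by (simp add: nonlinear_solution_def)
  next
    case False
    then have "v t = (\<lambda>_. 0)" by (auto simp: v_def fun_eq_iff)
    then show ?thesis by (simp add: antimono_def)
  qed
  show "growth_bounded v"
  proof -
    obtain B where "AE z in lebesgue_on ({0..T} \<times> UNIV). norm ((\<lambda>(t, x). u t x /\<^sub>R (1 + norm x)) z) \<le> B"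
      using sol unfolding nonlinear_solution_def L_infinity_def by blast
    then have "AE z in lebesgue. z \<in> {0..T} \<times> (UNIV :: (real ^ 'd) set) \<longrightarrow> norm ((\<lambda>(t, x). u t x /\<^sub>R (1 + norm x)) z) \<le> B"
      by (simp only: AE_lebesgue_on[OF slab_lebesgue])
    from AE_lebesgue_sections(1)[OF this]
    have "AE t in lebesgue. AE x in lebesgue. t \<in> {0..T} \<longrightarrow> norm (v t x /\<^sub>R (1 + norm x)) \<le> B"
      by (simp add: v_def cong: imp_cong)
    then have "AE t in lebesgue. t \<in> {0..T} \<longrightarrow> (\<forall>x i. \<bar>v t x $ i\<bar> \<le> max B 0 * (1 + norm x))"
    proof eventually_elim
      case (elim t)
      show ?case
      proof (intro impI allI)
        fix x i assume "t \<in> {0..T}"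
        then have "AE x in lebesgue. norm (v t x /\<^sub>R (1 + norm x)) \<le> max B 0"
          using elim by (auto elim: eventually_mono)
        then show "\<bar>v t x $ i\<bar> \<le> max B 0 * (1 + norm x)" by (rule antimono_AE_bound[OF anti])
      qed
    qed
    then show ?thesis unfolding growth_bounded_def by (intro exI[of _ "max B 0"]) auto
  qed
  obtain \<phi> where flow: "regular_lagrangian_flow T (\<lambda>t x. f0 t x (u t x)) \<phi>"
    and rep: "\<And>t. t \<in> {0..T} \<Longrightarrow> AE x in lebesgue.
          set_integrable lebesgue {t..T} (\<lambda>s. exp (LINT r:{t..s}|lebesgue. - C0 r) *\<^sub>R (g0 s (\<phi> s t x) (u s (\<phi> s t x)) + C0 s *\<^sub>R u s (\<phi> s t x))) \<and>
          u t x = exp (LINT s:{t..T}|lebesgue. - C0 s) *\<^sub>R uT (\<phi> T t x)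
            + (LINT s:{t..T}|lebesgue. exp (LINT r:{t..s}|lebesgue. - C0 r) *\<^sub>R (g0 s (\<phi> s t x) (u s (\<phi> s t x)) + C0 s *\<^sub>R u s (\<phi> s t x)))"
    using sol unfolding nonlinear_solution_def linear_solution_def by blast
  show "char_solution v"
    unfolding char_solution_def
  proof
    fix t assume t: "t \<in> {0..T}"
    then have t0: "0 \<le> t" by simp
    have "AE x in lebesgue. filippov_solution T (\<lambda>t x. f0 t x (u t x)) t x (\<lambda>s. \<phi> s t x)"
      using flow t unfolding regular_lagrangian_flow_def by (auto elim: eventually_mono)
    then show "AE x in lebesgue. \<exists>y. represents v t y \<and> y t = x"
      using rep[OF t]
    proof eventually_elim
      case (elim x)
      define y where "y = (\<lambda>s. \<phi> s t x)"
      define h where "h = (\<lambda>s. exp (LINT r:{t..s}|lebesgue. - C0 r) *\<^sub>R (g0 s (y s) (u s (y s)) + C0 s *\<^sub>R u s (y s)))"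
      have hint: "h absolutely_integrable_on {t..T}" and eq: "u t x = exp (LINT s:{t..T}|lebesgue. - C0 s) *\<^sub>R uT (y T) + (LINT s:{t..T}|lebesgue. h s)"
        using elim(2) by (simp_all add: h_def y_def)
      have hs: "AE s in lebesgue. s \<in> {t..T} \<longrightarrow> w t s *\<^sub>R src v s (y s) = h s"
      proof -
        have "AE s in lebesgue. s \<in> {t..T} \<longrightarrow>
            exp (LINT r:{t..s}|lebesgue. - C0 r) *\<^sub>R (g0 s (y s) (u s (y s)) + C0 s *\<^sub>R u s (y s)) = w t s *\<^sub>R src v s (y s)"
          by (rule same_integrand[OF t0]) (rule uv)
        then show ?thesis by eventually_elim (simp add: h_def)
      qed
      have ei: "exp (LINT s:{t..T}|lebesgue. - C0 s) = w t T" by (rule same_weight[OF t0 order_refl])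
      have "trajectory C (vel v) t T y \<and> y t = x"
      proof -
        have "filippov_solution T (\<lambda>t x. f0 t x (u t x)) t x y \<longleftrightarrow> trajectory C (vel v) t T y \<and> y t = x"
          by (rule same_trajectory[OF t0]) (rule uv anti; assumption?)+
        then show ?thesis using elim(1) by (simp add: y_def)
      qed
      moreover note absolutely_integrable_AE_eq(1)[OF hint hs]
      moreover have "v t x = w t T *\<^sub>R uT (y T) + integral {t..T} (\<lambda>s. w t s *\<^sub>R src v s (y s))"
        using eq unfolding ei set_lebesgue_integral_eq_integral(2)[OF hint] absolutely_integrable_AE_eq(3)[OF hint hs] uv[OF t] .
      ultimately show ?case unfolding represents_def by blast
    qed
  qed
qed

lemma char_solution_imp_nonlinear_solution:
  assumes sol: "char_solution u" and u: "admissible u" and out: "\<And>t x. t \<notin> {0..T} \<Longrightarrow> u t x = 0"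
    and jc: "jointly_continuous T u"
  shows "nonlinear_solution T f0 g0 C0 uT u"
  unfolding nonlinear_solution_def
proof (intro conjI ballI allI)
  interpret fl: one_sided_field "vel u" C K T L by (rule field[OF u])
  note anti = admissible_antimono[OF u]
  obtain M where M: "0 \<le> M" "\<And>t x i. t \<in> {0..T} \<Longrightarrow> \<bar>u t x $ i\<bar> \<le> M * (1 + norm x)"
    using u unfolding admissible_def by blast
  have norm_u: "norm (u t x) \<le> real CARD('m) * (M * (1 + norm x))" if "t \<in> {0..T}" for t x
    by (rule norm_le_card_times) (rule M(2)[OF that])
  show "bounded ((\<lambda>(t, x). u t x) ` ({0..T} \<times> cball 0 R))" for R
  proof (rule boundedI)
    fix z assume "z \<in> (\<lambda>(t, x). u t x) ` ({0..T} \<times> cball 0 R)"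
    then obtain t x where tx: "t \<in> {0..T}" "norm x \<le> R" "z = u t x" by auto
    have "norm z \<le> real CARD('m) * (M * (1 + norm x))" unfolding tx(3) by (rule norm_u[OF tx(1)])
    also have "... \<le> real CARD('m) * (M * (1 + R))" using tx(2) M(1) by (intro mult_left_mono) auto
    finally show "norm z \<le> real CARD('m) * (M * (1 + R))" .
  qed
  show "antimono (u t)" for t by (rule anti)
  show "L_infinity (lebesgue_on ({0..T} \<times> UNIV)) (\<lambda>(t, x). u t x /\<^sub>R (1 + norm x))"
    unfolding L_infinity_def
  proof (intro conjI exI[of _ "real CARD('m) * M"])
    have "(\<lambda>z :: real \<times> (real ^ 'd). inverse (1 + norm (snd z))) \<in> borel_measurable borel"
      by (intro borel_measurable_continuous_onI continuous_intros) (metis add_nonneg_pos norm_ge_zero order_less_irrefl zero_less_one add.commute)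
    then have "(\<lambda>z :: real \<times> (real ^ 'd). inverse (1 + norm (snd z))) \<in> borel_measurable lebesgue"
      by (intro measurable_completion) simp
    moreover have "(\<lambda>(t, x). u t x) \<in> borel_measurable lebesgue"
      by (rule jointly_continuous_measurable(2)[OF jc anti]) (rule out)
    ultimately have "(\<lambda>z. inverse (1 + norm (snd z)) *\<^sub>R (case z of (t, x) \<Rightarrow> u t x)) \<in> borel_measurable lebesgue"
      by (rule borel_measurable_scaleR)
    then have "(\<lambda>(t, x). u t x /\<^sub>R (1 + norm x)) \<in> borel_measurable lebesgue" by (simp add: case_prod_unfold)
    then show "(\<lambda>(t, x). u t x /\<^sub>R (1 + norm x)) \<in> borel_measurable (lebesgue_on ({0..T} \<times> UNIV))"
      by (rule measurable_restrict_space1)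
    show "AE z in lebesgue_on ({0..T} \<times> UNIV). norm ((\<lambda>(t, x). u t x /\<^sub>R (1 + norm x)) z) \<le> real CARD('m) * M"
    proof (rule AE_I2)
      fix z assume "z \<in> space (lebesgue_on ({0..T} \<times> (UNIV :: (real ^ 'd) set)))"
      then obtain t x where z: "z = (t, x)" "t \<in> {0..T}" by (auto simp: space_restrict_space)
      have "norm (u t x) / (1 + norm x) \<le> real CARD('m) * M"
        using norm_u[OF z(2), of x] by (simp add: divide_le_eq add_pos_nonneg mult_ac)
      then show "norm ((\<lambda>(t, x). u t x /\<^sub>R (1 + norm x)) z) \<le> real CARD('m) * M"
        by (simp add: z(1) divide_inverse mult.commute)
    qed
  qed
  show "linear_solution T (\<lambda>t x. f0 t x (u t x)) (\<lambda>t. - C0 t) (\<lambda>t x. g0 t x (u t x) + C0 t *\<^sub>R u t x) uT u"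
    unfolding linear_solution_def
  proof (intro exI[of _ "Phi u"] conjI ballI)
    have traj: "filippov_solution T (\<lambda>t x. f0 t x (u t x)) t x y \<longleftrightarrow> trajectory C (vel u) t T y \<and> y t = x"
      if "t \<in> {0..T}" for t x y
      by (rule same_trajectory) (use that anti in auto)
    show "regular_lagrangian_flow T (\<lambda>t x. f0 t x (u t x)) (Phi u)"
      unfolding regular_lagrangian_flow_def
    proof (intro conjI ballI exI[of _ "fl.E T ^ CARD('d)"])
      fix s assume s: "s \<in> {0..T}"
      then have s0: "0 \<le> s" by simp
      show "AE x in lebesgue. filippov_solution T (\<lambda>t x. f0 t x (u t x)) s x (\<lambda>t. Phi u t s x) \<and>
          (\<forall>y. filippov_solution T (\<lambda>t x. f0 t x (u t x)) s x y \<longrightarrow> (\<forall>t\<in>{s..T}. y t = Phi u t s x))"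
        unfolding traj[OF s] using fl.AE_unique_trajectory[OF s0]
        by eventually_elim (use Phi_trajectory[OF u s0] Phi_start[OF u s0] in blast)
      fix t assume t: "t \<in> {s..T}"
      show "Phi u t s \<in> lebesgue \<rightarrow>\<^sub>M lebesgue" by (rule fl.flow_noncompressing(1)[OF s t])
      show "emeasure lebesgue (Phi u t s -` A) \<le> ennreal (fl.E T ^ CARD('d)) * emeasure lebesgue A" if "A \<in> sets lebesgue" for A
        by (rule fl.flow_noncompressing(2)[OF s t that])
    qed
    fix t assume t: "t \<in> {0..T}"
    then have t0: "0 \<le> t" "t \<le> T" by auto
    show "AE x in lebesgue.
          set_integrable lebesgue {t..T}
            (\<lambda>s. exp (LINT r:{t..s}|lebesgue. - C0 r) *\<^sub>R (g0 s (Phi u s t x) (u s (Phi u s t x)) + C0 s *\<^sub>R u s (Phi u s t x))) \<and>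
          u t x = exp (LINT s:{t..T}|lebesgue. - C0 s) *\<^sub>R uT (Phi u T t x)
            + (LINT s:{t..T}|lebesgue. exp (LINT r:{t..s}|lebesgue. - C0 r) *\<^sub>R (g0 s (Phi u s t x) (u s (Phi u s t x)) + C0 s *\<^sub>R u s (Phi u s t x)))"
      using sol[unfolded char_solution_def, rule_format, OF t] fl.AE_unique_trajectory[OF t0(1)]
    proof eventually_elim
      case (elim x)
      then obtain y where y: "\<forall>s\<in>{t..T}. y s = Phi u s t x"
        and int: "(\<lambda>s. w t s *\<^sub>R src u s (y s)) absolutely_integrable_on {t..T}"
        and eq: "u t x = w t T *\<^sub>R uT (y T) + integral {t..T} (\<lambda>s. w t s *\<^sub>R src u s (y s))"
        unfolding represents_def by blast
      have hs: "AE s in lebesgue. s \<in> {t..T} \<longrightarrow>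
          exp (LINT r:{t..s}|lebesgue. - C0 r) *\<^sub>R (g0 s (Phi u s t x) (u s (Phi u s t x)) + C0 s *\<^sub>R u s (Phi u s t x)) = w t s *\<^sub>R src u s (y s)"
      proof -
        have "AE s in lebesgue. s \<in> {t..T} \<longrightarrow>
          exp (LINT r:{t..s}|lebesgue. - C0 r) *\<^sub>R (g0 s (Phi u s t x) (u s (Phi u s t x)) + C0 s *\<^sub>R u s (Phi u s t x)) = w t s *\<^sub>R src u s (Phi u s t x)"
          by (rule same_integrand[OF t0(1)]) (rule refl)
        then show ?thesis by eventually_elim (use y in simp)
      qed
      have yT: "y T = Phi u T t x" using y t0 by auto
      have ei: "exp (LINT s:{t..T}|lebesgue. - C0 s) = w t T" by (rule same_weight[OF t0(1) order_refl])
      show ?case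
        unfolding ei absolutely_integrable_AE_eq(2)[OF int hs]
        using absolutely_integrable_AE_eq(1)[OF int hs] eq unfolding yT by blast
    qed
  qed
qed

end

end

section \<open>Regularity of the coefficients\<close>

text \<open>The path from \<open>x\<close> to \<open>y\<close> changes one coordinate at a time.\<close>

lemma coordinatewise_increase:
  fixes h :: "real ^ 'n \<Rightarrow> real"
  assumes step: "\<And>i z s. 0 \<le> s \<Longrightarrow> h z + c i * s \<le> h (z + s *\<^sub>R axis i 1)" and xy: "x \<le> y"
  shows "h x + (\<Sum>i\<in>UNIV. c i * (y $ i - x $ i)) \<le> h y"
proof -
  have "h x + (\<Sum>i\<in>F. c i * (y $ i - x $ i)) \<le> h (\<chi> i. if i \<in> F then y $ i else x $ i)" if "finite F" for F
    using that
  proof induction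
    case empty
    have "(\<chi> i. if i \<in> {} then y $ i else x $ i) = x" by (simp add: vec_eq_iff)
    then show ?case by simp
  next
    case (insert i F)
    define z where "z = (\<chi> i. if i \<in> F then y $ i else x $ i)"
    have "z + (y $ i - x $ i) *\<^sub>R axis i 1 = (\<chi> j. if j \<in> insert i F then y $ j else x $ j)"
      using insert(2) by (simp add: vec_eq_iff z_def axis_def)
    moreover have "h z + c i * (y $ i - x $ i) \<le> h (z + (y $ i - x $ i) *\<^sub>R axis i 1)"
      by (rule step) (use xy in "simp add: less_eq_vec_def")
    ultimately show ?case using insert unfolding z_def[symmetric] by simp
  qed
  from this[of UNIV] show ?thesis by simp
qed

lemma lower_deriv_imp_mono:
  fixes h :: "real ^ 'n \<Rightarrow> real ^ 'n"
  assumes "\<And>x i j. lower_deriv (\<lambda>x'. h x' $ j) (axis i 1) x \<ge> ereal (- c * of_bool (i = j))" and xy: "x \<le> y"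
  shows "h x + c *\<^sub>R x \<le> h y + c *\<^sub>R y"
  unfolding less_eq_vec_def
proof
  fix j
  have "\<forall>z. \<forall>s\<ge>0. h z $ j + (- c * of_bool (i = j)) * s \<le> h (z + s *\<^sub>R axis i 1) $ j" for i
    using assms(1) by (intro lower_deriv_ge_iff[where h = "\<lambda>x'. h x' $ j", THEN iffD1]) blast
  then have "h x $ j + (\<Sum>i\<in>UNIV. (- c * of_bool (i = j)) * (y $ i - x $ i)) \<le> h y $ j"
    by (intro coordinatewise_increase[where h = "\<lambda>x'. h x' $ j", OF _ xy]) blast
  also have "(\<Sum>i\<in>UNIV. (- c * of_bool (i = j)) * (y $ i - x $ i)) = (\<Sum>i\<in>UNIV. if i = j then - c * (y $ i - x $ i) else 0)"
    by (rule sum.cong) auto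
  finally show "(h x + c *\<^sub>R x) $ j \<le> (h y + c *\<^sub>R y) $ j" by (simp add: algebra_simps)
qed

lemma upper_deriv_imp_antimono:
  fixes h :: "real ^ 'n \<Rightarrow> real ^ 'k"
  assumes "\<And>x i j. upper_deriv (\<lambda>x'. h x' $ j) (axis i 1) x \<le> 0" and xy: "x \<le> y"
  shows "h y \<le> h x"
  unfolding less_eq_vec_def
proof
  fix j
  have "\<forall>z. \<forall>s\<ge>0. h (z + s *\<^sub>R axis i 1) $ j \<le> h z $ j + 0 * s" for i
    using assms(1) by (intro upper_deriv_le_iff[where h = "\<lambda>x'. h x' $ j", THEN iffD1]) (simp add: zero_ereal_def)
  then have "- h x $ j + (\<Sum>i\<in>UNIV. 0 * (y $ i - x $ i)) \<le> - h y $ j"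
    by (intro coordinatewise_increase[where h = "\<lambda>x'. - h x' $ j", OF _ xy]) simp
  then show "h y $ j \<le> h x $ j" by simp
qed

lemma lebesgue_sections_measurable:
  fixes h :: "real \<times> 'a::euclidean_space \<Rightarrow> real ^ 'k"
  assumes "h \<in> borel_measurable lebesgue"
  shows "AE q in lebesgue. (\<lambda>t. h (t, q)) \<in> borel_measurable lebesgue"
proof -
  have "AE q in lebesgue. (\<lambda>t. h (t, q) $ i) \<in> borel_measurable lebesgue" for i
  proof -
    have "(\<lambda>z. h z $ i) \<in> borel_measurable lebesgue" by (rule borel_measurable_vec_nth'[OF assms])
    then obtain k where k: "k \<in> borel_measurable lborel" and eq: "AE z in lborel. h z $ i = k z"
      using completion_ex_borel_measurable_real by blast
    have "AE q in lebesgue. AE t in lebesgue. h (t, q) $ i = k (t, q)"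
      by (rule AE_lebesgue_sections(2)) (use eq in "simp add: AE_lebesgue_lborel")
    then show ?thesis
    proof eventually_elim
      case (elim q)
      have pair: "(\<lambda>t. (t, q)) \<in> lborel \<rightarrow>\<^sub>M lborel"
        unfolding measurable_lborel1 measurable_lborel2 by (intro borel_measurable_continuous_onI continuous_intros)
      have "(\<lambda>t. k (t, q)) \<in> borel_measurable lebesgue"
        by (rule measurable_completion[OF measurable_compose[OF pair k]])
      then show ?case by (rule borel_measurable_AE) (use elim in "eventually_elim, simp")
    qed
  qed
  then have "AE q in lebesgue. \<forall>i. (\<lambda>t. h (t, q) $ i) \<in> borel_measurable lebesgue" unfolding AE_all_countable by blast
  then show ?thesis by eventually_elim (rule borel_measurable_vecI, blast)
qed

text \<open>Almost every section is measurable for \<open>u\<close> in a countable dense set at once, and continuity in \<open>u\<close>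
  gives the rest.\<close>

lemma caratheodory_sections_measurable:
  fixes h :: "real \<Rightarrow> real ^ 'd \<Rightarrow> real ^ 'm \<Rightarrow> real ^ 'k"
  assumes meas: "\<And>u. (\<lambda>(t, x). h t x u) \<in> borel_measurable (lebesgue_on ({0..T} \<times> UNIV))"
    and S: "S \<subseteq> {0..T}" "S \<in> sets lebesgue" and cont: "\<And>t x. t \<in> S \<Longrightarrow> continuous_on UNIV (h t x)"
  shows "AE q in lebesgue. \<forall>u. (\<lambda>t. indicator S t *\<^sub>R h t q u) \<in> borel_measurable lebesgue"
proof -
  obtain D :: "(real ^ 'm) set" where D: "countable D" "\<And>X. open X \<Longrightarrow> X \<noteq> {} \<Longrightarrow> \<exists>d\<in>D. d \<in> X"
    using countable_dense_setE by blast
  have "(\<lambda>z. if z \<in> {0..T} \<times> UNIV then (\<lambda>(t, x). h t x u) z else 0) \<in> borel_measurable lebesgue" for u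
    by (subst borel_measurable_if) (use meas slab_lebesgue in auto)
  then have "AE q in lebesgue. (\<lambda>t. if (t, q) \<in> {0..T} \<times> UNIV then (\<lambda>(t, x). h t x u) (t, q) else 0) \<in> borel_measurable lebesgue" for u
    by (rule lebesgue_sections_measurable)
  then have "AE q in lebesgue. \<forall>u\<in>D. (\<lambda>t. if (t, q) \<in> {0..T} \<times> UNIV then (\<lambda>(t, x). h t x u) (t, q) else 0) \<in> borel_measurable lebesgue"
    using D(1) by (simp add: AE_ball_countable)
  then show ?thesis
  proof eventually_elim
    case (elim q)
    have inD: "(\<lambda>t. indicator S t *\<^sub>R h t q u) \<in> borel_measurable lebesgue" if "u \<in> D" for u
    proof -
      have "(\<lambda>t. if (t, q) \<in> {0..T} \<times> UNIV then (\<lambda>(t, x). h t x u) (t, q) else 0) \<in> borel_measurable lebesgue"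
        using elim that by blast
      moreover have "(indicator S :: real \<Rightarrow> real) \<in> borel_measurable lebesgue" using S(2) by simp
      ultimately have "(\<lambda>t. (indicator S t :: real) *\<^sub>R (if (t, q) \<in> {0..T} \<times> UNIV then (\<lambda>(t, x). h t x u) (t, q) else 0)) \<in> borel_measurable lebesgue"
        by (intro borel_measurable_scaleR)
      moreover have "(indicator S t :: real) *\<^sub>R (if (t, q) \<in> {0..T} \<times> (UNIV :: (real ^ 'd) set) then (\<lambda>(t, x). h t x u) (t, q) else 0) = indicator S t *\<^sub>R h t q u" for t
        using S(1) by (auto simp: indicator_def)
      ultimately show ?thesis by (simp only:)
    qed
    show ?case
    proof
      fix u
      have "\<exists>v\<in>D. dist u v < 1 / real (Suc n)" for n
      proof -
        have "\<exists>d\<in>D. d \<in> ball u (1 / real (Suc n))" by (rule D(2)) simp_all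
        then show ?thesis by (simp only: mem_ball)
      qed
      then have "\<forall>n. \<exists>v. v \<in> D \<and> dist u v < 1 / real (Suc n)" by blast
      from choice[OF this] obtain v where "\<forall>n. v n \<in> D \<and> dist u (v n) < 1 / real (Suc n)" ..
      then have v: "v n \<in> D" "dist (v n) u < 1 / real (Suc n)" for n by (simp_all only: dist_commute[of "v n"])
      have lim: "v \<longlonglongrightarrow> u"
      proof (rule tendsto_dist_iff[THEN iffD2, OF tendsto_sandwich[OF _ _ tendsto_const LIMSEQ_inverse_real_of_nat]])
        show "\<forall>\<^sub>F n in sequentially. dist (v n) u \<le> inverse (real (Suc n))"
          unfolding inverse_eq_divide by (intro always_eventually allI less_imp_le v(2))
      qed simp
      show "(\<lambda>t. indicator S t *\<^sub>R h t q u) \<in> borel_measurable lebesgue"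
      proof (rule borel_measurable_LIMSEQ_metric[OF inD[OF v(1)]])
        fix t
        show "(\<lambda>n. indicator S t *\<^sub>R h t q (v n)) \<longlonglongrightarrow> indicator S t *\<^sub>R h t q u"
        proof (cases "t \<in> S")
          case True
          then have "isCont (h t q) u" using cont[of t q] by (simp add: continuous_on_eq_continuous_at)
          then show ?thesis by (intro tendsto_scaleR tendsto_const isCont_tendsto_compose[OF _ lim])
        qed simp
      qed
    qed
  qed
qed

lemma integrable_lebesgue_imp_integrable_on:
  fixes h :: "real \<Rightarrow> real"
  assumes "integrable lebesgue h" shows "h integrable_on {a..b}"
proof -
  have "set_integrable lebesgue {a..b} h"
    unfolding set_integrable_def by (rule integrable_mult_indicator[OF _ assms]) simp
  then show ?thesis by (rule set_lebesgue_integral_eq_integral(1))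
qed

section \<open>The extremal solutions\<close>

theorem theorem5p1:
  fixes T :: real
    and f :: "real \<Rightarrow> real ^ 'd \<Rightarrow> real ^ 'm \<Rightarrow> real ^ 'd"
    and g :: "real \<Rightarrow> real ^ 'd \<Rightarrow> real ^ 'm \<Rightarrow> real ^ 'm"
    and C\<^sub>0 :: "real \<Rightarrow> real"
    and uT :: "real ^ 'd \<Rightarrow> real ^ 'm"
  assumes T: "T > 0"
    and f_meas: "\<And>u. (\<lambda>(t, x). f t x u) \<in> borel_measurable (lebesgue_on ({0..T} \<times> UNIV))"
    and g_meas: "\<And>u. (\<lambda>(t, x). g t x u) \<in> borel_measurable (lebesgue_on ({0..T} \<times> UNIV))"
    and f_cont: "\<And>t x. t \<in> {0..T} \<Longrightarrow> continuous_on UNIV (f t x)"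
    and g_cont: "\<And>t x. t \<in> {0..T} \<Longrightarrow> continuous_on UNIV (g t x)"
    and growth_meas: "growth f g \<in> borel_measurable (lebesgue_on {0..T})"
    and growth_int: "(\<integral>\<^sup>+ t. growth f g t \<partial>lebesgue_on {0..T}) < \<infinity>"
    and C0_nonneg: "\<And>t. t \<in> {0..T} \<Longrightarrow> 0 \<le> C\<^sub>0 t"
    and C0_int: "set_integrable lebesgue {0..T} C\<^sub>0"
    and derivs: "AE t in lebesgue_on {0..T}. \<forall>x u.
        (\<forall>i j. lower_deriv (\<lambda>x'. f t x' u $ j) (axis i 1) x \<ge> ereal (- C\<^sub>0 t * of_bool (i = j))) \<and>
        (\<forall>k l. lower_deriv (\<lambda>u'. g t x u' $ l) (axis k 1) u \<ge> ereal (- C\<^sub>0 t * of_bool (k = l))) \<and>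
        (\<forall>i l. upper_deriv (\<lambda>x'. g t x' u $ l) (axis i 1) x \<le> 0) \<and>
        (\<forall>k j. upper_deriv (\<lambda>u'. f t x u' $ j) (axis k 1) u \<le> 0)"
    and uT_decreasing: "antimono uT"
    and uT_growth: "L_infinity lebesgue (\<lambda>x. uT x /\<^sub>R (1 + norm x))"
  shows "\<exists>u_plus u_minus.
      nonlinear_solution T f g C\<^sub>0 uT u_plus \<and>
      nonlinear_solution T f g C\<^sub>0 uT u_minus \<and>
      (\<forall>t\<in>{0..T}. upper_semicontinuous (u_plus t) \<and> lower_semicontinuous (u_minus t)) \<and>
      (AE z in lebesgue_on ({0..T} \<times> UNIV).
         continuous (at z within {0..T} \<times> UNIV) (\<lambda>(t, x). u_plus t x)) \<and>
      (AE z in lebesgue_on ({0..T} \<times> UNIV).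
         continuous (at z within {0..T} \<times> UNIV) (\<lambda>(t, x). u_minus t x)) \<and>
      (\<forall>u. nonlinear_solution T f g C\<^sub>0 uT u \<longrightarrow>
         (\<forall>t\<in>{0..T}. \<forall>x. u_minus t x \<le> u t x \<and> u t x \<le> u_plus t x))"
proof -
  \<comment> \<open>The coefficients are set to zero outside the set of good times, where the conditions hold trivially.\<close>
  define good where "good = (\<lambda>t. growth f g t \<noteq> \<infinity> \<and> (\<forall>x u.
        (\<forall>i j. lower_deriv (\<lambda>x'. f t x' u $ j) (axis i 1) x \<ge> ereal (- C\<^sub>0 t * of_bool (i = j))) \<and>
        (\<forall>k l. lower_deriv (\<lambda>u'. g t x u' $ l) (axis k 1) u \<ge> ereal (- C\<^sub>0 t * of_bool (k = l))) \<and>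
        (\<forall>i l. upper_deriv (\<lambda>x'. g t x' u $ l) (axis i 1) x \<le> 0) \<and>
        (\<forall>k j. upper_deriv (\<lambda>u'. f t x u' $ j) (axis k 1) u \<le> 0)))"
  define S where "S = {t \<in> {0..T}. good t}"
  have interval: "{0..T} \<in> sets lebesgue" by simp
  have "AE t in lebesgue_on {0..T}. growth f g t \<noteq> \<infinity>"
    by (rule nn_integral_PInf_AE[OF growth_meas]) (use growth_int in auto)
  with derivs have "AE t in lebesgue_on {0..T}. good t" unfolding good_def by eventually_elim blast
  then have ae_good: "AE t in lebesgue. t \<in> {0..T} \<longrightarrow> t \<in> S" by (simp add: AE_lebesgue_on S_def)
  have S: "S \<subseteq> {0..T}" "S \<in> sets lebesgue"
  proof -
    have "negligible ({0..T} - S)" using ae_good unfolding AE_lebesgue_iff_negligible by (rule negligible_subset) auto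
    then have "{0..T} - ({0..T} - S) \<in> sets lebesgue" by (intro sets.Diff interval negligible_imp_sets)
    moreover have "{0..T} - ({0..T} - S) = S" by (auto simp: S_def)
    ultimately show "S \<in> sets lebesgue" by simp
  qed (auto simp: S_def)
  define f' where "f' = (\<lambda>t x u. indicator S t *\<^sub>R f t x u)"
  define g' where "g' = (\<lambda>t x u. indicator S t *\<^sub>R g t x u)"
  define C where "C = (\<lambda>t. indicator S t *\<^sub>R C\<^sub>0 t)"
  define K where "K = (\<lambda>t. indicator S t *\<^sub>R enn2real (growth f g t))"
  have on: "f' t = f t" "g' t = g t" "C t = C\<^sub>0 t" "K t = enn2real (growth f g t)" if "t \<in> S" for t
    using that by (simp_all add: f'_def g'_def C_def K_def fun_eq_iff)
  have off: "f' t = (\<lambda>_ _. 0)" "g' t = (\<lambda>_ _. 0)" "C t = 0" "K t = 0" if "t \<notin> S" for t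
    using that by (simp_all add: f'_def g'_def C_def K_def fun_eq_iff)
  have deriv: "lower_deriv (\<lambda>x'. f t x' u $ j) (axis i 1) x \<ge> ereal (- C\<^sub>0 t * of_bool (i = j))"
      "lower_deriv (\<lambda>u'. g t x u' $ l) (axis k 1) u \<ge> ereal (- C\<^sub>0 t * of_bool (k = l))"
      "upper_deriv (\<lambda>x'. g t x' u $ l) (axis i 1) x \<le> 0"
      "upper_deriv (\<lambda>u'. f t x u' $ j) (axis k 1) u \<le> 0" if "t \<in> S" for t x u i j k l
  proof -
    from that have "good t" by (simp add: S_def)
    note d = this[unfolded good_def, THEN conjunct2, rule_format]
    show "lower_deriv (\<lambda>x'. f t x' u $ j) (axis i 1) x \<ge> ereal (- C\<^sub>0 t * of_bool (i = j))"
      "lower_deriv (\<lambda>u'. g t x u' $ l) (axis k 1) u \<ge> ereal (- C\<^sub>0 t * of_bool (k = l))"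
      "upper_deriv (\<lambda>x'. g t x' u $ l) (axis i 1) x \<le> 0"
      "upper_deriv (\<lambda>u'. f t x u' $ j) (axis k 1) u \<le> 0"
      using d[of u x] by blast+
  qed
  have growth_le: "norm (f t x u) / (1 + norm x) + norm (g t x u) / (1 + norm u) \<le> K t" if t: "t \<in> S" for t x u
  proof -
    have "growth f g t \<noteq> \<infinity>" using t by (simp add: S_def good_def)
    moreover have "ennreal (norm (f t x u) / (1 + norm x) + norm (g t x u) / (1 + norm u)) \<le> growth f g t"
      unfolding growth_def by (rule SUP_upper2[of "(x, u)"]) auto
    ultimately have "ennreal (norm (f t x u) / (1 + norm x) + norm (g t x u) / (1 + norm u)) \<le> ennreal (K t)"
      unfolding on(4)[OF t] by (simp add: less_top)
    then show ?thesis by (subst (asm) ennreal_le_iff) (simp_all add: on(4)[OF t])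
  qed
  have K: "0 \<le> K t" for t by (simp add: K_def)
  have C: "0 \<le> C t" for t using C0_nonneg[of t] S(1) by (cases "t \<in> S") (auto simp: on off)
  have K_int: "integrable lebesgue K"
  proof -
    have "integrable (lebesgue_on {0..T}) (\<lambda>t. enn2real (growth f g t))"
    proof (rule integrableI_bounded)
      show "(\<lambda>t. enn2real (growth f g t)) \<in> borel_measurable (lebesgue_on {0..T})" using growth_meas by simp
      have "(\<integral>\<^sup>+ t. ennreal (norm (enn2real (growth f g t))) \<partial>lebesgue_on {0..T}) \<le> (\<integral>\<^sup>+ t. growth f g t \<partial>lebesgue_on {0..T})"
        by (intro nn_integral_mono) (simp add: ennreal_enn2real_if)
      then show "(\<integral>\<^sup>+ t. ennreal (norm (enn2real (growth f g t))) \<partial>lebesgue_on {0..T}) < \<infinity>"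
        using growth_int by (rule le_less_trans)
    qed
    then have "set_integrable lebesgue {0..T} (\<lambda>t. enn2real (growth f g t))"
      by (simp add: integrable_restrict_space set_integrable_def)
    from set_integrable_subset[OF this S(2,1)] show ?thesis unfolding K_def set_integrable_def .
  qed
  have C_int: "integrable lebesgue C"
    using set_integrable_subset[OF C0_int S(2,1)] unfolding C_def set_integrable_def .
  obtain B where B: "0 \<le> B" "\<And>x i. \<bar>uT x $ i\<bar> \<le> B * (1 + norm x)"
  proof -
    obtain B where "AE x in lebesgue. norm (uT x /\<^sub>R (1 + norm x)) \<le> B" using uT_growth by (auto simp: L_infinity_def)
    then have "AE x in lebesgue. norm (uT x /\<^sub>R (1 + norm x)) \<le> max B 0" by eventually_elim simp
    from antimono_AE_bound[OF uT_decreasing this] show ?thesis by (intro that[of "max B 0"]) auto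
  qed
  define A where "A = B * (1 + real CARD('d)) + 1"
  have A_depth: "B * (1 + real CARD('d)) * depth x \<le> A * depth x" for x :: "real ^ 'd"
    using depth_ge1[of x] by (simp add: A_def distrib_right)
  define L where "L = 1 + real CARD('d) + real CARD('m)"
  interpret coupled_system f' g' C K T L A uT
  proof
    show "0 < T" by (rule T)
    show "f' t x u + C t *\<^sub>R x \<le> f' t y u + C t *\<^sub>R y" if "x \<le> y" for t x y u
    proof (cases "t \<in> S")
      case True
      show ?thesis unfolding on[OF True] by (rule lower_deriv_imp_mono[OF deriv(1)[OF True] that])
    qed (simp add: off)
    show "f' t x v \<le> f' t x u" if "u \<le> v" for t x u v
    proof (cases "t \<in> S")
      case True
      show ?thesis unfolding on[OF True] by (rule upper_deriv_imp_antimono[OF deriv(4)[OF True] that])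
    qed (simp add: off)
    show "g' t x u + C t *\<^sub>R u \<le> g' t x v + C t *\<^sub>R v" if "u \<le> v" for t x u v
    proof (cases "t \<in> S")
      case True
      show ?thesis unfolding on[OF True] by (rule lower_deriv_imp_mono[OF deriv(2)[OF True] that])
    qed (simp add: off)
    show "g' t y u \<le> g' t x u" if "x \<le> y" for t x y u
    proof (cases "t \<in> S")
      case True
      show ?thesis unfolding on[OF True]
        by (rule upper_deriv_imp_antimono[where h = "\<lambda>x. g t x u", OF deriv(3)[OF True] that])
    qed (simp add: off)
    have quotient: "p \<le> k * (1 + norm z)" if "p / (1 + norm z) + r \<le> k" "0 \<le> r" for p r k and z :: "'z::real_normed_vector"
    proof -
      have "p / (1 + norm z) \<le> k" using that by simp
      then show ?thesis by (simp add: divide_le_eq add_pos_nonneg)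
    qed
    show "norm (f' t x u) \<le> K t * (1 + norm x)" for t x u
    proof (cases "t \<in> S")
      case True
      show ?thesis unfolding on(1)[OF True] by (rule quotient[OF growth_le[OF True, of x u]]) simp
    qed (simp add: off)
    show "norm (g' t x u) \<le> K t * (1 + norm u)" for t x u
    proof (cases "t \<in> S")
      case True
      have "norm (g t x u) / (1 + norm u) + norm (f t x u) / (1 + norm x) \<le> K t" using growth_le[OF True, of x u] by simp
      then show ?thesis unfolding on(2)[OF True] by (rule quotient) simp
    qed (simp add: off)
    show "continuous_on UNIV (f' t x)" for t x
      using f_cont[of t x] S(1) by (cases "t \<in> S") (auto simp: on off)
    show "continuous_on UNIV (g' t x)" for t x
      using g_cont[of t x] S(1) by (cases "t \<in> S") (auto simp: on off)
    show "AE q in lebesgue. \<forall>u. (\<lambda>t. f' t q u) \<in> borel_measurable lebesgue"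
      unfolding f'_def by (rule caratheodory_sections_measurable[OF f_meas S]) (use f_cont S(1) in blast)
    show "AE q in lebesgue. \<forall>u. (\<lambda>t. g' t q u) \<in> borel_measurable lebesgue"
      unfolding g'_def by (rule caratheodory_sections_measurable[OF g_meas S]) (use g_cont S(1) in blast)
    show "0 \<le> K t" "0 \<le> C t" for t by (rule K C)+
    show "K integrable_on {0..t}" "C integrable_on {0..t}" for t
      by (rule integrable_lebesgue_imp_integrable_on, rule K_int C_int)+
    show "C \<in> borel_measurable lebesgue" by (rule borel_measurable_integrable[OF C_int])
    show "1 + real CARD('d) + real CARD('m) \<le> L" by (simp add: L_def)
    show "antimono uT" by (rule uT_decreasing)
    show "1 \<le> A" using B(1) by (simp add: A_def)
    show "uT x $ i \<le> A * depth x" for x i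
      using antimono_upper_depth[OF uT_decreasing B(2,1), of x i] A_depth[of x] by linarith
    show "- (A * depth (- x)) \<le> uT x $ i" for x i
      using antimono_lower_depth[OF uT_decreasing B(2,1), of x i] A_depth[of "- x"] by linarith
  qed
  have same: "AE t in lebesgue. t \<in> {0..T} \<longrightarrow> f t = f' t \<and> g t = g' t \<and> C\<^sub>0 t = C t"
    using ae_good by eventually_elim (auto simp: on)
  have ae_cont: "AE z in lebesgue_on ({0..T} \<times> UNIV). continuous (at z within {0..T} \<times> UNIV) (\<lambda>(t, x). u t x)"
    if "jointly_continuous T u" "admissible u" "\<And>t x. t \<notin> {0..T} \<Longrightarrow> u t x = 0" for u
  proof -
    have "AE z in lebesgue. isCont (\<lambda>(t, x). u t x) z"
      by (rule jointly_continuous_measurable(1)[OF that(1) admissible_antimono[OF that(2)]]) (rule that(3))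
    then show ?thesis unfolding AE_lebesgue_on[OF slab_lebesgue]
      by eventually_elim (simp add: continuous_at_imp_continuous_at_within)
  qed
  obtain u_plus u_minus where adm: "admissible u_plus" "admissible u_minus"
    and sol: "char_solution u_plus" "char_solution u_minus"
    and out: "\<And>t x. t \<notin> {0..T} \<Longrightarrow> u_plus t x = 0" "\<And>t x. t \<notin> {0..T} \<Longrightarrow> u_minus t x = 0"
    and jc: "jointly_continuous T u_plus" "jointly_continuous T u_minus"
    and sc: "\<And>t. t \<in> {0..T} \<Longrightarrow> upper_semicontinuous (u_plus t)" "\<And>t. t \<in> {0..T} \<Longrightarrow> lower_semicontinuous (u_minus t)"
    and extremal: "\<And>v t x. char_solution v \<Longrightarrow> (\<And>t. antimono (v t)) \<Longrightarrow> growth_bounded v \<Longrightarrow> t \<in> {0..T} \<Longrightarrow>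
       u_minus t x \<le> v t x \<and> v t x \<le> u_plus t x"
    using extremal_char_solutions by blast
  have "nonlinear_solution T f g C\<^sub>0 uT u_plus"
    by (rule char_solution_imp_nonlinear_solution[OF same sol(1) adm(1) _ jc(1)]) (rule out(1))
  moreover have "nonlinear_solution T f g C\<^sub>0 uT u_minus"
    by (rule char_solution_imp_nonlinear_solution[OF same sol(2) adm(2) _ jc(2)]) (rule out(2))
  moreover have "\<forall>t\<in>{0..T}. upper_semicontinuous (u_plus t) \<and> lower_semicontinuous (u_minus t)"
    using sc by blast
  moreover have "AE z in lebesgue_on ({0..T} \<times> UNIV). continuous (at z within {0..T} \<times> UNIV) (\<lambda>(t, x). u_plus t x)"
    by (rule ae_cont[OF jc(1) adm(1)]) (rule out(1))
  moreover have "AE z in lebesgue_on ({0..T} \<times> UNIV). continuous (at z within {0..T} \<times> UNIV) (\<lambda>(t, x). u_minus t x)"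
    by (rule ae_cont[OF jc(2) adm(2)]) (rule out(2))
  moreover have "u_minus t x \<le> u t x \<and> u t x \<le> u_plus t x"
    if u: "nonlinear_solution T f g C\<^sub>0 uT u" and t: "t \<in> {0..T}" for u t x
  proof -
    note v = nonlinear_solution_imp_char_solution[OF same u]
    from extremal[OF v(1) v(2) v(3) t, of x] show ?thesis using t by simp
  qed
  ultimately show ?thesis by blast
qed

end
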